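(* Let $\Omega\subset\mathbb{C}^d$ be a bounded convex domain and let $d_\Omega$ be the distance induced by its complete Kähler-Einstein metric with Ricci curvature $-1$. Then $(\Omega,d_\Omega)$ is Gromov hyperbolic if and only if every domain in $\overline{\mathrm{Aff}(\mathbb{C}^d)\cdot\Omega}\cap\mathbb{X}_d$ has simple boundary.
   Context: A convex domain in $\mathbb{C}^d$ is $\mathbb{C}$-properly convex if it contains no entire complex affine line. $\mathbb{X}_d$ is the set of all non-empty $\mathbb{C}$-properly convex domains in $\mathbb{C}^d$, with the local Hausdorff topology: $\Omega_n\to\Omega$ in $\mathbb{X}_d$ if there is $R_0\ge0$ such that for all $R\ge R_0$ the Hausdorff distance between $\overline{\Omega}_n\cap\overline{B(0;R)}$ and $\overline{\Omega}\cap\overline{B(0;R)}$ tends to $0$, where $B(0;R)$ is the Euclidean ball (the Hausdorff distance between the empty set and a non-empty set is $\infty$). $\mathrm{Aff}(\mathbb{C}^d)$ is the group of complex affine automorphisms of $\mathbb{C}^d$, acting on $\mathbb{X}_d$; thus $\overline{\mathrm{Aff}(\mathbb{C}^d)\cdot\Omega}\cap\mathbb{X}_d$ is the set of all $\mathcal{D}\in\mathbb{X}_d$ for which there are $A_n\in\mathrm{Aff}(\mathbb{C}^d)$ with $A_n\Omega\to\mathcal{D}$ in $\mathbb{X}_d$. A domain $\Omega\subset\mathbb{C}^d$ has simple boundary if every holomorphic map from the unit disk $\mathbb{D}\subset\mathbb{C}$ into $\partial\Omega$ is constant. A metric space $(X,d)$ is Gromov hyperbolic if there is $\delta\ge 0$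 with $(x|z)_w \geq \min\{(x|y)_w,(y|z)_w\}-\delta$ for all $x,y,z,w\in X$, where $(x|y)_w=\frac12(d(x,w)+d(w,y)-d(x,y))$. *)

theory Defs
  imports "HOL-Analysis.Analysis"
begin

section \<open>Convex domains and the local Hausdorff topology\<close>

definition C_properly_convex :: "(complex ^ 'd) set \<Rightarrow> bool" where
  "C_properly_convex \<Omega> \<longleftrightarrow> convex \<Omega> \<and> \<not> (\<exists>p v. v \<noteq> 0 \<and> range (\<lambda>c. p + c *s v) \<subseteq> \<Omega>)"

definition properly_convex_domains :: "(complex ^ 'd) set set" where
  "properly_convex_domains = {\<Omega>. open \<Omega> \<and> \<Omega> \<noteq> {} \<and> C_properly_convex \<Omega>}"

text \<open>
  With values in \<^typ>\<open>ennreal\<close>, an infimum over the empty set is \<open>\<infinity>\<close> and a supremum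
  over it is \<open>0\<close>, so the empty set has distance \<open>\<infinity>\<close> from every non-empty set and
  distance \<open>0\<close> from itself.
\<close>

definition hausdorff_distance :: "'a::metric_space set \<Rightarrow> 'a set \<Rightarrow> ennreal" where
  "hausdorff_distance A B =
     max (SUP a\<in>A. INF b\<in>B. ennreal (dist a b)) (SUP b\<in>B. INF a\<in>A. ennreal (dist a b))"

lemma hausdorff_distance_empty_left: "B \<noteq> {} \<Longrightarrow> hausdorff_distance {} B = \<infinity>"
  by (simp add: hausdorff_distance_def)

lemma hausdorff_distance_empty_right: "A \<noteq> {} \<Longrightarrow> hausdorff_distance A {} = \<infinity>"
  by (simp add: hausdorff_distance_def)

definition local_hausdorff_tendsto ::
    "(nat \<Rightarrow> (complex ^ 'd) set) \<Rightarrow> (complex ^ 'd) set \<Rightarrow> bool" where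
  "local_hausdorff_tendsto \<Omega>s \<Omega> \<longleftrightarrow>
     (\<exists>R0\<ge>0. \<forall>R\<ge>R0.
        (\<lambda>n. hausdorff_distance (closure (\<Omega>s n) \<inter> closure (ball 0 R))
                                (closure \<Omega> \<inter> closure (ball 0 R))) \<longlonglongrightarrow> 0)"

definition complex_affine_group :: "(complex ^ 'd \<Rightarrow> complex ^ 'd) set" where
  "complex_affine_group = {(\<lambda>x. A *v x + b) | A b. invertible A}"

definition affine_orbit_closure :: "(complex ^ 'd) set \<Rightarrow> (complex ^ 'd) set set" where
  "affine_orbit_closure \<Omega> =
     {D \<in> properly_convex_domains.
        \<exists>A. (\<forall>n. A n \<in> complex_affine_group) \<and> local_hausdorff_tendsto (\<lambda>n. A n ` \<Omega>) D}"

definition simple_boundary :: "(complex ^ 'd) set \<Rightarrow> bool" where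
  "simple_boundary \<Omega> \<longleftrightarrow>
     (\<forall>f. (\<forall>i. (\<lambda>z. f z $ i) holomorphic_on ball 0 1) \<and> f ` ball 0 1 \<subseteq> frontier \<Omega>
          \<longrightarrow> f constant_on ball 0 1)"


section \<open>Gromov hyperbolicity\<close>

definition gromov_product :: "('a \<Rightarrow> 'a \<Rightarrow> real) \<Rightarrow> 'a \<Rightarrow> 'a \<Rightarrow> 'a \<Rightarrow> real" where
  "gromov_product d w x y = (d x w + d w y - d x y) / 2"

definition gromov_hyperbolic :: "'a set \<Rightarrow> ('a \<Rightarrow> 'a \<Rightarrow> real) \<Rightarrow> bool" where
  "gromov_hyperbolic X d \<longleftrightarrow>
     (\<exists>\<delta>\<ge>0. \<forall>x\<in>X. \<forall>y\<in>X. \<forall>z\<in>X. \<forall>w\<in>X.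
        gromov_product d w x z \<ge> min (gromov_product d w x y) (gromov_product d w y z) - \<delta>)"


section \<open>Riemannian metrics on open sets of a Euclidean space\<close>

abbreviation dir_deriv :: "('a::real_normed_vector \<Rightarrow> 'b::real_normed_vector) \<Rightarrow> 'a \<Rightarrow> 'a \<Rightarrow> 'b" where
  "dir_deriv f z v \<equiv> frechet_derivative f (at z) v"

primrec Ck_on :: "nat \<Rightarrow> 'a::real_normed_vector set \<Rightarrow> ('a \<Rightarrow> 'b::real_normed_vector) \<Rightarrow> bool" where
  "Ck_on 0 \<Omega> f \<longleftrightarrow> continuous_on \<Omega> f"
| "Ck_on (Suc k) \<Omega> f \<longleftrightarrow>
     (\<forall>z\<in>\<Omega>. f differentiable (at z)) \<and> (\<forall>v. Ck_on k \<Omega> (\<lambda>z. dir_deriv f z v))"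

definition smooth_on :: "'a::real_normed_vector set \<Rightarrow> ('a \<Rightarrow> 'b::real_normed_vector) \<Rightarrow> bool" where
  "smooth_on \<Omega> f \<longleftrightarrow> (\<forall>k. Ck_on k \<Omega> f)"

text \<open>
  A metric \<open>G\<close> on an open set \<open>\<Omega>\<close> is a field of real inner products: \<open>G z v w\<close> is the inner
  product of the tangent vectors \<open>v\<close> and \<open>w\<close> at \<open>z\<close>, all tangent spaces being identified with
  the ambient vector space. Values of \<open>G\<close> outside \<open>\<Omega>\<close> are irrelevant.
\<close>

definition riemannian_metric ::
    "'a::euclidean_space set \<Rightarrow> ('a \<Rightarrow> 'a \<Rightarrow> 'a \<Rightarrow> real) \<Rightarrow> bool" where
  "riemannian_metric \<Omega> G \<longleftrightarrow>
     (\<forall>v w. smooth_on \<Omega> (\<lambda>z. G z v w)) \<and>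
     (\<forall>z\<in>\<Omega>. bilinear (G z) \<and> (\<forall>v w. G z v w = G z w v) \<and> (\<forall>v. v \<noteq> 0 \<longrightarrow> G z v v > 0))"

text \<open>
  The infimum is over piecewise \<open>C\<^sup>1\<close> paths of finite length. The library's piecewise \<open>C\<^sup>1\<close>
  paths may have unbounded speed near a breakpoint, so finiteness of the length has to be required
  (\<open>integral\<close> would silently return \<open>0\<close>). Outside \<open>\<Omega>\<close> the distance is set to \<open>0\<close>, because
  the locale \<open>Metric_space\<close> asks for non-negativity and symmetry on the whole type.
\<close>

definition riemannian_distance ::
    "'a::euclidean_space set \<Rightarrow> ('a \<Rightarrow> 'a \<Rightarrow> 'a \<Rightarrow> real) \<Rightarrow> 'a \<Rightarrow> 'a \<Rightarrow> real" where
  "riemannian_distance \<Omega> G x y =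
     (if x \<in> \<Omega> \<and> y \<in> \<Omega> then
        Inf {L. \<exists>\<gamma>. valid_path \<gamma> \<and> path_image \<gamma> \<subseteq> \<Omega> \<and> pathstart \<gamma> = x \<and> pathfinish \<gamma> = y \<and>
                ((\<lambda>t. sqrt (G (\<gamma> t) (vector_derivative \<gamma> (at t)) (vector_derivative \<gamma> (at t))))
                   has_integral L) {0..1}}
      else 0)"

text \<open>
  \<open>levi_civita G z v w\<close> is the value at \<open>z\<close> of the Levi-Civita covariant derivative
  \<open>\<nabla>\<^sub>v w\<close> of the constant vector field \<open>w\<close>; the Koszul formula has no bracket terms since
  constant fields commute.
\<close>

definition levi_civita ::
    "('a::euclidean_space \<Rightarrow> 'a \<Rightarrow> 'a \<Rightarrow> real) \<Rightarrow> 'a \<Rightarrow> 'a \<Rightarrow> 'a \<Rightarrow> 'a" where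
  "levi_civita G z v w =
     (THE x. \<forall>u. 2 * G z x u = dir_deriv (\<lambda>z. G z w u) z v
                              + dir_deriv (\<lambda>z. G z v u) z w
                              - dir_deriv (\<lambda>z. G z v w) z u)"

text \<open>
  The curvature tensor \<open>R(u,v)w = \<nabla>\<^sub>u\<nabla>\<^sub>v w - \<nabla>\<^sub>v\<nabla>\<^sub>u w\<close> on constant fields, and its trace
  \<open>Ric(v,w) = tr (u \<mapsto> R(u,v)w)\<close>, with which round spheres have positive Ricci curvature.
  The trace does not depend on the basis, so the standard one is used.
\<close>

definition riemann_curvature ::
    "('a::euclidean_space \<Rightarrow> 'a \<Rightarrow> 'a \<Rightarrow> real) \<Rightarrow> 'a \<Rightarrow> 'a \<Rightarrow> 'a \<Rightarrow> 'a \<Rightarrow> 'a" where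
  "riemann_curvature G z u v w =
     dir_deriv (\<lambda>z. levi_civita G z v w) z u + levi_civita G z u (levi_civita G z v w)
     - dir_deriv (\<lambda>z. levi_civita G z u w) z v - levi_civita G z v (levi_civita G z u w)"

definition ricci_curvature ::
    "('a::euclidean_space \<Rightarrow> 'a \<Rightarrow> 'a \<Rightarrow> real) \<Rightarrow> 'a \<Rightarrow> 'a \<Rightarrow> 'a \<Rightarrow> real" where
  "ricci_curvature G z v w = (\<Sum>b\<in>Basis. riemann_curvature G z b v w \<bullet> b)"


section \<open>Complete Kaehler-Einstein metrics\<close>

text \<open>
  The complex structure of \<open>\<complex>\<^sup>d\<close> is \<open>v \<mapsto> \<i> *s v\<close>. A Kaehler metric is a Riemannian metric
  invariant under it whose fundamental form \<open>\<omega>(v,w) = G(\<i>v,w)\<close> is closed;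
  \<open>d\<omega>(u,v,w)\<close> is evaluated on constant vector fields.
\<close>

definition fundamental_form ::
    "(complex ^ 'd \<Rightarrow> complex ^ 'd \<Rightarrow> complex ^ 'd \<Rightarrow> real)
       \<Rightarrow> complex ^ 'd \<Rightarrow> complex ^ 'd \<Rightarrow> complex ^ 'd \<Rightarrow> real" where
  "fundamental_form G z v w = G z (\<i> *s v) w"

definition kaehler_metric ::
    "(complex ^ 'd) set \<Rightarrow> (complex ^ 'd \<Rightarrow> complex ^ 'd \<Rightarrow> complex ^ 'd \<Rightarrow> real) \<Rightarrow> bool" where
  "kaehler_metric \<Omega> G \<longleftrightarrow>
     riemannian_metric \<Omega> G \<and>
     (\<forall>z\<in>\<Omega>. \<forall>v w. G z (\<i> *s v) (\<i> *s w) = G z v w) \<and>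
     (\<forall>z\<in>\<Omega>. \<forall>u v w.
        dir_deriv (\<lambda>z. fundamental_form G z v w) z u
        + dir_deriv (\<lambda>z. fundamental_form G z w u) z v
        + dir_deriv (\<lambda>z. fundamental_form G z u v) z w = 0)"

definition complete_kaehler_einstein ::
    "(complex ^ 'd) set \<Rightarrow> (complex ^ 'd \<Rightarrow> complex ^ 'd \<Rightarrow> complex ^ 'd \<Rightarrow> real) \<Rightarrow> bool" where
  "complete_kaehler_einstein \<Omega> G \<longleftrightarrow>
     kaehler_metric \<Omega> G \<and>
     (\<forall>z\<in>\<Omega>. \<forall>v w. ricci_curvature G z v w = - G z v w) \<and>
     Metric_space.mcomplete \<Omega> (riemannian_distance \<Omega> G)"

end

theory Submission
  imports Defs "HOL-Complex_Analysis.Complex_Analysis"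
begin

text \<open>A Bochner inequality for gradients of real affine functions, integrated against cutoff functions
 that exist by completeness, bounds the logarithmic derivative of every positive affine function by a
 multiple of the metric. Together with the maximum principle for the volume form this shows that the
 norm of a tangent vector is, up to constants, the inverse of the radius of the largest affine disc in
 its direction. Hence the metric can be controlled by convex geometry alone.

 Rescaling \<open>Omega\<close> at a sequence of points by inner ellipsoids of maximal volume gives limit domains
 in the closure of the affine orbit. If all of these have simple boundary, then segments from a base
 point to the boundary that come close to each other are much closer a bounded amount below, and the
 space looks like a tree. Conversely, an analytic disc in the boundary of a limit domain gives an affine
 disc, and between that disc and an interior point there are arbitrarily large squares embedded
 quasi-isometrically, which also exist in \<open>Omega\<close>.\<close>

subsection \<open>Functions of class \<open>C\<^sup>k\<close>\<close>

text \<open>The constants \<open>C0\<close>, \<open>C1\<close>, \<open>M1\<close> depend on the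
  dimension only. Estimates made in \<open>Omega\<close> therefore hold in every affine chart with
  the same constants, and no metric is ever put on a limit domain: limits enter only through compact
  sets that lie inside, or outside, the rescaled domains from some index on.

  The obstacle in the gradient estimate is that nothing is known about the volume of the metric. The
  potential \<open>psi\<close> gets the weight \<open>1 / p\<close> in the exponent, so that the
  divergence theorem bounds \<open>p\<close>-th powers against Lebesgue measure, which is finite on
  a bounded domain; growing \<open>p\<close> makes the bounds pointwise.

  The upper bound for the metric comes from the determinant: all eigenvalues relative to an inner
  ellipsoid are bounded below, so a bound for their product bounds each of them.

  From there on, lower bounds for distances come from logarithms of affine functions without zeros
  in the domain, upper bounds from discs along a path. Distances are infima over paths, so almost
  shortest paths, cut into unit steps, stand in for geodesics.\<close>

lemma Ck_on_cong:
 assumes "open S" "!!z. z \<in> S ==> f z = g z"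
 shows "Ck_on k S f \<longleftrightarrow> Ck_on k S g"
 using assms(2)
proof (induction k arbitrary: f g)
 case 0
 then show ?case by (simp cong: continuous_on_cong)
next
 case (Suc k)
 have hd: "(f has_derivative D) (at z) \<longleftrightarrow> (g has_derivative D) (at z)" if "z \<in> S" for z D
 proof
  assume "(f has_derivative D) (at z)"
  then show "(g has_derivative D) (at z)"
  by (rule has_derivative_transform_within_open[OF _ assms(1) that]) (use Suc.prems in auto)
 next
  assume "(g has_derivative D) (at z)"
  then show "(f has_derivative D) (at z)"
  by (rule has_derivative_transform_within_open[OF _ assms(1) that]) (use Suc.prems in auto)
 qed
 have diff: "f differentiable (at z) \<longleftrightarrow> g differentiable (at z)" if "z \<in> S" for z
  using hd[OF that] unfolding differentiable_def by simp
 have der: "frechet_derivative f (at z) = frechet_derivative g (at z)" if "z \<in> S" for z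
  using hd[OF that] unfolding frechet_derivative_def by simp
 have "Ck_on k S (%z. frechet_derivative f (at z) v) \<longleftrightarrow> Ck_on k S (%z. frechet_derivative g (at z) v)" for v
  by (rule Suc.IH) (simp add: der)
 then show ?case by (simp add: diff)
qed

lemma dir_deriv_cong:
 assumes "open S" "z \<in> S" "!!x. x \<in> S ==> f x = g x"
 shows "dir_deriv f z v = dir_deriv g z v"
proof -
 have "(f has_derivative D) (at z) \<longleftrightarrow> (g has_derivative D) (at z)" for D
  by (intro iffI; erule has_derivative_transform_within_open[OF _ assms(1,2)]) (simp_all add: assms(3))
 then show ?thesis unfolding frechet_derivative_def by simp
qed

lemma dir_deriv_eqI: "(f has_derivative f') (at z) ==> dir_deriv f z v = f' v"
 by (metis frechet_derivative_at)

text \<open>\<open>Ck_on\<close> speaks of the chosen derivative \<open>frechet_derivative\<close>;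
  this replaces it by any explicit formula valid on the open set.\<close>

lemma Ck_on_SucI:
 assumes "open S" "!!z. z \<in> S ==> (f has_derivative f' z) (at z)"
  and "!!v. Ck_on k S (%z. f' z v)"
 shows "Ck_on (Suc k) S f"
proof -
 have "Ck_on k S (%z. frechet_derivative f (at z) v) \<longleftrightarrow> Ck_on k S (%z. f' z v)" for v
  by (rule Ck_on_cong[OF assms(1)]) (simp add: frechet_derivative_at[OF assms(2), symmetric])
 then show ?thesis using assms by (auto simp: differentiable_def)
qed

lemma Ck_on_SucD:
 assumes "Ck_on (Suc k) S f"
 shows "!!z. z \<in> S ==> (f has_derivative dir_deriv f z) (at z)"
  and "!!v. Ck_on k S (%z. dir_deriv f z v)"
 using assms by (auto simp: frechet_derivative_works)

lemma Ck_on_lower: "Ck_on (Suc k) S f ==> Ck_on k S f"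
proof (induction k arbitrary: f)
 case 0
 then have "\<forall>z\<in>S. isCont f z"
  by (simp add: differentiable_imp_continuous_within)
 then show ?case
  by (simp add: continuous_at_imp_continuous_on)
next
 case (Suc k)
 have "Ck_on k S (%z. dir_deriv f z v)" for v
  by (rule Suc.IH) (use Suc.prems in \<open>simp only: Ck_on.simps(2)[of "Suc k"]\<close>)
 moreover have "\<forall>z\<in>S. f differentiable (at z)"
  using Suc.prems by (simp only: Ck_on.simps(2)[of "Suc k"]) blast
 ultimately show ?case by (simp only: Ck_on.simps(2)[of k]) blast
qed

lemma Ck_on_le: "Ck_on m S f ==> k <= m ==> Ck_on k S f"
proof (induction m arbitrary: k)
 case (Suc m)
 show ?case
 proof (cases "k = Suc m")
  case False
  then have "k <= m" using Suc.prems by simp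
  then show ?thesis using Suc.IH Ck_on_lower[OF Suc.prems(1)] by blast
 qed (use Suc in simp)
qed simp

lemma Ck_on_imp_continuous_on: "Ck_on k S f ==> continuous_on S f"
 using Ck_on_le[of k S f 0] by simp

lemma Ck_on_const: "open S ==> Ck_on k S (%z. c)"
proof (induction k arbitrary: c)
 case (Suc k)
 show ?case
  by (rule Ck_on_SucI[where f'="%_ _. 0"]) (auto intro: Suc.prems Suc.IH simp del: Ck_on.simps)
qed auto

lemma Ck_on_bounded_linear:
 assumes "open S" "bounded_linear L" "Ck_on k S f"
 shows "Ck_on k S (%z. L (f z))"
 using assms(3)
proof (induction k arbitrary: f)
 case 0
 then show ?case using bounded_linear.continuous_on[OF assms(2)] by auto
next
 case (Suc k)
 show ?case
 proof (rule Ck_on_SucI[where f'="%z v. L (dir_deriv f z v)"])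
  show "((%z. L (f z)) has_derivative (%v. L (dir_deriv f z v))) (at z)" if "z \<in> S" for z
  using bounded_linear.has_derivative[OF assms(2) Ck_on_SucD(1)[OF Suc.prems that]] .
 qed (rule assms(1) Suc.IH Ck_on_SucD(2)[OF Suc.prems])+
qed

lemma Ck_on_add:
 assumes "open S" "Ck_on k S f" "Ck_on k S g"
 shows "Ck_on k S (%z. f z + g z)"
 using assms(2,3)
proof (induction k arbitrary: f g)
 case 0
 then show ?case by (auto intro: continuous_on_add)
next
 case (Suc k)
 show ?case
 proof (rule Ck_on_SucI[where f'="%z v. dir_deriv f z v + dir_deriv g z v"])
  show "((%z. f z + g z) has_derivative (%v. dir_deriv f z v + dir_deriv g z v)) (at z)"
  if "z \<in> S" for z
  using Ck_on_SucD(1)[OF Suc.prems(1) that] Ck_on_SucD(1)[OF Suc.prems(2) that]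
  by (rule has_derivative_add)
 qed (rule assms(1) Suc.IH Ck_on_SucD(2)[OF Suc.prems(1)] Ck_on_SucD(2)[OF Suc.prems(2)])+
qed

lemma Ck_on_sum:
 assumes "open S" "!!i. i \<in> I ==> Ck_on k S (f i)"
 shows "Ck_on k S (%z. \<Sum>i\<in>I. f i z)"
 using assms(2)
proof (induction I rule: infinite_finite_induct)
 case (insert x F)
 then show ?case by (simp add: Ck_on_add assms(1))
qed (auto simp: Ck_on_const assms(1))

lemma Ck_on_bilinear:
 assumes "open S" "bounded_bilinear P" "Ck_on k S f" "Ck_on k S g"
 shows "Ck_on k S (%z. P (f z) (g z))"
 using assms(3,4)
proof (induction k arbitrary: f g)
 case 0
 then show ?case using bounded_bilinear.continuous_on[OF assms(2)] by auto
next
 case (Suc k)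
 show ?case
 proof (rule Ck_on_SucI[where f'="%z v. P (f z) (dir_deriv g z v) + P (dir_deriv f z v) (g z)"])
  show "((%z. P (f z) (g z)) has_derivative
  (%v. P (f z) (dir_deriv g z v) + P (dir_deriv f z v) (g z))) (at z)"
  if "z \<in> S" for z
  by (rule bounded_bilinear.FDERIV[OF assms(2) Ck_on_SucD(1)[OF Suc.prems(1) that]
  Ck_on_SucD(1)[OF Suc.prems(2) that]])
  show "Ck_on k S (%z. P (f z) (dir_deriv g z v) + P (dir_deriv f z v) (g z))" for v
  by (rule Ck_on_add[OF assms(1)
  Suc.IH[OF Ck_on_lower[OF Suc.prems(1)] Ck_on_SucD(2)[OF Suc.prems(2)]]
  Suc.IH[OF Ck_on_SucD(2)[OF Suc.prems(1)] Ck_on_lower[OF Suc.prems(2)]]])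
 qed (rule assms(1))
qed

lemmas Ck_on_mult = Ck_on_bilinear[OF _ bounded_bilinear_mult]
lemmas Ck_on_scaleR = Ck_on_bilinear[OF _ bounded_bilinear_scaleR]

lemma Ck_on_cmult: "open S ==> Ck_on k S f ==> Ck_on k S (%z. c * f z :: real)"
 by (intro Ck_on_mult Ck_on_const)

lemma Ck_on_minus: "open S ==> Ck_on k S f ==> Ck_on k S (%z. - f z)"
 by (rule Ck_on_bounded_linear[OF _ bounded_linear_minus[OF bounded_linear_ident]])

lemma Ck_on_diff: "open S ==> Ck_on k S f ==> Ck_on k S g ==> Ck_on k S (%z. f z - g z)"
 using Ck_on_add[of S k f "%z. - g z"] Ck_on_minus by auto

lemma Ck_on_affine: "open S ==> bounded_linear L ==> Ck_on k S (%z. c + L z)"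
proof (cases k)
 case 0
 assume "bounded_linear L"
 then show ?thesis unfolding 0 by (simp add: continuous_on_add linear_continuous_on)
next
 case (Suc m)
 assume S: "open S" and L: "bounded_linear L"
 have "((%z. c + L z) has_derivative L) (at z)" for z
  using has_derivative_add[OF has_derivative_const[of c] bounded_linear_imp_has_derivative[OF L]]
  by simp
 then show ?thesis unfolding Suc
  by (intro Ck_on_SucI[where f'="%z. L"] S Ck_on_const) auto
qed

lemma Ck_on_prod:
 fixes f :: "'i => 'a::real_normed_vector => 'b::{real_normed_algebra,comm_ring_1}"
 assumes "open S" "!!i. i \<in> I ==> Ck_on k S (f i)"
 shows "Ck_on k S (%z. \<Prod>i\<in>I. f i z)"
 using assms(2)
proof (induction I rule: infinite_finite_induct)
 case (insert x F)
 then show ?case by (simp add: Ck_on_mult assms(1))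
qed (auto simp: Ck_on_const assms(1))

lemma Ck_on_inverse:
 fixes f :: "'a::real_normed_vector => 'b::real_normed_field"
 assumes "open S" "Ck_on k S f" "!!z. z \<in> S ==> f z ~= 0"
 shows "Ck_on k S (%z. inverse (f z))"
 using assms(2)
proof (induction k)
 case 0
 then show ?case using assms by (auto intro!: continuous_intros)
next
 case (Suc k)
 show ?case
 proof (rule Ck_on_SucI[where f'="%z v. - (inverse (f z) * dir_deriv f z v * inverse (f z))"])
  show "((%z. inverse (f z)) has_derivative (%v. - (inverse (f z) * dir_deriv f z v * inverse (f z)))) (at z)"
  if "z \<in> S" for z
  by (rule Deriv.has_derivative_inverse[OF _ Ck_on_SucD(1)[OF Suc.prems that]]) (use assms that in auto)
  show "Ck_on k S (%z. - (inverse (f z) * dir_deriv f z v * inverse (f z)))" for v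
  by (intro Ck_on_minus Ck_on_mult Suc.IH assms(1) Ck_on_SucD(2)[OF Suc.prems]
  Ck_on_lower[OF Suc.prems])
 qed (rule assms(1))
qed

lemma Ck_on_ln:
 fixes f :: "'a::real_normed_vector => real"
 assumes "open S" "Ck_on k S f" "!!z. z \<in> S ==> f z > 0"
 shows "Ck_on k S (%z. ln (f z))"
proof (cases k)
 case 0
 then show ?thesis using assms by (fastforce intro!: continuous_intros)
next
 case (Suc m)
 note C = assms(2)[unfolded Suc]
 show ?thesis unfolding Suc
 proof (rule Ck_on_SucI[where f'="%z v. inverse (f z) * dir_deriv f z v"])
  show "((%z. ln (f z)) has_derivative (%v. inverse (f z) * dir_deriv f z v)) (at z)"
  if "z \<in> S" for z
  using has_derivative_ln[OF assms(3)[OF that] Ck_on_SucD(1)[OF C that]]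
  by (simp add: mult.commute)
  show "Ck_on m S (%z. inverse (f z) * dir_deriv f z v)" for v
  by (intro Ck_on_mult Ck_on_inverse assms(1) Ck_on_SucD(2)[OF C] Ck_on_lower[OF C])
  (use assms(3) in force)
 qed (rule assms(1))
qed

lemma Ck_on_exp:
 fixes f :: "'a::real_normed_vector => real"
 assumes "open S" "Ck_on k S f"
 shows "Ck_on k S (%z. exp (f z))"
 using assms(2)
proof (induction k)
 case 0
 then show ?case by (auto intro!: continuous_intros)
next
 case (Suc k)
 show ?case
 proof (rule Ck_on_SucI[where f'="%z v. exp (f z) * dir_deriv f z v"])
  show "((%z. exp (f z)) has_derivative (%v. exp (f z) * dir_deriv f z v)) (at z)"
  if "z \<in> S" for z
  using has_derivative_exp[OF Ck_on_SucD(1)[OF Suc.prems that]]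
  by (simp add: mult.commute)
 qed (intro Ck_on_mult assms(1) Ck_on_SucD(2)[OF Suc.prems] Suc.IH Ck_on_lower[OF Suc.prems])+
qed

lemma Ck_on_power:
 fixes f :: "'a::real_normed_vector => real"
 assumes "open S" "Ck_on k S f"
 shows "Ck_on k S (%z. f z ^ n)"
 by (induction n) (auto intro!: Ck_on_mult Ck_on_const assms)

lemma Ck_on_inner_const: "open S ==> Ck_on k S f ==> Ck_on k S (%z. f z \<bullet> b)"
 by (rule Ck_on_bounded_linear[OF _ bounded_linear_inner_left])

lemma smooth_on_deriv: "smooth_on S f ==> smooth_on S (%z. dir_deriv f z v)"
 unfolding smooth_on_def using Ck_on_SucD(2) by blast

lemma smooth_on_has_derivative:
 "smooth_on S f ==> z \<in> S ==> (f has_derivative dir_deriv f z) (at z)"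
 unfolding smooth_on_def using Ck_on_SucD(1) by blast

subsection \<open>Unitary frames\<close>

abbreviation J :: "complex ^ 'd => complex ^ 'd" where "J v \<equiv> \<i> *s v"

lemma J_J [simp]: "J (J v) = - v"
 by (simp add: vec_eq_iff)

lemma smult_eq_J: "c *s v = Re c *\<^sub>R v + Im c *\<^sub>R J v"
 by (simp add: vec_eq_iff complex_eq_iff)

lemma scaleR_smult: "c *\<^sub>R (v::complex^'d) = of_real c *s v"
 by (simp add: vec_eq_iff complex_eq_iff)

lemma linear_smult: "linear (%v::complex^'d. c *s v)"
 by (rule linearI) (simp_all add: vec_eq_iff algebra_simps)

lemma bounded_linear_smult: "bounded_linear (%v::complex^'d. c *s v)"
 using linear_smult linear_conv_bounded_linear by blast

lemma bounded_linear_smult_left: "bounded_linear (%c. c *s (v::complex^'d))"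
proof -
 have "linear (%c. c *s (v::complex^'d))"
  by (rule linearI) (simp_all add: vec_eq_iff algebra_simps)
 then show ?thesis using linear_conv_bounded_linear by blast
qed

lemma norm_smult: "norm (c *s (v::complex^'d)) = cmod c * norm v"
 unfolding norm_vec_def by (simp add: norm_mult L2_set_right_distrib)

text \<open>These are the real parts of Hermitian forms, not necessarily definite. The real form is
  kept because metrics are given as real inner products; \<open>herm\<close> recovers the complex
  one.\<close>

definition jsym :: "(complex^'d => complex^'d => real) => bool" where
 "jsym g \<longleftrightarrow> bilinear g & (\<forall>v w. g v w = g w v) & (\<forall>v w. g (J v) (J w) = g v w)"

definition jpos :: "(complex^'d => complex^'d => real) => bool" where
 "jpos g \<longleftrightarrow> jsym g & (\<forall>v. v ~= 0 --> g v v > 0)"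

text \<open>A unitary basis for the Hermitian form with real part \<open>g\<close>: the second
  condition makes imaginary parts vanish. The vectors \<open>e i\<close> and \<open>J (e i)\<close>
  together form a real orthonormal basis.\<close>

definition uframe :: "(complex^'d => complex^'d => real) => ('d => complex^'d) => bool" where
 "uframe g e \<longleftrightarrow> (\<forall>i j. g (e i) (e j) = (if i = j then 1 else 0) & g (e i) (J (e j)) = 0)"

lemma bilinear_simps:
 fixes g :: "'a::real_vector => 'b::real_vector => real"
 assumes "bilinear g"
 shows "g (x + y) z = g x z + g y z" "g v (z + w) = g v z + g v w"
  "g (c *\<^sub>R x) z = c * g x z" "g v (c *\<^sub>R w) = c * g v w"
  "g (- x) z = - g x z" "g v (- w) = - g v w" "g 0 z = 0" "g v 0 = 0"
  "g (x - y) z = g x z - g y z" "g v (z - w) = g v z - g v w"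
 using bilinear_ladd[OF assms] bilinear_radd[OF assms] bilinear_lmul[OF assms] bilinear_rmul[OF assms]
  bilinear_lneg[OF assms] bilinear_rneg[OF assms] bilinear_lzero[OF assms] bilinear_rzero[OF assms]
  bilinear_lsub[OF assms] bilinear_rsub[OF assms] by auto

lemma bilinear_sum_left:
 fixes g :: "'a::real_vector => 'b::real_vector => real"
 shows "bilinear g ==> g (\<Sum>i\<in>I. f i) z = (\<Sum>i\<in>I. g (f i) z)"
 unfolding bilinear_def using linear_sum by blast

lemma bilinear_sum_right:
 fixes g :: "'a::real_vector => 'b::real_vector => real"
 shows "bilinear g ==> g z (\<Sum>i\<in>I. f i) = (\<Sum>i\<in>I. g z (f i))"
 unfolding bilinear_def using linear_sum by blast

lemma jsymD:
 assumes "jsym g"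
 shows "bilinear g" "g v w = g w v" "g (J v) (J w) = g v w" "g (J v) w = - g v (J w)" "g v (J v) = 0"
proof -
 show b: "bilinear g" and s: "g v w = g w v" for v w using assms by (auto simp: jsym_def)
 show j: "g (J v) (J w) = g v w" for v w using assms by (auto simp: jsym_def)
 show k: "g (J v) w = - g v (J w)" for v w
  using j[of "J v" w] bilinear_simps[OF b] by auto
 show "g v (J v) = 0" using k[of v v] s[of v "J v"] by simp
qed

lemma jposD: assumes "jpos g" shows "jsym g" "v ~= 0 ==> g v v > 0" "g v v >= 0" "g v v = 0 \<longleftrightarrow> v = 0"
proof -
 show s: "jsym g" and p: "v ~= 0 ==> g v v > 0" for v using assms by (auto simp: jpos_def)
 have z: "g 0 0 = 0" using bilinear_simps(7)[OF jsymD(1)[OF s]] .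
 show "g v v >= 0" "g v v = 0 \<longleftrightarrow> v = 0" using p[of v] z by (cases "v = 0"; force)+
qed

lemma jsym_continuous_on: "jsym g ==> continuous_on S (%w. g w w)"
 using bounded_bilinear.continuous_on[OF _ continuous_on_id continuous_on_id]
  bilinear_conv_bounded_bilinear jsymD(1) by blast

text \<open>The first-order condition at a maximum in algebraic form: for small \<open>t\<close> a
  nonzero linear term wins, and \<open>t = A / (\<bar>B\<bar> + 1)\<close> is small enough.\<close>

lemma quadratic_nonpos_imp_zero:
 fixes A B :: real
 assumes "!!t. 2 * t * A + t\<^sup>2 * B <= 0"
 shows "A = 0"
proof (rule ccontr)
 assume A: "A ~= 0"
 define c where "c = 1 / (\<bar>B\<bar> + 1)"
 have c: "c > 0" "c * \<bar>B\<bar> <= 1" by (auto simp: c_def divide_simps)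
 have "2 * (c * A) * A + (c * A)\<^sup>2 * B <= 0" by (rule assms)
 then have "c * A\<^sup>2 * (2 + c * B) <= 0" by (simp add: power2_eq_square algebra_simps)
 moreover have "c * B >= -1" using c by (metis abs_ge_minus_self abs_le_D2 abs_mult abs_of_pos minus_le_iff)
 moreover have "c * A\<^sup>2 > 0" using c A by simp
 ultimately show False by (smt (verit) zero_less_mult_iff)
qed

text \<open>One step of the spectral theorem. On the complex orthogonal complement of the
  eigenvectors found so far, the Rayleigh quotient of \<open>b\<close> by \<open>g\<close> attains
  its maximum at a further eigenvector.\<close>

lemma diag_extend:
 fixes e :: "'d::finite => complex^'d"
 assumes g: "jpos g" and b: "jsym b" and k: "k \<notin> F"
  and on: "!!i j. i \<in> F ==> j \<in> F ==> g (e i) (e j) = (if i = j then 1 else 0) & g (e i) (J (e j)) = 0"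
  and eig: "!!i w. i \<in> F ==> b (e i) w = lam i * g (e i) w"
 obtains e0 l where "g e0 e0 = 1" "!!j. j \<in> F ==> g e0 (e j) = 0 & g e0 (J (e j)) = 0"
  "!!w. b e0 w = l * g e0 w"
proof -
 note gs = jposD(1)[OF g] and bl = jsymD(1)[OF jposD(1)[OF g]] and bb = jsymD(1)[OF b]
 define W where "W = {w. \<forall>j\<in>F. g w (e j) = 0 & g w (J (e j)) = 0}"
 define P where "P v = (\<Sum>j\<in>F. g v (e j) *\<^sub>R e j + g v (J (e j)) *\<^sub>R J (e j))" for v
 have PW: "v - P v \<in> W" for v
 proof -
  have "g (P v) (e j) = g v (e j) & g (P v) (J (e j)) = g v (J (e j))" if j: "j \<in> F" for j
  proof -
  have 1: "g (e i) (e j) = (if i = j then 1 else 0)" "g (e i) (J (e j)) = 0"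
  "g (J (e i)) (e j) = 0" "g (J (e i)) (J (e j)) = (if i = j then 1 else 0)" if "i \<in> F" for i
  using on[OF that j] jsymD(3,4)[OF gs] by auto
  have "g (P v) (e j) = (\<Sum>i\<in>F. if i = j then g v (e i) else 0)"
  unfolding P_def bilinear_sum_left[OF bl] bilinear_simps[OF bl]
  by (rule sum.cong) (auto simp: 1)
  moreover have "g (P v) (J (e j)) = (\<Sum>i\<in>F. if i = j then g v (J (e i)) else 0)"
  unfolding P_def bilinear_sum_left[OF bl] bilinear_simps[OF bl]
  by (rule sum.cong) (auto simp: 1)
  ultimately show ?thesis using j by simp
  qed
  then show ?thesis unfolding W_def by (simp add: bilinear_simps[OF bl])
 qed
 \<comment> \<open>\<open>Phi\<close> kills the axis \<open>k\<close>, so it is not onto. For a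
   vector \<open>v\<close> outside its range, \<open>v - P v\<close> is a nonzero element of
   \<open>W\<close>.\<close>
 define Phi where "Phi x = (\<Sum>i\<in>F. x $ i *s e i)" for x :: "complex^'d"
 have "linear Phi" unfolding Phi_def
  by (intro linear_compose_sum ballI linearI) (simp_all add: vec_eq_iff algebra_simps)
 moreover have "Phi (axis k 1) = Phi 0" unfolding Phi_def using k by (auto intro!: sum.neutral simp: axis_def)
 then have "~ inj Phi" by (metis axis_eq_0_iff injD zero_neq_one)
 ultimately have "~ surj Phi" using linear_surjective_imp_injective by blast
 then obtain v where v: "v \<notin> range Phi" by blast
 have "P v = Phi (\<chi> j. Complex (g v (e j)) (g v (J (e j))))"
  unfolding P_def Phi_def by (simp add: smult_eq_J[of "Complex _ _"])
 then have "v - P v ~= 0" using v by auto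
 then obtain w0 where w0: "w0 \<in> W" "w0 ~= 0" using PW by blast
 have W: "subspace W" unfolding W_def subspace_def by (auto simp: bilinear_simps[OF bl])
 have "closed W" using W by (rule closed_subspace)
 then have cK: "compact (W \<inter> sphere 0 1)" by auto
 have nK: "W \<inter> sphere 0 1 ~= {}"
 proof -
  have "(1 / norm w0) *\<^sub>R w0 \<in> W \<inter> sphere 0 1" using w0 W by (auto simp: subspace_scale)
  then show ?thesis by blast
 qed
 have "continuous_on (W \<inter> sphere 0 1) (%w. b w w / g w w)"
 proof (rule continuous_on_divide[OF jsym_continuous_on[OF b] jsym_continuous_on[OF gs]], rule ballI)
  show "g w w ~= 0" if "w \<in> W \<inter> sphere 0 1" for w
  using jposD(2)[OF g, of w] that by force
 qed
 then obtain u where u: "u \<in> W" "norm u = 1" and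
  umax: "!!w. w \<in> W \<inter> sphere 0 1 ==> b w w / g w w <= b u u / g u u"
  using continuous_attains_sup[OF cK nK] by (metis (no_types, lifting) Int_iff mem_sphere_0)
 define l where "l = b u u / g u u"
 have u0: "u ~= 0" using u by auto
 have gu: "g u u > 0" using jposD(2)[OF g u0] .
 have le: "b w w <= l * g w w" if "w \<in> W" for w
 proof (cases "w = 0")
  case False
  define w' where "w' = (1 / norm w) *\<^sub>R w"
  have "w' \<in> W \<inter> sphere 0 1" unfolding w'_def using that False W by (auto simp: subspace_scale)
  then have "b w' w' / g w' w' <= l" unfolding l_def using umax by blast
  moreover have "b w' w' / g w' w' = b w w / g w w" unfolding w'_def
  using False by (simp add: bilinear_simps[OF bl] bilinear_simps[OF bb])
  ultimately show ?thesis using jposD(2)[OF g False] by (simp add: divide_simps)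
 qed (simp add: bilinear_simps[OF bl] bilinear_simps[OF bb])
 have uW: "b u y = l * g u y" if y: "y \<in> W" for y
 proof -
  have "2 * t * (b u y - l * g u y) + t\<^sup>2 * (b y y - l * g y y) <= 0" for t
  proof -
  have "u + t *\<^sub>R y \<in> W" using u(1) y W by (simp add: subspace_add subspace_scale)
  from le[OF this] have "b u u + 2 * t * b u y + t\<^sup>2 * b y y <= l * (g u u + 2 * t * g u y + t\<^sup>2 * g y y)"
  by (simp add: bilinear_simps[OF bl] bilinear_simps[OF bb] jsymD(2)[OF gs, of y u] jsymD(2)[OF b, of y u]
  power2_eq_square algebra_simps)
  moreover have "b u u = l * g u u" unfolding l_def using gu by simp
  ultimately show ?thesis by (simp add: algebra_simps)
  qed
  then show ?thesis using quadratic_nonpos_imp_zero by force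
 qed
 \<comment> \<open>On the complex span of the old eigenvectors both sides vanish: \<open>u\<close>
   is orthogonal to them, and they are eigenvectors of \<open>b\<close>.\<close>
 have uP: "b u y = l * g u y" for y
 proof -
  have 1: "b u (e j) = 0" "b u (J (e j)) = 0" "g u (e j) = 0" "g u (J (e j)) = 0" if "j \<in> F" for j
  proof -
  show z: "g u (e j) = 0" "g u (J (e j)) = 0" using u(1) that by (auto simp: W_def)
  show "b u (e j) = 0" using eig[OF that, of u] z(1) jsymD(2)[OF b, of u] jsymD(2)[OF gs, of u] by simp
  have "b u (J (e j)) = - b (J u) (e j)" using jsymD(4)[OF b, of u "e j"] by simp
  also have "... = - (lam j * g (J u) (e j))"
  using eig[OF that, of "J u"] jsymD(2)[OF b, of "J u"] jsymD(2)[OF gs, of "J u"] by simp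
  also have "... = 0" using z(2) jsymD(4)[OF gs, of u "e j"] by simp
  finally show "b u (J (e j)) = 0" .
  qed
  have "b u (P y) = 0" "g u (P y) = 0"
  unfolding P_def bilinear_sum_right[OF bl] bilinear_sum_right[OF bb]
  by (auto intro!: sum.neutral simp: bilinear_simps[OF bl] bilinear_simps[OF bb] 1)
  then have "b u y = b u (y - P y)" "g u y = g u (y - P y)"
  by (auto simp: bilinear_simps[OF bl] bilinear_simps[OF bb])
  then show ?thesis using uW[OF PW[of y]] by simp
 qed
 show ?thesis
 proof
  let ?e = "(1 / sqrt (g u u)) *\<^sub>R u"
  show "g ?e ?e = 1" using gu by (simp add: bilinear_simps[OF bl] real_sqrt_mult_self flip: power2_eq_square)
  show "g ?e (e j) = 0 & g ?e (J (e j)) = 0" if "j \<in> F" for j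
  using u(1) that by (auto simp: W_def bilinear_simps[OF bl])
  show "b ?e w = l * g ?e w" for w by (simp add: bilinear_simps[OF bl] bilinear_simps[OF bb] uP)
 qed
qed

lemma simultaneous_diagonalization:
 fixes g b :: "complex^'d => complex^'d => real"
 assumes g: "jpos g" and b: "jsym b"
 obtains e lam where "uframe g e" "!!i w. b (e i) w = lam i * g (e i) w"
proof -
 note gs = jposD(1)[OF g]
 have "\<exists>e lam. (\<forall>i\<in>F. \<forall>j\<in>F. g (e i) (e j) = (if i = j then 1 else 0) & g (e i) (J (e j)) = 0) &
  (\<forall>i\<in>F. \<forall>w. b (e i) w = lam i * g (e i) w)" for F :: "'d set"
  using finite[of F]
 proof (induction F rule: finite_induct)
  case (insert k F)
  then obtain e lam where
  on: "!!i j. i \<in> F ==> j \<in> F ==> g (e i) (e j) = (if i = j then 1 else 0) & g (e i) (J (e j)) = 0"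
  and eig: "!!i w. i \<in> F ==> b (e i) w = lam i * g (e i) w" by metis
  obtain e0 l where e0: "g e0 e0 = 1" "!!j. j \<in> F ==> g e0 (e j) = 0 & g e0 (J (e j)) = 0"
  "!!w. b e0 w = l * g e0 w"
  using diag_extend[OF g b insert.hyps(2) on eig] by metis
  have e1: "g (e j) e0 = 0" "g (e j) (J e0) = 0" "g (J e0) (e j) = 0" if "j \<in> F" for j
  using e0(2)[OF that] jsymD(2)[OF gs, of "e j"] jsymD(4)[OF gs, of e0 "e j"] by auto
  have "g e0 (J e0) = 0" using jsymD(5)[OF gs] .
  then show ?case
  using on eig e0 e1 insert.hyps(2)
  by (intro exI[of _ "e(k := e0)"] exI[of _ "lam(k := l)"]) auto
 qed auto
 from this[of UNIV] show ?thesis using that unfolding uframe_def by blast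
qed

lemma uframe_exists:
 assumes "jpos g" obtains e where "uframe g e"
 by (rule simultaneous_diagonalization[OF assms jposD(1)[OF assms]])

lemma uframeD:
 assumes "jsym g" "uframe g e"
 shows "g (e i) (e j) = (if i = j then 1 else 0)" "g (e i) (J (e j)) = 0"
  "g (J (e i)) (e j) = 0" "g (J (e i)) (J (e j)) = (if i = j then 1 else 0)"
 using assms jsymD(3,4)[OF assms(1)] by (auto simp: uframe_def)

lemma uframe_expand:
 fixes g :: "complex^'d => complex^'d => real"
 assumes g: "jsym g" and e: "uframe g e"
 shows "v = (\<Sum>i\<in>UNIV. g v (e i) *\<^sub>R e i + g v (J (e i)) *\<^sub>R J (e i))"
proof -
 note bl = jsymD(1)[OF g]
 define Phi where "Phi x = (\<Sum>i\<in>UNIV. x $ i *s e i)" for x :: "complex^'d"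
 have lin: "linear Phi" unfolding Phi_def
  by (intro linear_compose_sum ballI linearI) (simp_all add: vec_eq_iff algebra_simps)
 have comp: "g (Phi x) (e j) = Re (x $ j)" "g (Phi x) (J (e j)) = Im (x $ j)" for x j
 proof -
  have "g (Phi x) (e j) = (\<Sum>i\<in>UNIV. if i = j then Re (x $ i) else 0)"
  unfolding Phi_def smult_eq_J[of "vec_nth _ _"] bilinear_sum_left[OF bl] bilinear_simps[OF bl]
  by (rule sum.cong) (auto simp: uframeD[OF g e])
  moreover have "g (Phi x) (J (e j)) = (\<Sum>i\<in>UNIV. if i = j then Im (x $ i) else 0)"
  unfolding Phi_def smult_eq_J[of "vec_nth _ _"] bilinear_sum_left[OF bl] bilinear_simps[OF bl]
  by (rule sum.cong) (auto simp: uframeD[OF g e])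
  ultimately show "g (Phi x) (e j) = Re (x $ j)" "g (Phi x) (J (e j)) = Im (x $ j)" by simp_all
 qed
 have "inj Phi"
 proof (rule injI)
  fix x y assume "Phi x = Phi y"
  then have "Re (x $ j) = Re (y $ j)" "Im (x $ j) = Im (y $ j)" for j
  using comp[of x j] comp[of y j] by simp_all
  then show "x = y" by (simp add: vec_eq_iff complex_eq_iff)
 qed
 then have "surj Phi" using lin linear_injective_imp_surjective by blast
 then obtain x where x: "v = Phi x" by blast
 show ?thesis unfolding x comp by (simp add: Phi_def smult_eq_J[of "vec_nth _ _"])
qed

lemma uframe_parseval:
 assumes g: "jsym g" and e: "uframe g e" and b: "bilinear b"
 shows "b v w = (\<Sum>i\<in>UNIV. g v (e i) * b (e i) w + g v (J (e i)) * b (J (e i)) w)"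
 by (subst uframe_expand[OF g e, of v]) (simp add: bilinear_sum_left[OF b] bilinear_simps[OF b])

text \<open>Both sides are the trace of \<open>A\<close> as a real linear map. Ricci curvature is
  defined with the Euclidean basis, whereas all estimates are made in frames unitary for the
  metric.\<close>

lemma uframe_trace:
 fixes A :: "complex^'d => complex^'d"
 assumes g: "jsym g" and e: "uframe g e" and A: "linear A"
 shows "(\<Sum>b\<in>Basis. A b \<bullet> b) = (\<Sum>i\<in>UNIV. g (A (e i)) (e i) + g (A (J (e i))) (J (e i)))"
proof -
 note bl = jsymD(1)[OF g]
 have "A b \<bullet> b = (\<Sum>i\<in>UNIV. g b (e i) * (A (e i) \<bullet> b) + g b (J (e i)) * (A (J (e i)) \<bullet> b))" for b
  by (subst uframe_expand[OF g e, of b])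
  (simp add: linear_sum[OF A] linear_add[OF A] linear_scale[OF A] inner_sum_left inner_add_left)
 then have "(\<Sum>b\<in>Basis. A b \<bullet> b) =
  (\<Sum>b\<in>Basis. \<Sum>i\<in>UNIV. g b (e i) * (A (e i) \<bullet> b) + g b (J (e i)) * (A (J (e i)) \<bullet> b))"
  by (rule sum.cong[OF refl])
 also have "... = (\<Sum>i\<in>UNIV. \<Sum>b\<in>Basis. g b (e i) * (A (e i) \<bullet> b) + g b (J (e i)) * (A (J (e i)) \<bullet> b))"
  by (rule sum.swap)
 also have "... = (\<Sum>i\<in>UNIV. (\<Sum>b\<in>Basis. g b (e i) * (A (e i) \<bullet> b)) + (\<Sum>b\<in>Basis. g b (J (e i)) * (A (J (e i)) \<bullet> b)))"
  by (simp only: sum.distrib)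
 finally have "(\<Sum>b\<in>Basis. A b \<bullet> b) =
  (\<Sum>i\<in>UNIV. (\<Sum>b\<in>Basis. g b (e i) * (A (e i) \<bullet> b)) + (\<Sum>b\<in>Basis. g b (J (e i)) * (A (J (e i)) \<bullet> b)))" .
 moreover have "(\<Sum>b\<in>Basis. g b y * (x \<bullet> b)) = g x y" for x y
 proof -
  have "g x y = g (\<Sum>b\<in>Basis. (x \<bullet> b) *\<^sub>R b) y" by (simp add: euclidean_representation)
  then show ?thesis by (simp add: bilinear_sum_left[OF bl] bilinear_simps[OF bl] mult.commute)
 qed
 ultimately show ?thesis by simp
qed

subsection \<open>The determinant of a Hermitian form\<close>

text \<open>The sign of the imaginary part makes the form linear in the first and conjugate linear
  in the second argument.\<close>

definition herm :: "(complex^'d => complex^'d => real) => complex^'d => complex^'d => complex" where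
 "herm g v w = Complex (g v w) (g v (J w))"

definition hmat :: "(complex^'d => complex^'d => real) => ('d => complex^'d) => complex^'d^'d" where
 "hmat g e = (\<chi> i j. herm g (e i) (e j))"

text \<open>For a Kaehler metric this is the density of the Riemannian volume with respect to
  Lebesgue measure.\<close>

definition hdet :: "(complex^'d => complex^'d => real) => real" where
 "hdet g = Re (det (hmat g (%i. axis i 1)))"

lemma herm_smult: assumes "jsym g"
 shows "herm g (c *s v) w = c * herm g v w" "herm g v (c *s w) = cnj c * herm g v w"
proof -
 note b = bilinear_simps[OF jsymD(1)[OF assms]]
 have "g v (J (c *s w)) = Re c * g v (J w) - Im c * g v w"
 proof -
  have "J (c *s w) = Re c *\<^sub>R J w - Im c *\<^sub>R w"
  by (simp add: vec_eq_iff complex_eq_iff)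
  then show ?thesis by (simp add: b)
 qed
 then show "herm g v (c *s w) = cnj c * herm g v w"
  by (simp add: herm_def smult_eq_J[of c] b complex_eq_iff)
 show "herm g (c *s v) w = c * herm g v w"
  by (simp add: herm_def smult_eq_J[of c] b complex_eq_iff jsymD(3,4)[OF assms] algebra_simps)
qed

lemma herm_sum: assumes "jsym g"
 shows "herm g (\<Sum>i\<in>I. f i) w = (\<Sum>i\<in>I. herm g (f i) w)"
  "herm g w (\<Sum>i\<in>I. f i) = (\<Sum>i\<in>I. herm g w (f i))"
proof -
 note bl = jsymD(1)[OF assms]
 have "J (\<Sum>i\<in>I. f i) = (\<Sum>i\<in>I. J (f i))" using linear_sum[OF linear_smult] by blast
 then show "herm g (\<Sum>i\<in>I. f i) w = (\<Sum>i\<in>I. herm g (f i) w)"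
  "herm g w (\<Sum>i\<in>I. f i) = (\<Sum>i\<in>I. herm g w (f i))"
  by (simp_all add: herm_def bilinear_sum_left[OF bl] bilinear_sum_right[OF bl] complex_eq_iff)
qed

lemma det_cnj_transpose: "det ((\<chi> i j. cnj (T $ j $ i)) :: complex^'d^'d) = cnj (det T)"
proof -
 have "(\<chi> i j. cnj (T $ j $ i)) = transpose (\<chi> i j. cnj (T $ i $ j))"
  by (simp add: transpose_def)
 then have "det ((\<chi> i j. cnj (T $ j $ i)) :: complex^'d^'d) = det ((\<chi> i j. cnj (T $ i $ j)) :: complex^'d^'d)"
  by (simp only: det_transpose)
 also have "... = cnj (det T)" unfolding det_def by simp
 finally show ?thesis .
qed

lemma det_hmat_change:
 fixes e :: "'d => complex^'d"
 assumes "jsym g"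
 shows "det (hmat g e) = of_real ((cmod (det (\<chi> i j. e i $ j)))\<^sup>2) * det (hmat g (%i. axis i 1))"
proof -
 define T where "T = (\<chi> i j. e i $ j)"
 have ex: "e i = (\<Sum>k\<in>UNIV. (e i $ k) *s axis k 1)" for i by (simp add: basis_expansion)
 have "hmat g e = T ** hmat g (%i. axis i 1) ** (\<chi> i j. cnj (T $ j $ i))"
 proof -
  have "herm g (e i) (e j) = (\<Sum>l\<in>UNIV. (\<Sum>k\<in>UNIV. e i $ k * herm g (axis k 1) (axis l 1)) * cnj (e j $ l))" for i j
  by (subst ex[of i], subst ex[of j])
  (simp add: herm_sum[OF assms] herm_smult[OF assms] sum_distrib_left sum_distrib_right mult_ac)
  then show ?thesis by (simp add: vec_eq_iff hmat_def matrix_matrix_mult_def T_def)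
 qed
 then have "det (hmat g e) = det T * det (hmat g (%i. axis i 1)) * cnj (det T)"
  by (simp add: det_mul det_cnj_transpose)
 then show ?thesis unfolding T_def[symmetric]
  by (simp add: complex_norm_square mult_ac flip: of_real_power)
qed

text \<open>In a unitary frame of eigenvectors the matrix of \<open>g\<close> is the identity and
  that of \<open>b\<close> is diagonal; passing to standard coordinates multiplies both determinants
  by the same factor.\<close>

lemma hdet_diag:
 fixes g b :: "complex^'d => complex^'d => real"
 assumes g: "jsym g" and e: "uframe g e" and b: "jsym b" and eig: "!!i w. b (e i) w = lam i * g (e i) w"
 shows "hdet g > 0" "hdet b = (\<Prod>i\<in>UNIV. lam i) * hdet g"
  "(cmod (det (\<chi> i j. e i $ j)))\<^sup>2 = 1 / hdet g"
proof -
 define c where "c = (cmod (det (\<chi> i j. e i $ j)))\<^sup>2"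
 have hb: "hmat b e = (\<chi> i j. if i = j then of_real (lam i) else 0)"
  unfolding hmat_def herm_def by (simp add: vec_eq_iff eig uframeD[OF g e] complex_eq_iff)
 have "det (hmat b e) = (\<Prod>i\<in>UNIV. of_real (lam i))"
  unfolding hb by (subst det_diagonal) auto
 then have 1: "of_real c * det (hmat b (%i. axis i 1)) = of_real (\<Prod>i\<in>UNIV. lam i)"
  using det_hmat_change[OF b, of e] by (simp add: c_def)
 have hg: "hmat g e = mat 1"
  unfolding hmat_def herm_def mat_def by (simp add: vec_eq_iff uframeD[OF g e] complex_eq_iff)
 have 2: "of_real c * det (hmat g (%i. axis i 1)) = 1"
  using det_hmat_change[OF g, of e] by (simp add: c_def hg)
 have "c * hdet g = 1" using arg_cong[OF 2, of Re] by (simp add: hdet_def)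
 moreover have "c * hdet b = (\<Prod>i\<in>UNIV. lam i)" using arg_cong[OF 1, of Re] by (simp add: hdet_def del: of_real_prod)
 moreover have "c >= 0" by (simp add: c_def)
 ultimately have c: "c > 0" "hdet g = 1 / c" "hdet b = (\<Prod>i\<in>UNIV. lam i) / c"
  by (auto simp: less_le eq_divide_eq mult.commute)
 then show "hdet g > 0" "hdet b = (\<Prod>i\<in>UNIV. lam i) * hdet g" "c = 1 / hdet g"
  by simp_all
qed

lemma hdet_pos: "jpos g ==> hdet g > 0"
 using uframe_exists[of g] hdet_diag(1)[OF jposD(1) _ jposD(1), of g _ g "%_. 1"] by fastforce

text \<open>A permutation other than the identity moves at least two indices, so differentiating one
  factor of its product leaves a factor that is zero.\<close>

lemma det_derivative_at_one:
 fixes M :: "'a::real_normed_vector => complex^'d^'d"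
 assumes M: "M z = mat 1" and D: "!!i j. ((%z. M z $ i $ j) has_derivative M' i j) (at z)"
 shows "((%z. det (M z)) has_derivative (%y. \<Sum>i\<in>UNIV. M' i i y)) (at z)"
proof -
 have "((%z. det (M z)) has_derivative (%y. \<Sum>p | p permutes UNIV. of_int (sign p) *
  (\<Sum>i\<in>UNIV. M' i (p i) y * (\<Prod>j\<in>UNIV - {i}. M z $ j $ p j)))) (at z)"
  unfolding det_def
  by (intro has_derivative_sum has_derivative_mult_right has_derivative_prod D)
 moreover have "(\<Sum>p | p permutes (UNIV::'d set). of_int (sign p) *
  (\<Sum>i\<in>UNIV. M' i (p i) y * (\<Prod>j\<in>UNIV - {i}. M z $ j $ p j))) = (\<Sum>i\<in>UNIV. M' i i y)" for y
 proof -
  have 0: "(\<Prod>j\<in>UNIV - {i}. M z $ j $ p j) = 0" if p: "p ~= id" "p permutes UNIV" for p i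
  proof -
  obtain j where j: "p j ~= j" using p(1) by fastforce
  have "p (p j) ~= p j" using j p(2) by (metis permutes_inj injD)
  then obtain k where "k ~= i" "p k ~= k" using j by metis
  then show ?thesis by (intro prod_zero bexI[of _ k]) (auto simp: M mat_def)
  qed
  have "(\<Sum>p | p permutes (UNIV::'d set). of_int (sign p) *
  (\<Sum>i\<in>UNIV. M' i (p i) y * (\<Prod>j\<in>UNIV - {i}. M z $ j $ p j))) =
  (\<Sum>p\<in>{id}. of_int (sign p) * (\<Sum>i\<in>UNIV. M' i (p i) y * (\<Prod>j\<in>UNIV - {i}. M z $ j $ p j)))"
  by (rule sum.mono_neutral_right) (auto simp: 0 permutes_id finite_permutations)
  then show ?thesis by (simp add: M mat_def)
 qed
 ultimately show ?thesis by simp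
qed

text \<open>Jacobi's formula. The frame, unitary at \<open>z\<close>, is held constant, so it only
  rescales the determinant; at \<open>z\<close> the matrix is the identity, where the derivative of
  the determinant is the trace.\<close>

lemma hdet_has_derivative:
 fixes g :: "'a::real_normed_vector => complex^'d => complex^'d => real"
 assumes S: "open S" "z \<in> S" and g: "!!x. x \<in> S ==> jsym (g x)" and e: "uframe (g z) e"
  and D: "!!v w. ((%x. g x v w) has_derivative g' v w) (at z)"
 shows "((%x. hdet (g x)) has_derivative (%y. hdet (g z) * (\<Sum>i\<in>UNIV. g' (e i) (e i) y))) (at z)"
proof -
 have gz: "jsym (g z)" using g S by blast
 define c where "c = (cmod (det (\<chi> i j. e i $ j)))\<^sup>2"
 have c: "c = 1 / hdet (g z)" "hdet (g z) > 0"
  using hdet_diag[OF gz e gz, of "%_. 1"] by (auto simp: c_def)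
 have m1: "hmat (g z) e = mat 1"
  unfolding hmat_def herm_def mat_def by (simp add: vec_eq_iff uframeD[OF gz e] complex_eq_iff)
 have "((%x. det (hmat (g x) e)) has_derivative (%y. \<Sum>i\<in>UNIV. Complex (g' (e i) (e i) y) (g' (e i) (J (e i)) y))) (at z)"
 proof (rule det_derivative_at_one[where M' = "%i j y. Complex (g' (e i) (e j) y) (g' (e i) (J (e j)) y)"])
  show "hmat (g z) e = mat 1" by (fact m1)
  show "((%x. hmat (g x) e $ i $ j) has_derivative (%y. Complex (g' (e i) (e j) y) (g' (e i) (J (e j)) y))) (at z)" for i j
  unfolding hmat_def herm_def Complex_eq vec_lambda_beta
  by (intro has_derivative_add has_derivative_mult_right has_derivative_of_real D)
 qed
 from bounded_linear.has_derivative[OF bounded_linear_Re this]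
 have "((%x. Re (det (hmat (g x) e))) has_derivative (%y. \<Sum>i\<in>UNIV. g' (e i) (e i) y)) (at z)" by simp
 then have "((%x. hdet (g z) * Re (det (hmat (g x) e))) has_derivative (%y. hdet (g z) * (\<Sum>i\<in>UNIV. g' (e i) (e i) y))) (at z)"
  by (rule has_derivative_mult_right)
 then show ?thesis
 proof (rule has_derivative_transform_within_open[OF _ S])
  show "hdet (g z) * Re (det (hmat (g x) e)) = hdet (g x)" if "x \<in> S" for x
  proof -
  have "Re (det (hmat (g x) e)) = c * hdet (g x)"
  unfolding det_hmat_change[OF g[OF that], of e] c_def[symmetric] hdet_def by simp
  then show ?thesis using c by simp
  qed
 qed
qed

subsection \<open>Second derivatives\<close>

text \<open>The mixed second difference over the parallelogram with sides \<open>h u\<close> and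
  \<open>h v\<close> is symmetric in \<open>u\<close> and \<open>v\<close>; by two applications of
  the mean value theorem it is \<open>h^2\<close> times either mixed derivative, up to an error of
  smaller order.\<close>

lemma second_derivative_symmetric:
 fixes f :: "'a::real_normed_vector => real"
 assumes S: "open S" "z \<in> S" and f: "Ck_on 2 S f"
 shows "dir_deriv (%x. dir_deriv f x v) z u = dir_deriv (%x. dir_deriv f x u) z v"
proof -
 have f': "Ck_on (Suc (Suc 0)) S f" using f by (simp only: numeral_2_eq_2)
 note d1 = Ck_on_SucD(1)[OF f'] and d2 = Ck_on_SucD(1)[OF Ck_on_SucD(2)[OF f']]
 have con: "continuous_on S (%x. dir_deriv (%x. dir_deriv f x v) x u)" for u v
  using Ck_on_imp_continuous_on[OF Ck_on_SucD(2)[OF Ck_on_SucD(2)[OF f']]] .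
 have key: "\<exists>d>0. \<forall>h. 0 < h & h < d -->
  \<bar>f (z + h *\<^sub>R u + h *\<^sub>R v) - f (z + h *\<^sub>R u) - f (z + h *\<^sub>R v) + f z
  - h\<^sup>2 * dir_deriv (%x. dir_deriv f x u) z v\<bar> <= h\<^sup>2 * e" if e: "e > 0" for e u v
 proof -
  have "isCont (%x. dir_deriv (%x. dir_deriv f x u) x v) z"
  using con S by (simp add: continuous_on_eq_continuous_at)
  then obtain r0 where r0: "r0 > 0" "!!x. dist x z < r0 ==>
  dist (dir_deriv (%x. dir_deriv f x u) x v) (dir_deriv (%x. dir_deriv f x u) z v) < e"
  using e unfolding continuous_at_eps_delta by (metis dist_commute)
  obtain r1 where r1: "r1 > 0" "ball z r1 \<subseteq> S" using S openE by blast
  define r where "r = min r0 r1"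
  define d where "d = r / (norm u + norm v + 1)"
  have r: "r > 0" "ball z r \<subseteq> S" using r0 r1 by (auto simp: r_def)
  have d: "d > 0" unfolding d_def using r by (simp add: add_nonneg_pos)
  show ?thesis
  proof (intro exI[of _ d] conjI d allI impI)
  fix h :: real assume h: "0 < h & h < d"
  have inb: "z + s *\<^sub>R u + t *\<^sub>R v \<in> ball z r" if "0 <= s" "s <= h" "0 <= t" "t <= h" for s t
  proof -
  have "norm (s *\<^sub>R u + t *\<^sub>R v) <= s * norm u + t * norm v"
  using that by (intro norm_triangle_le) auto
  also have "... <= h * (norm u + norm v + 1)"
  using that h by (simp add: distrib_left add_mono mult_right_mono add_increasing2)
  also have "... < r" using h unfolding d_def
  by (simp add: pos_less_divide_eq add_nonneg_pos)
  finally have "norm (s *\<^sub>R u + t *\<^sub>R v) < r" .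
  then show ?thesis by (simp add: dist_norm norm_minus_commute algebra_simps)
  qed
  define p where "p s = f (z + s *\<^sub>R u + h *\<^sub>R v) - f (z + s *\<^sub>R u)" for s
  have dp: "(p has_real_derivative (dir_deriv f (z + s *\<^sub>R u + h *\<^sub>R v) u - dir_deriv f (z + s *\<^sub>R u) u)) (at s)"
  if "0 <= s" "s <= h" for s
  proof -
  have 1: "((%s. f (z + s *\<^sub>R u + c)) has_derivative (%y. dir_deriv f (z + s *\<^sub>R u + c) (y *\<^sub>R u))) (at s)"
  if "z + s *\<^sub>R u + c \<in> S" for c
  by (rule has_derivative_compose[where f="%s. z + s *\<^sub>R u + c" and g=f, OF _ d1[OF that]])
  (auto intro!: derivative_eq_intros)
  have m: "z + s *\<^sub>R u + h *\<^sub>R v \<in> S" "z + s *\<^sub>R u + 0 \<in> S"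
  using inb[of s h] inb[of s 0] that h r by auto
  have l: "linear (dir_deriv f x)" if "x \<in> S" for x
  using d1[OF that] has_derivative_linear by blast
  have "(p has_derivative (%y. dir_deriv f (z + s *\<^sub>R u + h *\<^sub>R v) (y *\<^sub>R u) - dir_deriv f (z + s *\<^sub>R u + 0) (y *\<^sub>R u))) (at s)"
  unfolding p_def using has_derivative_diff[OF 1[OF m(1)] 1[OF m(2)]] by simp
  then show ?thesis unfolding has_field_derivative_def
  by (rule has_derivative_eq_rhs)
  (use linear_scale[OF l[OF m(1)]] linear_scale[OF l[OF m(2)]] in \<open>auto simp: fun_eq_iff algebra_simps\<close>)
  qed
  obtain s where s: "0 < s" "s < h" and
  ps: "p h - p 0 = (h - 0) * (dir_deriv f (z + s *\<^sub>R u + h *\<^sub>R v) u - dir_deriv f (z + s *\<^sub>R u) u)"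
  using MVT2[of 0 h p, OF _ dp] h by auto
  define q where "q t = dir_deriv f (z + s *\<^sub>R u + t *\<^sub>R v) u" for t
  have dq: "(q has_real_derivative dir_deriv (%x. dir_deriv f x u) (z + s *\<^sub>R u + t *\<^sub>R v) v) (at t)"
  if "0 <= t" "t <= h" for t
  proof -
  have m: "z + s *\<^sub>R u + t *\<^sub>R v \<in> S"
  using inb[of s t] that h s r by auto
  have "(q has_derivative (%y. dir_deriv (%x. dir_deriv f x u) (z + s *\<^sub>R u + t *\<^sub>R v) (y *\<^sub>R v))) (at t)"
  unfolding q_def
  by (rule has_derivative_compose[where f="%t. z + s *\<^sub>R u + t *\<^sub>R v" and g="%x. dir_deriv f x u", OF _ d2[OF m]])
  (auto intro!: derivative_eq_intros)
  then show ?thesis unfolding has_field_derivative_def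
  by (rule has_derivative_eq_rhs)
  (use linear_scale[OF has_derivative_linear[OF d2[OF m, of u]]] in \<open>auto simp: fun_eq_iff algebra_simps\<close>)
  qed
  obtain t where t: "0 < t" "t < h" and
  qs: "q h - q 0 = (h - 0) * dir_deriv (%x. dir_deriv f x u) (z + s *\<^sub>R u + t *\<^sub>R v) v"
  using MVT2[of 0 h q, OF _ dq] h by auto
  show "\<bar>f (z + h *\<^sub>R u + h *\<^sub>R v) - f (z + h *\<^sub>R u) - f (z + h *\<^sub>R v) + f z
  - h\<^sup>2 * dir_deriv (%x. dir_deriv f x u) z v\<bar> <= h\<^sup>2 * e"
  proof -
  have "z + s *\<^sub>R u + t *\<^sub>R v \<in> ball z r0" using inb[of s t] s t by (auto simp: r_def)
  then have "\<bar>dir_deriv (%x. dir_deriv f x u) (z + s *\<^sub>R u + t *\<^sub>R v) v - dir_deriv (%x. dir_deriv f x u) z v\<bar> <= e"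
  using r0(2)[of "z + s *\<^sub>R u + t *\<^sub>R v"] by (simp add: dist_commute dist_real_def)
  moreover have "f (z + h *\<^sub>R u + h *\<^sub>R v) - f (z + h *\<^sub>R u) - f (z + h *\<^sub>R v) + f z
  = h\<^sup>2 * dir_deriv (%x. dir_deriv f x u) (z + s *\<^sub>R u + t *\<^sub>R v) v"
  using ps qs by (simp add: p_def q_def power2_eq_square)
  ultimately show ?thesis
  by (simp add: abs_mult mult_left_mono flip: right_diff_distrib)
  qed
  qed
 qed
 define A B where "A = dir_deriv (%x. dir_deriv f x u) z v" and "B = dir_deriv (%x. dir_deriv f x v) z u"
 have "\<bar>A - B\<bar> <= e" if "e > 0" for e
 proof -
  obtain d where d: "d > 0" "!!h. 0 < h ==> h < d ==>
  \<bar>f (z + h *\<^sub>R u + h *\<^sub>R v) - f (z + h *\<^sub>R u) - f (z + h *\<^sub>R v) + f z - h\<^sup>2 * A\<bar> <= h\<^sup>2 * (e / 2)"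
  using key[of "e / 2" u v] \<open>e > 0\<close> unfolding A_def by auto
  obtain d' where d': "d' > 0" "!!h. 0 < h ==> h < d' ==>
  \<bar>f (z + h *\<^sub>R v + h *\<^sub>R u) - f (z + h *\<^sub>R v) - f (z + h *\<^sub>R u) + f z - h\<^sup>2 * B\<bar> <= h\<^sup>2 * (e / 2)"
  using key[of "e / 2" v u] \<open>e > 0\<close> unfolding B_def by auto
  define h where "h = min d d' / 2"
  have h: "0 < h" "h < d" "h < d'" using d(1) d'(1) by (auto simp: h_def)
  have sw: "z + h *\<^sub>R v + h *\<^sub>R u = z + h *\<^sub>R u + h *\<^sub>R v" by simp
  have abs4: "\<bar>X - Y - Z + W - p\<bar> <= h\<^sup>2 * (e / 2) ==> \<bar>X - Z - Y + W - q\<bar> <= h\<^sup>2 * (e / 2) ==> \<bar>p - q\<bar> <= h\<^sup>2 * e"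
  for X Y Z W p q :: real
  unfolding abs_le_iff by simp
  have "\<bar>h\<^sup>2 * A - h\<^sup>2 * B\<bar> <= h\<^sup>2 * e"
  by (rule abs4[OF d(2)[OF h(1,2)] d'(2)[OF h(1,3), unfolded sw]])
  then have "h\<^sup>2 * \<bar>A - B\<bar> <= h\<^sup>2 * e" by (simp add: abs_mult flip: right_diff_distrib)
  then show ?thesis using h by simp
 qed
 then have "\<bar>A - B\<bar> <= 0" by (rule field_le_epsilon) simp
 then show ?thesis by (simp add: A_def B_def)
qed

subsection \<open>The Levi-Civita connection of a Kaehler metric\<close>

lemma Ck_on_det:
 fixes M :: "'a::real_normed_vector => complex^'d^'d"
 assumes "open S" "!!i j. Ck_on k S (%z. M z $ i $ j)"
 shows "Ck_on k S (%z. det (M z))"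
 unfolding det_def by (intro Ck_on_sum Ck_on_mult Ck_on_const Ck_on_prod assms)

lemma trace_commute:
 fixes A B :: "'a::euclidean_space => 'a"
 assumes "linear A" "linear B"
 shows "(\<Sum>b\<in>Basis. A (B b) \<bullet> b) = (\<Sum>b\<in>Basis. B (A b) \<bullet> b)"
proof -
 have 1: "(\<Sum>b\<in>Basis. A (B b) \<bullet> b) = (\<Sum>b\<in>Basis. \<Sum>c\<in>Basis. (B b \<bullet> c) * (A c \<bullet> b))"
  if "linear A" "linear B" for A B :: "'a => 'a"
 proof (rule sum.cong[OF refl])
  fix b :: 'a
  have "A (B b) = A (\<Sum>c\<in>Basis. (B b \<bullet> c) *\<^sub>R c)" by (simp add: euclidean_representation)
  also have "... = (\<Sum>c\<in>Basis. (B b \<bullet> c) *\<^sub>R A c)"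
  by (simp add: linear_sum[OF that(1)] linear_scale[OF that(1)])
  finally show "A (B b) \<bullet> b = (\<Sum>c\<in>Basis. (B b \<bullet> c) * (A c \<bullet> b))"
  by (simp add: inner_sum_left)
 qed
 show ?thesis unfolding 1[OF assms] 1[OF assms(2,1)]
  by (subst sum.swap) (simp add: mult.commute)
qed

locale kaehler =
 fixes Omega :: "(complex^'d) set" and G :: "complex^'d => complex^'d => complex^'d => real"
 assumes open_dom: "open Omega" and kaehler: "kaehler_metric Omega G"
begin

abbreviation "dG z u v w \<equiv> dir_deriv (%z. G z v w) z u"
abbreviation "Gam \<equiv> levi_civita G"
abbreviation "dGam z u v w \<equiv> dir_deriv (%z. Gam z v w) z u"
abbreviation "curv \<equiv> riemann_curvature G"

lemma jpos_G: "z \<in> Omega ==> jpos (G z)"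
 using kaehler unfolding kaehler_metric_def riemannian_metric_def jpos_def jsym_def by blast

lemmas jsym_G = jposD(1)[OF jpos_G]
lemmas bilinear_G = jsymD(1)[OF jsym_G]
lemmas G_simps = bilinear_simps[OF bilinear_G]
lemmas G_commute = jsymD(2)[OF jsym_G]
lemmas G_J = jsymD(4)[OF jsym_G]

lemma smooth_G: "smooth_on Omega (%z. G z v w)"
 using kaehler unfolding kaehler_metric_def riemannian_metric_def by blast

lemma Ck_G: "Ck_on k Omega (%z. G z v w)"
 using smooth_G unfolding smooth_on_def by blast

lemma G_has_derivative: "z \<in> Omega ==> ((%z. G z v w) has_derivative (%u. dG z u v w)) (at z)"
 using smooth_on_has_derivative[OF smooth_G] by simp

lemma smooth_dG: "smooth_on Omega (%z. dG z u v w)"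
 by (rule smooth_on_deriv[OF smooth_G])

lemma Ck_dG: "Ck_on k Omega (%z. dG z u v w)"
 using smooth_dG unfolding smooth_on_def by blast

lemma linear_dG: "z \<in> Omega ==> linear (%u. dG z u v w)"
 using G_has_derivative has_derivative_linear by blast

lemma jsym_dG: assumes z: "z \<in> Omega" shows "jsym (dG z u)"
proof -
 have sym: "dG z u a b = dG z u b a" for a b
  by (rule dir_deriv_cong[OF open_dom z]) (rule G_commute)
 have J: "dG z u (J a) (J b) = dG z u a b" for a b
  by (rule dir_deriv_cong[OF open_dom z]) (rule jsymD(3)[OF jsym_G])
 have add: "dG z u (a + a') b = dG z u a b + dG z u a' b" for a a' b
 proof -
  have "dG z u (a + a') b = dir_deriv (%x. G x a b + G x a' b) z u"
  by (rule dir_deriv_cong[OF open_dom z]) (simp add: G_simps)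
  then show ?thesis
  using dir_deriv_eqI[OF has_derivative_add[OF G_has_derivative[OF z] G_has_derivative[OF z]]] by simp
 qed
 have scale: "dG z u (c *\<^sub>R a) b = c *\<^sub>R dG z u a b" for a c b
 proof -
  have "dG z u (c *\<^sub>R a) b = dir_deriv (%x. c * G x a b) z u"
  by (rule dir_deriv_cong[OF open_dom z]) (simp add: G_simps)
  then show ?thesis
  using dir_deriv_eqI[OF has_derivative_mult_right[OF G_has_derivative[OF z]]] by simp
 qed
 have l: "linear (%a. dG z u a b)" for b by (rule linearI; rule add scale)
 moreover have "linear (%b. dG z u a b)" for a using l[of a] by (simp only: sym[of a])
 ultimately show ?thesis unfolding jsym_def bilinear_def using sym J by auto
qed

lemmas dG_simps = bilinear_simps[OF jsymD(1)[OF jsym_dG]]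
lemmas dG_commute = jsymD(2)[OF jsym_dG]
lemmas dG_J = jsymD(4)[OF jsym_dG]

lemma dG_closed: assumes z: "z \<in> Omega"
 shows "dG z u (J v) w + dG z v (J w) u + dG z w (J u) v = 0"
 using kaehler z unfolding kaehler_metric_def fundamental_form_def by blast

lemma riesz_exists:
 assumes z: "z \<in> Omega" and beta: "linear beta"
 obtains x where "!!u. G z x u = beta u"
proof -
 obtain e where e: "uframe (G z) e" using uframe_exists[OF jpos_G[OF z]] .
 have "G z (\<Sum>i\<in>UNIV. beta (e i) *\<^sub>R e i + beta (J (e i)) *\<^sub>R J (e i)) u = beta u" for u
 proof -
  have "beta u = beta (\<Sum>i\<in>UNIV. G z u (e i) *\<^sub>R e i + G z u (J (e i)) *\<^sub>R J (e i))"
  using uframe_expand[OF jsym_G[OF z] e, of u] by simp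
  then show ?thesis
  by (simp add: linear_sum[OF beta] linear_add[OF beta] linear_scale[OF beta] bilinear_sum_left[OF bilinear_G[OF z]]
  G_simps[OF z] G_commute[OF z, of u] mult.commute)
 qed
 then show ?thesis by (rule that)
qed

lemma riesz_unique:
 assumes z: "z \<in> Omega" and "!!u. G z x u = G z y u"
 shows "x = y"
proof -
 have "G z (x - y) (x - y) = 0" using G_simps(9)[OF z, of x y "x - y"] assms(2)[of "x - y"] by simp
 then show ?thesis using jposD(4)[OF jpos_G[OF z], of "x - y"] by simp
qed

text \<open>The representing vector solves a complex square linear system with \<open>C^k\<close>
  coefficients and nonvanishing determinant, so Cramer's rule gives its regularity.\<close>

lemma riesz_Ck:
 assumes s: "!!z u. z \<in> Omega ==> G z (s z) u = beta z u" and beta: "!!u. Ck_on k Omega (%z. beta z u)"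
 shows "Ck_on k Omega s"
proof -
 define M where "M z = (\<chi> j i. herm (G z) (axis i 1) (axis j 1))" for z
 define b where "b z = (\<chi> j. Complex (beta z (axis j 1)) (beta z (J (axis j 1))))" for z
 have dM: "det (M z) ~= 0" if z: "z \<in> Omega" for z
 proof -
  have "M z = transpose (hmat (G z) (%i. axis i 1))" by (simp add: M_def hmat_def transpose_def)
  then have "Re (det (M z)) = hdet (G z)" by (simp add: hdet_def det_transpose)
  then show ?thesis using hdet_pos[OF jpos_G[OF z]] by auto
 qed
 have Ms: "M z *v s z = b z" if z: "z \<in> Omega" for z
 proof -
  have "herm (G z) (s z) (axis j 1) = (\<Sum>i\<in>UNIV. (s z $ i) * herm (G z) (axis i 1) (axis j 1))" for j
  by (subst (1) basis_expansion[of "s z", symmetric])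
  (simp only: herm_sum[OF jsym_G[OF z]] herm_smult[OF jsym_G[OF z]])
  then show ?thesis
  by (simp add: vec_eq_iff matrix_vector_mult_def M_def b_def herm_def s[OF z] mult.commute)
 qed
 have C: "Ck_on k Omega (%z. Complex (p z) (q z))" if "Ck_on k Omega p" "Ck_on k Omega q" for p q :: "complex^'d => real"
  unfolding Complex_eq
  by (intro Ck_on_add Ck_on_mult Ck_on_const open_dom Ck_on_bounded_linear[OF _ bounded_linear_of_real] that)
 have eq: "s z $ k' = det (\<chi> i j. if j = k' then b z $ i else M z $ i $ j) * inverse (det (M z))" if "z \<in> Omega" for z k'
  using cramer[OF dM[OF that], of "s z" "b z"] Ms[OF that] by (simp add: divide_inverse)
 have comp: "Ck_on k Omega (%z. s z $ k')" for k'
 proof -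
  have CM: "Ck_on k Omega (%z. M z $ i $ j)" for i j
  unfolding M_def herm_def by (simp add: C Ck_G)
  have Cb: "Ck_on k Omega (%z. b z $ i)" for i
  unfolding b_def by (simp add: C beta)
  have "Ck_on k Omega (%z. (\<chi> i j. if j = k' then b z $ i else M z $ i $ j) $ i $ j)" for i j
  using CM Cb by (cases "j = k'") auto
  then have *: "Ck_on k Omega (%z. det (\<chi> i j. if j = k' then b z $ i else M z $ i $ j) * inverse (det (M z)))"
  by (intro Ck_on_mult Ck_on_inverse Ck_on_det open_dom CM dM)
  moreover have "Ck_on k Omega (%z. s z $ k') \<longleftrightarrow>
  Ck_on k Omega (%z. det (\<chi> i j. if j = k' then b z $ i else M z $ i $ j) * inverse (det (M z)))"
  by (rule Ck_on_cong[OF open_dom]) (rule eq)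
  ultimately show ?thesis by (simp only:)
 qed
 have "Ck_on k Omega (%z. \<Sum>i\<in>UNIV. (s z $ i) *s axis i 1)"
  by (intro Ck_on_sum open_dom Ck_on_bounded_linear[OF _ bounded_linear_smult_left] comp)
 then show ?thesis by (simp add: basis_expansion)
qed

text \<open>The definite description in \<open>levi_civita\<close> denotes: the right-hand side is
  linear in \<open>u\<close>, and Riesz representation gives existence and uniqueness.\<close>

lemma LC_eq: assumes z: "z \<in> Omega"
 shows "2 * G z (Gam z v w) u = dG z v w u + dG z w v u - dG z u v w"
proof -
 have l: "linear (%u. (dG z v w u + dG z w v u - dG z u v w) / 2)"
  by (rule linearI) (simp_all add: dG_simps[OF z] linear_add[OF linear_dG[OF z]]
  linear_scale[OF linear_dG[OF z]] field_simps)
 obtain x where x0: "!!u. G z x u = (dG z v w u + dG z w v u - dG z u v w) / 2"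
  by (rule riesz_exists[OF z l]) blast
 have x: "\<forall>u. 2 * G z x u = dG z v w u + dG z w v u - dG z u v w"
 proof
  show "2 * G z x u = dG z v w u + dG z w v u - dG z u v w" for u unfolding x0 by simp
 qed
 have "\<forall>u. 2 * G z (Gam z v w) u = dG z v w u + dG z w v u - dG z u v w"
  unfolding levi_civita_def
 proof (rule theI[of _ x])
  show "\<forall>u. 2 * G z x u = dG z v w u + dG z w v u - dG z u v w" by (fact x)
  show "y = x" if "\<forall>u. 2 * G z y u = dG z v w u + dG z w v u - dG z u v w" for y
  proof (rule riesz_unique[OF z])
  show "G z y u = G z x u" for u using spec[OF x, of u] spec[OF that, of u] by linarith
  qed
 qed
 then show ?thesis by blast
qed

lemma Ck_Gam: "Ck_on k Omega (%z. Gam z v w)"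
proof (rule riesz_Ck)
 show "G z (Gam z v w) u = (1 / 2) * (dG z v w u + dG z w v u - dG z u v w)" if "z \<in> Omega" for z u
  using LC_eq[OF that, of v w u] by simp
 show "Ck_on k Omega (%z. (1 / 2) * (dG z v w u + dG z w v u - dG z u v w))" for u
  by (intro Ck_on_cmult Ck_on_add Ck_on_diff Ck_dG open_dom)
qed

lemma Gam_has_derivative: "z \<in> Omega ==> ((%z. Gam z v w) has_derivative (%u. dGam z u v w)) (at z)"
 using Ck_on_SucD(1)[OF Ck_Gam[of "Suc 0"]] by simp

lemma Gam_eqI: assumes "z \<in> Omega" "!!u. 2 * G z x u = dG z v w u + dG z w v u - dG z u v w"
 shows "Gam z v w = x"
proof (rule riesz_unique[OF assms(1)])
 show "G z (Gam z v w) u = G z x u" for u using LC_eq[OF assms(1), of v w u] assms(2)[of u] by linarith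
qed

lemma Gam_commute: "z \<in> Omega ==> Gam z v w = Gam z w v"
 by (rule Gam_eqI) (use LC_eq dG_commute in force)+

lemma Gam_add: "z \<in> Omega ==> Gam z v (w + w') = Gam z v w + Gam z v w'"
 by (rule Gam_eqI) (simp_all add: G_simps dG_simps distrib_left LC_eq linear_add[OF linear_dG])

lemma Gam_scale: "z \<in> Omega ==> Gam z v (c *\<^sub>R w) = c *\<^sub>R Gam z v w"
proof (rule Gam_eqI)
 fix u assume z: "z \<in> Omega"
 show "2 * G z (c *\<^sub>R Gam z v w) u = dG z v (c *\<^sub>R w) u + dG z (c *\<^sub>R w) v u - dG z u v (c *\<^sub>R w)"
  using arg_cong[OF LC_eq[OF z, of v w u], of "(*) c"]
  by (simp add: G_simps[OF z] dG_simps[OF z] linear_scale[OF linear_dG[OF z]] algebra_simps)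
qed

text \<open>The complex structure is parallel because the fundamental form is closed: closedness on
  two triples of constant fields, \<open>c1\<close> and \<open>c2\<close>, matches the Koszul
  formulas of both sides.\<close>

lemma Gam_J: assumes z: "z \<in> Omega" shows "Gam z v (J w) = J (Gam z v w)"
proof (rule Gam_eqI[OF z])
 fix u
 have J1: "dG z x (J a) b = - dG z x a (J b)" for x a b by (rule dG_J[OF z])
 have c1: "dG z w (J u) v + dG z u (J v) w + dG z v (J w) u = 0" by (rule dG_closed[OF z])
 have c2: "dG z (J w) (J (J u)) v + dG z (J u) (J v) (J w) + dG z v (J (J w)) (J u) = 0" by (rule dG_closed[OF z])
 have "2 * G z (J (Gam z v w)) u = - (2 * G z (Gam z v w) (J u))" by (simp add: G_J[OF z])
 also have "... = - (dG z v w (J u) + dG z w v (J u) - dG z (J u) v w)" by (simp only: LC_eq[OF z])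
 also have "... = dG z v (J w) u + dG z (J w) v u - dG z u v (J w)"
 proof -
  have "dG z (J w) (J (J u)) v = - dG z (J w) v u" "dG z (J u) (J v) (J w) = dG z (J u) v w"
  "dG z v (J (J w)) (J u) = - dG z v w (J u)"
  using dG_commute[OF z, where v=u and w=v and u="J w"]
  by (simp_all add: dG_simps[OF z] jsymD(3)[OF jsym_dG[OF z]])
  with c1 c2 J1[where x=u and a=v and b=w] J1[where x=v and a=w and b=u]
  dG_commute[OF z, where u=w and v=v and w="J u"] show ?thesis by linarith
 qed
 finally show "2 * G z (J (Gam z v w)) u = dG z v (J w) u + dG z (J w) v u - dG z u v (J w)" .
qed

lemma Gam_J_left: "z \<in> Omega ==> Gam z (J v) w = J (Gam z v w)"
 by (simp add: Gam_commute[of z "J v"] Gam_J Gam_commute[of z w])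

lemma linear_Gam: assumes "z \<in> Omega" shows "linear (Gam z v)" "linear (%v. Gam z v w)"
proof -
 show "linear (Gam z v)" for v by (rule linearI) (simp_all add: Gam_add Gam_scale assms)
 then show "linear (%v. Gam z v w)" by (simp add: Gam_commute[OF assms, of _ w])
qed

lemma dG_compat: assumes z: "z \<in> Omega" shows "dG z v a b = G z (Gam z v a) b + G z a (Gam z v b)"
 using LC_eq[OF z, of v a b] LC_eq[OF z, of v b a] dG_commute[OF z, where u=v and v=a and w=b]
  dG_commute[OF z, where u=a and v=v and w=b] dG_commute[OF z, where u=b and v=v and w=a]
  G_commute[OF z, where v=a and w="Gam z v b"] by linarith

lemma linear_dGam: assumes z: "z \<in> Omega"
 shows "linear (%u. dGam z u v w)" "linear (dGam z u v)"
proof -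
 show "linear (%u. dGam z u v w)" using Gam_has_derivative[OF z] has_derivative_linear by blast
 show "linear (dGam z u v)"
 proof (rule linearI)
  fix x y c
  have "dGam z u v (x + y) = dir_deriv (%z. Gam z v x + Gam z v y) z u"
  by (rule dir_deriv_cong[OF open_dom z]) (rule Gam_add)
  then show "dGam z u v (x + y) = dGam z u v x + dGam z u v y"
  using dir_deriv_eqI[OF has_derivative_add[OF Gam_has_derivative[OF z] Gam_has_derivative[OF z]]] by simp
  have "dGam z u v (c *\<^sub>R x) = dir_deriv (%z. c *\<^sub>R Gam z v x) z u"
  by (rule dir_deriv_cong[OF open_dom z]) (rule Gam_scale)
  then show "dGam z u v (c *\<^sub>R x) = c *\<^sub>R dGam z u v x"
  using dir_deriv_eqI[OF has_derivative_scaleR_right[OF Gam_has_derivative[OF z]]] by simp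
 qed
qed

lemma dGam_commute: "z \<in> Omega ==> dGam z u v w = dGam z u w v"
 by (rule dir_deriv_cong[OF open_dom]) (auto intro: Gam_commute)

lemma dGam_J: assumes z: "z \<in> Omega" shows "dGam z u v (J w) = J (dGam z u v w)"
proof -
 have "dGam z u v (J w) = dir_deriv (%z. J (Gam z v w)) z u"
  by (rule dir_deriv_cong[OF open_dom z]) (rule Gam_J)
 then show ?thesis
  using dir_deriv_eqI[OF bounded_linear.has_derivative[OF bounded_linear_smult Gam_has_derivative[OF z]]] by simp
qed

lemma dGam_J_left: assumes z: "z \<in> Omega" shows "dGam z u (J v) w = J (dGam z u v w)"
proof -
 have "dGam z u (J v) w = dGam z u w (J v)" by (rule dGam_commute[OF z])
 also have "... = J (dGam z u w v)" by (rule dGam_J[OF z])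
 also have "dGam z u w v = dGam z u v w" by (rule dGam_commute[OF z])
 finally show ?thesis .
qed

subsection \<open>Curvature of a Kaehler metric\<close>

lemma curv_eq: "curv z u v w = dGam z u v w + Gam z u (Gam z v w) - dGam z v u w - Gam z v (Gam z u w)"
 by (simp add: riemann_curvature_def)

lemma curv_skew: "curv z u v w = - curv z v u w"
 by (simp add: curv_eq)

lemma bianchi: assumes z: "z \<in> Omega" shows "curv z u v w + curv z v w u + curv z w u v = 0"
proof -
 have "dGam z u v w - dGam z u w v = 0" "dGam z v u w - dGam z v w u = 0" "dGam z w u v - dGam z w v u = 0"
  unfolding right_minus_eq by (rule dGam_commute[OF z])+
 then show ?thesis
  unfolding curv_eq Gam_commute[OF z, of v w] Gam_commute[OF z, of u v] Gam_commute[OF z, of u w]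
  by (simp add: algebra_simps)
qed

lemma curv_J: "z \<in> Omega ==> curv z u v (J w) = J (curv z u v w)"
 by (simp add: curv_eq dGam_J Gam_J vector_ssub_ldistrib vector_add_ldistrib)

text \<open>Metric compatibility, differentiated once more. The last bracket is symmetric in
  \<open>u\<close> and \<open>v\<close>, so antisymmetrizing leaves curvature only; this is how
  \<open>curv_antisym\<close> follows.\<close>

lemma d2G: assumes z: "z \<in> Omega"
 shows "dir_deriv (%z. dG z v a b) z u = G z (dGam z u v a + Gam z u (Gam z v a)) b + G z a (dGam z u v b + Gam z u (Gam z v b))
  + (G z (Gam z v a) (Gam z u b) + G z (Gam z u a) (Gam z v b))"
proof -
  have P: "dir_deriv (%z. G z (s z) w) z u = dG z u (s z) w + G z (dir_deriv s z u) w"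
  if s: "Ck_on (Suc 0) Omega s" for s w
  proof -
  note sd = Ck_on_SucD(1)[OF s z]
  have "((%x. \<Sum>b\<in>Basis. (s x \<bullet> b) * G x b w) has_derivative
  (%u. \<Sum>b\<in>Basis. (s z \<bullet> b) * dG z u b w + (dir_deriv s z u \<bullet> b) * G z b w)) (at z)"
  by (intro has_derivative_sum has_derivative_mult has_derivative_inner_left sd G_has_derivative z)
  then have "((%x. G x (s x) w) has_derivative
  (%u. \<Sum>b\<in>Basis. (s z \<bullet> b) * dG z u b w + (dir_deriv s z u \<bullet> b) * G z b w)) (at z)"
  proof (rule has_derivative_transform_within_open[OF _ open_dom z])
  fix x assume x: "x \<in> Omega"
  have "G x (s x) w = G x (\<Sum>b\<in>Basis. (s x \<bullet> b) *\<^sub>R b) w" by (simp add: euclidean_representation)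
  then show "(\<Sum>b\<in>Basis. (s x \<bullet> b) * G x b w) = G x (s x) w"
  by (simp add: bilinear_sum_left[OF bilinear_G[OF x]] G_simps[OF x])
  qed
  then have "dir_deriv (%z. G z (s z) w) z u = (\<Sum>b\<in>Basis. (s z \<bullet> b) * dG z u b w + (dir_deriv s z u \<bullet> b) * G z b w)"
  by (rule dir_deriv_eqI)
  also have "... = dG z u (\<Sum>b\<in>Basis. (s z \<bullet> b) *\<^sub>R b) w + G z (\<Sum>b\<in>Basis. (dir_deriv s z u \<bullet> b) *\<^sub>R b) w"
  by (simp add: bilinear_sum_left[OF bilinear_G[OF z]] bilinear_sum_left[OF jsymD(1)[OF jsym_dG[OF z]]]
  G_simps[OF z] dG_simps[OF z] sum.distrib del: euclidean_representation_sum euclidean_representation_sum')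
  finally show ?thesis by (simp add: euclidean_representation)
  qed
  have diff: "((%z. G z (Gam z v a') b') has_derivative dir_deriv (%z. G z (Gam z v a') b') z) (at z)" for a' b'
  proof (rule Ck_on_SucD(1)[OF _ z, of 0])
  have "Ck_on (Suc 0) Omega (%z. (1 / 2) * (dG z v a' b' + dG z a' v b' - dG z b' v a'))"
  by (intro Ck_on_cmult Ck_on_add Ck_on_diff Ck_dG open_dom)
  then show "Ck_on (Suc 0) Omega (%z. G z (Gam z v a') b')"
  proof (rule iffD2[OF Ck_on_cong[OF open_dom], rotated])
  show "G z (Gam z v a') b' = (1 / 2) * (dG z v a' b' + dG z a' v b' - dG z b' v a')" if "z \<in> Omega" for z
  using LC_eq[OF that, of v a' b'] by simp
  qed
  qed
  have "dir_deriv (%z. dG z v a b) z u = dir_deriv (%z. G z (Gam z v a) b + G z (Gam z v b) a) z u"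
  by (rule dir_deriv_cong[OF open_dom z]) (simp add: dG_compat G_commute[of _ a])
  also have "... = dir_deriv (%z. G z (Gam z v a) b) z u + dir_deriv (%z. G z (Gam z v b) a) z u"
  by (rule dir_deriv_eqI[OF has_derivative_add[OF diff diff]])
  also have "... = dG z u (Gam z v a) b + G z (dGam z u v a) b + (dG z u (Gam z v b) a + G z (dGam z u v b) a)"
  by (simp only: P[OF Ck_Gam])
  finally show ?thesis
  by (simp add: dG_compat[OF z] G_simps[OF z] G_commute[OF z])
qed

lemma curv_antisym: assumes z: "z \<in> Omega" shows "G z (curv z u v a) b = - G z a (curv z u v b)"
proof -
 have "dir_deriv (%z. dG z v a b) z u = dir_deriv (%z. dG z u a b) z v"
  by (rule second_derivative_symmetric[OF open_dom z Ck_G])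
 then show ?thesis unfolding d2G[OF z] curv_eq by (simp add: G_simps[OF z])
qed

text \<open>The logarithm of the volume density. Up to a constant factor the Ricci form is minus its
  complex Hessian, which is how the Einstein equation enters.\<close>

definition psi :: "complex^'d => real" where "psi z = ln (hdet (G z))"

lemma Ck_psi: "Ck_on k Omega psi"
proof -
 have C: "Ck_on k Omega (%z. Complex (p z) (q z))" if "Ck_on k Omega p" "Ck_on k Omega q" for p q :: "complex^'d => real"
  unfolding Complex_eq
  by (intro Ck_on_add Ck_on_mult Ck_on_const open_dom Ck_on_bounded_linear[OF _ bounded_linear_of_real] that)
 have "Ck_on k Omega (%z. hmat (G z) (%i. axis i 1) $ i $ j)" for i j
  unfolding hmat_def herm_def by (simp add: C Ck_G)
 then have "Ck_on k Omega (%z. hdet (G z))" unfolding hdet_def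
  by (intro Ck_on_bounded_linear[OF open_dom bounded_linear_Re] Ck_on_det open_dom)
 then show ?thesis unfolding psi_def[abs_def]
  by (intro Ck_on_ln open_dom) (auto intro: hdet_pos jpos_G)
qed

lemma dpsi_frame: assumes z: "z \<in> Omega" and e: "uframe (G z) e"
 shows "dir_deriv psi z y = (\<Sum>i\<in>UNIV. dG z y (e i) (e i))"
proof -
 have "((%x. hdet (G x)) has_derivative (%y. hdet (G z) * (\<Sum>i\<in>UNIV. dG z y (e i) (e i)))) (at z)"
  by (rule hdet_has_derivative[OF open_dom z jsym_G e G_has_derivative[OF z]])
 then have "(psi has_derivative (%y. inverse (hdet (G z)) * (hdet (G z) * (\<Sum>i\<in>UNIV. dG z y (e i) (e i))))) (at z)"
  unfolding psi_def[abs_def]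
  by (rule has_derivative_eq_rhs[OF has_derivative_ln[where g="%x. hdet (G x)" and x=z, OF hdet_pos[OF jpos_G[OF z]]]])
  (auto simp: fun_eq_iff mult.commute)
 from dir_deriv_eqI[OF this] show ?thesis using hdet_pos[OF jpos_G[OF z]] by simp
qed

lemma dpsi_trace: assumes z: "z \<in> Omega"
 shows "dir_deriv psi z y = (\<Sum>b\<in>Basis. Gam z y b \<bullet> b)"
proof -
 obtain e where e: "uframe (G z) e" using uframe_exists[OF jpos_G[OF z]] .
 have "(\<Sum>b\<in>Basis. Gam z y b \<bullet> b) = (\<Sum>i\<in>UNIV. G z (Gam z y (e i)) (e i) + G z (Gam z y (J (e i))) (J (e i)))"
  by (rule uframe_trace[OF jsym_G[OF z] e linear_Gam(1)[OF z]])
 also have "... = (\<Sum>i\<in>UNIV. dG z y (e i) (e i))"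
  by (rule sum.cong) (simp_all add: dG_compat[OF z] Gam_J[OF z] jsymD(3)[OF jsym_G[OF z]] G_commute[OF z])
 finally show ?thesis using dpsi_frame[OF z e] by simp
qed

lemma d2psi_trace: assumes z: "z \<in> Omega"
 shows "dir_deriv (%z. dir_deriv psi z y) z u = (\<Sum>b\<in>Basis. dGam z u y b \<bullet> b)"
proof -
 have "dir_deriv (%z. dir_deriv psi z y) z u = dir_deriv (%z. \<Sum>b\<in>Basis. Gam z y b \<bullet> b) z u"
  by (rule dir_deriv_cong[OF open_dom z]) (rule dpsi_trace)
 also have "... = (\<Sum>b\<in>Basis. dGam z u y b \<bullet> b)"
  by (rule dir_deriv_eqI) (intro has_derivative_sum has_derivative_inner_left Gam_has_derivative z)
 finally show ?thesis .
qed

text \<open>The first Bianchi identity writes the curvature endomorphism as a difference of two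
  terms whose traces are Ricci curvatures, and \<open>J\<close> moves into the last slot.\<close>

lemma ricci_trace: assumes z: "z \<in> Omega"
 shows "(\<Sum>b\<in>Basis. J (curv z v w b) \<bullet> b) = ricci_curvature G z w (J v) - ricci_curvature G z v (J w)"
proof -
 have "J (curv z v w b) = curv z b w (J v) - curv z b v (J w)" for b
 proof -
  have "curv z v w b = curv z b w v - curv z b v w"
  using bianchi[OF z, of v w b] curv_skew[of z w b v] by (simp add: algebra_simps add_eq_0_iff)
  then show ?thesis by (simp add: curv_J[OF z] vector_ssub_ldistrib)
 qed
 then show ?thesis by (simp add: ricci_curvature_def inner_diff_left sum_subtractf)
qed

text \<open>The quadratic terms of the curvature form the commutator of two endomorphisms commuting
  with \<open>J\<close>, whose trace against \<open>J\<close> is zero. Only derivatives of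
  \<open>Gam\<close> remain, and their traces are second derivatives of \<open>psi\<close>.\<close>

lemma ricci_psi: assumes z: "z \<in> Omega"
 shows "dir_deriv (%z. dir_deriv psi z (J w)) z v - dir_deriv (%z. dir_deriv psi z (J v)) z w
  = ricci_curvature G z w (J v) - ricci_curvature G z v (J w)"
proof -
 have lin: "linear (%b. J (Gam z v b))" for v
  using linear_compose[OF linear_Gam(1)[OF z] linear_smult] by (simp add: o_def)
 have t: "(\<Sum>b\<in>Basis. J (Gam z v (Gam z w b)) \<bullet> b) = (\<Sum>b\<in>Basis. J (Gam z w (Gam z v b)) \<bullet> b)"
  using trace_commute[OF lin[of v] linear_Gam(1)[OF z, of w]] by (simp add: Gam_J[OF z])
 have "(\<Sum>b\<in>Basis. J (curv z v w b) \<bullet> b) = (\<Sum>b\<in>Basis. dGam z v (J w) b \<bullet> b) - (\<Sum>b\<in>Basis. dGam z w (J v) b \<bullet> b)"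
  unfolding curv_eq vector_ssub_ldistrib vector_add_ldistrib inner_diff_left inner_add_left
  sum_subtractf sum.distrib t dGam_J_left[OF z] by simp
 then show ?thesis using ricci_trace[OF z] d2psi_trace[OF z] by simp
qed

end

subsection \<open>Levi forms, and a Bochner inequality\<close>

text \<open>The second part, the Hermitian inequality, is the real one for \<open>x\<close> and the
  vector \<open>p y + q J y\<close>, whose coefficients are the two components to be
  estimated.\<close>

lemma jpos_cauchy_schwarz:
 assumes g: "jpos g"
 shows "(g x y)\<^sup>2 <= g x x * g y y" "(g x y)\<^sup>2 + (g x (J y))\<^sup>2 <= g x x * g y y"
proof -
 note s = jposD(1)[OF g] and b = bilinear_simps[OF jsymD(1)[OF jposD(1)[OF g]]]
 show cs: "(g x y)\<^sup>2 <= g x x * g y y" for x y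
 proof (cases "y = 0")
  case False
  have "0 <= g (g y y *\<^sub>R x - g x y *\<^sub>R y) (g y y *\<^sub>R x - g x y *\<^sub>R y)"
  by (rule jposD(3)[OF g])
  also have "... = g y y * (g x x * g y y - (g x y)\<^sup>2)"
  by (simp add: b jsymD(2)[OF s, of y x] power2_eq_square algebra_simps)
  finally show ?thesis using jposD(2)[OF g False] by (simp add: zero_le_mult_iff)
 qed (simp add: b)
 define p q where "p = g x y" and "q = g x (J y)"
 have "(p\<^sup>2 + q\<^sup>2)\<^sup>2 = (g x (p *\<^sub>R y + q *\<^sub>R J y))\<^sup>2"
  by (simp add: b p_def q_def power2_eq_square)
 also have "... <= g x x * g (p *\<^sub>R y + q *\<^sub>R J y) (p *\<^sub>R y + q *\<^sub>R J y)" by (rule cs)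
 also have "... = (p\<^sup>2 + q\<^sup>2) * (g x x * g y y)"
  by (simp add: b jsymD(3)[OF s] jsymD(5)[OF s] jsymD(4)[OF s, of y y] power2_eq_square algebra_simps)
 finally have "(p\<^sup>2 + q\<^sup>2) * (p\<^sup>2 + q\<^sup>2) <= (p\<^sup>2 + q\<^sup>2) * (g x x * g y y)"
  by (simp add: power2_eq_square)
 moreover have "0 <= g x x * g y y" using jposD(3)[OF g] by simp
 ultimately show "(g x y)\<^sup>2 + (g x (J y))\<^sup>2 <= g x x * g y y"
  unfolding p_def[symmetric] q_def[symmetric]
  by (cases "p\<^sup>2 + q\<^sup>2 = 0") (auto simp: mult_le_cancel_left intro: less_le_trans sum_power2_gt_zero_iff[THEN iffD2])
qed

lemma bilinear_family_derivative:
 fixes B :: "'a::real_normed_vector => 'b::euclidean_space => 'c::euclidean_space => real"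
 assumes S: "open S" "z \<in> S" and bil: "!!x. x \<in> S ==> bilinear (B x)"
  and B': "!!v w. ((%x. B x v w) has_derivative B' v w) (at z)"
  and s: "(s has_derivative s') (at z)" and t: "(t has_derivative t') (at z)"
 shows "((%x. B x (s x) (t x)) has_derivative
  (%u. B' (s z) (t z) u + B z (s' u) (t z) + B z (s z) (t' u))) (at z)"
proof -
 have ex: "B x a b = (\<Sum>i\<in>Basis. \<Sum>j\<in>Basis. (a \<bullet> i) * (b \<bullet> j) * B x i j)" if "x \<in> S" for x a b
 proof -
  have "B x a b = B x (\<Sum>i\<in>Basis. (a \<bullet> i) *\<^sub>R i) b"
  by (simp add: euclidean_representation)
  also have "... = (\<Sum>i\<in>Basis. (a \<bullet> i) * B x i b)"
  by (simp add: bilinear_sum_left[OF bil[OF that]] bilinear_simps[OF bil[OF that]]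
  del: euclidean_representation_sum euclidean_representation_sum')
  also have "... = (\<Sum>i\<in>Basis. (a \<bullet> i) * B x i (\<Sum>j\<in>Basis. (b \<bullet> j) *\<^sub>R j))"
  by (simp add: euclidean_representation)
  also have "... = (\<Sum>i\<in>Basis. \<Sum>j\<in>Basis. (a \<bullet> i) * (b \<bullet> j) * B x i j)"
  by (simp add: bilinear_sum_right[OF bil[OF that]] bilinear_simps[OF bil[OF that]]
  sum_distrib_left mult.assoc
  del: euclidean_representation_sum euclidean_representation_sum')
  finally show ?thesis .
 qed
 have exB': "B' a b = (%u. \<Sum>i\<in>Basis. \<Sum>j\<in>Basis. (a \<bullet> i) * (b \<bullet> j) * B' i j u)" for a b
 proof (rule has_derivative_unique[OF B'])
  have "((%x. \<Sum>i\<in>Basis. \<Sum>j\<in>Basis. (a \<bullet> i) * (b \<bullet> j) * B x i j) has_derivative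
  (%u. \<Sum>i\<in>Basis. \<Sum>j\<in>Basis. (a \<bullet> i) * (b \<bullet> j) * B' i j u)) (at z)"
  by (intro has_derivative_sum has_derivative_mult_right B')
  then show "((%x. B x a b) has_derivative (%u. \<Sum>i\<in>Basis. \<Sum>j\<in>Basis. (a \<bullet> i) * (b \<bullet> j) * B' i j u)) (at z)"
  by (rule has_derivative_transform_within_open[OF _ S]) (simp add: ex)
 qed
 have "((%x. \<Sum>i\<in>Basis. \<Sum>j\<in>Basis. (s x \<bullet> i) * (t x \<bullet> j) * B x i j) has_derivative
  (%u. \<Sum>i\<in>Basis. \<Sum>j\<in>Basis. (s z \<bullet> i) * (t z \<bullet> j) * B' i j u
  + ((s z \<bullet> i) * (t' u \<bullet> j) + (s' u \<bullet> i) * (t z \<bullet> j)) * B z i j)) (at z)"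
  by (intro has_derivative_sum has_derivative_mult has_derivative_inner_left B' s t)
 then have "((%x. B x (s x) (t x)) has_derivative
  (%u. \<Sum>i\<in>Basis. \<Sum>j\<in>Basis. (s z \<bullet> i) * (t z \<bullet> j) * B' i j u
  + ((s z \<bullet> i) * (t' u \<bullet> j) + (s' u \<bullet> i) * (t z \<bullet> j)) * B z i j)) (at z)"
  by (rule has_derivative_transform_within_open[OF _ S]) (simp add: ex)
 then show ?thesis
 proof (rule has_derivative_eq_rhs, intro ext)
  fix u
  show "(\<Sum>i\<in>Basis. \<Sum>j\<in>Basis. (s z \<bullet> i) * (t z \<bullet> j) * B' i j u
  + ((s z \<bullet> i) * (t' u \<bullet> j) + (s' u \<bullet> i) * (t z \<bullet> j)) * B z i j)
  = B' (s z) (t z) u + B z (s' u) (t z) + B z (s z) (t' u)"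
  unfolding exB'[of "s z" "t z"] ex[OF S(2), of "s' u" "t z"] ex[OF S(2), of "s z" "t' u"] sum.distrib[symmetric]
  by (intro sum.cong refl) (simp add: algebra_simps)
 qed
qed

lemma second_derivative_test:
 fixes f :: "'a::real_normed_vector => real"
 assumes S: "open S" "z \<in> S" and f: "Ck_on 2 S f" and min: "!!x. x \<in> S ==> f z <= f x"
 shows "dir_deriv f z v = 0" "dir_deriv (%x. dir_deriv f x v) z v >= 0"
proof -
 have f': "Ck_on (Suc (Suc 0)) S f" using f by (simp only: numeral_2_eq_2)
 note d1 = Ck_on_SucD(1)[OF f'] and d2 = Ck_on_SucD(1)[OF Ck_on_SucD(2)[OF f']]
 have z0: "dir_deriv f z = (%v. 0)"
  by (rule differential_zero_maxmin[OF S(2,1) d1[OF S(2)]]) (use min in auto)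
 then show "dir_deriv f z v = 0" by simp
 have lin: "((%t. z + t *\<^sub>R v) has_derivative (%y. y *\<^sub>R v)) (at t)" for t
  by (auto intro!: derivative_eq_intros)
 define p q where "p t = f (z + t *\<^sub>R v)" and "q t = dir_deriv f (z + t *\<^sub>R v) v" for t
 have p: "(p has_real_derivative q t) (at t)" if "z + t *\<^sub>R v \<in> S" for t
  unfolding has_field_derivative_def p_def
  by (rule has_derivative_eq_rhs[OF has_derivative_compose[OF lin d1[OF that]]])
  (simp add: fun_eq_iff q_def linear_scale[OF has_derivative_linear[OF d1[OF that]]] mult.commute)
 have q: "(q has_real_derivative dir_deriv (%x. dir_deriv f x v) (z + t *\<^sub>R v) v) (at t)" if "z + t *\<^sub>R v \<in> S" for t
  unfolding has_field_derivative_def q_def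
  by (rule has_derivative_eq_rhs[OF has_derivative_compose[OF lin d2[OF that]]])
  (simp add: fun_eq_iff linear_scale[OF has_derivative_linear[OF d2[OF that]]] mult.commute)
 show "dir_deriv (%x. dir_deriv f x v) z v >= 0"
 proof (rule ccontr)
  assume "~ ?thesis"
  then have "dir_deriv (%x. dir_deriv f x v) (z + 0 *\<^sub>R v) v < 0" by simp
  from DERIV_neg_dec_right[OF q this] S(2)
  obtain d where d: "d > 0" "!!h. h > 0 ==> h < d ==> q h < q 0" by auto
  have "open ((%t. z + t *\<^sub>R v) -` S)"
  by (rule open_vimage[OF S(1)]) (auto intro!: continuous_intros)
  moreover have "0 \<in> (%t. z + t *\<^sub>R v) -` S" using S(2) by simp
  ultimately obtain e where e0: "e > 0" "ball 0 e \<subseteq> (%t. z + t *\<^sub>R v) -` S" by (rule openE)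
  have e: "e > 0" "!!t. \<bar>t\<bar> < e ==> z + t *\<^sub>R v \<in> S"
  using e0 by (auto simp: subset_iff)
  define h where "h = min d e / 2"
  have h: "0 < h" "h < d" "h < e" using d e by (auto simp: h_def)
  obtain c where c: "0 < c" "c < h" "p h - p 0 = (h - 0) * q c"
  using MVT2[of 0 h p q] p e(2) h by (smt (verit, best))
  have "q c < 0" using d(2)[of c] c h z0 by (simp add: q_def)
  then have "p h < p 0" using c h by (smt (verit) mult_pos_neg)
  then show False using min[OF e(2)[of h]] h by (simp add: p_def)
 qed
qed

text \<open>Four times the complex Hessian in direction \<open>v\<close>. Summed over a unitary
  frame this is the Laplacian of a Kaehler metric, since the Christoffel terms at \<open>v\<close>
  and \<open>J v\<close> cancel.\<close>

definition lev :: "(complex^'d => real) => complex^'d => complex^'d => real" where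
 "lev f z v = dir_deriv (%x. dir_deriv f x v) z v + dir_deriv (%x. dir_deriv f x (J v)) z (J v)"

lemma Ck_on_2D:
 assumes "Ck_on 2 S f" "z \<in> S"
 shows "(f has_derivative dir_deriv f z) (at z)"
  "((%x. dir_deriv f x v) has_derivative (%u. dir_deriv (%x. dir_deriv f x v) z u)) (at z)"
proof -
 have f': "Ck_on (Suc (Suc 0)) S f" using assms by (simp only: numeral_2_eq_2)
 show "(f has_derivative dir_deriv f z) (at z)"
  "((%x. dir_deriv f x v) has_derivative (%u. dir_deriv (%x. dir_deriv f x v) z u)) (at z)"
  using Ck_on_SucD(1)[OF f' assms(2)] Ck_on_SucD(1)[OF Ck_on_SucD(2)[OF f'] assms(2)] by auto
qed

lemma hess_mult:
 fixes f g :: "'a::real_normed_vector => real"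
 assumes S: "open S" "z \<in> S" and f: "Ck_on 2 S f" and g: "Ck_on 2 S g"
 shows "dir_deriv (%x. dir_deriv (%x. f x * g x) x v) z v =
  f z * dir_deriv (%x. dir_deriv g x v) z v + 2 * (dir_deriv f z v * dir_deriv g z v)
  + dir_deriv (%x. dir_deriv f x v) z v * g z"
proof -
 have "dir_deriv (%x. dir_deriv (%x. f x * g x) x v) z v
  = dir_deriv (%x. f x * dir_deriv g x v + dir_deriv f x v * g x) z v"
  by (rule dir_deriv_cong[OF S])
  (rule dir_deriv_eqI[OF has_derivative_mult[OF Ck_on_2D(1)[OF f] Ck_on_2D(1)[OF g]]])
 also have "... = (f z * dir_deriv (%x. dir_deriv g x v) z v + dir_deriv f z v * dir_deriv g z v)
  + (dir_deriv f z v * dir_deriv g z v + dir_deriv (%x. dir_deriv f x v) z v * g z)"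
  by (rule dir_deriv_eqI)
  (intro has_derivative_add has_derivative_mult Ck_on_2D[OF f S(2)] Ck_on_2D[OF g S(2)])
 finally show ?thesis by simp
qed

lemma hess_add:
 fixes f g :: "'a::real_normed_vector => real"
 assumes S: "open S" "z \<in> S" and f: "Ck_on 2 S f" and g: "Ck_on 2 S g"
 shows "dir_deriv (%x. dir_deriv (%x. f x + g x) x v) z v =
  dir_deriv (%x. dir_deriv f x v) z v + dir_deriv (%x. dir_deriv g x v) z v"
proof -
 have "dir_deriv (%x. dir_deriv (%x. f x + g x) x v) z v
  = dir_deriv (%x. dir_deriv f x v + dir_deriv g x v) z v"
  by (rule dir_deriv_cong[OF S])
  (rule dir_deriv_eqI[OF has_derivative_add[OF Ck_on_2D(1)[OF f] Ck_on_2D(1)[OF g]]])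
 also have "... = dir_deriv (%x. dir_deriv f x v) z v + dir_deriv (%x. dir_deriv g x v) z v"
  by (rule dir_deriv_eqI) (intro has_derivative_add Ck_on_2D[OF f S(2)] Ck_on_2D[OF g S(2)])
 finally show ?thesis .
qed

lemma hess_cmult:
 fixes f :: "'a::real_normed_vector => real"
 assumes S: "open S" "z \<in> S" and f: "Ck_on 2 S f"
 shows "dir_deriv (%x. dir_deriv (%x. c * f x) x v) z v = c * dir_deriv (%x. dir_deriv f x v) z v"
proof -
 have "dir_deriv (%x. dir_deriv (%x. c * f x) x v) z v = dir_deriv (%x. c * dir_deriv f x v) z v"
  by (rule dir_deriv_cong[OF S])
  (rule dir_deriv_eqI[OF has_derivative_mult_right[OF Ck_on_2D(1)[OF f]]])
 also have "... = c * dir_deriv (%x. dir_deriv f x v) z v"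
  by (rule dir_deriv_eqI) (intro has_derivative_mult_right Ck_on_2D[OF f S(2)])
 finally show ?thesis .
qed

lemma hess_ln:
 fixes f :: "'a::real_normed_vector => real"
 assumes S: "open S" "z \<in> S" and f: "Ck_on 2 S f" and pos: "!!x. x \<in> S ==> f x > 0"
 shows "dir_deriv (%x. dir_deriv (%x. ln (f x)) x v) z v =
  dir_deriv (%x. dir_deriv f x v) z v / f z - (dir_deriv f z v)\<^sup>2 / (f z)\<^sup>2"
proof -
 have "dir_deriv (%x. dir_deriv (%x. ln (f x)) x v) z v = dir_deriv (%x. dir_deriv f x v * inverse (f x)) z v"
  by (rule dir_deriv_cong[OF S])
  (rule dir_deriv_eqI[OF has_derivative_ln[OF pos Ck_on_2D(1)[OF f]]])
 also have "... = dir_deriv f z v * - (inverse (f z) * dir_deriv f z v * inverse (f z))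
  + dir_deriv (%x. dir_deriv f x v) z v * inverse (f z)"
  by (rule dir_deriv_eqI)
  (intro has_derivative_mult Deriv.has_derivative_inverse Ck_on_2D[OF f S(2)] less_imp_neq[OF pos[OF S(2)], symmetric])
 finally show ?thesis by (simp add: divide_inverse power2_eq_square algebra_simps)
qed

lemma hess_affine:
 fixes f :: "'a::real_normed_vector => real"
 assumes f: "bounded_linear f"
 shows "dir_deriv (%x. c + f x) z v = f v" "dir_deriv (%x. dir_deriv (%x. c + f x) x v) z w = 0"
proof -
 have 1: "((%x. c + f x) has_derivative f) (at z)" for z
  by (rule has_derivative_eq_rhs[OF has_derivative_add[OF has_derivative_const bounded_linear_imp_has_derivative[OF f]]]) simp
 show "dir_deriv (%x. c + f x) z v = f v" for z by (rule dir_deriv_eqI[OF 1])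
 then show "dir_deriv (%x. dir_deriv (%x. c + f x) x v) z w = 0"
  using dir_deriv_eqI[OF has_derivative_const[of "f v" "at z"]] by simp
qed

context kaehler
begin

definition grad :: "(complex^'d => real) => complex^'d => complex^'d" where
 "grad f z = (SOME x. \<forall>u. G z x u = dir_deriv f z u)"

lemma grad: assumes "z \<in> Omega" "(f has_derivative dir_deriv f z) (at z)"
 shows "G z (grad f z) u = dir_deriv f z u"
proof -
 have l: "linear (dir_deriv f z)" using assms(2) has_derivative_linear by blast
 obtain x where "!!u. G z x u = dir_deriv f z u" by (rule riesz_exists[OF assms(1) l]) blast
 then have "\<exists>x. \<forall>u. G z x u = dir_deriv f z u" by blast
 then show ?thesis unfolding grad_def by (rule someI2_ex) blast
qed

lemma Ck_grad: assumes "Ck_on (Suc k) Omega f" shows "Ck_on k Omega (grad f)"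
 by (rule riesz_Ck[OF grad[OF _ Ck_on_SucD(1)[OF assms]] Ck_on_SucD(2)[OF assms]])

text \<open>The left-hand side is the divergence with respect to the density \<open>exp psi\<close>.
  Closedness of the fundamental form identifies the derivative of the metric along the gradient with
  the terms that differentiating \<open>grad f\<close> in the frame leaves over.\<close>

lemma div_grad:
 assumes f: "Ck_on 2 Omega f" and z: "z \<in> Omega" and e: "uframe (G z) e"
 shows "(\<Sum>b\<in>Basis. dir_deriv (grad f) z b \<bullet> b) + dir_deriv psi z (grad f z) = (\<Sum>i\<in>UNIV. lev f z (e i))"
proof -
 have f': "Ck_on (Suc (Suc 0)) Omega f" using f by (simp only: numeral_2_eq_2)
 define Y where "Y = grad f z"
 define DY where "DY u = dir_deriv (grad f) z u" for u
 have hg: "(grad f has_derivative DY) (at z)"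
  using Ck_on_SucD(1)[OF Ck_grad[OF f'] z] unfolding DY_def by simp
 have key: "G z (DY w) u = dir_deriv (%x. dir_deriv f x u) z w - dG z w Y u" for u w
 proof -
  have "((%x. G x (grad f x) u) has_derivative (%w. dG z w (grad f z) u + G z (DY w) u + G z (grad f z) 0)) (at z)"
  by (rule bilinear_family_derivative[OF open_dom z bilinear_G G_has_derivative[OF z] hg has_derivative_const])
  from dir_deriv_eqI[OF this, of w]
  have "dir_deriv (%x. G x (grad f x) u) z w = dG z w Y u + G z (DY w) u"
  by (simp add: Y_def G_simps[OF z])
  moreover have "dir_deriv (%x. G x (grad f x) u) z w = dir_deriv (%x. dir_deriv f x u) z w"
  by (rule dir_deriv_cong[OF open_dom z]) (rule grad[OF _ Ck_on_SucD(1)[OF f']])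
  ultimately show ?thesis by simp
 qed
 have "(\<Sum>b\<in>Basis. DY b \<bullet> b) = (\<Sum>i\<in>UNIV. G z (DY (e i)) (e i) + G z (DY (J (e i))) (J (e i)))"
  by (rule uframe_trace[OF jsym_G[OF z] e has_derivative_linear[OF hg]])
 also have "... = (\<Sum>i\<in>UNIV. lev f z (e i) - dG z Y (e i) (e i))"
 proof (rule sum.cong[OF refl])
  fix i
  have "dG z Y (J (e i)) (J (e i)) + dG z (e i) (J (J (e i))) Y + dG z (J (e i)) (J Y) (e i) = 0"
  by (rule dG_closed[OF z])
  then have "dG z Y (e i) (e i) = dG z (e i) Y (e i) + dG z (J (e i)) Y (J (e i))"
  using dG_commute[OF z, where u="e i" and v=Y and w="e i"] dG_J[OF z, where v=Y and w="e i" and u="J (e i)"]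
  by (simp add: jsymD(3)[OF jsym_dG[OF z]] dG_simps[OF z])
  then show "G z (DY (e i)) (e i) + G z (DY (J (e i))) (J (e i)) = lev f z (e i) - dG z Y (e i) (e i)"
  by (simp add: key lev_def)
 qed
 finally show ?thesis unfolding Y_def[symmetric] DY_def[symmetric] dpsi_frame[OF z e]
  by (simp add: sum_subtractf)
qed

end

locale kaehler_einstein = kaehler Omega G
 for Omega :: "(complex^'d) set" and G :: "complex^'d => complex^'d => complex^'d => real" +
 assumes einstein: "!!z v w. z \<in> Omega ==> ricci_curvature G z v w = - G z v w"
begin

text \<open>The Einstein equation as an equation for the volume density: \<open>ricci_psi\<close>
  for the pair \<open>v\<close> and \<open>- J v\<close>.\<close>

lemma lev_psi: assumes z: "z \<in> Omega" shows "lev psi z v = 2 * G z v v"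
proof -
 have l: "linear (%u. dir_deriv (%z. dir_deriv psi z (J v)) z u)"
  using Ck_on_2D(2)[OF Ck_psi z] has_derivative_linear by blast
 have "dir_deriv (%z. dir_deriv psi z (J (- J v))) z v - dir_deriv (%z. dir_deriv psi z (J v)) z (- J v)
  = ricci_curvature G z (- J v) (J v) - ricci_curvature G z v (J (- J v))"
  by (rule ricci_psi[OF z])
 moreover have "J (- J v) = v" by (simp add: vec_eq_iff)
 ultimately show ?thesis unfolding lev_def
  by (simp add: einstein[OF z] linear_neg[OF l] G_simps[OF z] jsymD(3)[OF jsym_G[OF z]])
qed

lemma linear_dGam': assumes z: "z \<in> Omega" shows "linear (%v. dGam z u v w)"
proof -
 have "(%v. dGam z u v w) = (%v. dGam z u w v)" by (rule ext) (rule dGam_commute[OF z])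
 then show ?thesis using linear_dGam(2)[OF z, where u=u and v=w] by (simp only:)
qed

text \<open>Let \<open>l\<close> be the complex linear extension of \<open>f\<close> and let the affine field \<open>xi\<close> agree with \<open>Y\<close> to first
 order at \<open>z\<close>. By the Cauchy-Schwarz inequality \<open>f (Y)\<close> dominates the quotient of \<open>\<bar>l xi\<bar>\<^sup>2\<close>, whose logarithm
 is pluriharmonic, by the square norm of \<open>xi\<close>, with equality at \<open>z\<close>.\<close>

lemma bochner:
 assumes f: "linear f" "f ~= (%_. 0)" and Y: "!!z u. z \<in> Omega ==> G z (Y z) u = f u"
  and z: "z \<in> Omega" and e: "uframe (G z) e"
 shows "(\<Sum>i\<in>UNIV. lev (%z. ln (f (Y z))) z (e i)) >= - 2" "f (Y z) > 0" "Ck_on k Omega (%z. f (Y z))"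
proof -
 have bf: "bounded_linear f" using f(1) linear_conv_bounded_linear by blast
 define q where "q x = f (Y x)" for x
 have qG: "q x = G x (Y x) (Y x)" if "x \<in> Omega" for x using Y[OF that] by (simp add: q_def)
 have qpos: "q x > 0" if x: "x \<in> Omega" for x
 proof -
  have "Y x ~= 0"
  proof
  assume "Y x = 0"
  then have "f u = 0" for u using Y[OF x, of u] by (simp add: G_simps[OF x])
  then show False using f(2) by auto
  qed
  then show ?thesis using jposD(2)[OF jpos_G[OF x]] qG[OF x] by simp
 qed
 show "f (Y z) > 0" using qpos[OF z] by (simp add: q_def)
 have CY: "Ck_on k Omega Y" for k by (rule riesz_Ck[OF Y Ck_on_const[OF open_dom]])
 then show Cq: "Ck_on k Omega (%z. f (Y z))" for k by (rule Ck_on_bounded_linear[OF open_dom bf])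
 then have Cq': "Ck_on k Omega q" for k by (simp add: q_def[abs_def])
 define Y0 q0 where "Y0 = Y z" and "q0 = q z"
 have q0: "q0 > 0" "q0 = G z Y0 Y0" "q0 = f Y0" using qpos[OF z] qG[OF z] by (auto simp: q0_def Y0_def q_def)
 have fG: "f u = G z Y0 u" for u using Y[OF z] by (simp add: Y0_def)
 define L where "L v = - Gam z v Y0" for v
 have L: "bounded_linear L" unfolding L_def[abs_def]
  by (intro bounded_linear_minus linear_conv_bounded_linear[THEN iffD1] linear_Gam(2)[OF z])
 have LJ: "L (J v) = J (L v)" for v unfolding L_def by (simp add: Gam_J_left[OF z] vec_eq_iff)
 define xi where "xi x = (Y0 - L z) + L x" for x
 have xiz: "xi z = Y0" by (simp add: xi_def)
 have dxi: "(xi has_derivative L) (at x)" for x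
  unfolding xi_def[abs_def]
  using has_derivative_add[OF has_derivative_const[of "Y0 - L z"] bounded_linear_imp_has_derivative[OF L]] by simp
 define m where "m x = G x (xi x) (xi x)" for x
 define a where "a x = f (Y0 - L z) + f (L x)" for x
 define b where "b x = f (J (Y0 - L z)) + f (J (L x))" for x
 have la: "bounded_linear (%x. f (L x))" using bounded_linear_compose[OF bf L] .
 have "bounded_linear (%x. J (L x))" using bounded_linear_compose[OF bounded_linear_smult L] .
 from bounded_linear_compose[OF bf this] have lb: "bounded_linear (%x. f (J (L x)))" .
 have ab: "a x = f (xi x)" "b x = f (J (xi x))" for x
  unfolding a_def b_def xi_def by (simp_all add: linear_add[OF f(1)] vector_add_ldistrib)
 have Ca: "Ck_on k Omega a" and Cb: "Ck_on k Omega b" for k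
  unfolding a_def[abs_def] b_def[abs_def] by (rule Ck_on_affine[OF open_dom la] Ck_on_affine[OF open_dom lb])+
 have m': "(m has_derivative (%u. dG x u (xi x) (xi x) + 2 * G x (L u) (xi x))) (at x)" if x: "x \<in> Omega" for x
  unfolding m_def[abs_def]
  by (rule has_derivative_eq_rhs[OF bilinear_family_derivative[OF open_dom x bilinear_G G_has_derivative[OF x] dxi dxi]])
  (simp_all add: fun_eq_iff G_commute[OF x, where v="xi x"])
 have Cxi: "Ck_on k Omega xi" for k unfolding xi_def[abs_def] by (rule Ck_on_affine[OF open_dom L])
 have Cm: "Ck_on k Omega m" for k
 proof -
  have "Ck_on k Omega (%x. \<Sum>i\<in>Basis. \<Sum>j\<in>Basis. (xi x \<bullet> i) * (xi x \<bullet> j) * G x i j)"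
  by (intro Ck_on_sum Ck_on_mult Ck_on_inner_const Cxi open_dom Ck_G)
  moreover have "m x = (\<Sum>i\<in>Basis. \<Sum>j\<in>Basis. (xi x \<bullet> i) * (xi x \<bullet> j) * G x i j)" if "x \<in> Omega" for x
  proof -
  have "m x = G x (\<Sum>i\<in>Basis. (xi x \<bullet> i) *\<^sub>R i) (\<Sum>j\<in>Basis. (xi x \<bullet> j) *\<^sub>R j)"
  by (simp add: euclidean_representation m_def)
  also have "... = (\<Sum>i\<in>Basis. (xi x \<bullet> i) * G x i (\<Sum>j\<in>Basis. (xi x \<bullet> j) *\<^sub>R j))"
  by (simp only: bilinear_sum_left[OF bilinear_G[OF that]] G_simps[OF that])
  also have "... = (\<Sum>i\<in>Basis. \<Sum>j\<in>Basis. (xi x \<bullet> i) * (xi x \<bullet> j) * G x i j)"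
  by (simp only: bilinear_sum_right[OF bilinear_G[OF that]] G_simps[OF that] sum_distrib_left mult.assoc)
  finally show ?thesis .
  qed
  ultimately show ?thesis using Ck_on_cong[OF open_dom, of m] by (simp only:)
 qed
 have dm: "dir_deriv m z v = 0" for v
  using dir_deriv_eqI[OF m'[OF z], of v]
  by (simp add: xiz dG_compat[OF z] L_def G_simps[OF z] G_commute[OF z, where v=Y0])
 have hm: "dir_deriv (%x. dir_deriv m x v) z v = 2 * G z (dGam z v v Y0) Y0 - 2 * G z (Gam z v (Gam z v Y0)) Y0" for v
 proof -
  have "dir_deriv (%x. dir_deriv m x v) z v = dir_deriv (%x. dG x v (xi x) (xi x) + 2 * G x (L v) (xi x)) z v"
  by (rule dir_deriv_cong[OF open_dom z]) (rule dir_deriv_eqI[OF m'])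
  also have "... = (dir_deriv (%x. dG x v (xi z) (xi z)) z v + dG z v (L v) (xi z) + dG z v (xi z) (L v))
  + 2 * (dG z v (L v) (xi z) + G z 0 (xi z) + G z (L v) (L v))"
  by (rule dir_deriv_eqI)
  (intro has_derivative_add has_derivative_mult_right
  bilinear_family_derivative[OF open_dom z jsymD(1)[OF jsym_dG] smooth_on_has_derivative[OF smooth_dG z] dxi dxi]
  bilinear_family_derivative[OF open_dom z bilinear_G G_has_derivative[OF z] has_derivative_const dxi])
  also have "... = dir_deriv (%x. dG x v Y0 Y0) z v + 4 * dG z v (L v) Y0 + 2 * G z (L v) (L v)"
  by (simp add: xiz dG_commute[OF z, where v=Y0] G_simps[OF z])
  also have "... = 2 * G z (dGam z v v Y0) Y0 - 2 * G z (Gam z v (Gam z v Y0)) Y0"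
  unfolding d2G[OF z] dG_compat[OF z] L_def
  by (simp add: G_simps[OF z] linear_neg[OF linear_Gam(1)[OF z]] G_commute[OF z, where v=Y0])
  finally show ?thesis .
 qed
 have levm: "lev m z v = - 2 * G z (J (curv z v (J v) Y0)) Y0" for v
  unfolding lev_def hm curv_eq
  by (simp add: Gam_J_left[OF z] Gam_J[OF z] dGam_J_left[OF z] vector_ssub_ldistrib vector_add_ldistrib G_simps[OF z] algebra_simps)
 \<comment> \<open>The Bianchi identity rearranges each term so that the sum is \<open>-2\<close>
   times the Ricci curvature of \<open>Y0\<close>, hence \<open>2 * q0\<close> by the Einstein
   equation.\<close>
 have "(\<Sum>i\<in>UNIV. lev m z (e i)) = (\<Sum>i\<in>UNIV. -2 * (G z (curv z (e i) Y0 Y0) (e i) + G z (curv z (J (e i)) Y0 Y0) (J (e i))))"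
 proof (rule sum.cong[OF refl])
  fix i
  have "curv z (e i) (J (e i)) Y0 = - curv z (J (e i)) Y0 (e i) + curv z (e i) Y0 (J (e i))"
  using bianchi[OF z, of "e i" "J (e i)" Y0] curv_skew[of z Y0 "e i" "J (e i)"]
  by (simp add: add_eq_0_iff2 algebra_simps)
  then have "J (curv z (e i) (J (e i)) Y0) = J (- curv z (J (e i)) Y0 (e i) + J (curv z (e i) Y0 (e i)))"
  unfolding curv_J[OF z] by (rule arg_cong)
  also have "... = - J (curv z (J (e i)) Y0 (e i)) - curv z (e i) Y0 (e i)"
  by (simp add: vec_eq_iff algebra_simps)
  finally have "J (curv z (e i) (J (e i)) Y0) = - curv z (J (e i)) Y0 (J (e i)) - curv z (e i) Y0 (e i)"
  unfolding curv_J[OF z] .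
  then show "lev m z (e i) = -2 * (G z (curv z (e i) Y0 Y0) (e i) + G z (curv z (J (e i)) Y0 Y0) (J (e i)))"
  unfolding levm
  using curv_antisym[OF z, of "e i" Y0 "e i" Y0] curv_antisym[OF z, of "J (e i)" Y0 "J (e i)" Y0]
  G_commute[OF z, where v="e i" and w="curv z (e i) Y0 Y0"]
  G_commute[OF z, where v="J (e i)" and w="curv z (J (e i)) Y0 Y0"]
  by (simp add: G_simps[OF z])
 qed
 also have "... = -2 * (\<Sum>i\<in>UNIV. G z (curv z (e i) Y0 Y0) (e i) + G z (curv z (J (e i)) Y0 Y0) (J (e i)))"
  by (simp add: sum_distrib_left)
 also have "... = -2 * ricci_curvature G z Y0 Y0"
 proof -
  have "linear (%b. curv z b Y0 Y0)"
  unfolding curv_eq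
  by (intro linear_compose_sub linear_compose_add linear_dGam[OF z] linear_Gam[OF z]
  linear_compose[OF linear_Gam(2)[OF z] linear_Gam(1)[OF z], unfolded o_def]
  linear_dGam'[OF z])
  from uframe_trace[OF jsym_G[OF z] e this] show ?thesis unfolding ricci_curvature_def by simp
 qed
 finally have sum_m: "(\<Sum>i\<in>UNIV. lev m z (e i)) = 2 * q0" by (simp add: einstein[OF z] q0)
 \<comment> \<open>\<open>D\<close> has a minimum at \<open>z\<close> with value 0. Its first
   derivative determines that of \<open>q\<close>, its second bounds the Levi form of
   \<open>q\<close> from below; \<open>a\<close> and \<open>b\<close> are affine and have no second
   derivatives.\<close>
 define D where "D x = q x * m x + (-1) * (a x * a x + b x * b x)" for x
 have CD: "Ck_on 2 Omega D" unfolding D_def[abs_def]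
  by (intro Ck_on_add Ck_on_mult Ck_on_const open_dom Cq' Cm Ca Cb)
 have az: "a z = q0" "b z = 0" using q0 jsymD(5)[OF jsym_G[OF z]] by (auto simp: ab xiz fG)
 have Dz: "D z = 0" unfolding D_def az using q0 by (simp add: m_def xiz q0_def[symmetric])
 have Dmin: "D z <= D x" if x: "x \<in> Omega" for x
 proof -
  have "(G x (Y x) (xi x))\<^sup>2 + (G x (Y x) (J (xi x)))\<^sup>2 <= G x (Y x) (Y x) * G x (xi x) (xi x)"
  by (rule jpos_cauchy_schwarz(2)[OF jpos_G[OF x]])
  then have "0 <= D x" unfolding D_def by (simp add: Y[OF x] ab m_def q_def power2_eq_square)
  then show ?thesis by (simp only: Dz)
 qed
 have da: "dir_deriv a z v = f (L v)" "dir_deriv (%x. dir_deriv a x v) z v = 0"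
  "dir_deriv b z v = f (J (L v))" "dir_deriv (%x. dir_deriv b x v) z v = 0" for v
  unfolding a_def[abs_def] b_def[abs_def] using hess_affine[OF la] hess_affine[OF lb] by auto
 have dq: "dir_deriv q z v = 2 * f (L v)" for v
 proof -
  have "dir_deriv D z v = (q z * dir_deriv m z v + dir_deriv q z v * m z)
  + (-1) * ((a z * dir_deriv a z v + dir_deriv a z v * a z) + (b z * dir_deriv b z v + dir_deriv b z v * b z))"
  unfolding D_def[abs_def]
  by (rule dir_deriv_eqI)
  (intro has_derivative_add has_derivative_mult has_derivative_mult_right Ck_on_2D(1)[OF Cq' z] Ck_on_2D(1)[OF Cm z]
  Ck_on_2D(1)[OF Ca z] Ck_on_2D(1)[OF Cb z])
  moreover have "dir_deriv D z v = 0" by (rule second_derivative_test(1)[OF open_dom z CD Dmin])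
  moreover have "m z = q0" unfolding m_def xiz using q0 by simp
  ultimately have "0 = dir_deriv q z v * q0 - (q0 * f (L v) + f (L v) * q0)"
  by (simp only: dm az da) simp
  then show ?thesis using q0(1) by simp
 qed
 have hD: "dir_deriv (%x. dir_deriv q x v) z v * q0 + q0 * dir_deriv (%x. dir_deriv m x v) z v
  - 2 * (f (L v))\<^sup>2 - 2 * (f (J (L v)))\<^sup>2 >= 0" for v
 proof -
  have "dir_deriv (%x. dir_deriv D x v) z v =
  (q z * dir_deriv (%x. dir_deriv m x v) z v + 2 * (dir_deriv q z v * dir_deriv m z v) + dir_deriv (%x. dir_deriv q x v) z v * m z)
  + (-1) * ((a z * 0 + 2 * (dir_deriv a z v * dir_deriv a z v) + 0 * a z) + (b z * 0 + 2 * (dir_deriv b z v * dir_deriv b z v) + 0 * b z))"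
  unfolding D_def[abs_def]
  apply (subst hess_add[OF open_dom z])
  apply (intro Ck_on_mult open_dom Cq' Cm)
  apply (intro Ck_on_cmult Ck_on_add Ck_on_mult open_dom Ca Cb)
  apply (subst hess_cmult[OF open_dom z])
  apply (intro Ck_on_add Ck_on_mult open_dom Ca Cb)
  apply (subst hess_add[OF open_dom z])
  apply (intro Ck_on_mult open_dom Ca Cb)+
  apply (simp only: hess_mult[OF open_dom z Cq' Cm] hess_mult[OF open_dom z Ca Ca] hess_mult[OF open_dom z Cb Cb] da)
  done
  moreover have "m z = q0" "q z = q0" using q0 by (auto simp: m_def xiz q0_def)
  ultimately show ?thesis
  using second_derivative_test(2)[OF open_dom z CD Dmin, of v]
  by (simp add: dm da power2_eq_square)
 qed
 have levq: "lev (%z. ln (q z)) z v >= - lev m z v / q0" for v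
 proof -
  have 1: "dir_deriv (%x. dir_deriv (%x. ln (q x)) x v) z v = dir_deriv (%x. dir_deriv q x v) z v / q0 - (2 * f (L v))\<^sup>2 / q0\<^sup>2" for v
  using hess_ln[OF open_dom z Cq' qpos] by (simp add: dq q0_def)
  have fL: "f (L (J v)) = f (J (L v))" "f (J (L (J v))) = - f (L v)"
  using linear_neg[OF f(1), of "L v"] by (simp_all add: LJ)
  define A B P where "A = f (L v)" and "B = f (J (L v))"
  and "P = dir_deriv (%x. dir_deriv q x v) z v + dir_deriv (%x. dir_deriv q x (J v)) z (J v)"
  have "P * q0 + q0 * lev m z v - 4 * A\<^sup>2 - 4 * B\<^sup>2 >= 0"
  using hD[of v] hD[of "J v"] by (simp add: fL lev_def P_def A_def B_def algebra_simps)
  then have "(P * q0 + q0 * lev m z v - 4 * A\<^sup>2 - 4 * B\<^sup>2) / q0\<^sup>2 >= 0" by simp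
  moreover have "lev (%z. ln (q z)) z v = P / q0 - 4 * A\<^sup>2 / q0\<^sup>2 - 4 * B\<^sup>2 / q0\<^sup>2"
  unfolding lev_def 1 fL A_def B_def P_def by (simp add: power_mult_distrib add_divide_distrib)
  moreover have "(P * q0 + q0 * lev m z v - 4 * A\<^sup>2 - 4 * B\<^sup>2) / q0\<^sup>2 = P / q0 + lev m z v / q0 - 4 * A\<^sup>2 / q0\<^sup>2 - 4 * B\<^sup>2 / q0\<^sup>2"
  using q0 by (simp add: add_divide_distrib diff_divide_distrib power2_eq_square)
  ultimately show ?thesis by simp
 qed
 have "- 2 = - (\<Sum>i\<in>UNIV. lev m z (e i)) / q0" using sum_m q0 by simp
 also have "... = (\<Sum>i\<in>UNIV. - lev m z (e i) / q0)" by (simp add: sum_divide_distrib sum_negf)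
 also have "... <= (\<Sum>i\<in>UNIV. lev (%z. ln (q z)) z (e i))" by (intro sum_mono levq)
 finally show "(\<Sum>i\<in>UNIV. lev (%z. ln (f (Y z))) z (e i)) >= - 2" by (simp add: q_def)
qed

end

subsection \<open>The gradient estimate of affine functions\<close>

lemma Ck_on_Un:
 assumes "open A" "open B" "Ck_on k A f" "Ck_on k B f"
 shows "Ck_on k (A \<union> B) f"
 using assms(3,4)
proof (induction k arbitrary: f)
 case 0
 then show ?case using continuous_on_open_Un[OF assms(1,2)] by simp
next
 case (Suc k)
 have "Ck_on k (A \<union> B) (%z. dir_deriv f z v)" for v
  by (rule Suc.IH[OF Ck_on_SucD(2)[OF Suc.prems(1)] Ck_on_SucD(2)[OF Suc.prems(2)]])
 moreover have "f differentiable (at z)" if "z \<in> A \<union> B" for z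
  using that Suc.prems by auto
 ultimately show ?case by simp
qed

lemma compact_support_bounded:
 fixes g :: "'a::euclidean_space => real"
 assumes "continuous_on UNIV g" "compact S" "!!z. z \<notin> S ==> g z = 0"
 shows "integrable lborel g" "\<exists>M\<ge>0. \<forall>z. \<bar>g z\<bar> <= M"
proof -
 have "integrable lborel (%x. indicator S x *\<^sub>R g x)"
  by (rule borel_integrable_compact[OF assms(2)]) (rule continuous_on_subset[OF assms(1)], simp)
 moreover have "(%x. indicator S x *\<^sub>R g x) = g"
  by (rule ext) (use assms(3) in \<open>auto simp: indicator_def\<close>)
 ultimately show "integrable lborel g" by simp
 have "compact (g ` S)" using assms continuous_on_subset compact_continuous_image by blast
 then obtain M where M: "!!y. y \<in> g ` S ==> norm y <= M"
  using compact_imp_bounded bounded_iff by metis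
 show "\<exists>M\<ge>0. \<forall>z. \<bar>g z\<bar> <= M"
  by (rule exI[of _ "max M 0"]) (use M assms(3) in \<open>force simp: max_def\<close>)
qed

text \<open>Difference quotients have integral zero by translation invariance, and they converge
  under the constant bound \<open>M\<close> on the compact thickening \<open>S'\<close> of the
  support.\<close>

lemma integral_derivative_eq_0:
 fixes g :: "'a::euclidean_space => real"
 assumes C: "Ck_on (Suc 0) UNIV g" and S: "compact S" and 0: "!!z. z \<notin> S ==> g z = 0"
 shows "integrable lborel (%z. dir_deriv g z v)" "(\<integral>z. dir_deriv g z v \<partial>lborel) = 0"
proof -
 note d = Ck_on_SucD(1)[OF C UNIV_I]
 have cg: "continuous_on UNIV g" by (rule Ck_on_imp_continuous_on[OF C])
 have cd: "continuous_on UNIV (%z. dir_deriv g z v)" using Ck_on_SucD(2)[OF C, of v] by simp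
 have d0: "dir_deriv g z v = 0" if "z \<notin> S" for z
 proof -
  have "open (- S)" using S by (simp add: compact_imp_closed open_Compl)
  then have "dir_deriv g z v = dir_deriv (%_. 0) z v"
  by (rule dir_deriv_cong) (use that 0 in auto)
  then show ?thesis by simp
 qed
 show "integrable lborel (%z. dir_deriv g z v)" by (rule compact_support_bounded(1)[OF cd S d0])
 obtain M where M: "M >= 0" "!!z. \<bar>dir_deriv g z v\<bar> <= M"
  using compact_support_bounded(2)[OF cd S d0] by blast
 define S' where "S' = {x + y |x y. x \<in> S & y \<in> cball 0 (norm v)}"
 have S': "compact S'" unfolding S'_def by (rule compact_sums[OF S compact_cball])
 define h where "h n = inverse (real (Suc n))" for n
 have h: "h n > 0" "h n <= 1" for n unfolding h_def by (auto simp: divide_simps)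
 define F where "F n z = (g (h n *\<^sub>R v + z) - g z) / h n" for n z
 have int0: "(\<integral>z. F n z \<partial>lborel) = 0" for n
 proof -
  have g: "integrable lborel g" by (rule compact_support_bounded(1)[OF cg S 0])
  have gb: "g \<in> borel_measurable borel" using cg by (simp add: borel_measurable_continuous_onI)
  have 1: "integrable lborel (%z. g (h n *\<^sub>R v + z))" "(\<integral>z. g (h n *\<^sub>R v + z) \<partial>lborel) = (\<integral>z. g z \<partial>lborel)"
  using g integrable_distr_eq[of "(+) (h n *\<^sub>R v)" lborel borel g] gb
  integral_distr[of "(+) (h n *\<^sub>R v)" lborel borel g]
  by (simp_all add: lborel_distr_plus)
  show ?thesis unfolding F_def using 1 g by simp
 qed
 have "(%n. \<integral>z. F n z \<partial>lborel) \<longlonglongrightarrow> (\<integral>z. dir_deriv g z v \<partial>lborel)"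
 proof (rule integral_dominated_convergence[where w="%z. M * indicator S' z"])
  show "(%z. dir_deriv g z v) \<in> borel_measurable lborel"
  using cd by (simp add: borel_measurable_continuous_onI)
  show "F n \<in> borel_measurable lborel" for n
  unfolding F_def using cg
  by (auto intro!: borel_measurable_continuous_onI continuous_intros continuous_on_compose2[OF cg] simp: h_def)
  show "integrable lborel (%z. M * indicator S' z)"
  using S' emeasure_compact_finite[OF S'] by (auto intro!: integrable_mult_right integrable_real_indicator simp: compact_imp_closed borel_closed)
  show "AE z in lborel. (%n. F n z) \<longlonglongrightarrow> dir_deriv g z v"
  proof (rule AE_I2)
  fix z
  have "((%t. g (t *\<^sub>R v + z)) has_derivative (%y. dir_deriv g z (y *\<^sub>R v))) (at 0)"
  by (rule has_derivative_compose[where f="%t. t *\<^sub>R v + z" and g=g]) (auto intro!: derivative_eq_intros d)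
  then have "((%t. g (t *\<^sub>R v + z)) has_real_derivative dir_deriv g z v) (at 0)"
  unfolding has_field_derivative_def
  by (rule has_derivative_eq_rhs) (simp add: fun_eq_iff linear_scale[OF has_derivative_linear[OF d]])
  then have "((%t. (g (t *\<^sub>R v + z) - g z) / t) \<longlongrightarrow> dir_deriv g z v) (at 0)"
  by (simp add: has_field_derivative_iff)
  moreover have "filterlim h (at 0) sequentially"
  unfolding filterlim_at h_def using LIMSEQ_inverse_real_of_nat by auto
  ultimately show "(%n. F n z) \<longlonglongrightarrow> dir_deriv g z v"
  unfolding F_def by (rule filterlim_compose)
  qed
  show "AE z in lborel. norm (F n z) <= M * indicator S' z" for n
  proof (rule AE_I2)
  fix z
  show "norm (F n z) <= M * indicator S' z"
  proof (cases "z \<in> S'")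
  case True
  have "norm (g (h n *\<^sub>R v + z) - g z) <= M * (h n - 0)"
  proof -
  have "norm (g (h n *\<^sub>R v + z) - g (0 *\<^sub>R v + z)) <= M * norm (h n - 0)"
  proof (rule differentiable_bound[where S="{0..h n}" and f="%t. g (t *\<^sub>R v + z)" and f'="%t y. dir_deriv g (t *\<^sub>R v + z) (y *\<^sub>R v)"])
  fix t
  show "((%t. g (t *\<^sub>R v + z)) has_derivative (%y. dir_deriv g (t *\<^sub>R v + z) (y *\<^sub>R v))) (at t within {0..h n})"
  by (rule has_derivative_at_withinI, rule has_derivative_compose[where f="%t. t *\<^sub>R v + z" and g=g])
  (auto intro!: derivative_eq_intros d)
  show "onorm (%y. dir_deriv g (t *\<^sub>R v + z) (y *\<^sub>R v)) <= M"
  proof (rule onorm_le)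
  show "norm (dir_deriv g (t *\<^sub>R v + z) (y *\<^sub>R v)) <= M * norm y" for y
  using mult_right_mono[OF M(2)[of "t *\<^sub>R v + z"], of "\<bar>y\<bar>"]
  by (simp add: linear_scale[OF has_derivative_linear[OF d]] abs_mult mult.commute)
  qed
  qed (use h[of n] in auto)
  then show ?thesis using h[of n] by simp
  qed
  then show ?thesis using True h[of n] by (simp add: F_def divide_simps mult.commute)
  next
  case False
  have "z \<in> S ==> z \<in> S'" unfolding S'_def by force
  moreover have "h n *\<^sub>R v + z \<in> S ==> z \<in> S'"
  proof -
  assume "h n *\<^sub>R v + z \<in> S"
  moreover have "z = (h n *\<^sub>R v + z) + (- (h n *\<^sub>R v))" by simp
  moreover have "- (h n *\<^sub>R v) \<in> cball 0 (norm v)" using h[of n] by (simp add: mult_left_le_one_le)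
  ultimately show ?thesis unfolding S'_def by blast
  qed
  ultimately have "z \<notin> S" "h n *\<^sub>R v + z \<notin> S" using False by auto
  then show ?thesis using False by (simp add: F_def 0)
  qed
  qed
 qed
 then show "(\<integral>z. dir_deriv g z v \<partial>lborel) = 0" unfolding int0 by (simp add: LIMSEQ_const_iff)
qed

lemma integral_divergence_eq_0:
 fixes X :: "'a::euclidean_space => 'a"
 assumes C: "Ck_on (Suc 0) UNIV X" and S: "compact S" and 0: "!!z. z \<notin> S ==> X z = 0"
 shows "integrable lborel (%z. \<Sum>b\<in>Basis. dir_deriv X z b \<bullet> b)"
  "(\<integral>z. (\<Sum>b\<in>Basis. dir_deriv X z b \<bullet> b) \<partial>lborel) = 0"
proof -
 have 1: "dir_deriv (%z. X z \<bullet> b) z v = dir_deriv X z v \<bullet> b" for z v b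
  by (rule dir_deriv_eqI[OF has_derivative_inner_left[OF Ck_on_SucD(1)[OF C UNIV_I]]])
 have c: "Ck_on (Suc 0) UNIV (%z. X z \<bullet> b)" for b by (rule Ck_on_inner_const[OF open_UNIV C])
 have i: "integrable lborel (%z. dir_deriv X z v \<bullet> b)" "(\<integral>z. dir_deriv X z v \<bullet> b \<partial>lborel) = 0" for b v
  using integral_derivative_eq_0[OF c S, of b v] 0 by (auto simp: 1)
 show "integrable lborel (%z. \<Sum>b\<in>Basis. dir_deriv X z b \<bullet> b)"
  "(\<integral>z. (\<Sum>b\<in>Basis. dir_deriv X z b \<bullet> b) \<partial>lborel) = 0"
  using i by simp_all
qed

text \<open>Absorbs the lower power of \<open>x\<close> into the higher one at the end of the
  integral estimate.\<close>

lemma power_young: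
 fixes x L :: real
 assumes "x >= 0" "L > 0"
 shows "x ^ p * L <= x ^ Suc p + L ^ Suc p"
proof (cases "x <= L")
 case True
 then have "x ^ p * L <= L ^ p * L" using assms by (intro mult_right_mono power_mono) auto
 then show ?thesis using assms by (simp add: mult.commute add_increasing)
next
 case False
 then have "x ^ p * L <= x ^ p * x" using assms by (intro mult_left_mono) auto
 then show ?thesis using assms by (simp add: mult.commute add_increasing2)
qed

text \<open>The lower bound \<open>1 / sqrt 2\<close> on \<open>K\<close> instead of 1 leaves room
  for smoothing. The last condition says that the gradient of \<open>eta\<close> has length at most
  \<open>1 / R\<close>.\<close>

definition (in kaehler) cutoff :: "real => (complex^'d) set => (complex^'d => real) => bool" where
 "cutoff R K eta \<longleftrightarrow> Ck_on (Suc 0) UNIV eta & (\<exists>S. compact S & S \<subseteq> Omega & (\<forall>z. z \<notin> S --> eta z = 0)) &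
  (\<forall>z. 0 <= eta z & eta z <= 1) & (\<forall>z\<in>K. 1 <= 2 * (eta z)\<^sup>2) &
  (\<forall>z\<in>Omega. \<forall>v. (R * dir_deriv eta z v)\<^sup>2 <= G z v v)"

context kaehler_einstein
begin

text \<open>The quantity estimated is \<open>u\<close>, the squared length of the gradient of
  \<open>ln (c + f)\<close>. The divergence theorem is applied to the gradient of
  \<open>theta\<close> with weight \<open>eta ^ (2 * Suc p) * u ^ p\<close>. In \<open>L\<close>,
  the summands 2, \<open>2 n\<close> and 1 pay for \<open>bochner\<close>, for the potential and for
  the cutoff.\<close>

lemma integral_estimate:
 assumes f: "linear f" "f ~= (%_. 0)" and r: "!!z. z \<in> Omega ==> c + f z > 0"
  and Y: "!!z u. z \<in> Omega ==> G z (Y z) u = f u" and p: "p > 0"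
  and S: "compact S" "S \<subseteq> Omega" "!!z. z \<notin> S ==> eta z = 0"
  and eta: "Ck_on (Suc 0) UNIV eta" "!!z. 0 <= eta z" "!!z. eta z <= 1"
  "!!z v. z \<in> Omega ==> (R * dir_deriv eta z v)\<^sup>2 <= G z v v" and R: "real (Suc p) ^ 2 <= real p * R\<^sup>2"
 defines "L \<equiv> 3 + 2 * real CARD('d)"
 shows "integrable lborel (%z. indicator S z * ((eta z)\<^sup>2 * (f (Y z) / (c + f z)\<^sup>2)) ^ Suc p)"
  "(\<integral>z. indicator S z * ((eta z)\<^sup>2 * (f (Y z) / (c + f z)\<^sup>2)) ^ Suc p \<partial>lborel) <= L ^ Suc p * measure lborel S"
proof -
 have bf: "bounded_linear f" using f(1) linear_conv_bounded_linear by blast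
 define q r u where "q z = f (Y z)" and "r z = c + f z" and "u z = q z / (r z)\<^sup>2" for z
 have boch: "(\<Sum>i\<in>UNIV. lev (%z. ln (f (Y z))) z (e i)) >= - 2" "f (Y z) > 0"
  if "z \<in> Omega" "uframe (G z) e" for z e
  using bochner[OF f _ that, of Y] Y by blast+
 have qpos: "q z > 0" and rpos: "r z > 0" if z: "z \<in> Omega" for z
 proof -
  obtain e where "uframe (G z) e" using uframe_exists[OF jpos_G[OF z]] .
  then show "q z > 0" "r z > 0" using boch(2)[OF z] r[OF z] by (auto simp: q_def r_def)
 qed
 have upos: "u z > 0" if "z \<in> Omega" for z using qpos[OF that] rpos[OF that] by (simp add: u_def)
 have Cq: "Ck_on k Omega q" for k
 proof -
  have "Ck_on k Omega Y" by (rule riesz_Ck[OF Y Ck_on_const[OF open_dom]])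
  from Ck_on_bounded_linear[OF open_dom bf this] show ?thesis by (simp add: q_def[abs_def])
 qed
 have Cr: "Ck_on k Omega r" for k unfolding r_def[abs_def] by (rule Ck_on_affine[OF open_dom bf])
 \<comment> \<open>This weight gives \<open>exp (p * theta + psi) = u ^ p\<close>: the factor
   \<open>exp psi\<close> that turns the Laplacian into a Euclidean divergence is absorbed, and a
   plain power of \<open>u\<close> remains against Lebesgue measure.\<close>
 define eps where "eps = 1 / real p"
 define lq lr where "lq z = ln (q z)" and "lr z = ln (r z)" for z
 have Clq: "Ck_on k Omega lq" and Clr: "Ck_on k Omega lr" for k
  unfolding lq_def[abs_def] lr_def[abs_def] by (rule Ck_on_ln[OF open_dom Cq qpos] Ck_on_ln[OF open_dom Cr rpos]; assumption)+
 define theta where "theta z = lq z + ((- 2) * lr z + (- eps) * psi z)" for z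
 have Ctheta: "Ck_on k Omega theta" for k unfolding theta_def[abs_def]
  by (rule Ck_on_add[OF open_dom Clq Ck_on_add[OF open_dom Ck_on_cmult[OF open_dom Clr] Ck_on_cmult[OF open_dom Ck_psi]]])
 have exptheta: "exp (real p * theta z + psi z) = u z ^ p" if z: "z \<in> Omega" for z
 proof -
  have "real p * theta z + psi z = real p * ln (u z)"
  using qpos[OF z] rpos[OF z] p unfolding theta_def lq_def lr_def u_def eps_def
  by (simp add: ln_div ln_realpow algebra_simps)
  then show ?thesis using upos[OF z] by (simp add: exp_of_nat_mult)
 qed
 \<comment> \<open>The good term \<open>2 * u\<close> comes from \<open>-2 * ln (c + f)\<close>;
   \<open>ln q\<close> costs at most 2, and the potential at most \<open>2 n\<close> because
   \<open>eps <= 1\<close>.\<close>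
 have levtheta: "(\<Sum>i\<in>UNIV. lev theta z (e i)) >= 2 * u z - 2 - 2 * real CARD('d)"
  if z: "z \<in> Omega" and e: "uframe (G z) e" for z e
 proof -
  have h: "dir_deriv (%x. dir_deriv theta x v) z v = dir_deriv (%x. dir_deriv lq x v) z v
  + ((-2) * dir_deriv (%x. dir_deriv lr x v) z v + (- eps) * dir_deriv (%x. dir_deriv psi x v) z v)" for v
  unfolding theta_def[abs_def]
  hess_add[OF open_dom z Clq Ck_on_add[OF open_dom Ck_on_cmult[OF open_dom Clr] Ck_on_cmult[OF open_dom Ck_psi]]]
  hess_add[OF open_dom z Ck_on_cmult[OF open_dom Clr] Ck_on_cmult[OF open_dom Ck_psi]]
  hess_cmult[OF open_dom z Clr] hess_cmult[OF open_dom z Ck_psi] ..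
  have hr: "dir_deriv (%x. dir_deriv lr x v) z v = - (f v)\<^sup>2 / (r z)\<^sup>2" for v
  proof -
  have "dir_deriv (%x. dir_deriv (%x. ln (r x)) x v) z v =
  dir_deriv (%x. dir_deriv r x v) z v / r z - (dir_deriv r z v)\<^sup>2 / (r z)\<^sup>2"
  by (rule hess_ln[OF open_dom z Cr rpos])
  moreover have "dir_deriv (%x. dir_deriv r x v) z v = 0" "dir_deriv r z v = f v"
  unfolding r_def[abs_def] by (rule hess_affine[OF bf])+
  ultimately show ?thesis unfolding lr_def[abs_def] by simp
  qed
  have l: "lev theta z v = lev lq z v + 2 * ((f v)\<^sup>2 + (f (J v))\<^sup>2) / (r z)\<^sup>2 - 2 * eps * G z v v" for v
  proof -
  have "lev theta z v = lev lq z v + 2 * ((f v)\<^sup>2 + (f (J v))\<^sup>2) / (r z)\<^sup>2 - eps * lev psi z v"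
  unfolding lev_def h hr by (simp add: add_divide_distrib algebra_simps)
  then show ?thesis by (simp add: lev_psi[OF z])
  qed
  have "(\<Sum>i\<in>UNIV. (f (e i))\<^sup>2 + (f (J (e i)))\<^sup>2) = q z"
  proof -
  have gY: "G z v (Y z) = f v" for v using Y[OF z, of v] G_commute[OF z, where v=v and w="Y z"] by simp
  show ?thesis
  using uframe_parseval[OF jsym_G[OF z] e bilinear_G[OF z], of "Y z" "Y z"]
  by (simp only: Y[OF z] q_def gY power2_eq_square)
  qed
  then have "(\<Sum>i\<in>UNIV. 2 * ((f (e i))\<^sup>2 + (f (J (e i)))\<^sup>2) / (r z)\<^sup>2) = 2 * u z"
  unfolding u_def sum_divide_distrib[symmetric] sum_distrib_left[symmetric] by simp
  moreover have "(\<Sum>i\<in>UNIV. 2 * eps * G z (e i) (e i)) = 2 * eps * real CARD('d)"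
  by (simp add: uframeD(1)[OF jsym_G[OF z] e])
  ultimately have "(\<Sum>i\<in>UNIV. lev theta z (e i)) = (\<Sum>i\<in>UNIV. lev lq z (e i)) + 2 * u z - 2 * eps * real CARD('d)"
  by (simp only: l sum.distrib sum_subtractf)
  moreover have "(\<Sum>i\<in>UNIV. lev lq z (e i)) >= - 2" using boch(1)[OF z e] by (simp add: lq_def[abs_def] q_def)
  moreover have "eps * real CARD('d) <= real CARD('d)"
  using p by (simp add: eps_def divide_simps mult_le_cancel_left1)
  ultimately show ?thesis by linarith
 qed
 define W where "W = grad theta"
 have CW: "Ck_on (Suc 0) Omega W" unfolding W_def by (rule Ck_grad[OF Ctheta])
 define w where "w z = eta z ^ (2 * Suc p) * exp (real p * theta z + psi z)" for z
 define X where "X z = (if z \<in> Omega then w z *\<^sub>R W z else 0)" for z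
 have Ceta: "Ck_on (Suc 0) Omega eta" using eta(1) by auto (meson continuous_on_subset subset_UNIV)
 have Cw: "Ck_on (Suc 0) Omega w" unfolding w_def[abs_def]
  by (rule Ck_on_mult[OF open_dom Ck_on_power[OF open_dom Ceta] Ck_on_exp[OF open_dom Ck_on_add[OF open_dom Ck_on_cmult[OF open_dom Ctheta] Ck_psi]]])
 have X0: "X z = 0" if "z \<notin> S" for z using S(3)[OF that] by (simp add: X_def w_def)
 have CX: "Ck_on (Suc 0) UNIV X"
 proof -
  have oS: "open (- S)" using S(1) by (simp add: compact_imp_closed open_Compl)
  have "Ck_on (Suc 0) (- S) X \<longleftrightarrow> Ck_on (Suc 0) (- S) (%z. 0 :: complex^'d)"
  by (rule Ck_on_cong[OF oS]) (simp add: X0)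
  moreover have "Ck_on (Suc 0) (- S) (%z. 0 :: complex^'d)" by (rule Ck_on_const[OF oS])
  moreover have "Ck_on (Suc 0) Omega X \<longleftrightarrow> Ck_on (Suc 0) Omega (%z. w z *\<^sub>R W z)"
  by (rule Ck_on_cong[OF open_dom]) (simp add: X_def)
  moreover have "Ck_on (Suc 0) Omega (%z. w z *\<^sub>R W z)" by (rule Ck_on_scaleR[OF open_dom Cw CW])
  ultimately have "Ck_on (Suc 0) (Omega \<union> - S) X" using Ck_on_Un[OF open_dom oS] by blast
  moreover have "Omega \<union> - S = UNIV" using S(2) by auto
  ultimately show ?thesis by (simp only:)
 qed
 define dv where "dv z = (\<Sum>b\<in>Basis. dir_deriv X z b \<bullet> b)" for z
 have dv0: "dv z = 0" if "z \<notin> S" for z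
 proof -
  have "open (- S)" using S(1) by (simp add: compact_imp_closed open_Compl)
  then have "dir_deriv X z b = dir_deriv (%_. 0) z b" for b
  by (rule dir_deriv_cong) (use that X0 in auto)
  then show ?thesis by (simp add: dv_def)
 qed
 have idv: "integrable lborel dv" "(\<integral>z. dv z \<partial>lborel) = 0"
  using integral_divergence_eq_0[OF CX S(1) X0] by (auto simp: dv_def[abs_def])
 define T where "T z = ((eta z)\<^sup>2 * u z) ^ Suc p" for z
 have dvT: "dv z >= T z - L ^ Suc p" if z: "z \<in> Omega" for z
 proof -
  obtain e where e: "uframe (G z) e" using uframe_exists[OF jpos_G[OF z]] .
  define E where "E = exp (real p * theta z + psi z)"
  have Epos: "E > 0" by (simp add: E_def)
  define s where "s = dir_deriv theta z (W z)"
  have dtheta: "(theta has_derivative dir_deriv theta z) (at z)" by (rule Ck_on_2D(1)[OF Ctheta z])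
  have dpsi: "(psi has_derivative dir_deriv psi z) (at z)" by (rule Ck_on_2D(1)[OF Ck_psi z])
  have sG: "s = G z (W z) (W z)" using grad[OF z dtheta, of "W z"] by (simp add: W_def s_def)
  define t where "t = dir_deriv eta z (W z)"
  have t: "(R * t)\<^sup>2 <= s" unfolding t_def sG by (rule eta(4)[OF z])
  have dw: "dir_deriv w z y = eta z ^ (2 * Suc p) * (E * (real p * dir_deriv theta z y + dir_deriv psi z y))
  + (real (2 * Suc p) * dir_deriv eta z y * eta z ^ (2 * Suc p - 1)) * E" for y
  proof -
  have deta: "(eta has_derivative dir_deriv eta z) (at z)" by (rule Ck_on_SucD(1)[OF Ceta z])
  have "((%z. exp (real p * theta z + psi z)) has_derivative (%y. E * (real p * dir_deriv theta z y + dir_deriv psi z y))) (at z)"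
  by (rule has_derivative_eq_rhs[OF has_derivative_exp[OF has_derivative_add[OF has_derivative_mult_right[OF dtheta] dpsi]]])
  (simp add: E_def mult.commute)
  from has_derivative_mult[OF has_derivative_power[OF deta, of "2 * Suc p"] this]
  show ?thesis unfolding w_def[abs_def] by (rule dir_deriv_eqI[THEN trans]) (simp add: E_def)
  qed
  have "dir_deriv X z b = w z *\<^sub>R dir_deriv W z b + dir_deriv w z b *\<^sub>R W z" for b
  proof -
  have "dir_deriv X z b = dir_deriv (%z. w z *\<^sub>R W z) z b"
  by (rule dir_deriv_cong[OF open_dom z]) (simp add: X_def)
  then show ?thesis
  using dir_deriv_eqI[OF has_derivative_scaleR[OF Ck_on_SucD(1)[OF Cw z] Ck_on_SucD(1)[OF CW z]], of b] by simp
  qed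
  then have "dv z = w z * (\<Sum>b\<in>Basis. dir_deriv W z b \<bullet> b) + (\<Sum>b\<in>Basis. dir_deriv w z b * (W z \<bullet> b))"
  unfolding dv_def by (simp add: inner_add_left sum.distrib sum_distrib_left)
  also have "(\<Sum>b\<in>Basis. dir_deriv w z b * (W z \<bullet> b)) = dir_deriv w z (W z)"
  proof -
  have lw: "linear (dir_deriv w z)" by (rule has_derivative_linear[OF Ck_on_SucD(1)[OF Cw z]])
  have "dir_deriv w z (W z) = dir_deriv w z (\<Sum>b\<in>Basis. (W z \<bullet> b) *\<^sub>R b)" by (simp add: euclidean_representation)
  then show ?thesis by (simp add: linear_sum[OF lw] linear_scale[OF lw] mult.commute
  del: euclidean_representation_sum euclidean_representation_sum')
  qed
  also have "(\<Sum>b\<in>Basis. dir_deriv W z b \<bullet> b) = (\<Sum>i\<in>UNIV. lev theta z (e i)) - dir_deriv psi z (W z)"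
  using div_grad[OF Ctheta z e] by (simp add: W_def)
  finally have "dv z = w z * (\<Sum>i\<in>UNIV. lev theta z (e i)) + eta z ^ (2 * Suc p) * E * (real p * s)
  + real (2 * Suc p) * t * eta z ^ (2 * Suc p - 1) * E"
  unfolding dw by (simp add: w_def E_def s_def t_def algebra_simps)
  moreover have "w z * (\<Sum>i\<in>UNIV. lev theta z (e i)) >= w z * (2 * u z - 2 - 2 * real CARD('d))"
  using levtheta[OF z e] Epos eta(2) by (intro mult_left_mono) (auto simp: w_def)
  moreover have "w z = eta z ^ (2 * Suc p) * E" by (simp add: w_def E_def)
  ultimately have 1: "dv z >= E * (eta z ^ (2 * Suc p) * (2 * u z - 2 - 2 * real CARD('d))
  + (eta z ^ (2 * Suc p) * (real p * s) + real (2 * Suc p) * t * eta z ^ (2 * Suc p - 1)))"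
  by (simp add: algebra_simps)
  have R0: "real p * R\<^sup>2 > 0" using R p by (smt (verit) of_nat_0_less_iff zero_less_Suc zero_less_power)
  \<comment> \<open>Completing the square absorbs the derivative of the cutoff into the term with
    \<open>s\<close>, the squared length of the gradient of \<open>theta\<close>. The relation
    between \<open>p\<close> and \<open>R\<close> makes the remainder at most 1.\<close>
  have 2: "eta z ^ (2 * Suc p) * (real p * s) + real (2 * Suc p) * t * eta z ^ (2 * Suc p - 1) >= - (eta z ^ (2 * p))"
  proof -
  have "0 <= (real p * (R * t) * R * eta z + real (Suc p))\<^sup>2" by simp
  also have "... = (real p * R\<^sup>2) * (real p * (R * t)\<^sup>2 * (eta z)\<^sup>2 + 2 * real (Suc p) * t * eta z) + real (Suc p) ^ 2"
  by (simp add: power2_eq_square algebra_simps)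
  also have "... <= (real p * R\<^sup>2) * (real p * s * (eta z)\<^sup>2 + 2 * real (Suc p) * t * eta z) + (real p * R\<^sup>2) * 1"
  using R t R0 by (intro add_mono mult_left_mono mult_right_mono order_refl) auto
  finally have "0 <= real p * s * (eta z)\<^sup>2 + 2 * real (Suc p) * t * eta z + 1"
  using R0 by (simp only: distrib_left[symmetric] zero_le_mult_iff) auto
  then have "0 <= eta z ^ (2 * p) * (real p * s * (eta z)\<^sup>2 + 2 * real (Suc p) * t * eta z + 1)"
  using eta(2) by simp
  also have "... = eta z ^ (2 * Suc p) * (real p * s) + real (2 * Suc p) * t * eta z ^ (2 * Suc p - 1) + eta z ^ (2 * p)"
  by (simp add: power2_eq_square power_add[symmetric] algebra_simps)
  finally show ?thesis by linarith
  qed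
  define x where "x = (eta z)\<^sup>2 * u z"
  have x0: "x >= 0" using upos[OF z] by (simp add: x_def)
  have "E * (eta z ^ (2 * Suc p) * (2 * u z - 2 - 2 * real CARD('d)) - eta z ^ (2 * p))
  >= E * (eta z ^ (2 * Suc p) * (2 * u z) - eta z ^ (2 * p) * (2 + 2 * real CARD('d)) - eta z ^ (2 * p))"
  proof -
  have "eta z ^ (2 * Suc p) <= eta z ^ (2 * p)" using eta(2,3) by (intro power_decreasing) auto
  then have "eta z ^ (2 * Suc p) * (2 + 2 * real CARD('d)) <= eta z ^ (2 * p) * (2 + 2 * real CARD('d))"
  by (intro mult_right_mono) auto
  then show ?thesis using Epos by (intro mult_left_mono) (auto simp: algebra_simps)
  qed
  moreover have "E * (eta z ^ (2 * Suc p) * (2 * u z) - eta z ^ (2 * p) * (2 + 2 * real CARD('d)) - eta z ^ (2 * p))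
  = 2 * x ^ Suc p - L * x ^ p"
  proof -
  have xp: "x ^ p = eta z ^ (2 * p) * E"
  using exptheta[OF z] unfolding E_def x_def power_mult_distrib power_mult by simp
  have etaS: "eta z ^ (2 * Suc p) = eta z ^ (2 * p) * (eta z)\<^sup>2" by (simp add: power_add power2_eq_square)
  show ?thesis unfolding power_Suc xp etaS unfolding L_def x_def by (simp add: algebra_simps)
  qed
  moreover have "x ^ p * L <= x ^ Suc p + L ^ Suc p" by (rule power_young[OF x0]) (simp add: L_def add_pos_nonneg)
  moreover have "E * (eta z ^ (2 * Suc p) * (2 * u z - 2 - 2 * real CARD('d)) - eta z ^ (2 * p)) <= dv z"
  proof (rule order_trans[OF _ 1], rule mult_left_mono)
  show "eta z ^ (2 * Suc p) * (2 * u z - 2 - 2 * real CARD('d)) - eta z ^ (2 * p)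
  <= eta z ^ (2 * Suc p) * (2 * u z - 2 - 2 * real CARD('d))
  + (eta z ^ (2 * Suc p) * (real p * s) + real (2 * Suc p) * t * eta z ^ (2 * Suc p - 1))"
  using 2 by linarith
  qed (use Epos in simp)
  ultimately show ?thesis unfolding T_def x_def[symmetric] by (simp add: mult.commute)
 qed
 have cT: "continuous_on S T"
 proof -
  have "continuous_on Omega T" unfolding T_def u_def
  using Ck_on_imp_continuous_on[OF Cq[of 0]] Ck_on_imp_continuous_on[OF Cr[of 0]] Ck_on_imp_continuous_on[OF Ceta] rpos
  by (intro continuous_intros) (auto simp: less_imp_neq[symmetric])
  then show ?thesis using S(2) continuous_on_subset by blast
 qed
 have iT: "integrable lborel (%z. indicator S z *\<^sub>R T z)" by (rule borel_integrable_compact[OF S(1) cT])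
 then show "integrable lborel (%z. indicator S z * ((eta z)\<^sup>2 * (f (Y z) / (c + f z)\<^sup>2)) ^ Suc p)"
  by (simp add: T_def u_def q_def r_def)
 have iL: "integrable lborel (%z. L ^ Suc p * indicator S z)"
  using emeasure_compact_finite[OF S(1)] S(1)
  by (intro integrable_mult_right integrable_real_indicator) (auto simp: compact_imp_closed borel_closed)
 have "(\<integral>z. indicator S z *\<^sub>R T z \<partial>lborel) <= (\<integral>z. dv z + L ^ Suc p * indicator S z \<partial>lborel)"
 proof (rule integral_mono[OF iT Bochner_Integration.integrable_add[OF idv(1) iL]])
  fix z
  show "indicator S z *\<^sub>R T z <= dv z + L ^ Suc p * indicator S z"
  using dvT[of z] dv0[of z] S(2) by (cases "z \<in> S") (auto simp: algebra_simps)
 qed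
 also have "... = L ^ Suc p * measure lborel S"
  using idv iL S(1) by (simp add: compact_imp_closed borel_closed)
 finally show "(\<integral>z. indicator S z * ((eta z)\<^sup>2 * (f (Y z) / (c + f z)\<^sup>2)) ^ Suc p \<partial>lborel) <= L ^ Suc p * measure lborel S"
  by (simp add: T_def u_def q_def r_def)
qed

end

text \<open>If \<open>u > s > 2 * L\<close> on a small ball, the integral over it is at least
  \<open>(s / 2) ^ Suc p\<close> times its measure, against \<open>L ^ Suc p\<close> times a fixed
  volume: impossible for large \<open>p\<close>. The factor 2 in \<open>2 * L\<close> is the price
  of \<open>1 <= 2 * (eta z)^2\<close>.\<close>

lemma (in kaehler_einstein) gradient_estimate_of_cutoffs:
 assumes bd: "bounded Omega" and cut: "!!R K. R > 0 ==> compact K ==> K \<subseteq> Omega ==> \<exists>eta. cutoff R K eta"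
  and f: "linear f" and r: "!!z. z \<in> Omega ==> c + f z > 0" and z: "z \<in> Omega"
 shows "(f v)\<^sup>2 <= (6 + 4 * real CARD('d)) * (c + f z)\<^sup>2 * G z v v"
proof (cases "f = (%_. 0)")
 case True
 then show ?thesis using jposD(3)[OF jpos_G[OF z], of v] by simp
next
 case False
 define L where "L = 3 + 2 * real CARD('d)"
 have L: "L > 0" by (simp add: L_def add_pos_nonneg)
 define Y where "Y z = (SOME y. \<forall>u. G z y u = f u)" for z
 have Y: "G z (Y z) u = f u" if zz: "z \<in> Omega" for z u
 proof -
  obtain x where "!!u. G z x u = f u" by (rule riesz_exists[OF zz f]) blast
  then have "\<exists>x. \<forall>u. G z x u = f u" by blast
  then show ?thesis unfolding Y_def by (rule someI2_ex) blast
 qed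
 define u where "u z = f (Y z) / (c + f z)\<^sup>2" for z
 have cu: "continuous_on Omega u"
 proof -
  have bf: "bounded_linear f" using f linear_conv_bounded_linear by blast
  have "Ck_on 0 Omega Y" by (rule riesz_Ck[OF Y Ck_on_const[OF open_dom]])
  then have "continuous_on Omega (%z. f (Y z))" by (simp add: bounded_linear.continuous_on[OF bf])
  moreover have "continuous_on Omega f" using bf by (rule linear_continuous_on)
  ultimately show ?thesis unfolding u_def[abs_def]
  using r by (intro continuous_intros) (auto simp: less_imp_neq[symmetric])
 qed
 have "u z <= 2 * L"
 proof (rule ccontr)
  assume "~ u z <= 2 * L"
  then obtain s where s: "2 * L < s" "s < u z" using dense by (metis not_le)
  have "open (u -` {s<..} \<inter> Omega)"
  by (rule iffD1[OF continuous_on_open_vimage[OF open_dom] cu, rule_format]) (rule open_greaterThan)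
  moreover have "z \<in> u -` {s<..} \<inter> Omega" using s z by simp
  ultimately obtain rho where rho: "rho > 0" "cball z rho \<subseteq> u -` {s<..} \<inter> Omega"
  unfolding open_contains_cball by blast
  define K where "K = cball z rho"
  have K: "compact K" "K \<subseteq> Omega" "!!x. x \<in> K ==> s < u x" using rho by (auto simp: K_def)
  have mK: "measure lborel K > 0" unfolding K_def using content_cball_pos[OF rho(1), of z] by (simp add: measure_completion)
  obtain B where B: "Omega \<subseteq> cball 0 B" using bd unfolding bounded_iff by (auto simp: subset_iff)
  define V where "V = measure lborel (cball (0::complex^'d) B)"
  have key: "(s / (2 * L)) ^ Suc p * measure lborel K <= V" if p: "p > 0" for p
  proof -
  obtain eta where eta: "cutoff (real (Suc p)) K eta" using cut[OF _ K(1,2), of "real (Suc p)"] by auto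
  then obtain S where S: "compact S" "S \<subseteq> Omega" "!!z. z \<notin> S ==> eta z = 0"
  and eta1: "Ck_on (Suc 0) UNIV eta" "!!z. 0 <= eta z" "!!z. eta z <= 1" "!!z. z \<in> K ==> 1 <= 2 * (eta z)\<^sup>2"
  "!!z v. z \<in> Omega ==> (real (Suc p) * dir_deriv eta z v)\<^sup>2 <= G z v v"
  unfolding cutoff_def by auto
  define T where "T z = indicator S z * ((eta z)\<^sup>2 * u z) ^ Suc p" for z
  have iR: "real (Suc p) ^ 2 <= real p * (real (Suc p))\<^sup>2" using p by simp
  have iT: "integrable lborel T" "(\<integral>z. T z \<partial>lborel) <= L ^ Suc p * measure lborel S"
  using integral_estimate[OF f False r Y p S eta1(1,2,3,5) iR] unfolding T_def[abs_def] u_def L_def by blast+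
  have KS: "K \<subseteq> S"
  proof
  fix x assume "x \<in> K"
  then show "x \<in> S" using eta1(4)[of x] S(3)[of x] by force
  qed
  have "(s / 2) ^ Suc p * measure lborel K = (\<integral>z. (s / 2) ^ Suc p * indicator K z \<partial>lborel)"
  using K(1) by (simp add: compact_imp_closed borel_closed)
  also have "... <= (\<integral>z. T z \<partial>lborel)"
  proof (rule integral_mono[OF _ iT(1)])
  show "integrable lborel (%z. (s / 2) ^ Suc p * indicator K z)"
  using emeasure_compact_finite[OF K(1)] K(1)
  by (intro integrable_mult_right integrable_real_indicator) (auto simp: compact_imp_closed borel_closed)
  fix x
  have u0: "u x >= 0" if "x \<in> Omega"
  using jposD(3)[OF jpos_G[OF that], of "Y x"] by (simp add: u_def Y[OF that])
  show "(s / 2) ^ Suc p * indicator K x <= T x"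
  proof (cases "x \<in> K")
  case True
  have "s / 2 <= (eta x)\<^sup>2 * u x"
  proof -
  have "s / 2 <= (1 / 2) * u x" using K(3)[OF True] by simp
  also have "... <= (eta x)\<^sup>2 * u x" using eta1(4)[OF True] u0 K(2) True by (intro mult_right_mono) auto
  finally show ?thesis .
  qed
  then have "(s / 2) ^ Suc p <= ((eta x)\<^sup>2 * u x) ^ Suc p" using s L by (intro power_mono) auto
  then show ?thesis using True KS by (simp add: T_def subset_iff)
  next
  case False
  then show ?thesis using u0 S(2) by (cases "x \<in> S") (auto simp: T_def)
  qed
  qed
  also have "... <= L ^ Suc p * measure lborel S" by (rule iT)
  also have "... <= L ^ Suc p * V"
  proof (rule mult_left_mono)
  show "measure lborel S <= V" unfolding V_def
  using S B emeasure_compact_finite[of "cball (0::complex^'d) B"]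
  by (intro measure_mono_fmeasurable) (auto simp: fmeasurable_def compact_imp_closed borel_closed)
  qed (use L in simp)
  finally show ?thesis using L by (simp add: power_divide power_mult_distrib divide_simps mult_ac)
  qed
  have "s / (2 * L) > 1" using s L by simp
  then obtain p where p: "V / measure lborel K < (s / (2 * L)) ^ p" using real_arch_pow by blast
  have "(s / (2 * L)) ^ p <= (s / (2 * L)) ^ Suc (Suc p)" using \<open>s / (2 * L) > 1\<close> by (intro power_increasing) auto
  then have "V / measure lborel K < (s / (2 * L)) ^ Suc (Suc p)" using p by linarith
  then show False using key[of "Suc p"] mK by (simp add: divide_less_eq del: power_Suc)
 qed
 then have q: "f (Y z) <= 2 * L * (c + f z)\<^sup>2" using r[OF z] by (simp add: u_def divide_le_eq)
 have "(f v)\<^sup>2 <= G z (Y z) (Y z) * G z v v" using jpos_cauchy_schwarz(1)[OF jpos_G[OF z], of "Y z" v] by (simp add: Y[OF z])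
 also have "... <= (2 * L * (c + f z)\<^sup>2) * G z v v"
  using q jposD(3)[OF jpos_G[OF z], of v] by (intro mult_right_mono) (simp add: Y[OF z])
 finally show ?thesis by (simp add: L_def algebra_simps)
qed

subsection \<open>Length of paths\<close>

text \<open>\<open>N z v\<close> is the length of the tangent vector \<open>v\<close> at
  \<open>z\<close>. With \<open>has_integral\<close> the finiteness of the length is part of the
  statement.\<close>

definition plen :: "('a::real_normed_vector => 'a => real) => (real => 'a) => real => bool" where
 "plen N gamma L \<longleftrightarrow> ((%t. N (gamma t) (vector_derivative gamma (at t))) has_integral L) {0..1}"

lemma plen_reversepath:
 assumes g: "valid_path g" and f: "plen N g i" and N: "!!z v. N z (- v) = N z v"
 shows "plen N (reversepath g) i"
proof -
 obtain S where S: "finite S" "!!x. x \<in> {0..1} - S ==> g differentiable at x"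
  using g unfolding piecewise_C1_differentiable_on_def C1_differentiable_on_eq valid_path_def by blast
 have *: "vector_derivative (%x. g (1 - x)) (at x) = - vector_derivative g (at (1 - x))"
  if "x \<notin> (%x. 1 - x) ` S" "0 <= x" "x <= 1" for x
 proof (rule vector_derivative_at)
  have "1 - x \<notin> S" using that by (metis diff_diff_cancel diff_diff_eq2 add_diff_cancel_left' imageI)
  then have "(g has_vector_derivative vector_derivative g (at (1 - x))) (at (1 - x))"
  using S(2)[of "1 - x"] that by (simp add: vector_derivative_works)
  then have "(g \<circ> (%x. 1 - x) has_vector_derivative -1 *\<^sub>R vector_derivative g (at (1 - x))) (at x)"
  by (intro vector_diff_chain_at derivative_eq_intros | simp)+
  then show "((%x. g (1 - x)) has_vector_derivative - vector_derivative g (at (1 - x))) (at x)"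
  by (simp add: o_def)
 qed
 have "((%x. N (g (1 - x)) (vector_derivative g (at (1 - x)))) has_integral i) {0..1}"
  using has_integral_affinity01 [where m= "-1" and c=1, OF f [unfolded plen_def]] by simp
 then show ?thesis
  unfolding reversepath_def plen_def
  by (rule has_integral_spike_finite[rotated 2, where S = "(%x. 1 - x) ` S"]) (use S(1) in \<open>auto simp: * N\<close>)
qed

lemma plen_join:
 assumes "plen N g1 i1" "plen N g2 i2" "valid_path g1" "valid_path g2"
  and N: "!!z v. N z (2 *\<^sub>R v) = 2 * N z v"
 shows "plen N (g1 +++ g2) (i1 + i2)"
proof -
 obtain s1 s2
  where s1: "finite s1" "\<forall>x\<in>{0..1} - s1. g1 differentiable at x"
  and s2: "finite s2" "\<forall>x\<in>{0..1} - s2. g2 differentiable at x"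
  using assms
  by (auto simp: valid_path_def piecewise_C1_differentiable_on_def C1_differentiable_on_eq)
 note 1 = assms(1)[unfolded plen_def] and 2 = assms(2)[unfolded plen_def]
 have i1: "((%x. 2 * N (g1 (2*x)) (vector_derivative g1 (at (2*x)))) has_integral i1) {0..1/2}"
  and i2: "((%x. 2 * N (g2 (2*x - 1)) (vector_derivative g2 (at (2*x - 1)))) has_integral i2) {1/2..1}"
  using has_integral_affinity01 [OF 1, where m= 2 and c=0, THEN has_integral_cmul [where c=2]]
  has_integral_affinity01 [OF 2, where m= 2 and c="-1", THEN has_integral_cmul [where c=2]]
  by (simp_all only: image_affinity_atLeastAtMost_div_diff, simp_all add: mult_ac)
 have g1: "vector_derivative (%x. if x*2 <= 1 then g1 (2*x) else g2 (2*x - 1)) (at z) =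
  2 *\<^sub>R vector_derivative g1 (at (z*2))"
  if "0 <= z" "z*2 < 1" "z*2 \<notin> s1" for z
 proof (rule vector_derivative_at [OF has_vector_derivative_transform_within])
  show "0 < \<bar>z - 1/2\<bar>"
  using that by auto
  have "((*) 2 has_vector_derivative 2) (at z)"
  by (simp add: has_vector_derivative_def has_derivative_def bounded_linear_mult_left)
  moreover have "(g1 has_vector_derivative vector_derivative g1 (at (z * 2))) (at (2 * z))"
  using s1 that by (auto simp: algebra_simps vector_derivative_works)
  ultimately
  show "((%x. g1 (2 * x)) has_vector_derivative 2 *\<^sub>R vector_derivative g1 (at (z * 2))) (at z)"
  by (intro vector_diff_chain_at [simplified o_def])
 qed (use that in \<open>simp_all add: dist_real_def abs_if split: if_split_asm\<close>)
 have g2: "vector_derivative (%x. if x*2 <= 1 then g1 (2*x) else g2 (2*x - 1)) (at z) =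
  2 *\<^sub>R vector_derivative g2 (at (z*2 - 1))"
  if "1 < z*2" "z <= 1" "z*2 - 1 \<notin> s2" for z
 proof (rule vector_derivative_at [OF has_vector_derivative_transform_within])
  show "0 < \<bar>z - 1/2\<bar>"
  using that by auto
  have "((%x. 2 * x - 1) has_vector_derivative 2) (at z)"
  by (simp add: has_vector_derivative_def has_derivative_def bounded_linear_mult_left)
  moreover have "(g2 has_vector_derivative vector_derivative g2 (at (z * 2 - 1))) (at (2 * z - 1))"
  using s2 that by (auto simp: algebra_simps vector_derivative_works)
  ultimately
  show "((%x. g2 (2 * x - 1)) has_vector_derivative 2 *\<^sub>R vector_derivative g2 (at (z * 2 - 1))) (at z)"
  by (intro vector_diff_chain_at [simplified o_def])
 qed (use that in \<open>simp_all add: dist_real_def abs_if split: if_split_asm\<close>)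
 have "((%x. N ((g1 +++ g2) x) (vector_derivative (g1 +++ g2) (at x))) has_integral i1) {0..1/2}"
 proof (rule has_integral_spike_finite [OF _ _ i1])
  show "finite (insert (1/2) ((*) 2 -` s1))"
  using s1 by (force intro: finite_vimageI [where h = "(*)2"] inj_onI)
 qed (auto simp add: joinpaths_def mult_ac g1 N)
 moreover have "((%x. N ((g1 +++ g2) x) (vector_derivative (g1 +++ g2) (at x))) has_integral i2) {1/2..1}"
 proof (rule has_integral_spike_finite [OF _ _ i2])
  show "finite (insert (1/2) ((%x. 2 * x - 1) -` s2))"
  using s2 by (force intro: finite_vimageI [where h = "%x. 2*x-1"] inj_onI)
 qed (auto simp add: joinpaths_def mult_ac g2 N)
 ultimately show ?thesis
  by (simp add: plen_def has_integral_combine [where c = "1/2"])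
qed

lemma plen_subpath:
 assumes f: "plen N g L" and g: "valid_path g"
  and uv: "u \<in> {0..1}" "v \<in> {0..1}" "u <= v"
  and N: "!!z c v. c >= 0 ==> N z (c *\<^sub>R v) = c * N z v"
 shows "plen N (subpath u v g) (integral {u..v} (%t. N (g t) (vector_derivative g (at t))))"
proof (cases "v=u")
 case True
 then show ?thesis using N[of 0] by (simp add: plen_def subpath_def)
next
 case False
 obtain S where S: "!!x. x \<in> {0..1} - S ==> g differentiable at x" and fs: "finite S"
  using g unfolding piecewise_C1_differentiable_on_def C1_differentiable_on_eq valid_path_def by blast
 have "(%t. N (g t) (vector_derivative g (at t))) integrable_on {u..v}"
  by (rule integrable_on_subinterval[of _ "{0..1}"]) (use f uv in \<open>auto simp: plen_def integrable_on_def\<close>)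
 then have *: "((%x. N (g ((v - u) * x + u)) (vector_derivative g (at ((v - u) * x + u))))
  has_integral (1 / (v - u)) * integral {u..v} (%t. N (g t) (vector_derivative g (at t))))
  {0..1}"
  using uv False unfolding has_integral_integral
  apply simp
  apply (drule has_integral_affinity [where m="v-u" and c=u, simplified])
  apply (simp_all add: image_affinity_atLeastAtMost_div_diff)
  apply (simp add: divide_simps)
  done
 have vd: "vector_derivative (%x. g ((v-u) * x + u)) (at x) = (v-u) *\<^sub>R vector_derivative g (at ((v-u) * x + u))"
  if "x \<in> {0..1}"  "x \<notin> (%t. (v-u) *\<^sub>R t + u) -` S" for x
 proof (rule vector_derivative_at [OF vector_diff_chain_at [simplified o_def]])
  show "((%x. (v - u) * x + u) has_vector_derivative v - u) (at x)"
  by (intro derivative_eq_intros | simp)+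
 qed (use S uv mult_left_le [of x "v-u"] that in \<open>auto simp: vector_derivative_works\<close>)
 have fin: "finite ((%t. (v - u) *\<^sub>R t + u) -` S)"
  using fs by (auto simp: inj_on_def False finite_vimageI)
 have "((%x. (v - u) * N (g ((v - u) * x + u)) (vector_derivative g (at ((v - u) * x + u))))
  has_integral integral {u..v} (%t. N (g t) (vector_derivative g (at t)))) {0..1}"
  using has_integral_mult_right[OF *, of "v - u"] False by simp
 then show ?thesis
  unfolding subpath_def plen_def
  by (rule has_integral_spike_finite [OF fin, rotated]) (use uv in \<open>auto simp: vd N\<close>)
qed

text \<open>Squaring smooths the corner of the truncation; the bump function of
  \<open>d_lower_local\<close> and the kernel of \<open>smoothing\<close> are built from it.\<close>

lemma max_0_square_has_derivative: "((%s::real. (max 0 s)\<^sup>2) has_real_derivative 2 * max 0 s) (at s)"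
proof -
 consider "s > 0" | "s < 0" | "s = 0" by linarith
 then show ?thesis
 proof cases
  case 1
  have "((%s::real. s\<^sup>2) has_real_derivative 2 * max 0 s) (at s)"
  using 1 by (auto intro!: derivative_eq_intros)
  then show ?thesis
  by (rule has_field_derivative_transform_within_open[where S="{0<..}"]) (use 1 in auto)
 next
  case 2
  have "((%s::real. 0) has_real_derivative 2 * max 0 s) (at s)"
  using 2 by (auto intro!: derivative_eq_intros)
  then show ?thesis
  by (rule has_field_derivative_transform_within_open[where S="{..<0}"]) (use 2 in auto)
 next
  case 3
  have "((%h::real. (max 0 h)\<^sup>2 / h) \<longlongrightarrow> 0) (at 0)"
  proof (rule Lim_null_comparison[where g="%h. \<bar>h\<bar>"])
  show "\<forall>\<^sub>F h in at 0. norm ((max 0 h)\<^sup>2 / h) <= \<bar>h::real\<bar>"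
  by (intro always_eventually allI) (auto simp: max_def power2_eq_square)
  show "((%h::real. \<bar>h\<bar>) \<longlongrightarrow> 0) (at 0)" by (rule tendsto_eq_intros | simp)+
  qed
  then show ?thesis unfolding 3 by (simp add: has_field_derivative_iff)
 qed
qed

section \<open>The Riemannian distance of a convex domain\<close>

locale kaehler_convex = kaehler Omega G
 for Omega :: "(complex^'d) set" and G :: "complex^'d => complex^'d => complex^'d => real" +
 assumes convex_dom: "convex Omega"
begin

text \<open>Zero outside the domain, so that homogeneity holds at every point, as the lemmas on
  \<open>plen\<close> require.\<close>

definition nrm :: "complex^'d => complex^'d => real" where
 "nrm z v = (if z \<in> Omega then sqrt (G z v v) else 0)"

abbreviation d :: "complex^'d => complex^'d => real" where "d \<equiv> riemannian_distance Omega G"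

lemma nrm_nonneg: "nrm z v >= 0"
 using jposD(3)[OF jpos_G, of z v] by (simp add: nrm_def)

lemma nrm_sq: "z \<in> Omega ==> (nrm z v)\<^sup>2 = G z v v"
 using jposD(3)[OF jpos_G, of z v] by (simp add: nrm_def)

lemma nrm_smult: "nrm z (c *s v) = cmod c * nrm z v"
proof (cases "z \<in> Omega")
 case True
 have "G z (c *s v) (c *s v) = (cmod c)\<^sup>2 * G z v v"
  unfolding smult_eq_J[of c v] cmod_power2
  by (simp add: G_simps[OF True] jsymD(3)[OF jsym_G[OF True]] jsymD(5)[OF jsym_G[OF True]]
  G_J[OF True] power2_eq_square algebra_simps)
 then show ?thesis using True by (simp add: nrm_def real_sqrt_mult)
qed (simp add: nrm_def)



lemma nrm_scaleR: "nrm z (c *\<^sub>R v) = \<bar>c\<bar> * nrm z v"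
 by (simp add: scaleR_smult nrm_smult)

lemma nrm_minus: "nrm z (- v) = nrm z v"
 using nrm_scaleR[of z "-1" v] by simp

lemma continuous_on_G: "continuous_on (Omega \<times> UNIV) (%(z, v). G z v v)"
proof -
 have "continuous_on (Omega \<times> UNIV) (%p. \<Sum>i\<in>Basis. \<Sum>j\<in>Basis. (snd p \<bullet> i) * (snd p \<bullet> j) * G (fst p) i j)"
 proof (intro continuous_intros)
  fix i j :: "complex^'d"
  have "continuous_on Omega (%z. G z i j)" using Ck_on_imp_continuous_on[OF Ck_G[of 0]] .
  then show "continuous_on (Omega \<times> UNIV) (%p. G (fst p) i j)"
  by (rule continuous_on_compose2) (auto intro: continuous_intros)
 qed
 moreover have "(\<Sum>i\<in>Basis. \<Sum>j\<in>Basis. (v \<bullet> i) * (v \<bullet> j) * G z i j) = G z v v" if "z \<in> Omega" for z v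
 proof -
  have "G z v v = G z (\<Sum>i\<in>Basis. (v \<bullet> i) *\<^sub>R i) (\<Sum>j\<in>Basis. (v \<bullet> j) *\<^sub>R j)"
  by (simp add: euclidean_representation)
  also have "... = (\<Sum>i\<in>Basis. (v \<bullet> i) * G z i (\<Sum>j\<in>Basis. (v \<bullet> j) *\<^sub>R j))"
  by (simp only: bilinear_sum_left[OF bilinear_G[OF that]] G_simps[OF that])
  also have "... = (\<Sum>i\<in>Basis. \<Sum>j\<in>Basis. (v \<bullet> i) * (v \<bullet> j) * G z i j)"
  by (simp only: bilinear_sum_right[OF bilinear_G[OF that]] G_simps[OF that] sum_distrib_left mult.assoc)
  finally show ?thesis by simp
 qed
 ultimately show ?thesis by (subst continuous_on_cong[OF refl]) auto
qed

lemma continuous_on_nrm: "continuous_on (Omega \<times> UNIV) (%(z, v). nrm z v)"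
proof -
 have "continuous_on (Omega \<times> UNIV) (%p. sqrt (case p of (z, v) => G z v v))"
  by (intro continuous_intros continuous_on_G)
 moreover have "sqrt (case p of (z, v) => G z v v) = (case p of (z, v) => nrm z v)"
  if "p \<in> Omega \<times> UNIV" for p using that by (auto simp: nrm_def)
 ultimately show ?thesis by (subst continuous_on_cong[OF refl]) auto
qed

lemma nrm_pos: "z \<in> Omega ==> v ~= 0 ==> nrm z v > 0"
 using jposD(2)[OF jpos_G, of z v] by (simp add: nrm_def)

lemma nrm_compact_bounds:
 assumes S: "compact S" "S \<subseteq> Omega"
 obtains c C where "c > 0" "C > 0" "!!z v. z \<in> S ==> c * norm v <= nrm z v" "!!z v. z \<in> S ==> nrm z v <= C * norm v"
proof (cases "S = {}")
 case True
 then show ?thesis using that[of 1 1] by simp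
next
 case False
 define P where "P = S \<times> sphere (0::complex^'d) 1"
 have "axis (undefined::'d) (1::complex) \<in> sphere 0 1" by (simp add: norm_axis_1)
 then have P: "compact P" "P ~= {}" "P \<subseteq> Omega \<times> UNIV" using S False by (auto simp: P_def intro!: compact_Times)
 have con: "continuous_on P (%(z, v). nrm z v)" by (rule continuous_on_subset[OF continuous_on_nrm P(3)])
 obtain p where p: "p \<in> P" "!!q. q \<in> P ==> (case p of (z, v) => nrm z v) <= (case q of (z, v) => nrm z v)"
  using continuous_attains_inf[OF P(1,2) con] by blast
 obtain p' where p': "p' \<in> P" "!!q. q \<in> P ==> (case q of (z, v) => nrm z v) <= (case p' of (z, v) => nrm z v)"
  using continuous_attains_sup[OF P(1,2) con] by blast
 define c C where "c = (case p of (z, v) => nrm z v)" and "C = (case p' of (z, v) => nrm z v)"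
 have "c > 0"
 proof -
  obtain z v where zv: "p = (z, v)" by (cases p)
  then have "z \<in> Omega" "v ~= 0" using p(1) S(2) by (auto simp: P_def)
  then show ?thesis using nrm_pos by (simp add: c_def zv)
 qed
 moreover have "C > 0" using p'(2)[OF p(1)] \<open>c > 0\<close> by (simp add: c_def C_def)
 moreover have b: "c * norm v <= nrm z v & nrm z v <= C * norm v" if z: "z \<in> S" for z v
 proof (cases "v = 0")
  case True
  then show ?thesis using nrm_scaleR[of z 0 0] by simp
 next
  case False
  have "(z, (1 / norm v) *\<^sub>R v) \<in> P" using z False by (simp add: P_def)
  from p(2)[OF this] p'(2)[OF this] show ?thesis using False
  by (simp add: c_def C_def nrm_scaleR divide_simps mult.commute)
 qed
 ultimately show ?thesis using that[of c C] by blast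
qed

definition arc :: "(real => complex^'d) => real => bool" where
 "arc gamma L \<longleftrightarrow> valid_path gamma & path_image gamma \<subseteq> Omega & plen nrm gamma L"

lemma arc_iff: "arc gamma L \<longleftrightarrow> valid_path gamma & path_image gamma \<subseteq> Omega &
 ((%t. sqrt (G (gamma t) (vector_derivative gamma (at t)) (vector_derivative gamma (at t)))) has_integral L) {0..1}"
proof -
 have "plen nrm gamma L \<longleftrightarrow> ((%t. sqrt (G (gamma t) (vector_derivative gamma (at t)) (vector_derivative gamma (at t)))) has_integral L) {0..1}"
  if "path_image gamma \<subseteq> Omega"
  unfolding plen_def by (rule has_integral_cong) (use that in \<open>force simp: nrm_def path_image_def\<close>)
 then show ?thesis unfolding arc_def by blast
qed

lemma d_eq: "x \<in> Omega ==> y \<in> Omega ==> d x y = Inf {L. \<exists>gamma. arc gamma L & pathstart gamma = x & pathfinish gamma = y}"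
 unfolding riemannian_distance_def arc_iff by (simp add: conj_ac)

lemma arc_nonneg: "arc gamma L ==> L >= 0"
 unfolding arc_def plen_def using has_integral_nonneg nrm_nonneg by blast

lemma d_le: assumes "arc gamma L" shows "d (pathstart gamma) (pathfinish gamma) <= L"
proof -
 have "pathstart gamma \<in> Omega" "pathfinish gamma \<in> Omega" using assms by (auto simp: arc_def)
 then show ?thesis unfolding d_eq[OF \<open>pathstart gamma \<in> Omega\<close> \<open>pathfinish gamma \<in> Omega\<close>]
  by (intro cInf_lower) (use assms arc_nonneg in \<open>auto intro!: bdd_belowI[of _ 0]\<close>)
qed

lemma arc_linepath:
 assumes "x \<in> Omega" "y \<in> Omega"
 shows "arc (linepath x y) (integral {0..1} (%t. nrm (linepath x y t) (y - x)))"
proof -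
 have sub: "path_image (linepath x y) \<subseteq> Omega"
  using assms convex_dom by (simp add: closed_segment_subset)
 have "continuous_on {0..1} (%t. (%(z, v). nrm z v) (linepath x y t, y - x))"
  by (rule continuous_on_compose2[OF continuous_on_nrm])
  (use sub in \<open>auto intro!: continuous_intros simp: path_image_def\<close>)
 then have "(%t. nrm (linepath x y t) (y - x)) integrable_on {0..1}"
  by (intro integrable_continuous_interval) simp
 then show ?thesis using sub unfolding arc_def plen_def by (simp add: integrable_integral)
qed

lemma arcs_nonempty:
 assumes "x \<in> Omega" "y \<in> Omega"
 shows "{L. \<exists>gamma. arc gamma L & pathstart gamma = x & pathfinish gamma = y} ~= {}"
 using arc_linepath[OF assms] by fastforce

lemma d_approx:
 assumes "x \<in> Omega" "y \<in> Omega" "eps > 0"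
 obtains gamma L where "arc gamma L" "pathstart gamma = x" "pathfinish gamma = y" "L < d x y + eps"
proof -
 have "Inf {L. \<exists>gamma. arc gamma L & pathstart gamma = x & pathfinish gamma = y} < d x y + eps"
  using assms by (simp add: d_eq)
 from cInf_lessD[OF arcs_nonempty[OF assms(1,2)] this] show ?thesis using that by blast
qed

lemma d_segment:
 assumes "x \<in> Omega" "y \<in> Omega" "!!z. z \<in> closed_segment x y ==> nrm z (y - x) <= M"
 shows "d x y <= M"
proof -
 have "d x y <= integral {0..1} (%t. nrm (linepath x y t) (y - x))"
  using d_le[OF arc_linepath[OF assms(1,2)]] by simp
 also have "... <= integral {0..1::real} (%t. M)"
 proof (rule integral_le)
  show "(%t. nrm (linepath x y t) (y - x)) integrable_on {0..1}"
  using arc_linepath[OF assms(1,2)] by (auto simp: arc_def plen_def integrable_on_def)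
  fix t :: real assume "t \<in> {0..1}"
  then have "linepath x y t \<in> closed_segment x y" by (auto simp: linepath_def closed_segment_def)
  then show "nrm (linepath x y t) (y - x) <= M" by (rule assms(3))
 qed auto
 finally show ?thesis by simp
qed

lemma d_nonneg: "d x y >= 0"
proof (cases "x \<in> Omega & y \<in> Omega")
 case True
 then show ?thesis using d_eq[of x y] cInf_greatest[OF arcs_nonempty[of x y], of 0] arc_nonneg by auto
qed (auto simp: riemannian_distance_def)

lemma d_self: "d x x = 0"
proof (cases "x \<in> Omega")
 case True
 have "d x x <= 0" by (rule d_segment[OF True True]) (use nrm_scaleR[of _ 0 0] in simp)
 then show ?thesis using d_nonneg[of x x] by simp
qed (auto simp: riemannian_distance_def)

lemma d_commute: "d x y = d y x"
proof (cases "x \<in> Omega & y \<in> Omega")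
 case True
 have "d y x <= d x y" if xy: "x \<in> Omega" "y \<in> Omega" for x y
 proof (rule field_le_epsilon)
  fix e :: real assume "e > 0"
  then obtain gamma L where g: "arc gamma L" "pathstart gamma = x" "pathfinish gamma = y" "L < d x y + e"
  using d_approx[OF xy] by blast
  have "arc (reversepath gamma) L" using g(1) unfolding arc_def
  by (auto intro: plen_reversepath nrm_minus)
  from d_le[OF this] g show "d y x <= d x y + e" by simp
 qed
 then show ?thesis using True by (simp add: order_antisym)
qed (auto simp: riemannian_distance_def)

lemma d_triangle: assumes "x \<in> Omega" "y \<in> Omega" "z \<in> Omega" shows "d x z <= d x y + d y z"
proof (rule field_le_epsilon)
 fix e :: real assume e: "e > 0"
 obtain gamma L where g: "arc gamma L" "pathstart gamma = x" "pathfinish gamma = y" "L < d x y + e / 2"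
  using d_approx[OF assms(1,2), of "e / 2"] e by auto
 obtain gamma' L' where g': "arc gamma' L'" "pathstart gamma' = y" "pathfinish gamma' = z" "L' < d y z + e / 2"
  using d_approx[OF assms(2,3), of "e / 2"] e by auto
 have "arc (gamma +++ gamma') (L + L')" using g g' unfolding arc_def
  by (auto intro!: plen_join valid_path_join simp: nrm_scaleR path_image_join)
 from d_le[OF this] g g' show "d x z <= d x y + d y z + e" by simp
qed

text \<open>Along a path the derivative of \<open>rho\<close> is at most \<open>K\<close> times the
  speed. Lower bounds for \<open>d\<close> are obtained from explicit functions
  \<open>rho\<close>.\<close>

lemma d_lipschitz:
 assumes rho: "!!z. z \<in> Omega ==> (rho has_derivative rho' z) (at z)"
  and K: "!!z v. z \<in> Omega ==> \<bar>rho' z v\<bar> <= K * nrm z v" and "K >= 0" and xy: "x \<in> Omega" "y \<in> Omega"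
 shows "\<bar>rho x - rho y\<bar> <= K * d x y"
proof (rule field_le_epsilon)
 fix e :: real assume e: "e > 0"
 define e' where "e' = e / (K + 1)"
 have e': "e' > 0" "K * e' <= e" using e \<open>K >= 0\<close> by (auto simp: e'_def divide_simps)
 obtain gamma L where g: "arc gamma L" "pathstart gamma = x" "pathfinish gamma = y" "L < d x y + e'"
  using d_approx[OF xy e'(1)] by blast
 have v: "valid_path gamma" and sub: "path_image gamma \<subseteq> Omega" and len: "plen nrm gamma L" using g(1) by (auto simp: arc_def)
 obtain S where S: "finite S" "!!t. t \<in> {0..1} - S ==> gamma differentiable at t"
  using v unfolding piecewise_C1_differentiable_on_def C1_differentiable_on_eq valid_path_def by blast
 have gammain: "gamma t \<in> Omega" if "t \<in> {0..1}" for t using sub that by (auto simp: path_image_def)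
 define D where "D t = rho' (gamma t) (vector_derivative gamma (at t))" for t
 have 1: "(D has_integral (rho (gamma 1) - rho (gamma 0))) {0..1}"
 proof (rule fundamental_theorem_of_calculus_interior_strong[OF S(1), where f="%t. rho (gamma t)"])
  show "((%t. rho (gamma t)) has_vector_derivative D t) (at t)" if "t \<in> {0<..<1} - S" for t
  proof -
  have "(gamma has_vector_derivative vector_derivative gamma (at t)) (at t)"
  using S(2)[of t] that by (auto simp: vector_derivative_works)
  then have "((%t. rho (gamma t)) has_derivative (%h. rho' (gamma t) (h *\<^sub>R vector_derivative gamma (at t)))) (at t)"
  unfolding has_vector_derivative_def
  by (rule has_derivative_compose[OF _ rho]) (use gammain[of t] that in auto)
  then show ?thesis unfolding has_vector_derivative_def D_def
  using linear_scale[OF has_derivative_linear[OF rho[OF gammain]]] that by simp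
  qed
  have "continuous_on Omega rho" using rho by (auto intro!: continuous_at_imp_continuous_on has_derivative_continuous)
  then show "continuous_on {0..1} (%t. rho (gamma t))"
  by (rule continuous_on_compose2) (use valid_path_imp_path[OF v] gammain in \<open>auto simp: path_def\<close>)
 qed auto
 have "norm (rho (gamma 1) - rho (gamma 0)) <= K * L"
 proof -
  have kl: "((%t. K * nrm (gamma t) (vector_derivative gamma (at t))) has_integral (K * L)) {0..1}"
  using len unfolding plen_def by (rule has_integral_mult_right)
  have b: "\<bar>D t\<bar> <= K * nrm (gamma t) (vector_derivative gamma (at t))" if "t \<in> {0..1}" for t
  unfolding D_def by (rule K[OF gammain[OF that]])
  have "rho (gamma 1) - rho (gamma 0) <= K * L" by (rule has_integral_le[OF 1 kl]) (use b in force)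
  moreover have "- (rho (gamma 1) - rho (gamma 0)) <= K * L" by (rule has_integral_le[OF has_integral_neg[OF 1] kl]) (use b in force)
  ultimately show ?thesis by simp
 qed
 also have "... <= K * (d x y + e')" using g(4) \<open>K >= 0\<close> by (intro mult_left_mono) auto
 also have "... <= K * d x y + e" using e'(2) by (simp add: distrib_left)
 finally show "\<bar>rho x - rho y\<bar> <= K * d x y + e" using g(2,3) by (simp add: pathstart_def pathfinish_def)
qed

text \<open>\<open>lf\<close> is the arc length of a path that is shortest up to \<open>eps\<close>;
  its continuity allows points to be chosen at prescribed arc length.\<close>

lemma near_geodesic:
 assumes "x \<in> Omega" "y \<in> Omega" "eps > 0"
 obtains w lf where "w (0::real) = x" "w 1 = y" "!!t. t \<in> {0..1} ==> w t \<in> Omega" "lf 0 = (0::real)" "lf 1 < d x y + eps"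
  "continuous_on {0..1} lf" "!!s t. 0 <= s ==> s <= t ==> t <= 1 ==> d (w s) (w t) <= lf t - lf s"
proof -
 obtain gamma L where g: "arc gamma L" "pathstart gamma = x" "pathfinish gamma = y" "L < d x y + eps"
  using d_approx[OF assms] by blast
 define f where "f t = nrm (gamma t) (vector_derivative gamma (at t))" for t
 have v: "valid_path gamma" and sub: "path_image gamma \<subseteq> Omega" and len: "(f has_integral L) {0..1}"
  using g(1) by (auto simp: arc_def plen_def f_def[abs_def])
 have fi: "f integrable_on {0..1}" using len by (auto simp: integrable_on_def)
 define lf where "lf t = integral {0..t} f" for t
 have "d (gamma s) (gamma t) <= lf t - lf s" if st: "0 <= s" "s <= t" "t <= 1" for s t
 proof -
  have "plen nrm (subpath s t gamma) (integral {s..t} f)" unfolding f_def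
  by (rule plen_subpath[of _ _ L]) (use g(1) st in \<open>auto simp: arc_def nrm_scaleR\<close>)
  moreover have "path_image (subpath s t gamma) \<subseteq> Omega"
  using path_image_subpath_subset[of s t gamma] sub st by auto
  ultimately have "arc (subpath s t gamma) (integral {s..t} f)"
  unfolding arc_def using valid_path_subpath[OF v] st by simp
  from d_le[OF this] have "d (gamma s) (gamma t) <= integral {s..t} f" by simp
  moreover have "lf s + integral {s..t} f = lf t" unfolding lf_def
  by (rule Henstock_Kurzweil_Integration.integral_combine)
  (use st in \<open>auto intro: integrable_on_subinterval[OF fi]\<close>)
  ultimately show ?thesis by simp
 qed
 moreover have "continuous_on {0..1} lf" unfolding lf_def by (rule indefinite_integral_continuous_1[OF fi])
 moreover have "lf 0 = 0" by (simp add: lf_def)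
 moreover have "lf 1 < d x y + eps" unfolding lf_def using integral_unique[OF len] g(4) by simp
 moreover have "gamma t \<in> Omega" if "t \<in> {0..1}" for t using sub that by (auto simp: path_image_def)
 ultimately show ?thesis using that[of gamma lf] g(2,3) by (simp add: pathstart_def pathfinish_def)
qed

lemma intermediate_point:
 assumes "x \<in> Omega" "y \<in> Omega" "eps > 0" "0 <= a"
 obtains w where "w \<in> Omega" "d x w <= a" "d w y <= max 0 (d x y - a) + eps"
proof -
 obtain w lf where w: "w (0::real) = x" "w 1 = y" "!!t. t \<in> {0..1} ==> w t \<in> Omega" "lf 0 = (0::real)" "lf 1 < d x y + eps"
  "continuous_on {0..1} lf" "!!s t. 0 <= s ==> s <= t ==> t <= 1 ==> d (w s) (w t) <= lf t - lf s"
  using near_geodesic[OF assms(1-3)] by blast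
 show ?thesis
 proof (cases "a >= lf 1")
  case True
  have "d x y <= a" using w(7)[of 0 1] w(1,2,4) True by simp
  then show ?thesis using that[of y] assms by (simp add: d_self)
 next
  case False
  then obtain t where t: "0 <= t" "t <= 1" "lf t = a"
  using IVT'[of lf 0 a 1] w(4,6) assms(4) by auto
  then show ?thesis using that[of "w t"] w(3)[of t] w(7)[of 0 t] w(7)[of t 1] w(1,2,4,5) by force
 qed
qed

text \<open>A differentiable bump supported in a Euclidean ball is Lipschitz for \<open>d\<close>.
  The resulting bound is only quadratic in the Euclidean distance, which is enough to separate
  points and to compare topologies.\<close>

lemma d_lower_local:
 assumes r: "r > 0" "cball x r \<subseteq> Omega" and c: "c > 0" "!!z v. z \<in> cball x r ==> c * norm v <= nrm z v"
  and y: "y \<in> Omega"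
 shows "c / (4 * r) * (min (norm (y - x)) r)\<^sup>2 <= d x y"
proof -
 define rho where "rho z = (max 0 (r\<^sup>2 - (z - x) \<bullet> (z - x)))\<^sup>2" for z
 define rho' where "rho' z v = 2 * max 0 (r\<^sup>2 - (z - x) \<bullet> (z - x)) * (- 2 * ((z - x) \<bullet> v))" for z v
 have x: "x \<in> Omega" using r by auto
 have dr: "(rho has_derivative rho' z) (at z)" for z
 proof -
  have "((%z. r\<^sup>2 - (z - x) \<bullet> (z - x)) has_derivative (%v. - 2 * ((z - x) \<bullet> v))) (at z)"
  by (auto intro!: derivative_eq_intros simp: inner_commute)
  from has_derivative_compose[OF this max_0_square_has_derivative[unfolded has_field_derivative_def]]
  show ?thesis unfolding rho_def[abs_def] rho'_def[abs_def] by simp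
 qed
 have le: "\<bar>rho' z v\<bar> <= 4 * r ^ 3 / c * nrm z v" for z v
 proof (cases "norm (z - x) <= r")
  case True
  then have zx: "(z - x) \<bullet> (z - x) <= r\<^sup>2" by (simp add: dot_square_norm power_mono)
  have "\<bar>(z - x) \<bullet> v\<bar> <= norm (z - x) * norm v" by (rule Cauchy_Schwarz_ineq2)
  also have "... <= r * norm v" using True by (intro mult_right_mono) auto
  finally have 1: "\<bar>(z - x) \<bullet> v\<bar> <= r * norm v" .
  have "\<bar>rho' z v\<bar> = 4 * (r\<^sup>2 - (z - x) \<bullet> (z - x)) * \<bar>(z - x) \<bullet> v\<bar>"
  using zx by (simp add: rho'_def abs_mult)
  also have "... <= 4 * r\<^sup>2 * (r * norm v)"
  using zx 1 r by (intro mult_mono) auto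
  also have "... = 4 * r ^ 3 / c * (c * norm v)" using c by (simp add: power2_eq_square power3_eq_cube)
  also have "... <= 4 * r ^ 3 / c * nrm z v"
  using c(2)[of z v] True r c(1) by (intro mult_left_mono) (auto simp: dist_norm norm_minus_commute)
  finally show ?thesis .
 next
  case False
  then have "(z - x) \<bullet> (z - x) >= r\<^sup>2" using r by (simp add: dot_square_norm power_mono)
  then show ?thesis using nrm_nonneg[of z v] r c by (simp add: rho'_def)
 qed
 have L: "\<bar>rho x - rho y\<bar> <= 4 * r ^ 3 / c * d x y"
  by (rule d_lipschitz[OF dr le _ x y]) (use r c in auto)
 define s where "s = min (norm (y - x)) r"
 have s: "0 <= s" "s <= r" using r by (auto simp: s_def)
 have "rho y = (r\<^sup>2 - s\<^sup>2)\<^sup>2"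
 proof (cases "norm (y - x) <= r")
  case True
  then have "(y - x) \<bullet> (y - x) <= r\<^sup>2" by (simp add: dot_square_norm power_mono)
  then show ?thesis using True by (simp add: rho_def s_def dot_square_norm)
 next
  case False
  then have "(y - x) \<bullet> (y - x) >= r\<^sup>2" using r by (simp add: dot_square_norm power_mono)
  then show ?thesis using False by (simp add: rho_def s_def)
 qed
 moreover have "rho x = (r\<^sup>2)\<^sup>2" by (simp add: rho_def)
 ultimately have "(r\<^sup>2)\<^sup>2 - (r\<^sup>2 - s\<^sup>2)\<^sup>2 <= 4 * r ^ 3 / c * d x y" using L by simp
 moreover have "(r\<^sup>2)\<^sup>2 - (r\<^sup>2 - s\<^sup>2)\<^sup>2 = s\<^sup>2 * (2 * r\<^sup>2 - s\<^sup>2)" by (simp add: power2_eq_square algebra_simps)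
 moreover have "s\<^sup>2 * r\<^sup>2 <= s\<^sup>2 * (2 * r\<^sup>2 - s\<^sup>2)"
  using s power_mono[of s r 2] by (intro mult_left_mono) auto
 ultimately have "s\<^sup>2 * r\<^sup>2 <= 4 * r ^ 3 / c * d x y" by linarith
 then have "(c / (4 * r ^ 3)) * (s\<^sup>2 * r\<^sup>2) <= (c / (4 * r ^ 3)) * (4 * r ^ 3 / c * d x y)"
  using r c by (intro mult_left_mono) auto
 then show ?thesis using r c unfolding s_def[symmetric]
  by (simp add: power2_eq_square power3_eq_cube)
qed

lemma d_eq_0_iff: assumes "x \<in> Omega" "y \<in> Omega" shows "d x y = 0 \<longleftrightarrow> x = y"
proof
 assume 0: "d x y = 0"
 obtain r where r: "r > 0" "cball x r \<subseteq> Omega" using open_dom assms(1) unfolding open_contains_cball by blast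
 obtain c C where c: "c > 0" "!!z v. z \<in> cball x r ==> c * norm v <= nrm z v"
  using nrm_compact_bounds[OF compact_cball r(2)] by metis
 have "c / (4 * r) * (min (norm (y - x)) r)\<^sup>2 <= 0" using d_lower_local[OF r c assms(2)] 0 by simp
 moreover have pos: "c / (4 * r) > 0" using r c by simp
 ultimately have "(min (norm (y - x)) r)\<^sup>2 <= 0"
  using mult_pos_pos[OF pos, of "(min (norm (y - x)) r)\<^sup>2"] by linarith
 then show "x = y" using r by (auto simp: min_def split: if_splits)
qed (simp add: d_self)

sublocale dm: Metric_space Omega d
 by unfold_locales (use d_nonneg d_commute d_eq_0_iff d_triangle in auto)

end

subsection \<open>Completeness and cutoff functions\<close>

text \<open>Convolution with an explicit kernel supported in the ball of radius
  \<open>delta\<close>. The values of \<open>eta\<close> are averages of \<open>h\<close> over such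
  balls, which gives the last three properties.\<close>

lemma smoothing:
 fixes h :: "'a::euclidean_space => real"
 assumes h: "continuous_on UNIV h" and S: "compact S" "!!z. z \<notin> S ==> h z = 0" and delta: "delta > 0"
 obtains eta where "Ck_on (Suc 0) UNIV eta"
  "!!x m. (!!y. norm y <= delta ==> m <= h (x + y)) ==> m <= eta x"
  "!!x m. (!!y. norm y <= delta ==> h (x + y) <= m) ==> eta x <= m"
  "!!x x' m. (!!y. norm y <= delta ==> \<bar>h (x' + y) - h (x + y)\<bar> <= m) ==> \<bar>eta x' - eta x\<bar> <= m"
proof -
 define k where "k y = (max 0 (delta\<^sup>2 - y \<bullet> y))\<^sup>2" for y :: 'a
 have k0: "k y >= 0" for y by (simp add: k_def)
 have ks: "k y = 0" if "y \<notin> cball 0 delta" for y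
 proof -
  have "delta\<^sup>2 <= y \<bullet> y" using that delta by (simp add: dot_square_norm power_mono)
  then show ?thesis by (simp add: k_def)
 qed
 have ck: "continuous_on UNIV k" unfolding k_def by (intro continuous_intros)
 have ik: "integrable lborel k" by (rule compact_support_bounded(1)[OF ck compact_cball ks])
 define Z where "Z = (\<integral>y. k y \<partial>lborel)"
 have Z: "Z > 0"
 proof -
  have "(\<integral>y. (9 / 16 * delta\<^sup>2 * delta\<^sup>2) * indicator (cball (0::'a) (delta / 2)) y \<partial>lborel) <= (\<integral>y. k y \<partial>lborel)"
  proof (rule integral_mono[OF _ ik])
  show "integrable lborel (%y::'a. (9 / 16 * delta\<^sup>2 * delta\<^sup>2) * indicator (cball 0 (delta / 2)) y)"
  using emeasure_compact_finite[OF compact_cball, of "0::'a" "delta / 2"]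
  by (intro integrable_mult_right integrable_real_indicator) auto
  fix y :: 'a
  show "(9 / 16 * delta\<^sup>2 * delta\<^sup>2) * indicator (cball 0 (delta / 2)) y <= k y"
  proof (cases "y \<in> cball 0 (delta / 2)")
  case True
  then have "y \<bullet> y <= (delta / 2)\<^sup>2" by (simp add: dot_square_norm power_mono del: power_divide)
  then have "3 / 4 * delta\<^sup>2 <= delta\<^sup>2 - y \<bullet> y" by (simp add: power_divide)
  then have "3 / 4 * delta\<^sup>2 <= max 0 (delta\<^sup>2 - y \<bullet> y)" by linarith
  then have "(3 / 4 * delta\<^sup>2)\<^sup>2 <= k y" unfolding k_def by (rule power_mono) simp
  then show ?thesis using True by (simp add: power2_eq_square algebra_simps)
  qed (simp add: k0)
  qed
  then have "(9 / 16 * delta\<^sup>2 * delta\<^sup>2) * measure lborel (cball (0::'a) (delta / 2)) <= Z" by (simp add: Z_def)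
  moreover have "measure lborel (cball (0::'a) (delta / 2)) > 0"
  using content_cball_pos[of "delta / 2" "0::'a"] delta by (simp add: measure_completion)
  then have "0 < (9 / 16 * delta\<^sup>2 * delta\<^sup>2) * measure lborel (cball (0::'a) (delta / 2))" using delta by simp
  ultimately show ?thesis by linarith
 qed
 have ih: "integrable lborel (%y. h (x + y) * k y)" for x
 proof (rule compact_support_bounded(1)[OF _ compact_cball])
  show "continuous_on UNIV (%y. h (x + y) * k y)"
  by (intro continuous_intros ck continuous_on_compose2[OF h]) auto
  show "h (x + y) * k y = 0" if "y \<notin> cball 0 delta" for y using ks[OF that] by simp
 qed
 define eta where "eta x = (\<integral>y. h (x + y) * k y \<partial>lborel) / Z" for x
 have lo: "m <= eta x" if "!!y. norm y <= delta ==> m <= h (x + y)" for x m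
 proof -
  have "m * Z = (\<integral>y. m * k y \<partial>lborel)" by (simp add: Z_def)
  also have "... <= (\<integral>y. h (x + y) * k y \<partial>lborel)"
  proof (rule integral_mono[OF _ ih])
  show "m * k y <= h (x + y) * k y" for y
  using that[of y] k0[of y] ks[of y] by (cases "norm y <= delta") (auto intro: mult_right_mono)
  qed (use ik in simp)
  finally show ?thesis using Z by (simp add: eta_def le_divide_eq)
 qed
 have up: "eta x <= m" if "!!y. norm y <= delta ==> h (x + y) <= m" for x m
 proof -
  have "(\<integral>y. h (x + y) * k y \<partial>lborel) <= (\<integral>y. m * k y \<partial>lborel)"
  proof (rule integral_mono[OF ih])
  show "h (x + y) * k y <= m * k y" for y
  using that[of y] k0[of y] ks[of y] by (cases "norm y <= delta") (auto intro: mult_right_mono)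
  qed (use ik in simp)
  also have "... = m * Z" by (simp add: Z_def)
  finally show ?thesis using Z by (simp add: eta_def divide_le_eq)
 qed
 have lip: "\<bar>eta x' - eta x\<bar> <= m" if m: "!!y. norm y <= delta ==> \<bar>h (x' + y) - h (x + y)\<bar> <= m" for x x' m
 proof -
  have "\<bar>(\<integral>y. h (x' + y) * k y \<partial>lborel) - (\<integral>y. h (x + y) * k y \<partial>lborel)\<bar>
  = \<bar>\<integral>y. h (x' + y) * k y - h (x + y) * k y \<partial>lborel\<bar>"
  by (simp add: Bochner_Integration.integral_diff[OF ih ih])
  also have "... <= (\<integral>y. m * k y \<partial>lborel)"
  proof (rule integral_abs_bound_integral)
  show "\<bar>h (x' + y) * k y - h (x + y) * k y\<bar> <= m * k y" for y
  using m[of y] k0[of y] ks[of y]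
  by (cases "norm y <= delta") (auto simp: abs_mult mult_right_mono simp flip: left_diff_distrib)
  qed (use ik ih in simp_all)
  also have "... = m * Z" by (simp add: Z_def)
  finally show ?thesis using Z by (simp add: eta_def divide_le_eq flip: diff_divide_distrib)
 qed
 have C1: "Ck_on (Suc 0) UNIV eta"
 proof -
  obtain b where b: "S \<subseteq> cbox (- b) b" using bounded_subset_cbox_symmetric[OF compact_imp_bounded[OF S(1)]] by blast
  define f where "f x t = h t * k (t - x)" for x t
  define fx where "fx x t = (4 * h t * max 0 (delta\<^sup>2 - (t - x) \<bullet> (t - x))) *\<^sub>R blinfun_inner_left (t - x)" for x t
  \<comment> \<open>A change of variables moves \<open>x\<close> into the differentiable kernel and
    leaves a fixed domain of integration, so that the integral can be differentiated in
    \<open>x\<close>.\<close>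
  have eq: "eta x = integral (cbox (- b) b) (f x) / Z" for x
  proof -
  have fb: "(%w. h w * k (w - x)) \<in> borel_measurable borel"
  by (intro borel_measurable_continuous_onI continuous_intros h continuous_on_compose2[OF ck]) auto
  have "(\<integral>y. h (x + y) * k y \<partial>lborel) = (\<integral>y. h (x + y) * k ((x + y) - x) \<partial>lborel)" by simp
  also have "... = (\<integral>w. h w * k (w - x) \<partial>lborel)"
  using integral_distr[of "(+) x" lborel borel "%w. h w * k (w - x)"] fb by (simp add: lborel_distr_plus)
  also have "... = (\<integral>w. indicator (cbox (- b) b) w *\<^sub>R f x w \<partial>lborel)"
  by (rule Bochner_Integration.integral_cong[OF refl]) (use b S(2) in \<open>auto simp: f_def indicator_def\<close>)
  also have "... = integral (cbox (- b) b) (f x)"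
  proof -
  have "set_integrable lborel (cbox (- b) b) (f x)" unfolding set_integrable_def f_def
  by (intro borel_integrable_compact compact_cbox continuous_intros continuous_on_subset[OF h] continuous_on_compose2[OF ck]) auto
  then show ?thesis using set_borel_integral_eq_integral(2)[of "cbox (- b) b" "f x"] by (simp add: set_lebesgue_integral_def)
  qed
  finally show ?thesis by (simp add: eta_def)
  qed
  have cfx: "continuous_on (UNIV \<times> cbox (- b) b) (%(x, t). fx x t)"
  unfolding fx_def case_prod_unfold
  by (intro continuous_intros bounded_linear.continuous_on[OF bounded_linear_blinfun_inner_left]
  continuous_on_compose2[OF h]) auto
  have der: "((%x. integral (cbox (- b) b) (f x)) has_derivative integral (cbox (- b) b) (fx x0)) (at x0)" for x0
  proof (rule leibniz_rule[of UNIV])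
  show "((%x. f x t) has_derivative blinfun_apply (fx x t)) (at x within UNIV)" for x t
  proof -
  have "((%x. delta\<^sup>2 - (t - x) \<bullet> (t - x)) has_derivative (%v. 2 * ((t - x) \<bullet> v))) (at x)"
  by (auto intro!: derivative_eq_intros simp: inner_commute)
  from has_derivative_mult_right[OF has_derivative_compose[OF this max_0_square_has_derivative[unfolded has_field_derivative_def]], of "h t"]
  show ?thesis unfolding f_def k_def
  by (rule has_derivative_eq_rhs) (simp add: fx_def fun_eq_iff blinfun.scaleR_left inner_commute)
  qed
  show "f x integrable_on cbox (- b) b" for x unfolding f_def
  by (intro integrable_continuous continuous_intros continuous_on_subset[OF h] continuous_on_compose2[OF ck]) auto
  qed (use cfx in auto)
  show ?thesis
  proof (rule Ck_on_SucI[OF open_UNIV])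
  show "(eta has_derivative (%v. blinfun_apply (integral (cbox (- b) b) (fx z)) v / Z)) (at z)" for z
  unfolding eq[abs_def] divide_inverse by (intro has_derivative_mult_left der)
  have "continuous_on UNIV (%z. integral (cbox (- b) b) (fx z))" by (rule integral_continuous_on_param[OF cfx])
  then show "Ck_on 0 UNIV (%z. blinfun_apply (integral (cbox (- b) b) (fx z)) v / Z)" for v
  using Z by (auto intro!: continuous_intros)
  qed
 qed
 show ?thesis by (rule that[OF C1 lo up lip])
qed

context kaehler_convex
begin

lemma d_upper_local:
 assumes "cball x r \<subseteq> Omega" "r > 0" "!!z v. z \<in> cball x r ==> nrm z v <= C * norm v" and "a \<in> cball x r" "b \<in> cball x r"
 shows "d a b <= C * norm (b - a)"
proof (rule d_segment)
 fix z assume "z \<in> closed_segment a b"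
 then have "z \<in> cball x r" using assms(4,5) by (meson closed_segment_subset convex_cball subsetD)
 then show "nrm z (b - a) <= C * norm (b - a)" by (rule assms(3))
qed (use assms in auto)

lemma continuous_on_d: assumes y: "y \<in> Omega" shows "continuous_on Omega (d y)"
proof (rule continuous_at_imp_continuous_on, rule ballI)
 fix x assume x: "x \<in> Omega"
 obtain r where r: "r > 0" "cball x r \<subseteq> Omega" using open_dom x unfolding open_contains_cball by blast
 obtain C where C: "C > 0" "!!z v. z \<in> cball x r ==> nrm z v <= C * norm v"
  using nrm_compact_bounds[OF compact_cball r(2)] by metis
 show "isCont (d y) x" unfolding isCont_def
 proof (rule LIM_I)
  fix e :: real assume e: "e > 0"
  show "\<exists>s>0. \<forall>z. z ~= x & norm (z - x) < s --> norm (d y z - d y x) < e"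
  proof (intro exI[of _ "min r (e / C)"] conjI allI impI)
  fix z assume z: "z ~= x & norm (z - x) < min r (e / C)"
  then have zb: "z \<in> cball x r" by (simp add: dist_norm norm_minus_commute)
  have "d x z <= C * norm (z - x)"
  by (rule d_upper_local[OF r(2,1) C(2)]) (use zb r in auto)
  also have "... < e" using z C(1) by (simp add: pos_less_divide_eq mult.commute)
  finally have "d x z < e" .
  moreover have "d y z <= d y x + d x z" "d y x <= d y z + d x z"
  using d_triangle[OF y x, of z] d_triangle[OF y, of z x] x zb r d_commute[of x z] by auto
  ultimately show "norm (d y z - d y x) < e" by simp
  qed (use r C e in auto)
 qed
qed

lemma open_mball: "open (dm.mball y eps)"
proof (cases "y \<in> Omega")
 case True
 have "dm.mball y eps = d y -` {..<eps} \<inter> Omega" using True by (auto simp: dm.mball_def)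
 then show ?thesis
  using iffD1[OF continuous_on_open_vimage[OF open_dom] continuous_on_d[OF True], rule_format, of "{..<eps}"] by simp
qed (simp add: dm.mball_def)

text \<open>By \<open>d_lower_local\<close> the topology of \<open>d\<close> is at least as fine as
  the Euclidean one, so sets compact for \<open>d\<close> are compact in the Euclidean
  sense.\<close>

lemma continuous_map_id: "continuous_map dm.mtopology euclidean id"
proof -
 have "openin dm.mtopology {x \<in> Omega. x \<in> U}" if U: "open U" for U
  unfolding dm.openin_mtopology
 proof (intro conjI allI impI)
  fix x assume "x \<in> {x \<in> Omega. x \<in> U}"
  then have "x \<in> Omega \<inter> U" by simp
  then obtain r where r: "r > 0" "cball x r \<subseteq> Omega \<inter> U" using open_dom U unfolding open_contains_cball
  by (meson open_Int open_contains_cball open_dom U)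
  then have r2: "cball x r \<subseteq> Omega" by blast
  obtain c where c: "c > 0" "!!z v. z \<in> cball x r ==> c * norm v <= nrm z v"
  using nrm_compact_bounds[OF compact_cball r2] by metis
  have "dm.mball x (c * r / 4) \<subseteq> {x \<in> Omega. x \<in> U}"
  proof
  fix y assume "y \<in> dm.mball x (c * r / 4)"
  then have y: "y \<in> Omega" "d x y < c * r / 4" by (auto simp: dm.mball_def)
  have "norm (y - x) < r"
  proof (rule ccontr)
  assume "~ norm (y - x) < r"
  then show False using d_lower_local[OF r(1) r2 c y(1)] y(2) r(1) by (simp add: min_def power2_eq_square split: if_splits)
  qed
  then have "y \<in> cball x r" by (simp add: dist_norm norm_minus_commute)
  then show "y \<in> {x \<in> Omega. x \<in> U}" using r(2) by blast
  qed
  then show "\<exists>r>0. dm.mball x r \<subseteq> {x \<in> Omega. x \<in> U}" using c r by (intro exI[of _ "c * r / 4"]) auto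
 qed auto
 then show ?thesis by (simp add: continuous_map_def)
qed

text \<open>Relative compactness of a closed \<open>d\<close>-ball. For all radii this is the
  Hopf-Rinow theorem, proved by continuation in \<open>r\<close>: \<open>good_extend\<close> is the
  open and \<open>good_limit\<close> the closed condition.\<close>

definition good :: "complex^'d => real => bool" where
 "good p r \<longleftrightarrow> (\<exists>S. compact S & S \<subseteq> Omega & {x \<in> Omega. d p x <= r} \<subseteq> S)"

lemma compact_thickening:
 assumes S: "compact S" "S \<subseteq> Omega"
 obtains rho where "rho > 0" "compact {x + y |x y. x \<in> S & y \<in> cball 0 rho}" "{x + y |x y. x \<in> S & y \<in> cball 0 rho} \<subseteq> Omega"
proof -
 obtain e where e: "e > 0" "(\<Union>x\<in>S. ball x e) \<subseteq> Omega"
  using compact_subset_open_imp_ball_epsilon_subset[OF S(1) open_dom S(2)] by blast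
 show ?thesis
 proof (rule that[of "e / 2"])
  show "compact {x + y |x y. x \<in> S & y \<in> cball 0 (e / 2)}" by (rule compact_sums[OF S(1) compact_cball])
  show "{x + y |x y. x \<in> S & y \<in> cball 0 (e / 2)} \<subseteq> Omega"
  proof clarify
  fix x y :: "complex^'d" assume xy: "x \<in> S" "y \<in> cball 0 (e / 2)"
  then have "x + y \<in> ball x e" using e(1) by (simp add: dist_norm)
  then show "x + y \<in> Omega" using e(2) xy(1) by blast
  qed
 qed (use e in simp)
qed

text \<open>The compact set has a compact thickening inside the domain, and crossing the added layer
  costs a definite length.\<close>

lemma good_extend: assumes g: "good p r" and p: "p \<in> Omega" and r: "r >= 0"
 shows "\<exists>s>r. good p s"
proof -
 obtain S where S: "compact S" "S \<subseteq> Omega" "{x \<in> Omega. d p x <= r} \<subseteq> S" using g by (auto simp: good_def)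
 obtain rho where rho: "rho > 0" "compact {x + y |x y. x \<in> S & y \<in> cball 0 rho}" "{x + y |x y. x \<in> S & y \<in> cball 0 rho} \<subseteq> Omega"
  using compact_thickening[OF S(1,2)] by blast
 define S' where "S' = {x + y |x y. x \<in> S & y \<in> cball 0 rho}"
 have S': "compact S'" "S' \<subseteq> Omega" using rho by (auto simp: S'_def)
 have sub: "cball x rho \<subseteq> S'" if "x \<in> S" for x
 proof
  fix y assume "y \<in> cball x rho"
  then have "y = x + (y - x)" "y - x \<in> cball 0 rho" by (auto simp: dist_norm norm_minus_commute)
  then show "y \<in> S'" unfolding S'_def using that by blast
 qed
 obtain c where c: "c > 0" "!!z v. z \<in> S' ==> c * norm v <= nrm z v" using nrm_compact_bounds[OF S'] by metis
 \<comment> \<open>Crossing the layer costs at least \<open>c * rho / 4\<close>, while the points in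
   question are within \<open>2 * delta = c * rho / 8\<close> of the smaller ball.\<close>
 define delta where "delta = c * rho / 16"
 have delta: "delta > 0" using c rho by (simp add: delta_def)
 have "{x \<in> Omega. d p x <= r + delta} \<subseteq> S'"
 proof clarify
  fix z assume z: "z \<in> Omega" "d p z <= r + delta"
  obtain w where w: "w \<in> Omega" "d p w <= r" "d w z <= max 0 (d p z - r) + delta"
  using intermediate_point[OF p z(1) delta r] by blast
  have wS: "w \<in> S" using w S(3) by blast
  have dwz: "d w z <= 2 * delta" using w(3) z(2) delta by simp
  have "norm (z - w) < rho"
  proof (rule ccontr)
  assume "~ norm (z - w) < rho"
  moreover have "c / (4 * rho) * (min (norm (z - w)) rho)\<^sup>2 <= d w z"
  by (rule d_lower_local[OF rho(1) _ c(1) c(2) z(1)]) (use sub[OF wS] S'(2) in auto)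
  ultimately have "c / (4 * rho) * rho\<^sup>2 <= 2 * delta" using dwz by (simp add: min_def split: if_splits)
  then show False using c rho(1) by (simp add: delta_def power2_eq_square)
  qed
  then show "z \<in> S'" using sub[OF wS] by (auto simp: dist_norm norm_minus_commute)
 qed
 then show ?thesis using S' delta unfolding good_def by (intro exI[of _ "r + delta"]) auto
qed

text \<open>Smaller balls are relatively compact and come within any \<open>eps\<close> of the ball
  of radius \<open>r\<close>, which is therefore totally bounded; by completeness its closure is
  compact.\<close>

lemma good_limit:
 assumes com: "dm.mcomplete" and p: "p \<in> Omega" and r: "r > 0" and g: "!!s. 0 <= s ==> s < r ==> good p s"
 shows "good p r"
proof -
 define B where "B = {x \<in> Omega. d p x <= r}"
 have "dm.mtotally_bounded B" unfolding dm.mtotally_bounded_def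
 proof (intro allI impI)
  fix eps :: real assume eps: "eps > 0"
  define s where "s = max 0 (r - eps / 8)"
  have s: "0 <= s" "s < r" "r - s <= eps / 8" using r eps unfolding s_def by linarith+
  obtain S where S: "compact S" "S \<subseteq> Omega" "{x \<in> Omega. d p x <= s} \<subseteq> S" using g[OF s(1,2)] by (auto simp: good_def)
  have "S \<subseteq> (\<Union>y\<in>S. dm.mball y (eps / 4))" using S(2) eps by (auto simp: dm.mball_def d_self)
  then obtain K where K: "K \<subseteq> S" "finite K" "S \<subseteq> (\<Union>y\<in>K. dm.mball y (eps / 4))"
  using compactE_image[OF S(1), of S "%y. dm.mball y (eps / 4)"] open_mball by blast
  have near: "\<exists>y\<in>K. d y x < eps / 2" if x: "x \<in> B" for x
  proof -
  have x': "x \<in> Omega" "d p x <= r" using x by (auto simp: B_def)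
  obtain w where w: "w \<in> Omega" "d p w <= s" "d w x <= max 0 (d p x - s) + eps / 8"
  using intermediate_point[OF p x'(1) _ s(1), of "eps / 8"] eps by auto
  then have "w \<in> S" using S(3) by blast
  then obtain y where y: "y \<in> K" "d y w < eps / 4" using K(3) by (auto simp: dm.mball_def)
  have "d y x <= d y w + d w x" by (rule d_triangle) (use y K S w x' in auto)
  then show ?thesis using y w(3) x'(2) s(3) eps by (intro bexI[of _ y]) auto
  qed
  define pick where "pick y = (SOME x. x \<in> B & d y x < eps / 2)" for y
  define K' where "K' = pick ` {y \<in> K. \<exists>x. x \<in> B & d y x < eps / 2}"
  have pk: "pick y \<in> B & d y (pick y) < eps / 2" if "\<exists>x. x \<in> B & d y x < eps / 2" for y
  unfolding pick_def using someI_ex[OF that] .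
  show "\<exists>K. finite K & K \<subseteq> B & B \<subseteq> (\<Union>x\<in>K. dm.mball x eps)"
  proof (intro exI[of _ K'] conjI)
  show "finite K'" using K(2) by (simp add: K'_def)
  show "K' \<subseteq> B" using pk by (auto simp: K'_def)
  show "B \<subseteq> (\<Union>x\<in>K'. dm.mball x eps)"
  proof
  fix x assume x: "x \<in> B"
  obtain y where y: "y \<in> K" "d y x < eps / 2" using near[OF x] by blast
  have pk': "pick y \<in> B" "d y (pick y) < eps / 2" using pk x y by blast+
  have inOmega: "x \<in> Omega" "pick y \<in> Omega" "y \<in> Omega" using x pk'(1) y K S by (auto simp: B_def)
  have "d (pick y) x <= d (pick y) y + d y x" by (rule d_triangle[OF inOmega(2,3,1)])
  then have "d (pick y) x < eps" using y pk'(2) d_commute[of y "pick y"] by simp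
  then have "x \<in> dm.mball (pick y) eps" using inOmega by (simp add: dm.mball_def)
  moreover have "pick y \<in> K'" using x y by (auto simp: K'_def)
  ultimately show "x \<in> (\<Union>x\<in>K'. dm.mball x eps)" by blast
  qed
  qed
 qed
 then have "compactin dm.mtopology (dm.mtopology closure_of B)"
  using dm.mtotally_bounded_eq_compact_closure_of[OF com] by blast
 then have "compactin euclidean (id ` (dm.mtopology closure_of B))"
  using image_compactin[OF _ continuous_map_id] by blast
 then have "compact (dm.mtopology closure_of B)" by simp
 moreover have "dm.mtopology closure_of B \<subseteq> Omega" using closure_of_subset_topspace[of dm.mtopology B] by simp
 moreover have "B \<subseteq> dm.mtopology closure_of B" by (rule closure_of_subset) (auto simp: B_def)
 ultimately show ?thesis unfolding good_def B_def by blast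
qed

lemma good_all:
 assumes com: "dm.mcomplete" and p: "p \<in> Omega"
 shows "good p R"
proof (rule ccontr)
 assume nR: "~ good p R"
 have mono: "good p s" if "good p t" "s <= t" for s t
 proof -
  have "{x \<in> Omega. d p x <= s} \<subseteq> {x \<in> Omega. d p x <= t}" using that by auto
  then show ?thesis using that(1) unfolding good_def by blast
 qed
 have g0: "good p 0"
 proof -
  have "x = p" if "x \<in> Omega" "d p x <= 0" for x
  using d_eq_0_iff[OF p that(1)] d_nonneg[of p x] that(2) by simp
  then have "{x \<in> Omega. d p x <= 0} = {p}" using p by (auto simp: d_self)
  then show ?thesis unfolding good_def using p by (intro exI[of _ "{p}"]) auto
 qed
 define T where "T = {t. 0 <= t & good p t}"
 have T: "0 \<in> T" using g0 by (simp add: T_def)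
 have bT: "t <= R" if "t \<in> T" for t
 proof (rule ccontr)
  assume "~ t <= R"
  then show False using mono[of t R] that nR by (simp add: T_def)
 qed
 then have bdd: "bdd_above T" by (rule bdd_aboveI)
 define r where "r = Sup T"
 have r0: "0 <= r" unfolding r_def by (rule cSup_upper[OF T bdd])
 have gr: "good p r"
 proof (cases "r = 0")
  case False
  show ?thesis
  proof (rule good_limit[OF com p])
  show "r > 0" using r0 False by simp
  fix s assume s: "0 <= s" "s < r"
  then obtain t where "t \<in> T" "s < t" using less_cSup_iff[OF _ bdd, of s] T unfolding r_def by blast
  then show "good p s" using mono[of t s] by (simp add: T_def)
  qed
 qed (use g0 in simp)
 obtain s where s: "s > r" "good p s" using good_extend[OF gr p r0] by blast
 then have "s \<in> T" using r0 by (simp add: T_def)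
 then have "s <= r" unfolding r_def by (rule cSup_upper[OF _ bdd])
 then show False using s by simp
qed

text \<open>The distance from \<open>p\<close> is merely Lipschitz, so a truncated function of it is
  mollified. Over the mollification radius norms grow at most by a factor 2, which
  \<open>R1 >= 2 * R\<close> compensates.\<close>

lemma cutoff_exists:
 assumes com: "dm.mcomplete" and R: "R > 0" and K: "compact K" "K \<subseteq> Omega"
 shows "\<exists>eta. cutoff R K eta"
proof (cases "Omega = {}")
 case True
 then have "cutoff R K (%_. 0)" unfolding cutoff_def using K by (auto simp: Ck_on_const[OF open_UNIV] simp del: Ck_on.simps intro!: exI[of _ "{}"])
 then show ?thesis by blast
next
 case False
 then obtain p where p: "p \<in> Omega" by blast
 have "compact (d p ` K)" by (rule compact_continuous_image[OF continuous_on_subset[OF continuous_on_d[OF p] K(2)] K(1)])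
 then obtain M where M: "!!x. x \<in> K ==> d p x <= M" using compact_imp_bounded bounded_iff by (metis imageI real_norm_def abs_le_D1)
 define R1 where "R1 = max (max M (2 * R)) 1"
 have R1: "R1 >= 1" "R1 >= 2 * R" "!!x. x \<in> K ==> d p x <= R1" using M by (force simp: R1_def)+
 obtain S where S: "compact S" "S \<subseteq> Omega" "{x \<in> Omega. d p x <= 2 * R1} \<subseteq> S"
  using good_all[OF com p, of "2 * R1"] by (auto simp: good_def)
 define h where "h z = (if z \<in> Omega then max 0 (min 1 (2 - d p z / R1)) else 0)" for z
 have h01: "0 <= h z" "h z <= 1" for z by (auto simp: h_def)
 have hS: "h z = 0" if "z \<notin> S" for z
 proof (cases "z \<in> Omega")
  case True
  then have "d p z > 2 * R1" using S(3) that by force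
  then have "2 - d p z / R1 < 0" using R1(1) by (simp add: less_divide_eq)
  then show ?thesis by (simp add: h_def)
 qed (simp add: h_def)
 have hlip: "\<bar>h x - h y\<bar> <= d x y / R1" if "x \<in> Omega" "y \<in> Omega" for x y
 proof -
  have "\<bar>d p x - d p y\<bar> <= d x y" using d_triangle[OF p that] d_triangle[OF p that(2,1)] d_commute[of x y] by simp
  then have "\<bar>d p x / R1 - d p y / R1\<bar> <= d x y / R1" using R1(1) by (simp add: divide_right_mono flip: diff_divide_distrib)
  then show ?thesis using that by (simp add: h_def)
 qed
 have hc: "continuous_on UNIV h"
 proof -
  have "continuous_on Omega (%z. max 0 (min 1 (2 - d p z / R1)))"
  using R1(1) by (intro continuous_intros continuous_on_d p) auto
  then have "continuous_on Omega h" by (rule continuous_on_eq) (simp add: h_def)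
  moreover have "continuous_on (- S) h" by (rule continuous_on_eq[of _ "%_. 0"]) (use hS in auto)
  moreover have "open (- S)" using S(1) by (simp add: compact_imp_closed open_Compl)
  ultimately have "continuous_on (Omega \<union> - S) h" using open_dom continuous_on_open_Un by blast
  moreover have "Omega \<union> - S = UNIV" using S(2) by auto
  ultimately show ?thesis by simp
 qed
 obtain rho where rho: "rho > 0" "compact {x + y |x y. x \<in> S & y \<in> cball 0 rho}" "{x + y |x y. x \<in> S & y \<in> cball 0 rho} \<subseteq> Omega"
  using compact_thickening[OF S(1,2)] by blast
 define S2 where "S2 = {x + y |x y. x \<in> S & y \<in> cball 0 rho}"
 have S2: "compact S2" "S2 \<subseteq> Omega" using rho by (auto simp: S2_def)
 obtain c C where c: "c > 0" "C > 0" "!!z v. z \<in> S2 ==> c * norm v <= nrm z v" "!!z v. z \<in> S2 ==> nrm z v <= C * norm v"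
  using nrm_compact_bounds[OF S2] by metis
 define P where "P = S2 \<times> sphere (0::complex^'d) 1"
 have "uniformly_continuous_on P (%(z, v). nrm z v)"
  by (rule compact_uniformly_continuous[OF continuous_on_subset[OF continuous_on_nrm]]) (use S2 in \<open>auto simp: P_def intro!: compact_Times\<close>)
 then obtain delta0 where delta0: "delta0 > 0" "!!q q'. q \<in> P ==> q' \<in> P ==> dist q' q < delta0 ==>
  dist (case q' of (z, v) => nrm z v) (case q of (z, v) => nrm z v) < c"
  using c(1) unfolding uniformly_continuous_on_def by meson
 have double: "nrm x' v <= 2 * nrm x v" if "x \<in> S2" "x' \<in> S2" "norm (x' - x) < delta0" for x x' v
 proof (cases "v = 0")
  case False
  define w where "w = (1 / norm v) *\<^sub>R v"
  have "(x, w) \<in> P" "(x', w) \<in> P" using that False by (auto simp: P_def w_def)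
  moreover have "dist (x', w) (x, w) < delta0" using that(3) by (simp add: dist_Pair_Pair dist_norm)
  ultimately have "\<bar>nrm x' w - nrm x w\<bar> < c" using delta0(2)[of "(x, w)" "(x', w)"] by (simp add: dist_real_def)
  moreover have "c <= nrm x w" using c(3)[OF that(1), of w] False by (simp add: w_def)
  ultimately have "nrm x' w <= 2 * nrm x w" by linarith
  then show ?thesis using False by (simp add: w_def nrm_scaleR divide_right_mono divide_le_cancel)
 qed (use nrm_scaleR[of _ 0 0] in simp)
 \<comment> \<open>The first two bounds keep all points inside \<open>S2\<close> and in the range of
   \<open>double\<close>; the third makes \<open>h\<close>, hence \<open>eta\<close>, at least
   \<open>3 / 4\<close> on \<open>K\<close>.\<close>
 define delta where "delta = min (rho / 4) (min (delta0 / 4) (1 / (4 * C)))"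
 have delta: "delta > 0" "delta <= rho / 4" "delta <= delta0 / 4" "delta <= 1 / (4 * C)" using rho(1) delta0(1) c(2) by (auto simp: delta_def)
 have deltaC: "C * delta <= 1 / 4" using delta(4) c(2) by (simp add: field_simps)
 obtain eta where eta: "Ck_on (Suc 0) UNIV eta"
  "!!x m. (!!y. norm y <= delta ==> m <= h (x + y)) ==> m <= eta x"
  "!!x m. (!!y. norm y <= delta ==> h (x + y) <= m) ==> eta x <= m"
  "!!x x' m. (!!y. norm y <= delta ==> \<bar>h (x' + y) - h (x + y)\<bar> <= m) ==> \<bar>eta x' - eta x\<bar> <= m"
  using smoothing[OF hc S(1) hS delta(1)] by blast
 define S1 where "S1 = {x + y |x y. x \<in> S & y \<in> cball 0 delta}"
 have S1c: "compact S1" unfolding S1_def by (rule compact_sums[OF S(1) compact_cball])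
 have near: "z \<in> S2" if "x \<in> S" "norm (z - x) <= rho" for x z
 proof -
  have "z = x + (z - x)" "z - x \<in> cball 0 rho" using that by auto
  then show ?thesis unfolding S2_def using that(1) by blast
 qed
 have S1S2: "z \<in> S2" if xS: "x \<in> S1" and zx: "norm (z - x) <= 3 * delta" for x z
 proof -
  obtain a b where ab: "x = a + b" "a \<in> S" "norm b <= delta" using xS by (auto simp: S1_def)
  have "norm (z - a) <= norm (z - x) + norm b" using norm_triangle_ineq[of "z - x" b] ab(1) by (simp add: algebra_simps)
  then show ?thesis using near[OF ab(2), of z] zx ab(3) delta(2) by simp
 qed
 have eta0: "eta x = 0" if "x \<notin> S1" for x
 proof -
  have "h (x + y) = 0" if y: "norm y <= delta" for y
  proof (rule hS)
  show "x + y \<notin> S"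
  proof
  assume "x + y \<in> S"
  moreover have "x = (x + y) + (- y)" "- y \<in> cball 0 delta" using y by auto
  ultimately have "x \<in> S1" unfolding S1_def by blast
  then show False using \<open>x \<notin> S1\<close> by blast
  qed
  qed
  then show ?thesis using eta(2)[of 0 x] eta(3)[of x 0] by (simp add: order_antisym)
 qed
 have eta01: "0 <= eta x" "eta x <= 1" for x using eta(2)[of 0 x] eta(3)[of x 1] h01 by auto
 have dloc: "d a b <= 2 * nrm x (b - a)" if x: "x \<in> S1" and a: "norm (a - x) <= 2 * delta" and b: "norm (b - x) <= 2 * delta" for x a b
 proof (rule d_segment)
  have xS2: "x \<in> S2" using S1S2[OF x, of x] delta(1) by simp
  have "a \<in> S2" "b \<in> S2" by (rule S1S2[OF x]; use a b delta(1) in linarith)+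
  then show "a \<in> Omega" "b \<in> Omega" using S2(2) by auto
  fix z assume "z \<in> closed_segment a b"
  moreover have "closed_segment a b \<subseteq> cball x (2 * delta)"
  using a b by (intro closed_segment_subset convex_cball) (auto simp: dist_norm norm_minus_commute)
  ultimately have z: "norm (z - x) <= 2 * delta" by (auto simp: dist_norm norm_minus_commute)
  then have "z \<in> S2" using S1S2[OF x, of z] delta(1) by simp
  then show "nrm z (b - a) <= 2 * nrm x (b - a)" using double[OF xS2, of z "b - a"] z delta(1,3) delta0(1) by simp
 qed
 have deriv: "(R * dir_deriv eta x v)\<^sup>2 <= G x v v" if x: "x \<in> Omega" for x v
 proof (cases "x \<in> S1")
  case False
  have "open (- S1)" using S1c by (simp add: compact_imp_closed open_Compl)
  then have "dir_deriv eta x v = dir_deriv (%_. 0) x v" by (rule dir_deriv_cong) (use False eta0 in auto)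
  then show ?thesis using jposD(3)[OF jpos_G[OF x], of v] by simp
 next
  case True
  define D where "D = dir_deriv eta x v"
  have dh: "(eta has_derivative dir_deriv eta x) (at x)" by (rule Ck_on_SucD(1)[OF eta(1) UNIV_I])
  have "((%t. eta (x + t *\<^sub>R v)) has_derivative (%t. dir_deriv eta x (t *\<^sub>R v))) (at 0)"
  by (rule has_derivative_compose[where f="%t. x + t *\<^sub>R v" and g=eta]) (auto intro!: derivative_eq_intros dh)
  then have "((%t. eta (x + t *\<^sub>R v)) has_real_derivative D) (at 0)" unfolding has_field_derivative_def
  by (rule has_derivative_eq_rhs) (simp add: D_def fun_eq_iff linear_scale[OF has_derivative_linear[OF dh]])
  then have "((%t. (eta (x + t *\<^sub>R v) - eta x) / t) \<longlongrightarrow> D) (at 0)" by (simp add: has_field_derivative_iff)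
  then have "((%t. \<bar>(eta (x + t *\<^sub>R v) - eta x) / t\<bar>) \<longlongrightarrow> \<bar>D\<bar>) (at 0)" by (rule tendsto_rabs)
  moreover have "\<forall>\<^sub>F t in at 0. \<bar>(eta (x + t *\<^sub>R v) - eta x) / t\<bar> <= 2 * nrm x v / R1"
  proof -
  have "\<forall>\<^sub>F t::real in at 0. \<bar>t\<bar> < delta / (norm v + 1) & t ~= 0"
  unfolding eventually_at using delta(1) by (intro exI[of _ "delta / (norm v + 1)"]) (auto simp: add_nonneg_pos)
  then show ?thesis
  proof eventually_elim
  case (elim t)
  have "\<bar>t\<bar> * norm v <= \<bar>t\<bar> * (norm v + 1)" by (intro mult_left_mono) auto
  also have "... < delta" using elim by (simp add: pos_less_divide_eq add_nonneg_pos)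
  finally have tv: "\<bar>t\<bar> * norm v < delta" .
  have "\<bar>eta (x + t *\<^sub>R v) - eta x\<bar> <= 2 * (\<bar>t\<bar> * nrm x v) / R1"
  proof (rule eta(4))
  fix y :: "complex^'d" assume y: "norm y <= delta"
  have 1: "norm ((x + y) - x) <= 2 * delta" using y delta(1) by simp
  have "norm (t *\<^sub>R v + y) <= 2 * delta" using tv y norm_triangle_ineq[of "t *\<^sub>R v" y] by simp
  then have 2: "norm ((x + t *\<^sub>R v + y) - x) <= 2 * delta" by (simp add: algebra_simps)
  have "d (x + y) (x + t *\<^sub>R v + y) <= 2 * nrm x ((x + t *\<^sub>R v + y) - (x + y))" by (rule dloc[OF True 1 2])
  also have "(x + t *\<^sub>R v + y) - (x + y) = t *\<^sub>R v" by simp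
  finally have "d (x + t *\<^sub>R v + y) (x + y) <= 2 * (\<bar>t\<bar> * nrm x v)" by (simp add: nrm_scaleR d_commute)
  moreover have "x + y \<in> Omega" "x + t *\<^sub>R v + y \<in> Omega"
  using S1S2[OF True, of "x + y"] S1S2[OF True, of "x + t *\<^sub>R v + y"] 1 2 delta(1) S2(2) by auto
  ultimately show "\<bar>h (x + t *\<^sub>R v + y) - h (x + y)\<bar> <= 2 * (\<bar>t\<bar> * nrm x v) / R1"
  using hlip[of "x + t *\<^sub>R v + y" "x + y"] R1(1) by (smt (verit) divide_right_mono)
  qed
  then show ?case using elim by (simp add: abs_divide divide_le_eq mult_ac)
  qed
  qed
  ultimately have "\<bar>D\<bar> <= 2 * nrm x v / R1"
  by (rule tendsto_upperbound) simp
  then have "\<bar>R\<bar> * \<bar>D\<bar> <= \<bar>R\<bar> * (2 * nrm x v / R1)" by (rule mult_left_mono) simp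
  then have "\<bar>R * D\<bar> <= R * (2 * nrm x v / R1)" unfolding abs_mult using R by simp
  also have "... = (2 * R / R1) * nrm x v" by simp
  also have "... <= 1 * nrm x v" using R1 nrm_nonneg[of x v] by (intro mult_right_mono) auto
  finally have "\<bar>R * D\<bar> <= nrm x v" by simp
  then have "(R * D)\<^sup>2 <= (nrm x v)\<^sup>2" using abs_le_square_iff[of "R * D" "nrm x v"] nrm_nonneg[of x v] by simp
  then show ?thesis by (simp add: D_def nrm_sq[OF x])
 qed
 have onK: "1 <= 2 * (eta x)\<^sup>2" if x: "x \<in> K" for x
 proof -
  have xO: "x \<in> Omega" using x K by blast
  have hx: "h x = 1"
  proof -
  have "2 - d p x / R1 >= 1" using R1(1) R1(3)[OF x] by (simp add: divide_le_eq)
  then show ?thesis using xO by (simp add: h_def)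
  qed
  then have xS: "x \<in> S" using hS by fastforce
  have "x = x + 0" "(0::complex^'d) \<in> cball 0 delta" using delta(1) by auto
  then have xS1: "x \<in> S1" unfolding S1_def using xS by blast
  have "1 / 2 + 1 / 4 <= eta x"
  proof (rule eta(2))
  fix y :: "complex^'d" assume y: "norm y <= delta"
  have yO: "x + y \<in> S2" by (rule S1S2[OF xS1]) (use y delta(1) in simp)
  have cv: "d x (x + y) <= C * norm ((x + y) - x)"
  proof (rule d_segment[OF xO])
  show "x + y \<in> Omega" using yO S2 by blast
  fix z assume "z \<in> closed_segment x (x + y)"
  moreover have "closed_segment x (x + y) \<subseteq> cball x delta"
  using y delta(1) by (intro closed_segment_subset convex_cball) (auto simp: dist_norm)
  ultimately have "norm (z - x) <= 3 * delta" using delta(1) by (auto simp: dist_norm norm_minus_commute subset_iff)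
  then show "nrm z ((x + y) - x) <= C * norm ((x + y) - x)" using c(4)[OF S1S2[OF xS1]] by blast
  qed
  also have "... <= C * delta" using y c(2) by simp
  also have "... <= 1 / 4" by (rule deltaC)
  finally have dd: "d x (x + y) <= 1 / 4" .
  have "d x (x + y) / R1 <= (1 / 4) / 1" by (rule frac_le[OF _ dd _ R1(1)]) simp_all
  then have "d x (x + y) / R1 <= 1 / 4" by simp
  moreover have "x + y \<in> Omega" using yO S2(2) by blast
  then have "\<bar>h x - h (x + y)\<bar> <= d x (x + y) / R1" by (rule hlip[OF xO])
  ultimately show "1 / 2 + 1 / 4 <= h (x + y)" using hx by linarith
  qed
  then have "(3 / 4)\<^sup>2 <= (eta x)\<^sup>2" by (intro power_mono) auto
  then show ?thesis by (simp add: power2_eq_square)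
 qed
 have "cutoff R K eta" unfolding cutoff_def
 proof (intro conjI)
  show "Ck_on (Suc 0) UNIV eta" by (fact eta(1))
  have "S1 \<subseteq> Omega" using S1S2 delta(1) S2(2) by fastforce
  then show "\<exists>S. compact S & S \<subseteq> Omega & (\<forall>z. z \<notin> S --> eta z = 0)" using S1c eta0 by blast
 qed (use eta01 onK deriv in auto)
 then show ?thesis by blast
qed

end

subsection \<open>A normal form for pointed convex domains\<close>

text \<open>The maximal determinant in \<open>normal_form\<close> bounds each coordinate by
  \<open>2 ^ n + 1\<close>; the factor \<open>n\<close> sums over the coordinates.\<close>

definition width :: "'d itself => real" where
 "width _ = real CARD('d) * (2 ^ CARD('d) + 1)"

text \<open>Openness of \<open>S\<close> turns weak separation into a strict inequality even if
  \<open>T\<close> touches the closure of \<open>S\<close>.\<close>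

lemma open_separation:
 fixes S T :: "'a::euclidean_space set"
 assumes S: "open S" "convex S" and T: "convex T" "T ~= {}" and dis: "S \<inter> T = {}"
 obtains a where "!!x p. x \<in> S ==> p \<in> T ==> a \<bullet> x < a \<bullet> p"
proof (cases "S = {}")
 case True
 then show ?thesis using that[of 0] by simp
next
 case False
 obtain a b where a: "a ~= 0" "!!x. x \<in> S ==> a \<bullet> x <= b" "!!x. x \<in> T ==> b <= a \<bullet> x"
  using separating_hyperplane_sets[OF S(2) T(1) False T(2) dis] by blast
 have "a \<bullet> x < b" if x: "x \<in> S" for x
 proof -
  obtain e where e: "e > 0" "cball x e \<subseteq> S" using S(1) x unfolding open_contains_cball by blast
  have "x + (e / norm a) *\<^sub>R a \<in> S" using e a(1) by (intro subsetD[OF e(2)]) (simp add: dist_norm)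
  then have "a \<bullet> x + (e / norm a) * (a \<bullet> a) <= b" using a(2) by (force simp: inner_add_right)
  moreover have "(e / norm a) * (a \<bullet> a) > 0" using e(1) a(1) by simp
  ultimately show ?thesis by linarith
 qed
 then show ?thesis using that[of a] a(3) by (meson less_le_trans)
qed

lemma matrix_smult: "(A::complex^'n^'m) *v (c *s x) = c *s (A *v x)"
 by (rule vector_scalar_commute)

lemma linear_matrix: "linear (%x. (A::complex^'n^'m) *v x)"
 by (rule matrix_vector_mul_linear)

lemma bounded_linear_matrix: "bounded_linear (%x. (A::complex^'n^'m) *v x)"
 using linear_matrix linear_conv_bounded_linear by blast

lemma norm_le_sum_components: "norm (w::complex^'d) <= (\<Sum>k\<in>UNIV. cmod (w $ k))"
 by (simp add: norm_vec_def L2_set_le_sum)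

text \<open>The matrix is the mean of the identity and the map \<open>x -> x_k w\<close>, the
  competitor in the maximality argument of \<open>normal_form\<close>.\<close>

lemma det_scaled_rank_one:
 fixes w :: "complex^'d"
 shows "det ((\<chi> i j. (1/2) * ((if i = j then 1 else 0) + (if j = k then w $ i else 0))) :: complex^'d^'d)
  = (1/2) ^ CARD('d) * (1 + w $ k)"
proof -
 have "det ((\<chi> i j. if j = k then (mat 1 *v (axis k 1 + w)) $ i else (mat 1 :: complex^'d^'d) $ i $ j))
  = (axis k 1 + w) $ k * det (mat 1 :: complex^'d^'d)"
  by (rule cramer_lemma)
 then have 1: "det ((\<chi> i j. (if i = j then 1 else 0) + (if j = k then w $ i else 0)) :: complex^'d^'d) = 1 + w $ k"
 proof -
  have "(\<chi> i j. if j = k then (mat 1 *v (axis k 1 + w)) $ i else (mat 1 :: complex^'d^'d) $ i $ j)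
  = ((\<chi> i j. (if i = j then 1 else 0) + (if j = k then w $ i else 0)) :: complex^'d^'d)"
  by (simp add: vec_eq_iff) (simp add: axis_def mat_def)
  then show ?thesis
  using \<open>det _ = (axis k 1 + w) $ k * det (mat 1 :: complex^'d^'d)\<close> by (simp add: axis_def)
 qed
 have "det ((\<chi> i j. c * M $ i $ j) :: complex^'d^'d) = c ^ CARD('d) * det M" for c and M :: "complex^'d^'d"
  unfolding det_def by (simp add: prod.distrib sum_distrib_left mult_ac)
 from this[of "1/2" "\<chi> i j. (if i = j then 1 else 0) + (if j = k then w $ i else 0)"]
 show ?thesis by (simp add: 1)
qed

text \<open>An inner complex ellipsoid of maximal volume centred at a point takes the role of a
 Frankel normalization: no complex disc through the centre can be much longer than it.\<close>

lemma normal_form: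
 fixes Omega :: "(complex^'d) set"
 assumes Omega: "open Omega" "convex Omega" "bounded Omega" and z: "z \<in> Omega"
 obtains A :: "complex^'d^'d" where "invertible A" "!!x. norm x < 1 ==> z + A *v x \<in> Omega"
  "!!w. (!!c. cmod c <= 1 ==> z + c *s (A *v w) \<in> closure Omega) ==> norm w <= width TYPE('d)"
proof -
 define M where "M = {A::complex^'d^'d. \<forall>x\<in>cball 0 1. z + A *v x \<in> closure Omega}"
 have cl: "closed M"
 proof -
  have "M = (\<Inter>x\<in>cball 0 1. (%A. z + A *v x) -` closure Omega)" by (auto simp: M_def)
  moreover have "closed ((%A::complex^'d^'d. z + A *v x) -` closure Omega)" for x
  proof (rule closed_vimage[OF closed_closure])
  have "linear (%A::complex^'d^'d. A *v x)"
  by (rule linearI) (simp_all add: vec_eq_iff matrix_vector_mult_def sum.distrib scaleR_sum_right algebra_simps)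
  then show "continuous_on UNIV (%A::complex^'d^'d. z + A *v x)"
  by (intro continuous_intros linear_continuous_on) (simp add: linear_conv_bounded_linear)
  qed
  ultimately show ?thesis by auto
 qed
 obtain B where B: "!!x. x \<in> closure Omega ==> norm x <= B"
  using bounded_closure[OF Omega(3)] unfolding bounded_iff by blast
 have bd: "bounded M"
 proof -
  have "norm A <= real CARD('d) * (real CARD('d) * (2 * B))" if A: "A \<in> M" for A
  proof -
  have ent: "cmod (A $ i $ j) <= 2 * B" for i j
  proof -
  have "z + A *v axis j 1 \<in> closure Omega" using A by (auto simp: M_def)
  then have "norm (A *v axis j 1) <= norm (z + A *v axis j 1) + norm z"
  using norm_triangle_ineq4[of "z + A *v axis j 1" z] by simp
  also have "... <= 2 * B" using B[OF \<open>z + A *v axis j 1 \<in> closure Omega\<close>] B[of z] z closure_subset by fastforce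
  finally have "norm (A *v axis j 1) <= 2 * B" .
  moreover have "(A *v axis j 1) $ i = A $ i $ j" by (simp add: matrix_vector_mult_def axis_def if_distrib cong: if_cong)
  ultimately show ?thesis using Finite_Cartesian_Product.norm_nth_le[of "A *v axis j 1" i] by simp
  qed
  have "norm A <= (\<Sum>i\<in>UNIV. norm (A $ i))" by (simp add: norm_vec_def[of A] L2_set_le_sum)
  also have "... <= (\<Sum>i\<in>(UNIV::'d set). real CARD('d) * (2 * B))"
  proof (rule sum_mono)
  fix i
  have "norm (A $ i) <= (\<Sum>j\<in>UNIV. cmod (A $ i $ j))" by (rule norm_le_sum_components)
  also have "... <= (\<Sum>j\<in>(UNIV::'d set). 2 * B)" by (intro sum_mono ent)
  finally show "norm (A $ i) <= real CARD('d) * (2 * B)" by simp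
  qed
  finally show ?thesis by simp
  qed
  then show ?thesis unfolding bounded_iff by blast
 qed
 obtain e where e: "e > 0" "cball z e \<subseteq> Omega" using Omega(1) z unfolding open_contains_cball by blast
 \<comment> \<open>A small round ball shows that the maximal determinant is positive.\<close>
 define E where "E = (\<chi> i j. if i = j then of_real e else 0 :: complex^'d^'d)"
 have Ev: "E *v x = e *\<^sub>R x" for x
  by (simp add: E_def vec_eq_iff matrix_vector_mult_def complex_eq_iff if_distrib[of "%c. c * _"] cong: if_cong)
 have EM: "E \<in> M" unfolding M_def
 proof (clarsimp simp: Ev)
  fix x :: "complex^'d" assume "norm x <= 1"
  then have "z + e *\<^sub>R x \<in> cball z e" using e by (simp add: dist_norm mult_left_le)
  then show "z + e *\<^sub>R x \<in> closure Omega" using e closure_subset by blast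
 qed
 have "compact M" using cl bd by (simp add: compact_eq_bounded_closed)
 moreover have "continuous_on M (%A. cmod (det A))"
  unfolding det_def by (intro continuous_intros)
 ultimately obtain A where A: "A \<in> M" "!!A'. A' \<in> M ==> cmod (det A') <= cmod (det A)"
  using continuous_attains_sup[of M] EM by blast
 have "det E = of_real e ^ CARD('d)" unfolding E_def by (subst det_diagonal) auto
 then have "cmod (det E) = e ^ CARD('d)" using e by (simp add: norm_power)
 moreover have "e ^ CARD('d) > 0" using e by simp
 ultimately have "cmod (det A) > 0" using A(2)[OF EM] by linarith
 then have inv: "invertible A" by (simp add: invertible_det_nz)
 then obtain A' where A': "A ** A' = mat 1" "A' ** A = mat 1" by (auto simp: invertible_def)
 have sub: "z + A *v x \<in> Omega" if "norm x < 1" for x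
 proof -
  have "open ((%y. A' *v (y - z)) -` ball 0 1)"
  by (rule open_vimage[OF open_ball])
  (intro linear_continuous_on bounded_linear.continuous_on[OF bounded_linear_matrix] continuous_intros)
  moreover have "(%y. A' *v (y - z)) -` ball 0 1 \<subseteq> closure Omega"
  proof
  fix y assume "y \<in> (%y. A' *v (y - z)) -` ball 0 1"
  then have "A' *v (y - z) \<in> cball 0 1" by simp
  then have "z + A *v (A' *v (y - z)) \<in> closure Omega" using A(1) by (simp only: M_def mem_Collect_eq)
  then show "y \<in> closure Omega" by (simp add: matrix_vector_mul_assoc A'(1))
  qed
  ultimately have "(%y. A' *v (y - z)) -` ball 0 1 \<subseteq> interior (closure Omega)" by (simp add: interior_maximal)
  also have "interior (closure Omega) = Omega" using convex_interior_closure[OF Omega(2)] Omega(1) by (simp add: interior_open)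
  finally show ?thesis using that by (auto simp: matrix_vector_mul_assoc A'(2))
 qed
 have wid: "norm w <= width TYPE('d)" if w: "!!c. cmod c <= 1 ==> z + c *s (A *v w) \<in> closure Omega" for w
 proof -
  have "cmod (w $ k) <= 2 ^ CARD('d) + 1" for k
  proof -
  \<comment> \<open>Composing with \<open>F\<close> averages the ellipsoid with the disc in
    direction \<open>w\<close>. By convexity this is again a competitor, and maximality of
    \<open>A\<close> bounds the determinant of \<open>F\<close>, that is
    \<open>1 + w $ k\<close>.\<close>
  define F where "F = ((\<chi> i j. (1/2) * ((if i = j then 1 else 0) + (if j = k then w $ i else 0))) :: complex^'d^'d)"
  have Fx: "F *v x = (1/2) *\<^sub>R x + (1/2) *\<^sub>R (x $ k *s w)" for x
  proof -
  have "(F *v x) $ i = (\<Sum>j\<in>UNIV. (if j = i then (1/2) * x $ j else 0) + (if j = k then (1/2) * (w $ i * x $ j) else 0))" for i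
  unfolding F_def matrix_vector_mult_def by (auto intro!: sum.cong simp: algebra_simps)
  then show ?thesis by (simp add: vec_eq_iff sum.distrib) (simp add: complex_eq_iff)
  qed
  have "A ** F \<in> M" unfolding M_def
  proof (intro CollectI ballI)
  fix x :: "complex^'d" assume x: "x \<in> cball 0 1"
  have "cmod (x $ k) <= 1" using x Finite_Cartesian_Product.norm_nth_le[of x k] by simp
  then have "z + (x $ k) *s (A *v w) \<in> closure Omega" by (rule w)
  moreover have "z + A *v x \<in> closure Omega" using A(1) x by (simp add: M_def)
  ultimately have "(1/2) *\<^sub>R (z + A *v x) + (1/2) *\<^sub>R (z + (x $ k) *s (A *v w)) \<in> closure Omega"
  using convexD[OF convex_closure[OF Omega(2)]] by force
  moreover have "(A ** F) *v x = (1/2) *\<^sub>R (A *v x) + (1/2) *\<^sub>R ((x $ k) *s (A *v w))"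
  unfolding matrix_vector_mul_assoc[symmetric] Fx
  by (simp add: linear_add[OF linear_matrix] linear_scale[OF linear_matrix] matrix_smult)
  moreover have "(1/2) *\<^sub>R z + (1/2) *\<^sub>R z = z" by (simp flip: scaleR_add_left)
  ultimately show "z + (A ** F) *v x \<in> closure Omega" by (simp add: scaleR_add_right add_ac)
  qed
  from A(2)[OF this] have "cmod (det A) * cmod (det F) <= cmod (det A)" by (simp add: det_mul norm_mult)
  then have "cmod (det F) <= 1" using \<open>cmod (det A) > 0\<close> by simp
  then have "(1/2) ^ CARD('d) * cmod (1 + w $ k) <= 1"
  unfolding F_def det_scaled_rank_one by (simp add: norm_mult norm_power norm_divide)
  then have "cmod (1 + w $ k) <= 2 ^ CARD('d)" by (simp add: power_divide divide_le_eq)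
  then show ?thesis using norm_triangle_ineq4[of "1 + w $ k" 1] by simp
  qed
  then have "(\<Sum>k\<in>UNIV. cmod (w $ k)) <= (\<Sum>k\<in>(UNIV::'d set). 2 ^ CARD('d) + 1)" by (intro sum_mono)
  then show ?thesis using norm_le_sum_components[of w] by (simp add: width_def)
 qed
 show ?thesis by (rule that[OF inv sub wid])
qed

subsection \<open>Comparison of the metric with inscribed discs\<close>

locale ke_domain = kaehler_einstein Omega G + kaehler_convex Omega G
 for Omega :: "(complex^'d) set" and G :: "complex^'d => complex^'d => complex^'d => real" +
 assumes bounded_dom: "bounded Omega" and complete_dom: "dm.mcomplete"
begin

definition C0 :: real where "C0 = sqrt (6 + 4 * real CARD('d))"

lemma C0_pos: "C0 > 0" by (simp add: C0_def add_pos_nonneg)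

lemma nrm_lower:
 assumes f: "linear f" and r: "!!z. z \<in> Omega ==> c + f z > 0" and z: "z \<in> Omega"
 shows "\<bar>f v\<bar> <= C0 * (c + f z) * nrm z v"
proof -
 have "(f v)\<^sup>2 <= (6 + 4 * real CARD('d)) * (c + f z)\<^sup>2 * G z v v"
  by (rule gradient_estimate_of_cutoffs[OF bounded_dom cutoff_exists[OF complete_dom] f r z])
 also have "... = (C0 * (c + f z) * nrm z v)\<^sup>2"
  by (simp add: power_mult_distrib nrm_sq[OF z] C0_def)
 finally have "\<bar>f v\<bar> <= \<bar>C0 * (c + f z) * nrm z v\<bar>" by (simp only: abs_le_square_iff)
 then show ?thesis using C0_pos r[OF z] nrm_nonneg[of z v] by simp
qed

text \<open>A real affine function that vanishes at \<open>z + c v\<close> and is positive on the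
  domain has at \<open>z\<close> a value equal, up to sign, to its change along \<open>c v\<close>;
  the gradient estimate compares the two.\<close>

lemma nrm_lower_disc:
 assumes z: "z \<in> Omega" and c: "cmod c <= 1" and p: "z + c *s v \<notin> Omega"
 shows "1 <= C0 * nrm z v"
proof -
 define p where "p = z + c *s v"
 obtain a where a: "!!x q. x \<in> Omega ==> q \<in> {p} ==> a \<bullet> x < a \<bullet> q"
  using open_separation[OF open_dom convex_dom, of "{p}"] assms(3) by (auto simp: p_def)
 have "\<bar>- (a \<bullet> (c *s v))\<bar> <= C0 * (a \<bullet> p + - (a \<bullet> z)) * nrm z (c *s v)"
 proof (rule nrm_lower[OF _ _ z])
  show "linear (%x. - (a \<bullet> x))" by (rule linearI) (simp_all add: inner_add_right)
  show "a \<bullet> p + - (a \<bullet> x) > 0" if "x \<in> Omega" for x using a[OF that] by simp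
 qed
 moreover have "a \<bullet> p + - (a \<bullet> z) = a \<bullet> (c *s v)" by (simp add: p_def inner_add_right)
 moreover have "a \<bullet> (c *s v) > 0" using a[OF z, of p] by (simp add: p_def inner_add_right)
 ultimately have "1 <= C0 * nrm z (c *s v)" by (simp add: mult.commute mult.left_commute)
 also have "... <= C0 * nrm z v" using c nrm_nonneg[of z v] C0_pos
  by (simp add: nrm_smult mult_left_le_one_le)
 finally show ?thesis .
qed

text \<open>Stretched to length \<open>width + 1\<close>, the disc in direction \<open>A v\<close>
  must leave the closure, so \<open>nrm_lower_disc\<close> applies.\<close>

lemma nrm_lower_normal:
 assumes z: "z \<in> Omega"
  and w: "!!w. (!!c. cmod c <= 1 ==> z + c *s ((A::complex^'d^'d) *v w) \<in> closure Omega) ==> norm w <= width TYPE('d)"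
 shows "norm v <= C0 * (width TYPE('d) + 1) * nrm z (A *v v)"
proof (cases "v = 0")
 case False
 have W: "width TYPE('d) + 1 > 0" by (simp add: width_def add_nonneg_pos)
 define k where "k = (width TYPE('d) + 1) / norm v"
 have k: "k > 0" using W False by (simp add: k_def)
 have "norm (k *\<^sub>R v) > width TYPE('d)" using False W by (simp add: k_def)
 then have "~ (\<forall>c. cmod c <= 1 --> z + c *s (A *v (k *\<^sub>R v)) \<in> closure Omega)" using w[of "k *\<^sub>R v"] by force
 then obtain c where c: "cmod c <= 1" "z + c *s (A *v (k *\<^sub>R v)) \<notin> closure Omega" by blast
 then have "z + c *s (A *v (k *\<^sub>R v)) \<notin> Omega" using closure_subset by blast
 from nrm_lower_disc[OF z c(1) this] have "1 <= C0 * (k * nrm z (A *v v))"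
  using k by (simp add: linear_scale[OF linear_matrix] nrm_scaleR)
 then show ?thesis using False by (simp add: k_def divide_simps mult_ac)
qed (use nrm_scaleR[of z 0 0] in simp)

text \<open>The eigenvalues of the metric relative to the ellipsoid are at least
  \<open>1 / (C0 * (width + 1))^2\<close> and have product at most \<open>(32 n) ^ n\<close>, which
  bounds each of them. The factor \<open>width\<close> passes from the ellipsoid to discs.\<close>

definition C1 :: real where
 "C1 = width TYPE('d) * sqrt ((32 * real CARD('d)) ^ CARD('d) * (C0 * (width TYPE('d) + 1)) ^ (2 * (CARD('d) - 1)))"

lemma C1_nonneg: "C1 >= 0"
 unfolding C1_def using C0_pos by (simp add: width_def)

lemma pullback_jpos:
 assumes B: "A ** B = mat 1"
 shows "jpos (%v w. ((B::complex^'d^'d) *v v) \<bullet> (B *v w))"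
proof -
 have J: "J x \<bullet> J y = x \<bullet> y" for x y :: "complex^'d" by (simp add: inner_vec_def inner_complex_def algebra_simps)
 have bil: "bilinear (%v w. (B *v v) \<bullet> (B *v w))"
  unfolding bilinear_def
  by (auto intro!: linearI simp: linear_add[OF linear_matrix] linear_scale[OF linear_matrix] inner_add_left inner_add_right)
 have inj: "B *v v = 0 ==> v = 0" for v
 proof -
  assume "B *v v = 0"
  then have "A *v (B *v v) = 0" by simp
  then show "v = 0" by (simp add: matrix_vector_mul_assoc B)
 qed
 show ?thesis unfolding jpos_def jsym_def using bil inj
  by (auto simp: inner_commute matrix_smult J)
qed

text \<open>The logarithm of the boundary function of the ball is the barrier in the maximum
  principle for the volume form.\<close>

lemma lev_ln_ball:
 fixes x :: "complex^'d"
 assumes x: "norm x < 1"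
 shows "lev (%x. ln (1 - x \<bullet> x)) x v >= - 8 * (v \<bullet> v) / (1 - x \<bullet> x)\<^sup>2" "Ck_on k (ball 0 1) (%x::complex^'d. ln (1 - x \<bullet> x))"
proof -
 define s where "s x = 1 + (- 1) * (x \<bullet> x)" for x :: "complex^'d"
 have spos: "s x > 0" if "x \<in> ball 0 1" for x
  using that by (simp add: s_def dot_square_norm abs_square_less_1)
 have Cid: "Ck_on k (ball 0 1) (%x::complex^'d. 0 + x)" for k
  by (rule Ck_on_affine[OF open_ball bounded_linear_ident])
 have Cs: "Ck_on k (ball 0 1) s" for k
 proof -
  have "Ck_on k (ball 0 1) (%x::complex^'d. 1 + (- 1) * ((0 + x) \<bullet> (0 + x)))"
  by (rule Ck_on_add[OF open_ball Ck_on_const[OF open_ball] Ck_on_cmult[OF open_ball Ck_on_bilinear[OF open_ball bounded_bilinear_inner Cid Cid]]])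
  then show ?thesis by (simp add: s_def[abs_def])
 qed
 show "Ck_on k (ball 0 1) (%x::complex^'d. ln (1 - x \<bullet> x))" for k
  using Ck_on_ln[OF open_ball Cs spos] by (simp add: s_def[abs_def])
 have xb: "x \<in> ball 0 1" using x by simp
 have ds: "dir_deriv s y v = - 2 * (y \<bullet> v)" for y v
 proof (rule dir_deriv_eqI)
  show "(s has_derivative (%v. - 2 * (y \<bullet> v))) (at y)"
  unfolding s_def[abs_def] by (auto intro!: derivative_eq_intros simp: inner_commute)
 qed
 have dds: "dir_deriv (%y. dir_deriv s y v) x v = - 2 * (v \<bullet> v)" for v
  unfolding ds by (rule dir_deriv_eqI) (auto intro!: derivative_eq_intros)
 have h: "dir_deriv (%y. dir_deriv (%y. ln (s y)) y v) x v = - 2 * (v \<bullet> v) / s x - (2 * (x \<bullet> v))\<^sup>2 / (s x)\<^sup>2" for v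
 proof -
  have "dir_deriv (%y. dir_deriv (%y. ln (s y)) y v) x v = dir_deriv (%x. dir_deriv s x v) x v / s x - (dir_deriv s x v)\<^sup>2 / (s x)\<^sup>2"
  by (rule hess_ln[OF open_ball xb Cs spos])
  then show ?thesis unfolding dds unfolding ds by (simp add: power2_eq_square)
 qed
 have JJ: "J v \<bullet> J v = v \<bullet> v" by (simp add: inner_vec_def inner_complex_def algebra_simps)
 have "jpos (%v w :: complex^'d. v \<bullet> w)"
  using pullback_jpos[of "mat 1" "mat 1"] by simp
 from jpos_cauchy_schwarz(2)[OF this, of x v] have cs: "(x \<bullet> v)\<^sup>2 + (x \<bullet> J v)\<^sup>2 <= (x \<bullet> x) * (v \<bullet> v)" .
 have s1: "0 < s x" "s x <= 1" using spos[OF xb] by (auto simp: s_def)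
 have sx: "1 - x \<bullet> x = s x" by (simp add: s_def)
 have "lev (%x. ln (1 - x \<bullet> x)) x v = lev (%x. ln (s x)) x v" by (simp add: s_def)
 also have "... = - 4 * (v \<bullet> v) / s x - 4 * ((x \<bullet> v)\<^sup>2 + (x \<bullet> J v)\<^sup>2) / (s x)\<^sup>2"
  unfolding lev_def h JJ using s1 by (simp add: divide_simps power2_eq_square algebra_simps)
 also have "... >= - 8 * (v \<bullet> v) / (s x)\<^sup>2"
 proof -
  have "s x * (v \<bullet> v) + (x \<bullet> v)\<^sup>2 + (x \<bullet> J v)\<^sup>2 <= 1 * (v \<bullet> v) + 1 * (v \<bullet> v)"
  proof -
  have "s x * (v \<bullet> v) <= 1 * (v \<bullet> v)" using s1 by (intro mult_right_mono) auto
  moreover have "(x \<bullet> x) * (v \<bullet> v) <= 1 * (v \<bullet> v)" using s1 by (intro mult_right_mono) (auto simp: s_def)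
  ultimately show ?thesis using cs by linarith
  qed
  then have "(s x * (v \<bullet> v) + (x \<bullet> v)\<^sup>2 + (x \<bullet> J v)\<^sup>2) / (s x)\<^sup>2 <= (2 * (v \<bullet> v)) / (s x)\<^sup>2"
  by (intro divide_right_mono) auto
  moreover have "- 4 * (v \<bullet> v) / s x - 4 * ((x \<bullet> v)\<^sup>2 + (x \<bullet> J v)\<^sup>2) / (s x)\<^sup>2
  = - 4 * ((s x * (v \<bullet> v) + (x \<bullet> v)\<^sup>2 + (x \<bullet> J v)\<^sup>2) / (s x)\<^sup>2)"
  using s1 by (simp add: divide_simps power2_eq_square algebra_simps)
  moreover have "- 8 * (v \<bullet> v) / (s x)\<^sup>2 = - 4 * ((2 * (v \<bullet> v)) / (s x)\<^sup>2)" by simp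
  ultimately show ?thesis by linarith
 qed
 finally show "lev (%x. ln (1 - x \<bullet> x)) x v >= - 8 * (v \<bullet> v) / (1 - x \<bullet> x)\<^sup>2" unfolding sx .
qed

lemma affine_pullback_hess:
 fixes L :: "complex^'d => complex^'d" and f :: "complex^'d => real"
 assumes f: "Ck_on 2 Omega f" and L: "bounded_linear L" and U: "open U" "x \<in> U" "!!y. y \<in> U ==> p + L y \<in> Omega"
 shows "dir_deriv (%y. dir_deriv (%y. f (p + L y)) y v) x v = dir_deriv (%y. dir_deriv f y (L v)) (p + L x) (L v)"
  "Ck_on 2 U (%y. f (p + L y))"
proof -
 have dl: "((%y. p + L y) has_derivative L) (at y)" for y
  using has_derivative_add[OF has_derivative_const[of p] bounded_linear_imp_has_derivative[OF L]] by simp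
 have f': "Ck_on (Suc (Suc 0)) Omega f" using f by (simp only: numeral_2_eq_2)
 have comp: "((%y. g (p + L y)) has_derivative (%v. g' (L v))) (at y)" if "(g has_derivative g') (at (p + L y))" for g :: "complex^'d => real" and g' y
  by (rule has_derivative_compose[where f="%y. p + L y" and g=g, OF dl that])
 have 1: "((%y. f (p + L y)) has_derivative (%v. dir_deriv f (p + L y) (L v))) (at y)" if "y \<in> U" for y
  by (rule comp[OF Ck_on_SucD(1)[OF f' U(3)[OF that]]])
 have 2: "((%y. dir_deriv f (p + L y) (L v)) has_derivative (%w. dir_deriv (%y. dir_deriv f y (L v)) (p + L y) (L w))) (at y)" if "y \<in> U" for y v
  by (rule comp[OF Ck_on_SucD(1)[OF Ck_on_SucD(2)[OF f'] U(3)[OF that]]])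
 have "dir_deriv (%y. dir_deriv (%y. f (p + L y)) y v) x v = dir_deriv (%y. dir_deriv f (p + L y) (L v)) x v"
  by (rule dir_deriv_cong[OF U(1,2)]) (rule dir_deriv_eqI[OF 1])
 also have "... = dir_deriv (%y. dir_deriv f y (L v)) (p + L x) (L v)"
  by (rule dir_deriv_eqI[OF 2[OF U(2)]])
 finally show "dir_deriv (%y. dir_deriv (%y. f (p + L y)) y v) x v = dir_deriv (%y. dir_deriv f y (L v)) (p + L x) (L v)" .
 have 3: "continuous_on U (%y. dir_deriv (%y. dir_deriv f y (L v)) (p + L y) (L w))" for v w
 proof (rule continuous_on_compose2[of Omega])
  show "continuous_on Omega (%y. dir_deriv (%y. dir_deriv f y (L v)) y (L w))"
  using Ck_on_SucD(2)[OF Ck_on_SucD(2)[OF f']] by simp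
  show "continuous_on U (%y. p + L y)" by (intro continuous_intros linear_continuous_on L)
 qed (use U in auto)
 have "Ck_on (Suc (Suc 0)) U (%y. f (p + L y))"
 proof (rule Ck_on_SucI[OF U(1) 1])
  show "Ck_on (Suc 0) U (%y. dir_deriv f (p + L y) (L v))" for v
  by (rule Ck_on_SucI[OF U(1) 2]) (use 3 in auto)
 qed
 then show "Ck_on 2 U (%y. f (p + L y))" by (simp only: numeral_2_eq_2)
qed

text \<open>A Schwarz lemma for the volume form. The density, multiplied by a power of
  \<open>1 - x \<bullet> x\<close>, is maximal at an interior point; there the Levi form of
  \<open>psi\<close>, which is twice the metric, is bounded by that of the barrier.\<close>

lemma hdet_upper:
 assumes z: "z \<in> Omega" and A: "A ** B = mat 1" "B ** A = mat 1" and sub: "!!x. norm x < 1 ==> z + (A::complex^'d^'d) *v x \<in> Omega"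
 shows "hdet (G z) <= (32 * real CARD('d)) ^ CARD('d) * hdet (%v w. (B *v v) \<bullet> (B *v w))"
proof -
 define K where "K = (%v w. (B *v v) \<bullet> (B *v w))"
 have jK: "jpos K" unfolding K_def by (rule pullback_jpos[OF A(1)])
 define n where "n = CARD('d)"
 \<comment> \<open>Halving keeps the image of the closed unit ball inside the domain; it costs a
   factor 4 and turns 8 into 32.\<close>
 define L where "L x = (1/2) *\<^sub>R (A *v x)" for x
 have L: "bounded_linear L" unfolding L_def[abs_def]
  by (rule bounded_linear_compose[OF bounded_linear_scaleR_right bounded_linear_matrix])
 have inO: "z + L x \<in> Omega" if "norm x <= 1" for x
 proof -
  have "z + A *v ((1/2) *\<^sub>R x) \<in> Omega" by (rule sub) (use that in simp)
  then show ?thesis by (simp add: L_def linear_scale[OF linear_matrix])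
 qed
 \<comment> \<open>The exponent \<open>2 * n\<close> cancels the factor \<open>1 / s^2\<close> that
   each of the \<open>n\<close> eigenvalues carries at the maximum.\<close>
 define Q where "Q x = hdet (G (z + L x)) * (1 - x \<bullet> x) ^ (2 * n)" for x
 have "continuous_on Omega (%z. exp (psi z))" using Ck_on_imp_continuous_on[OF Ck_psi[of 0]] by (intro continuous_intros)
 moreover have "exp (psi y) = hdet (G y)" if "y \<in> Omega" for y using hdet_pos[OF jpos_G[OF that]] by (simp add: psi_def)
 ultimately have ch: "continuous_on Omega (%z. hdet (G z))" by (rule continuous_on_eq)
 have cQ: "continuous_on (cball 0 1) Q" unfolding Q_def
  by (intro continuous_intros continuous_on_compose2[OF ch] linear_continuous_on L) (use inO in auto)
 obtain m where m: "m \<in> cball 0 1" "!!x. x \<in> cball 0 1 ==> Q x <= Q m"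
  using continuous_attains_sup[OF compact_cball _ cQ] by auto
 have L0: "L 0 = 0" by (simp add: L_def)
 have Q0: "Q 0 = hdet (G z)" by (simp add: Q_def L0)
 then have Q0pos: "Q 0 > 0" using hdet_pos[OF jpos_G[OF z]] by simp
 have mb: "norm m < 1"
 proof (rule ccontr)
  assume "~ norm m < 1"
  then have "m \<bullet> m = 1" using m(1) by (simp add: dot_square_norm)
  then have "Q m = 0" using n_def by (simp add: Q_def)
  then show False using m(2)[of 0] Q0pos by simp
 qed
 define s where "s = 1 - m \<bullet> m"
 have s: "s > 0" using mb by (simp add: s_def dot_square_norm abs_square_less_1)
 define p where "p = z + L m"
 have p: "p \<in> Omega" unfolding p_def by (rule inO) (use mb in simp)
 define U where "U = ball (0::complex^'d) 1"
 have U: "open U" "m \<in> U" "!!y. y \<in> U ==> z + L y \<in> Omega" using mb inO by (auto simp: U_def)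
 define lb where "lb x = ln (1 - x \<bullet> x)" for x :: "complex^'d"
 define f1 where "f1 x = psi (z + L x)" for x
 define Phi where "Phi x = (-1) * (f1 x + (2 * real n) * lb x)" for x
 have Cf1: "Ck_on 2 U f1" unfolding f1_def[abs_def] by (rule affine_pullback_hess(2)[OF Ck_psi L U])
 have Clb: "Ck_on 2 U lb" unfolding lb_def[abs_def] U_def by (rule lev_ln_ball(2)[of 0]) simp
 have CPhi: "Ck_on 2 U Phi" unfolding Phi_def[abs_def]
  by (rule Ck_on_cmult[OF U(1) Ck_on_add[OF U(1) Cf1 Ck_on_cmult[OF U(1) Clb]]])
 have PhiQ: "Phi x = - ln (Q x)" if "x \<in> U" for x
 proof -
  have "1 - x \<bullet> x > 0" using that by (simp add: U_def dot_square_norm abs_square_less_1)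
  then show ?thesis using hdet_pos[OF jpos_G[OF U(3)[OF that]]]
  by (simp add: Phi_def f1_def lb_def Q_def psi_def ln_mult ln_realpow)
 qed
 have Qpos: "Q x > 0" if "x \<in> U" for x
 proof -
  have "1 - x \<bullet> x > 0" using that by (simp add: U_def dot_square_norm abs_square_less_1)
  then show ?thesis using hdet_pos[OF jpos_G[OF U(3)[OF that]]] by (simp add: Q_def)
 qed
 have min: "Phi m <= Phi x" if "x \<in> U" for x
  unfolding PhiQ[OF that] PhiQ[OF U(2)] using m(2)[of x] Qpos[OF that] that Qpos[OF U(2)] by (simp add: U_def)
 have GL: "G p (L v) (L v) <= 8 * real n * (v \<bullet> v) / s\<^sup>2" for v
 proof -
  have h: "dir_deriv (%y. dir_deriv Phi y v) m v = (-1) * (dir_deriv (%y. dir_deriv f1 y v) m v + (2 * real n) * dir_deriv (%y. dir_deriv lb y v) m v)" for v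
  unfolding Phi_def[abs_def]
  hess_cmult[OF U(1,2) Ck_on_add[OF U(1) Cf1 Ck_on_cmult[OF U(1) Clb]]]
  hess_add[OF U(1,2) Cf1 Ck_on_cmult[OF U(1) Clb]] hess_cmult[OF U(1,2) Clb] ..
  have hf1: "dir_deriv (%y. dir_deriv f1 y v) m v = dir_deriv (%y. dir_deriv psi y (L v)) p (L v)" for v
  unfolding f1_def[abs_def] p_def by (rule affine_pullback_hess(1)[OF Ck_psi L U])
  have LJ: "L (J v) = J (L v)" by (simp add: L_def matrix_smult vec_eq_iff)
  have "lev Phi m v >= 0" unfolding lev_def
  using second_derivative_test(2)[OF U(1,2) CPhi min] by (intro add_nonneg_nonneg)
  moreover have "lev Phi m v = - (lev psi p (L v) + 2 * real n * lev lb m v)"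
  unfolding lev_def h hf1 LJ by (simp add: algebra_simps)
  moreover have "lev lb m v >= - 8 * (v \<bullet> v) / s\<^sup>2"
  unfolding lb_def[abs_def] s_def by (rule lev_ln_ball(1)[OF mb])
  ultimately have "2 * G p (L v) (L v) <= 2 * real n * (8 * (v \<bullet> v) / s\<^sup>2)"
  unfolding lev_psi[OF p] by (smt (verit) mult_left_mono of_nat_0_le_iff mult_minus_right minus_divide_left mult_minus_left)
  then show ?thesis by simp
 qed
 have GK: "G p v v <= (32 * real n / s\<^sup>2) * K v v" for v
 proof -
  have "L (2 *\<^sub>R (B *v v)) = v" by (simp add: L_def linear_scale[OF linear_matrix] matrix_vector_mul_assoc A)
  with GL[of "2 *\<^sub>R (B *v v)"] show ?thesis by (simp add: K_def)
 qed
 obtain e lam where e: "uframe K e" "!!i w. G p (e i) w = lam i * K (e i) w"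
  using simultaneous_diagonalization[OF jK jsym_G[OF p]] by blast
 have lam: "0 <= lam i" "lam i <= 32 * real n / s\<^sup>2" for i
  using GK[of "e i"] jposD(3)[OF jpos_G[OF p], of "e i"] e(2)[of i "e i"] uframeD(1)[OF jposD(1)[OF jK] e(1), of i i] by auto
 note hd = hdet_diag[OF jposD(1)[OF jK] e(1) jsym_G[OF p] e(2)]
 have "hdet (G p) = (\<Prod>i\<in>UNIV. lam i) * hdet K" by (rule hd(2))
 also have "... <= (\<Prod>i\<in>(UNIV::'d set). 32 * real n / s\<^sup>2) * hdet K"
  using hd(1) lam by (intro mult_right_mono prod_mono) auto
 finally have "hdet (G p) <= (32 * real n / s\<^sup>2) ^ n * hdet K" by (simp add: n_def)
 then have "Q m <= (32 * real n / s\<^sup>2) ^ n * hdet K * s ^ (2 * n)"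
  unfolding Q_def p_def[symmetric] s_def[symmetric] using s by (intro mult_right_mono) auto
 also have "... = (32 * real n) ^ n * hdet K" using s by (simp add: power_divide power_mult)
 finally show ?thesis using m(2)[of 0] Q0 unfolding n_def K_def by simp
qed

lemma nrm_upper_disc:
 assumes z: "z \<in> Omega" and disc: "!!c. cmod c <= 1 ==> z + c *s v \<in> Omega"
 shows "nrm z v <= C1"
proof -
 obtain A :: "complex^'d^'d" where A: "invertible A" "!!x. norm x < 1 ==> z + A *v x \<in> Omega"
  "!!w. (!!c. cmod c <= 1 ==> z + c *s (A *v w) \<in> closure Omega) ==> norm w <= width TYPE('d)"
  using normal_form[OF open_dom convex_dom bounded_dom z] by metis
 obtain B where B: "A ** B = mat 1" "B ** A = mat 1" using A(1) by (auto simp: invertible_def)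
 define K where "K = (%v w. (B *v v) \<bullet> (B *v w))"
 have jK: "jpos K" unfolding K_def by (rule pullback_jpos[OF B(1)])
 note sK = jposD(1)[OF jK]
 have AB: "A *v (B *v u) = u" for u by (simp add: matrix_vector_mul_assoc B)
 define n where "n = CARD('d)"
 define c where "c = C0 * (width TYPE('d) + 1)"
 have c: "c > 0" using C0_pos by (simp add: c_def width_def add_nonneg_pos)
 obtain e lam where e: "uframe K e" "!!i w. G z (e i) w = lam i * K (e i) w"
  using simultaneous_diagonalization[OF jK jsym_G[OF z]] by blast
 have lamG: "lam i = G z (e i) (e i)" for i using e(2)[of i "e i"] uframeD(1)[OF sK e(1), of i i] by simp
 have lam: "1 <= c\<^sup>2 * lam i" for i
 proof -
  have "norm (B *v e i) = 1" using uframeD(1)[OF sK e(1), of i i] by (simp add: K_def norm_eq_1)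
  then have "1 <= c * nrm z (e i)" using nrm_lower_normal[where A=A and v="B *v e i", OF z] A(3) by (simp add: AB c_def)
  then have "1\<^sup>2 <= (c * nrm z (e i))\<^sup>2" by (intro power_mono) auto
  then show ?thesis by (simp add: power_mult_distrib nrm_sq[OF z] lamG)
 qed
 have lampos: "lam i > 0" for i using lam[of i] c by (smt (verit) mult_nonneg_nonpos zero_le_power2)
 note hd = hdet_diag[OF sK e(1) jsym_G[OF z] e(2)]
 have "hdet (G z) <= (32 * real n) ^ n * hdet K"
  unfolding n_def K_def by (rule hdet_upper[OF z B A(2)])
 then have "(\<Prod>i\<in>UNIV. lam i) * hdet K <= (32 * real n) ^ n * hdet K" using hd(2) by simp
 then have pr: "(\<Prod>i\<in>UNIV. lam i) <= (32 * real n) ^ n" using hd(1) by simp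
 \<comment> \<open>Every other eigenvalue times \<open>c^2\<close> is at least 1, so multiplying by
   all of them only increases \<open>lam i\<close> and produces the determinant.\<close>
 have lamub: "lam i <= (32 * real n) ^ n * c ^ (2 * (n - 1))" for i
 proof -
  have "lam i = lam i * (\<Prod>j\<in>UNIV - {i}. 1)" by simp
  also have "... <= lam i * (\<Prod>j\<in>UNIV - {i}. c\<^sup>2 * lam j)"
  using lampos lam by (intro mult_left_mono prod_mono) (auto simp: less_imp_le)
  also have "... = (lam i * (\<Prod>j\<in>UNIV - {i}. lam j)) * c ^ (2 * (n - 1))"
  by (simp add: prod.distrib card_Diff_singleton n_def power_mult)
  also have "lam i * (\<Prod>j\<in>UNIV - {i}. lam j) = (\<Prod>j\<in>UNIV. lam j)" by (simp add: prod.remove[of UNIV i])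
  also have "(\<Prod>j\<in>UNIV. lam j) * c ^ (2 * (n - 1)) <= (32 * real n) ^ n * c ^ (2 * (n - 1))"
  using pr c by (intro mult_right_mono) auto
  finally show ?thesis .
 qed
 define C where "C = (32 * real n) ^ n * c ^ (2 * (n - 1))"
 have "G z v v = (\<Sum>i\<in>UNIV. K v (e i) * G z (e i) v + K v (J (e i)) * G z (J (e i)) v)"
  by (rule uframe_parseval[OF sK e(1) bilinear_G[OF z]])
 also have "... = (\<Sum>i\<in>UNIV. lam i * ((K v (e i))\<^sup>2 + (K v (J (e i)))\<^sup>2))"
 proof (rule sum.cong[OF refl])
  fix i
  have "G z (J (e i)) v = lam i * K (J (e i)) v"
  using e(2)[of i "J v"] jsymD(4)[OF jsym_G[OF z], of "e i" v] jsymD(4)[OF sK, of "e i" v] by simp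
  then show "K v (e i) * G z (e i) v + K v (J (e i)) * G z (J (e i)) v = lam i * ((K v (e i))\<^sup>2 + (K v (J (e i)))\<^sup>2)"
  using e(2)[of i v] jsymD(2)[OF sK, of v "e i"] jsymD(2)[OF sK, of v "J (e i)"] by (simp add: power2_eq_square algebra_simps)
 qed
 also have "... <= (\<Sum>i\<in>UNIV. C * ((K v (e i))\<^sup>2 + (K v (J (e i)))\<^sup>2))"
  using lamub by (intro sum_mono mult_right_mono) (auto simp: C_def)
 also have "... = C * K v v"
 proof -
  have "K v v = (\<Sum>i\<in>UNIV. K v (e i) * K (e i) v + K v (J (e i)) * K (J (e i)) v)"
  by (rule uframe_parseval[OF sK e(1) jsymD(1)[OF sK]])
  also have "... = (\<Sum>i\<in>UNIV. (K v (e i))\<^sup>2 + (K v (J (e i)))\<^sup>2)"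
  by (rule sum.cong[OF refl]) (simp add: power2_eq_square jsymD(2)[OF sK, of _ v])
  finally show ?thesis by (simp add: sum_distrib_left)
 qed
 also have "... <= C * (width TYPE('d))\<^sup>2"
 proof (rule mult_left_mono)
  have "norm (B *v v) <= width TYPE('d)"
  by (rule A(3)) (use disc closure_subset in \<open>auto simp: AB\<close>)
  then show "K v v <= (width TYPE('d))\<^sup>2" by (simp add: K_def dot_square_norm power_mono)
  show "C >= 0" using c by (simp add: C_def)
 qed
 finally have "nrm z v <= sqrt (C * (width TYPE('d))\<^sup>2)" using z by (simp add: nrm_def)
 also have "... = C1" by (simp add: C1_def C_def c_def n_def real_sqrt_mult width_def)
 finally show ?thesis .
qed

end

subsection \<open>Distance estimates\<close>

text \<open>The complex linear functional with real part \<open>a \<bullet> x\<close>.\<close>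

definition cfun :: "complex^'d => complex^'d => complex" where
 "cfun a x = Complex (a \<bullet> x) (- (a \<bullet> J x))"

lemma bounded_linear_cfun: "bounded_linear (cfun a)"
proof -
 have "linear (cfun a)"
  by (rule linearI) (simp_all add: cfun_def complex_eq_iff inner_add_right vector_scalar_commute
  vector_add_ldistrib scaleR_smult vector_smult_assoc mult.commute flip: inner_scaleR_right)
 then show ?thesis by (rule linear_conv_bounded_linear[THEN iffD1])
qed

lemma cfun_smult: "cfun a (c *s x) = c * cfun a x"
proof -
 have "J (c *s x) = (- Im c) *\<^sub>R x + Re c *\<^sub>R J x"
  by (simp add: smult_eq_J[of c] vector_add_ldistrib linear_scale[OF linear_smult])
 then have "a \<bullet> J (c *s x) = - Im c * (a \<bullet> x) + Re c * (a \<bullet> J x)" by (simp add: inner_add_right inner_diff_right)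
 moreover have "a \<bullet> (c *s x) = Re c * (a \<bullet> x) + Im c * (a \<bullet> J x)" by (simp add: smult_eq_J[of c] inner_add_right)
 ultimately show ?thesis by (simp add: cfun_def complex_eq_iff)
qed

context ke_domain
begin

text \<open>From \<open>z\<close> in direction \<open>v\<close> the omitted level set is reached at
  the complex parameter \<open>- w / cfun a v\<close>. This limits the disc at \<open>z\<close> and
  bounds the norm of \<open>v\<close> from below by the logarithmic derivative.\<close>

lemma ln_cfun_lipschitz:
 assumes nz: "!!z. z \<in> Omega ==> cfun a z ~= beta" and xy: "x \<in> Omega" "y \<in> Omega"
 shows "\<bar>ln (cmod (cfun a x - beta)) - ln (cmod (cfun a y - beta))\<bar> <= C0 * d x y"
proof (rule d_lipschitz[OF _ _ less_imp_le[OF C0_pos] xy])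
 fix z assume z: "z \<in> Omega"
 define w where "w = cfun a z - beta"
 have w: "w ~= 0" using nz[OF z] by (simp add: w_def)
 have "((%z. cfun a z - beta) has_derivative cfun a) (at z)"
  using bounded_linear.has_derivative[OF bounded_linear_cfun has_derivative_ident, of a]
  by (auto intro!: derivative_eq_intros)
 from has_derivative_compose[OF this has_derivative_norm] have "((%z. cmod (cfun a z - beta)) has_derivative (%v. cfun a v \<bullet> sgn w)) (at z)"
  using w by (simp add: w_def inner_commute)
 then show "((%z. ln (cmod (cfun a z - beta))) has_derivative (%v. (cfun a v \<bullet> sgn w) / cmod w)) (at z)"
  using w by (auto intro!: derivative_eq_intros simp: w_def divide_inverse)
 fix v
 show "\<bar>(cfun a v \<bullet> sgn w) / cmod w\<bar> <= C0 * nrm z v"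
 proof (cases "cfun a v = 0")
  case True
  then show ?thesis using nrm_nonneg[of z v] C0_pos by simp
 next
  case False
  define c where "c = - w / cfun a v"
  have "cfun a (z + c *s v) = beta"
  using False by (simp add: linear_add[OF bounded_linear.linear[OF bounded_linear_cfun]] cfun_smult c_def w_def)
  then have "z + 1 *s (c *s v) \<notin> Omega" using nz by auto
  then have "1 <= C0 * nrm z (c *s v)" by (intro nrm_lower_disc[OF z, of 1]) auto
  then have "1 <= C0 * (cmod w / cmod (cfun a v) * nrm z v)" unfolding nrm_smult c_def by (simp add: norm_divide)
  then have "cmod (cfun a v) / cmod w <= C0 * nrm z v" using False w by (simp add: field_simps)
  moreover have "\<bar>cfun a v \<bullet> sgn w\<bar> <= cmod (cfun a v) * 1"
  using Cauchy_Schwarz_ineq2[of "cfun a v" "sgn w"] w by (simp add: norm_sgn)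
  then have "\<bar>cfun a v \<bullet> sgn w\<bar> / cmod w <= cmod (cfun a v) / cmod w" by (simp add: divide_right_mono)
  ultimately show ?thesis by simp
 qed
qed

lemma ln_affine_lipschitz:
 assumes f: "linear f" and r: "!!z. z \<in> Omega ==> c + f z > 0" and xy: "x \<in> Omega" "y \<in> Omega"
 shows "\<bar>ln (c + f x) - ln (c + f y)\<bar> <= C0 * d x y"
proof (rule d_lipschitz[OF _ _ less_imp_le[OF C0_pos] xy])
 fix z assume z: "z \<in> Omega"
 have "(f has_derivative f) (at z)" using f by (intro bounded_linear_imp_has_derivative) (simp add: linear_conv_bounded_linear)
 then show "((%z. ln (c + f z)) has_derivative (%v. f v / (c + f z))) (at z)"
  using r[OF z] by (auto intro!: derivative_eq_intros simp: divide_inverse)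
 fix v
 show "\<bar>f v / (c + f z)\<bar> <= C0 * nrm z v"
 proof -
  have "\<bar>f v / (c + f z)\<bar> = \<bar>f v\<bar> / (c + f z)" using r[OF z] by (simp add: abs_divide)
  also have "... <= C0 * (c + f z) * nrm z v / (c + f z)"
  using nrm_lower[OF f r z, of v] r[OF z] by (intro divide_right_mono) auto
  finally show ?thesis using r[OF z] by simp
 qed
qed

text \<open>Real separation becomes complex through \<open>cfun\<close>: the level set of
  \<open>l\<close> through a point of \<open>T\<close> is a complex hyperplane missing the domain.
  Allowing a whole convex set \<open>T\<close> gives control over the direction of
  \<open>l\<close>.\<close>

lemma separating_functional:
 assumes T: "convex T" "T ~= {}" and dis: "!!p. p \<in> T ==> u + (A::complex^'d^'d) *v p \<notin> Omega"
 obtains l :: "complex^'d => complex" where "linear l" "!!c x. l (c *s x) = c * l x"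
  "!!x p. u + A *v x \<in> Omega ==> p \<in> T ==> l x ~= l p"
  "!!x y p. u + A *v x \<in> Omega ==> u + A *v y \<in> Omega ==> p \<in> T ==>
  \<bar>ln (cmod (l x - l p)) - ln (cmod (l y - l p))\<bar> <= C0 * d (u + A *v x) (u + A *v y)"
proof -
 define T' where "T' = (%x. u + x) ` ((*v) A) ` T"
 have T': "convex T'" "T' ~= {}" "Omega \<inter> T' = {}" unfolding T'_def
  using T dis by (auto intro!: convex_translation convex_linear_image[OF linear_matrix])
 obtain a where a: "!!x q. x \<in> Omega ==> q \<in> T' ==> a \<bullet> x < a \<bullet> q"
  by (rule open_separation[OF open_dom convex_dom T']) blast
 note lin = bounded_linear.linear[OF bounded_linear_cfun, of a]
 have aff: "cfun a (u + A *v x) = cfun a u + cfun a (A *v x)" for x by (rule linear_add[OF lin])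
 have ne: "cfun a z ~= cfun a (u + A *v p)" if "z \<in> Omega" "p \<in> T" for z p
  using a[OF that(1), of "u + A *v p"] that(2) by (auto simp: T'_def cfun_def)
 show ?thesis
 proof (rule that[of "%x. cfun a (A *v x)"])
  show "linear (%x. cfun a (A *v x))" using linear_compose[OF linear_matrix lin] by (simp add: o_def)
  show "cfun a (A *v (c *s x)) = c * cfun a (A *v x)" for c x by (simp add: matrix_smult cfun_smult)
  fix x p assume x: "u + A *v x \<in> Omega" and p: "p \<in> T"
  show "cfun a (A *v x) ~= cfun a (A *v p)" using ne[OF x p] by (simp add: aff)
  fix y assume y: "u + A *v y \<in> Omega"
  show "\<bar>ln (cmod (cfun a (A *v x) - cfun a (A *v p))) - ln (cmod (cfun a (A *v y) - cfun a (A *v p)))\<bar>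
  <= C0 * d (u + A *v x) (u + A *v y)"
  using ln_cfun_lipschitz[OF ne[OF _ p] x y] by (simp add: aff)
 qed
qed

text \<open>On a complex line through an omitted point the functional is a multiple of the
  parameter, and the factor \<open>l v\<close> cancels in the difference of logarithms.\<close>

lemma line_ratio:
 assumes p: "u + (A::complex^'d^'d) *v p \<notin> Omega" and x: "u + A *v (p + c1 *s v) \<in> Omega" "u + A *v (p + c2 *s v) \<in> Omega"
 shows "\<bar>ln (cmod c1) - ln (cmod c2)\<bar> <= C0 * d (u + A *v (p + c1 *s v)) (u + A *v (p + c2 *s v))"
proof -
 obtain l :: "complex^'d => complex" where l: "linear l" "!!c x. l (c *s x) = c * l x"
  "!!x q. u + A *v x \<in> Omega ==> q \<in> {p} ==> l x ~= l q"
  "!!x y q. u + A *v x \<in> Omega ==> u + A *v y \<in> Omega ==> q \<in> {p} ==>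
  \<bar>ln (cmod (l x - l q)) - ln (cmod (l y - l q))\<bar> <= C0 * d (u + A *v x) (u + A *v y)"
  by (rule separating_functional[of "{p}" u A]) (use p in auto)
 have e: "l (p + c *s v) - l p = c * l v" for c by (simp add: linear_add[OF l(1)] l(2))
 have nz: "c1 * l v ~= 0" "c2 * l v ~= 0" using l(3)[OF x(1)] l(3)[OF x(2)] e[of c1] e[of c2] by auto
 then show ?thesis using l(4)[OF x, of p] unfolding e by (simp add: norm_mult ln_mult)
qed

lemma d_segment_discs:
 assumes "x \<in> Omega" "y \<in> Omega" "R > 0"
  and disc: "!!z c. z \<in> closed_segment x y ==> cmod c <= 1 ==> z + c *s (R *\<^sub>R (y - x)) \<in> Omega"
 shows "d x y <= C1 / R"
proof (rule d_segment[OF assms(1,2)])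
 fix z assume z: "z \<in> closed_segment x y"
 have "z \<in> Omega" using z convex_contains_segment[of Omega] convex_dom assms(1,2) by blast
 then have "nrm z (R *\<^sub>R (y - x)) <= C1" by (rule nrm_upper_disc) (rule disc[OF z])
 then show "nrm z (y - x) <= C1 / R" using assms(3) unfolding nrm_scaleR by (simp add: field_simps)
qed

text \<open>Lipschitz constant of homotheties. \<open>C0 * C1\<close> compares the lower and the
  upper bound that disc sizes give for norms; the factor 2 buys a strict inequality.\<close>

definition M1 :: real where "M1 = max 1 (2 * C0 * C1)"

lemma M1_ge_1: "M1 >= 1" by (simp add: M1_def)

text \<open>By convexity a homothety with centre in the domain maps discs in the domain to discs in
  the domain, and norms are comparable to disc sizes.\<close>

lemma nrm_homothety:
 assumes p: "p \<in> Omega" "z \<in> Omega" and lam: "0 < mu" "mu <= 1"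
 shows "nrm (p + mu *\<^sub>R (z - p)) (mu *\<^sub>R v) <= M1 * nrm z v"
proof (cases "v = 0")
 case True
 have "nrm w 0 = 0" for w using nrm_scaleR[of w 0 0] by simp
 then show ?thesis using True by simp
next
 case False
 then have N: "nrm z v > 0" by (rule nrm_pos[OF p(2)])
 define k where "k = 1 / (2 * C0 * nrm z v)"
 have k: "k > 0" using N C0_pos by (simp add: k_def)
 have nk: "C0 * nrm z (k *\<^sub>R v) < 1" using N C0_pos k by (simp add: nrm_scaleR k_def)
 have disc: "p + mu *\<^sub>R (z - p) + c *s (k *\<^sub>R (mu *\<^sub>R v)) \<in> Omega" if c: "cmod c <= 1" for c
 proof -
  have "z + c *s (k *\<^sub>R v) \<in> Omega" using nrm_lower_disc[OF p(2) c, of "k *\<^sub>R v"] nk by force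
  then have "(1 - mu) *\<^sub>R p + mu *\<^sub>R (z + c *s (k *\<^sub>R v)) \<in> Omega"
  using convexD_alt[OF convex_dom p(1), of "z + c *s (k *\<^sub>R v)" mu] lam by simp
  moreover have "mu *\<^sub>R (c *s (k *\<^sub>R v)) = c *s (k *\<^sub>R (mu *\<^sub>R v))"
  by (simp add: linear_scale[OF linear_smult] mult.commute)
  ultimately show ?thesis by (simp add: algebra_simps)
 qed
 have "p + mu *\<^sub>R (z - p) \<in> Omega" using disc[of 0] by simp
 from nrm_upper_disc[OF this disc] have "k * nrm (p + mu *\<^sub>R (z - p)) (mu *\<^sub>R v) <= C1"
  using k unfolding nrm_scaleR[of _ k] by simp
 then have "nrm (p + mu *\<^sub>R (z - p)) (mu *\<^sub>R v) <= 2 * C0 * C1 * nrm z v"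
  using N C0_pos by (simp add: k_def field_simps)
 also have "... <= M1 * nrm z v" using N by (intro mult_right_mono) (auto simp: M1_def)
 finally show ?thesis .
qed

lemma d_homothety:
 assumes p: "p \<in> Omega" and xy: "x \<in> Omega" "y \<in> Omega" and lam: "0 < mu" "mu <= 1"
 shows "d (p + mu *\<^sub>R (x - p)) (p + mu *\<^sub>R (y - p)) <= M1 * d x y"
proof (rule field_le_epsilon)
 fix e :: real assume e: "e > 0"
 define h where "h z = p + mu *\<^sub>R (z - p)" for z
 have hO: "h z \<in> Omega" if "z \<in> Omega" for z
  using convexD_alt[OF convex_dom p that, of mu] lam by (simp add: h_def algebra_simps)
 have e': "e / M1 > 0" using e M1_ge_1 by simp
 obtain gamma L where g: "arc gamma L" "pathstart gamma = x" "pathfinish gamma = y" "L < d x y + e / M1"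
  using d_approx[OF xy e'] by blast
 have v: "valid_path gamma" and sub: "path_image gamma \<subseteq> Omega" and len: "plen nrm gamma L" using g(1) by (auto simp: arc_def)
 obtain S where S: "finite S" "gamma C1_differentiable_on ({0..1} - S)" and cg: "continuous_on {0..1} gamma"
  using v unfolding valid_path_def piecewise_C1_differentiable_on_def by blast
 have S2: "!!t. t \<in> {0..1} - S ==> gamma differentiable at t" "continuous_on ({0..1} - S) (%t. vector_derivative gamma (at t))"
  using S(2) unfolding C1_differentiable_on_eq by auto
 have gO: "gamma t \<in> Omega" if "t \<in> {0..1}" for t using sub that by (auto simp: path_image_def)
 have vd: "((h \<circ> gamma) has_vector_derivative mu *\<^sub>R vector_derivative gamma (at t)) (at t)" if "t \<in> {0..1} - S" for t
 proof -
  have "(gamma has_vector_derivative vector_derivative gamma (at t)) (at t)" using S2(1)[OF that] by (simp add: vector_derivative_works)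
  then show ?thesis unfolding h_def o_def by (auto intro!: derivative_eq_intros)
 qed
 define F where "F t = nrm (h (gamma t)) (mu *\<^sub>R vector_derivative gamma (at t))" for t
 define N where "N t = nrm (gamma t) (vector_derivative gamma (at t))" for t
 have FN: "F t <= M1 * N t" if "t \<in> {0..1}" for t
  unfolding F_def N_def h_def by (rule nrm_homothety[OF p gO[OF that] lam])
 have F0: "0 <= F t" for t unfolding F_def by (rule nrm_nonneg)
 have NI: "((%t. M1 * N t) has_integral M1 * L) {0..1}"
  using len has_integral_mult_right unfolding plen_def N_def by blast
 have spike: "f integrable_on ({0..1} - S) \<longleftrightarrow> f integrable_on {0..1}" for f :: "real => real"
  by (rule integrable_spike_set_eq) (rule negligible_subset[OF negligible_finite[OF S(1)]], auto)
 \<comment> \<open>The speed \<open>F\<close> of the image path may be unbounded near the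
   exceptional points, so continuity does not settle integrability; \<open>F\<close> is measurable
   and dominated by the integrable \<open>M1 * N\<close>.\<close>
 have "continuous_on ({0..1} - S) (%t. (%(z, v). nrm z v) (h (gamma t), mu *\<^sub>R vector_derivative gamma (at t)))"
 proof (rule continuous_on_compose2[OF continuous_on_nrm])
  show "continuous_on ({0..1} - S) (%t. (h (gamma t), mu *\<^sub>R vector_derivative gamma (at t)))"
  unfolding h_def by (intro continuous_intros S2(2) continuous_on_subset[OF cg]) auto
 qed (use gO hO in auto)
 then have "F \<in> borel_measurable (lebesgue_on ({0..1} - S))"
  unfolding F_def[abs_def]
  by (intro continuous_imp_measurable_on_sets_lebesgue sets.Diff negligible_imp_sets[OF negligible_finite[OF S(1)]]) auto
 then have "F integrable_on ({0..1} - S)"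
 proof (rule measurable_bounded_by_integrable_imp_integrable)
  show "(%t. M1 * N t) integrable_on ({0..1} - S)" using NI spike by (auto simp: integrable_on_def)
  show "{0..1} - S \<in> sets lebesgue" by (intro sets.Diff negligible_imp_sets[OF negligible_finite[OF S(1)]]) auto
 qed (use FN F0 in auto)
 then have "F integrable_on {0..1}" by (simp add: spike)
 then obtain L' where L': "(F has_integral L') {0..1}" by (auto simp: integrable_on_def)
 have LL: "L' <= M1 * L" by (rule has_integral_le[OF L' NI]) (rule FN)
 have "plen nrm (h \<circ> gamma) L'" unfolding plen_def
  by (rule has_integral_spike_finite[OF S(1) _ L']) (simp add: F_def vector_derivative_at[OF vd])
 moreover have "valid_path (h \<circ> gamma)" unfolding valid_path_def piecewise_C1_differentiable_on_def
 proof (intro conjI exI)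
  show "continuous_on {0..1} (h \<circ> gamma)" unfolding h_def o_def by (intro continuous_intros cg)
  show "finite S" by (rule S(1))
  show "(h \<circ> gamma) C1_differentiable_on ({0..1} - S)" unfolding C1_differentiable_on_def
  proof (intro exI conjI ballI)
  show "((h \<circ> gamma) has_vector_derivative mu *\<^sub>R vector_derivative gamma (at t)) (at t)" if "t \<in> {0..1} - S" for t by (rule vd[OF that])
  qed (intro continuous_intros S2(2))
 qed
 moreover have "path_image (h \<circ> gamma) \<subseteq> Omega" using gO hO by (auto simp: path_image_def)
 ultimately have "arc (h \<circ> gamma) L'" by (simp add: arc_def)
 from d_le[OF this] have "d (h x) (h y) <= L'" using g(2,3) by (simp add: pathstart_compose pathfinish_compose)
 also have "... <= M1 * (d x y + e / M1)" using LL g(4) M1_ge_1 by (smt (verit) mult_left_mono)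
 also have "... = M1 * d x y + e" using M1_ge_1 by (simp add: distrib_left)
 finally show "d (p + mu *\<^sub>R (x - p)) (p + mu *\<^sub>R (y - p)) <= M1 * d x y + e" by (simp add: h_def)
qed

end

subsection \<open>A criterion for Gromov hyperbolicity\<close>

text \<open>Four instances at \<open>p\<close> give the four-point inequality for sums of two
  products. A change of base point alters all these sums equally.\<close>

lemma gromov_hyperbolic_basepoint:
 assumes sym: "!!x y. x \<in> X ==> y \<in> X ==> d x y = d y x" and "delta >= 0"
  and hyp: "!!x y z. x \<in> X ==> y \<in> X ==> z \<in> X ==>
  gromov_product d p x z >= min (gromov_product d p x y) (gromov_product d p y z) - delta"
  and p: "p \<in> X"
 shows "gromov_hyperbolic X d"
 unfolding gromov_hyperbolic_def
proof (intro exI[of _ "2 * delta"] conjI ballI)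
 fix x y z w assume X: "x \<in> X" "y \<in> X" "z \<in> X" "w \<in> X"
 define P where "P a b = gromov_product d p a b" for a b
 have P: "P a b = P b a" if "a \<in> X" "b \<in> X" for a b
  using sym[OF that] sym[OF that(1) p] sym[OF that(2) p] by (simp add: P_def gromov_product_def)
 have h: "P a c >= min (P a b) (P b c) - delta" if "a \<in> X" "b \<in> X" "c \<in> X" for a b c
  unfolding P_def by (rule hyp[OF that])
 have "P x z + P y w >= min (P x y + P z w) (P y z + P x w) - 2 * delta"
  using h[OF X(1,2,3)] h[OF X(1,4,3)] h[OF X(2,1,4)] h[OF X(2,3,4)]
  P[OF X(1,2)] P[OF X(3,4)] P[OF X(2,3)] P[OF X(1,4)] by linarith
 then show "gromov_product d w x z >= min (gromov_product d w x y) (gromov_product d w y z) - 2 * delta"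
  using sym[OF X(4,1)] sym[OF X(4,2)] sym[OF X(4,3)] sym[OF X(1) p] sym[OF X(2) p] sym[OF X(3) p] sym[OF X(4) p]
  sym[OF X(1,2)] sym[OF X(2,3)] sym[OF X(1,3)]
  by (simp add: P_def gromov_product_def field_simps min_def split: if_splits)
qed (use assms(2) in simp)

text \<open>An explicit point where the exponential has overtaken the linear function. It ends both
  the stability argument for almost geodesics and the exclusion of flats.\<close>

lemma two_power_le_linear:
 fixes A B :: real
 assumes "A >= 0" "B >= 0" "2 ^ n <= A * real n + B"
 shows "real n <= A + B + 4"
proof (rule ccontr)
 assume n: "~ real n <= A + B + 4"
 then have n4: "n >= 4" using assms by linarith
 have "k\<^sup>2 <= 2 ^ k" if "k >= 4" for k :: nat
  using that
 proof (induction k rule: dec_induct)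
  case (step k)
  have "(Suc k)\<^sup>2 <= 2 * k\<^sup>2"
  proof -
  have k4: "4 <= k" using step.hyps by simp
  then have "4 * k <= k * k" by (rule mult_le_mono1)
  moreover have "Suc k * Suc k = k * k + 2 * k + 1" by simp
  ultimately show ?thesis using k4 unfolding power2_eq_square by linarith
  qed
  then show ?case using step by simp
 qed simp
 then have "real (n\<^sup>2) <= real (2 ^ n)" using n4 by (simp only: of_nat_le_iff)
 then have "real n * real n <= A * real n + B" using assms(3) by (simp add: power2_eq_square)
 moreover have "(A + B + 4) * real n <= real n * real n" using n by (intro mult_right_mono) auto
 moreover have "B <= B * real n" using assms(2) n4 by (simp add: mult_le_cancel_left1)
 moreover have "4 * real n > 0" using n4 by simp
 ultimately show False by (simp add: algebra_simps)
qed

text \<open>Rays \<open>c x\<close> run from a common origin to \<open>x\<close>, parametrized by a height. If two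
 rays that are close at some height are very close a bounded amount below it, then the space is
 hyperbolic: the path that descends along the ray of \<open>x\<close> to the branching height and climbs
 along the ray of \<open>y\<close> stays near all almost geodesics from \<open>x\<close> to \<open>y\<close>.\<close>

locale ray_space =
 fixes X :: "'a set" and d :: "'a => 'a => real" and s :: "'a => real" and c :: "'a => real => 'a"
  and p0 :: 'a and C M :: real
 assumes d_ge0: "!!x y. x \<in> X ==> y \<in> X ==> d x y >= 0"
  and d_zero: "!!x. x \<in> X ==> d x x = 0"
  and d_sym: "!!x y. x \<in> X ==> y \<in> X ==> d x y = d y x"
  and d_tri: "!!x y z. x \<in> X ==> y \<in> X ==> z \<in> X ==> d x z <= d x y + d y z"
  and geo: "!!x y. x \<in> X ==> y \<in> X ==> \<exists>w lf. w (0::real) = x & w 1 = y & (\<forall>t\<in>{0..1}. w t \<in> X) &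
  lf 0 = (0::real) & lf 1 < d x y + 1 & continuous_on {0..1} lf &
  (\<forall>a b. 0 <= a --> a <= b --> b <= 1 --> d (w a) (w b) <= lf b - lf a)"
  and p0: "p0 \<in> X"
  and s0: "!!x. x \<in> X ==> s x >= 0"
  and c_in: "!!x t. x \<in> X ==> 0 <= t ==> t <= s x ==> c x t \<in> X"
  and c_end: "!!x. x \<in> X ==> c x (s x) = x"
  and c_start: "!!x. x \<in> X ==> c x 0 = p0"
  and s_c: "!!x t. x \<in> X ==> 0 <= t ==> t <= s x ==> s (c x t) = t"
  and c_c: "!!x t u. x \<in> X ==> 0 <= u ==> u <= t ==> t <= s x ==> c (c x t) u = c x u"
  and C1: "C >= 1" and M1: "M >= 1"
  and c_lip: "!!x t u. x \<in> X ==> 0 <= t ==> t <= u ==> u <= s x ==> d (c x t) (c x u) <= C * (u - t)"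
  and s_lip: "!!x y. x \<in> X ==> y \<in> X ==> \<bar>s x - s y\<bar> <= C * d x y + C"
  and mono: "!!x y t u. x \<in> X ==> y \<in> X ==> 0 <= t ==> t <= u ==> u <= s x ==> u <= s y ==>
  d (c x t) (c y t) <= M * d (c x u) (c y u)"
  and contr: "!!K. \<exists>sigma\<ge>0. \<forall>x\<in>X. \<forall>y\<in>X. \<forall>t. sigma <= t --> t <= s x --> t <= s y -->
  d (c x t) (c y t) <= K --> d (c x (t - sigma)) (c y (t - sigma)) <= 1"
begin

definition bset :: "'a => 'a => real set" where
 "bset x y = {t. 0 <= t & t <= s x & t <= s y & d (c x t) (c y t) <= 1}"

definition b :: "'a => 'a => real" where "b x y = Sup (bset x y)"

text \<open>A comb of two ray segments without a bridge between them: their lower ends are at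
  distance at most \<open>M'\<close>.\<close>

definition eta :: "'a => 'a => 'a set" where
 "eta x y = {c x t |t. b x y <= t & t <= s x} \<union> {c y t |t. b x y <= t & t <= s y}"

text \<open>The supremum \<open>b\<close> need not be attained. Descending by at most one unit to a
  height where the rays are close costs \<open>C\<close> on each ray.\<close>

definition M' :: real where "M' = M + 2 * C"

lemma bset_0: "x \<in> X ==> y \<in> X ==> 0 \<in> bset x y"
 using s0 p0 d_zero by (auto simp: bset_def c_start)

lemma bset_bdd: "bdd_above (bset x y)"
 by (rule bdd_aboveI[of _ "s x"]) (auto simp: bset_def)

lemma b_bounds:
 assumes "x \<in> X" "y \<in> X" shows "0 <= b x y" "b x y <= s x" "b x y <= s y"
proof -
 show "0 <= b x y" unfolding b_def by (rule cSup_upper[OF bset_0[OF assms] bset_bdd])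
 show "b x y <= s x" "b x y <= s y" unfolding b_def
  by (rule cSup_least; use bset_0[OF assms] in \<open>auto simp: bset_def\<close>)+
qed

lemma b_commute: "x \<in> X ==> y \<in> X ==> b x y = b y x"
proof -
 assume "x \<in> X" "y \<in> X"
 then have "bset x y = bset y x" unfolding bset_def using d_sym c_in by (auto simp: d_sym)
 then show ?thesis by (simp add: b_def)
qed

lemma eta_commute: "x \<in> X ==> y \<in> X ==> eta x y = eta y x"
 unfolding eta_def using b_commute by auto

lemma eta_sub: "x \<in> X ==> y \<in> X ==> eta x y \<subseteq> X"
 unfolding eta_def using b_bounds[of x y] c_in by force

lemma below_b:
 assumes xy: "x \<in> X" "y \<in> X" and t: "0 <= t" "t <= b x y"
 shows "d (c x t) (c y t) <= M'"
proof (cases "t = 0")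
 case True
 then show ?thesis using xy p0 d_zero C1 M1 by (simp add: c_start M'_def)
next
 case False
 define u where "u = max 0 (t - 1)"
 have u: "0 <= u" "u < t" "t - u <= 1" using t False by (auto simp: u_def)
 then have "u < Sup (bset x y)" using t by (simp add: b_def)
 then obtain v where v: "v \<in> bset x y" "u < v" using less_cSup_iff[OF _ bset_bdd] bset_0[OF xy] by blast
 have bt: "t <= s x" "t <= s y" using b_bounds[OF xy] t by auto
 have "d (c x u) (c y u) <= M * d (c x v) (c y v)" by (rule mono) (use xy v u in \<open>auto simp: bset_def\<close>)
 also have "... <= M * 1" using v M1 by (intro mult_left_mono) (auto simp: bset_def)
 finally have 1: "d (c x u) (c y u) <= M" by simp
 have in4: "c x t \<in> X" "c y t \<in> X" "c x u \<in> X" "c y u \<in> X" using c_in xy bt u t by auto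
 have "d (c x u) (c x t) <= C * (t - u)" "d (c y u) (c y t) <= C * (t - u)"
  using c_lip xy u bt by auto
 moreover have "C * (t - u) <= C * 1" using u C1 by (intro mult_left_mono) auto
 ultimately have "d (c x t) (c x u) <= C" "d (c y u) (c y t) <= C" using d_sym in4 by auto
 then show ?thesis using 1 d_tri[OF in4(1,3,2)] d_tri[OF in4(3,4,2)] by (simp add: M'_def)
qed

text \<open>Closeness of any size \<open>K\<close> at height \<open>t\<close> forces closeness 1 at
  \<open>t - sigma\<close>, which is then a member of \<open>bset x y\<close>.\<close>

lemma contr_b:
 obtains sigma where "sigma >= 0" "!!x y t. x \<in> X ==> y \<in> X ==> 0 <= t ==> t <= s x ==> t <= s y ==>
  d (c x t) (c y t) <= K ==> t <= b x y + sigma"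
proof -
 obtain sigma where sigma: "sigma >= 0" "\<forall>x\<in>X. \<forall>y\<in>X. \<forall>t. sigma <= t --> t <= s x --> t <= s y -->
  d (c x t) (c y t) <= K --> d (c x (t - sigma)) (c y (t - sigma)) <= 1" using contr by blast
 show ?thesis
 proof (rule that[OF sigma(1)])
  fix x y t assume a: "x \<in> X" "y \<in> X" "0 <= t" "t <= s x" "t <= s y" "d (c x t) (c y t) <= K"
  show "t <= b x y + sigma"
  proof (cases "sigma <= t")
  case True
  then have "t - sigma \<in> bset x y" using a sigma by (auto simp: bset_def)
  then have "t - sigma <= b x y" unfolding b_def by (rule cSup_upper[OF _ bset_bdd])
  then show ?thesis by simp
  next
  case False
  then show ?thesis using b_bounds(1)[OF a(1,2)] by simp
  qed
 qed
qed

text \<open>Branching heights satisfy the ultrametric inequality up to \<open>sigma\<close>, since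
  the middle ray passes near both others. So if neither \<open>x\<close> nor \<open>y\<close> has
  branched off from \<open>z\<close> by height \<open>t >= b x y\<close>, one of them does so by
  height \<open>t + sigma\<close>.\<close>

lemma thin:
 obtains h where "h >= 0" "!!x y z p. x \<in> X ==> y \<in> X ==> z \<in> X ==> p \<in> eta x y ==>
  \<exists>q \<in> eta x z \<union> eta z y. d p q <= h"
  "!!x y z. x \<in> X ==> y \<in> X ==> z \<in> X ==> min (b x y) (b y z) <= b x z + h"
proof -
 obtain sigma where sigma: "sigma >= 0" "!!x y t. x \<in> X ==> y \<in> X ==> 0 <= t ==> t <= s x ==> t <= s y ==>
  d (c x t) (c y t) <= 2 * M' ==> t <= b x y + sigma"
  using contr_b[of "2 * M'"] by blast
 define h where "h = M' + C * sigma"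
 have M'0: "M' >= 0" using M1 C1 by (simp add: M'_def)
 have hsigma: "sigma <= h" "C * sigma <= h" using sigma(1) C1 M'0 mult_right_mono[of 1 C sigma] by (auto simp: h_def)
 have mb: "min (b x y) (b y z) <= b x z + sigma" if X: "x \<in> X" "y \<in> X" "z \<in> X" for x y z
 proof -
  define t where "t = min (b x y) (b y z)"
  have t: "0 <= t" "t <= s x" "t <= s y" "t <= s z"
  using b_bounds[OF X(1,2)] b_bounds[OF X(2,3)] by (auto simp: t_def)
  have "d (c x t) (c y t) <= M'" "d (c y t) (c z t) <= M'"
  using below_b[OF X(1,2) t(1)] below_b[OF X(2,3) t(1)] by (auto simp: t_def)
  then have "d (c x t) (c z t) <= 2 * M'"
  using d_tri[of "c x t" "c y t" "c z t"] c_in X t by force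
  then show ?thesis using sigma(2)[OF X(1,3) t(1,2,4)] by (simp add: t_def)
 qed
 have half: "\<exists>q \<in> eta x z \<union> eta z y. d (c x t) q <= h"
  if X: "x \<in> X" "y \<in> X" "z \<in> X" and t: "b x y <= t" "t <= s x" for x y z t
 proof -
  have t0: "0 <= t" using t b_bounds[OF X(1,2)] by simp
  have cx: "c x t \<in> X" using c_in X t t0 by simp
  show ?thesis
  proof (cases "b x z <= t")
  case True
  then have "c x t \<in> eta x z" using t by (auto simp: eta_def)
  then show ?thesis using d_zero[OF cx] hsigma sigma(1) by (intro bexI[of _ "c x t"]) auto
  next
  case F1: False
  then have tz: "t <= s z" using b_bounds[OF X(1,3)] by simp
  have cz: "c z t \<in> X" using c_in X tz t0 by simp
  have xz: "d (c x t) (c z t) <= M'" by (rule below_b[OF X(1,3) t0]) (use F1 in simp)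
  show ?thesis
  proof (cases "b z y <= t")
  case True
  then have "c z t \<in> eta z y" using tz by (auto simp: eta_def)
  moreover have "M' <= h" using sigma(1) C1 by (simp add: h_def)
  ultimately show ?thesis using xz by (intro bexI[of _ "c z t"]) auto
  next
  case F2: False
  define t1 where "t1 = min (b x z) (b z y)"
  have t1: "t < t1" "t1 <= t + sigma" using F1 F2 mb[OF X(1,3,2)] t(1) by (auto simp: t1_def)
  have "C * (t1 - t) <= C * sigma" using t1(2) C1 by (intro mult_left_mono) auto
  consider "t1 = b x z" | "t1 = b z y" unfolding t1_def by linarith
  then show ?thesis
  proof cases
  case 1
  have "t1 <= s x" using b_bounds[OF X(1,3)] 1 by simp
  then have "c x t1 \<in> eta x z" "d (c x t) (c x t1) <= C * (t1 - t)"
  using 1 c_lip[OF X(1) t0, of t1] t1(1) by (auto simp: eta_def)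
  then show ?thesis using \<open>C * (t1 - t) <= C * sigma\<close> hsigma by (intro bexI[of _ "c x t1"]) auto
  next
  case 2
  have t1z: "t1 <= s z" using b_bounds[OF X(3,2)] 2 by simp
  then have "c z t1 \<in> eta z y" "d (c z t) (c z t1) <= C * (t1 - t)"
  using 2 c_lip[OF X(3) t0, of t1] t1(1) by (auto simp: eta_def)
  moreover have "d (c x t) (c z t1) <= d (c x t) (c z t) + d (c z t) (c z t1)"
  by (rule d_tri) (use cx cz c_in[OF X(3)] t1z t1 t0 in auto)
  ultimately show ?thesis using \<open>C * (t1 - t) <= C * sigma\<close> xz by (intro bexI[of _ "c z t1"]) (auto simp: h_def)
  qed
  qed
  qed
 qed
 show ?thesis
 proof (rule that[of h])
  show "h >= 0" using hsigma sigma(1) by simp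
  fix x y z assume X: "x \<in> X" "y \<in> X" "z \<in> X"
  show "min (b x y) (b y z) <= b x z + h" using mb[OF X] hsigma by simp
  fix p assume "p \<in> eta x y"
  then consider t where "p = c x t" "b x y <= t" "t <= s x" | t where "p = c y t" "b y x <= t" "t <= s y"
  using b_commute[OF X(1,2)] by (auto simp: eta_def)
  then show "\<exists>q \<in> eta x z \<union> eta z y. d p q <= h"
  proof cases
  case 1
  then show ?thesis using half[OF X] by simp
  next
  case 2
  then show ?thesis using half[OF X(2,1,3)] eta_commute[OF X(2,3)] eta_commute[OF X(1,3)] by (simp add: Un_commute)
  qed
 qed
qed

text \<open>The base case of the bisection in \<open>eta_near_chain\<close>.\<close>

lemma short_eta:
 obtains h where "h >= 0" "!!x y p. x \<in> X ==> y \<in> X ==> d x y <= 1 ==> p \<in> eta x y ==> d p x <= h"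
proof -
 define k2 where "k2 = C * (2 * C) + 1"
 obtain sigma where sigma: "sigma >= 0" "!!x y t. x \<in> X ==> y \<in> X ==> 0 <= t ==> t <= s x ==> t <= s y ==>
  d (c x t) (c y t) <= k2 ==> t <= b x y + sigma"
  using contr_b[of k2] by blast
 define h where "h = C * (2 * C + sigma) + 1"
 show ?thesis
 proof (rule that[of h])
  show "h >= 0" using C1 sigma(1) by (simp add: h_def)
  fix x y p assume X: "x \<in> X" "y \<in> X" and d1: "d x y <= 1" and p: "p \<in> eta x y"
  have "C * d x y <= C * 1" using d1 C1 by (intro mult_left_mono) auto
  then have sd: "\<bar>s x - s y\<bar> <= 2 * C" using s_lip[OF X] by linarith
  define t where "t = min (s x) (s y)"
  have t: "0 <= t" "t <= s x" "t <= s y" using s0 X by (auto simp: t_def)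
  have "d (c x t) (c y t) <= k2"
  proof (cases "s x <= s y")
  case True
  then have "t = s x" by (simp add: t_def)
  then have cx: "c x t = x" using c_end X by simp
  have "d (c y t) (c y (s y)) <= C * (s y - t)" by (rule c_lip[OF X(2) t(1,3)]) simp
  also have "... <= C * (2 * C)" using sd \<open>t = s x\<close> C1 by (intro mult_left_mono) auto
  finally have "d y (c y t) <= C * (2 * C)" using d_sym[OF X(2) c_in[OF X(2) t(1,3)]] c_end[OF X(2)] by simp
  then show ?thesis using d_tri[OF X c_in[OF X(2) t(1,3)]] d1 cx by (simp add: k2_def)
  next
  case False
  then have "t = s y" by (simp add: t_def)
  then have cy: "c y t = y" using c_end X by simp
  have "d (c x t) (c x (s x)) <= C * (s x - t)" by (rule c_lip[OF X(1) t(1,2)]) simp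
  also have "... <= C * (2 * C)" using sd \<open>t = s y\<close> C1 by (intro mult_left_mono) auto
  finally have "d (c x t) x <= C * (2 * C)" using c_end[OF X(1)] by simp
  then show ?thesis using d_tri[OF c_in[OF X(1) t(1,2)] X] d1 cy by (simp add: k2_def)
  qed
  then have tb: "t <= b x y + sigma" using sigma(2)[OF X t] by simp
  have cl: "d (c w u) w <= C * (2 * C + sigma)" if w: "w \<in> {x, y}" and u: "b x y <= u" "u <= s w" for w u
  proof -
  have wX: "w \<in> X" using w X by auto
  have u0: "0 <= u" using u b_bounds[OF X] by simp
  have "d (c w u) (c w (s w)) <= C * (s w - u)" by (rule c_lip[OF wX u0 u(2)]) simp
  also have "... <= C * (2 * C + sigma)" using w sd tb u C1 by (intro mult_left_mono) (auto simp: t_def)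
  finally show ?thesis using c_end[OF wX] by simp
  qed
  from p consider u where "p = c x u" "b x y <= u" "u <= s x" | u where "p = c y u" "b x y <= u" "u <= s y"
  by (auto simp: eta_def)
  then show "d p x <= h"
  proof cases
  case 1
  then show ?thesis using cl[of x u] by (simp add: h_def)
  next
  case 2
  have "p \<in> X" using p eta_sub[OF X] by blast
  then show ?thesis using cl[of y u] 2 d_tri[of p y x] X d1 d_sym[OF X] by (simp add: h_def)
  qed
 qed
qed

section \<open>Chains of unit steps and the stability of combs\<close>

definition chain :: "(nat => 'a) => nat => bool" where
 "chain a n \<longleftrightarrow> (\<forall>i\<le>n. a i \<in> X) & (\<forall>i<n. d (a i) (a (Suc i)) <= 1)"

text \<open>Each bisection of the chain costs one application of thinness, so the distance to a
  chain grows with the logarithm of its number of steps only.\<close>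

lemma eta_near_chain:
 obtains h where "h >= 0" "!!a n p. chain a (2 ^ n) ==> p \<in> eta (a 0) (a (2 ^ n)) ==>
  \<exists>i\<le>2^n. d p (a i) <= h * (real n + 1)"
proof -
 obtain h1 where h1: "h1 >= 0" "!!x y z p. x \<in> X ==> y \<in> X ==> z \<in> X ==> p \<in> eta x y ==>
  \<exists>q \<in> eta x z \<union> eta z y. d p q <= h1"
  by (rule thin) blast
 obtain h2 where h2: "h2 >= 0" "!!x y p. x \<in> X ==> y \<in> X ==> d x y <= 1 ==> p \<in> eta x y ==> d p x <= h2"
  by (rule short_eta) blast
 define h where "h = max h1 h2"
 show ?thesis
 proof (rule that[of h])
  show "h >= 0" using h1 by (simp add: h_def)
  fix a n p assume "chain a (2 ^ n)" "p \<in> eta (a 0) (a (2 ^ n))"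
  then show "\<exists>i\<le>2^n. d p (a i) <= h * (real n + 1)"
  proof (induction n arbitrary: a p)
  case 0
  then have "d p (a 0) <= h2" using h2(2)[of "a 0" "a 1" p] by (auto simp: chain_def)
  then show ?case by (intro exI[of _ 0]) (auto simp: h_def)
  next
  case (Suc n)
  define a' where "a' i = a (2 ^ n + i)" for i
  have ch: "chain a (2 ^ n)" "chain a' (2 ^ n)" using Suc.prems(1) by (auto simp: chain_def a'_def)
  have X: "a 0 \<in> X" "a (2 ^ Suc n) \<in> X" "a (2 ^ n) \<in> X" using Suc.prems(1) by (auto simp: chain_def)
  have pX: "p \<in> X" using Suc.prems(2) eta_sub[OF X(1,2)] by blast
  obtain q where q: "q \<in> eta (a 0) (a (2 ^ n)) \<union> eta (a (2 ^ n)) (a (2 ^ Suc n))" "d p q <= h1"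
  using h1(2)[OF X(1,2,3) Suc.prems(2)] by blast
  have ends: "a' 0 = a (2 ^ n)" "a' (2 ^ n) = a (2 ^ Suc n)" by (auto simp: a'_def mult_2)
  have "\<exists>i\<le>2 ^ Suc n. d q (a i) <= h * (real n + 1)"
  proof (cases "q \<in> eta (a 0) (a (2 ^ n))")
  case True
  then obtain i where "i <= 2 ^ n" "d q (a i) <= h * (real n + 1)" using Suc.IH[OF ch(1)] by blast
  then show ?thesis by (intro exI[of _ i]) auto
  next
  case False
  then obtain i where "i <= 2 ^ n" "d q (a' i) <= h * (real n + 1)" using Suc.IH[OF ch(2)] q(1) ends by auto
  then show ?thesis by (intro exI[of _ "2 ^ n + i"]) (auto simp: a'_def)
  qed
  then obtain i where i: "i <= 2 ^ Suc n" "d q (a i) <= h * (real n + 1)" by blast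
  have "q \<in> X" using q(1) eta_sub X by blast
  then have "d p (a i) <= d p q + d q (a i)" using d_tri[OF pX] i(1) Suc.prems(1) by (auto simp: chain_def)
  also have "... <= h + h * (real n + 1)" using q(2) i(2) by (simp add: h_def)
  finally show ?case using i(1) by (intro exI[of _ i]) (auto simp: algebra_simps)
  qed
 qed
qed

text \<open>An almost shortest path is divided into about \<open>d x y\<close> pieces of equal arc
  length at most 1. Since its total length exceeds \<open>d x y\<close> by less than 1, no part of
  it can be much longer than necessary.\<close>

lemma geo_chain:
 assumes "x \<in> X" "y \<in> X"
 obtains a n where "chain a n" "a 0 = x" "a n = y"
  "!!i j. i <= j ==> j <= n ==> real (j - i) <= d (a i) (a j) + 2"
  "!!i. i <= n ==> d x (a i) + d (a i) y <= d x y + 1"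
proof -
 obtain w lf where w: "w (0::real) = x" "w 1 = y" "!!t. t \<in> {0..1} ==> w t \<in> X"
  "lf 0 = (0::real)" "lf 1 < d x y + 1" "continuous_on {0..1} lf"
  "!!a b. 0 <= a ==> a <= b ==> b <= 1 ==> d (w a) (w b) <= lf b - lf a"
  using geo[OF assms] by blast
 define L where "L = lf 1"
 have L: "d x y <= L" "L < d x y + 1" using w(7)[of 0 1] w(1,2,4,5) by (auto simp: L_def)
 have L0: "0 <= L" using L(1) d_ge0[OF assms] by simp
 define n where "n = max 1 (nat \<lceil>L\<rceil>)"
 have n: "n >= 1" "L <= real n" "real n <= L + 1" using L0 by (auto simp: n_def) linarith+
 have "\<exists>t. 0 <= t & t <= 1 & lf t = real i * L / real n" if "i <= n" for i
 proof -
  have "real i * L / real n <= L" using that n L0 by (simp add: divide_le_eq mult.commute mult_left_mono)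
  then show ?thesis using IVT'[of lf 0 "real i * L / real n" 1] w(4,6) L0 by (auto simp: L_def)
 qed
 then have ex: "\<exists>t. i <= n --> 0 <= t & t <= 1 & lf t = real i * L / real n" for i by blast
 define tt where "tt i = (SOME t. 0 <= t & t <= 1 & lf t = real i * L / real n)" for i
 have tt: "0 <= tt i" "tt i <= 1" "lf (tt i) = real i * L / real n" if "i <= n" for i
  using someI_ex[of "%t. 0 <= t & t <= 1 & lf t = real i * L / real n"] ex[of i] that unfolding tt_def by auto
 define a where "a i = (if i = 0 then x else if i = n then y else w (tt i))" for i
 define ti where "ti i = (if i = 0 then 0 else if i = n then 1 else tt i)" for i
 have ti: "0 <= ti i" "ti i <= 1" "lf (ti i) = real i * L / real n" "a i = w (ti i)" if "i <= n" for i
  using tt[OF that] w(1,2,4) n by (auto simp: ti_def a_def L_def)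
 have aX: "a i \<in> X" if "i <= n" for i using ti[OF that] w(3) by auto
 have dij: "d (a i) (a j) <= real (j - i) * L / real n" if "i <= j" "j <= n" for i j
 proof -
  have i: "i <= n" using that by simp
  have "d (w u) (w v) <= \<bar>lf v - lf u\<bar>" if "0 <= u" "u <= 1" "0 <= v" "v <= 1" for u v
  proof (cases "u <= v")
  case False
  have "w u \<in> X" "w v \<in> X" using w(3) that by auto
  then show ?thesis using w(7)[of v u] that False d_sym[of "w u" "w v"] by simp
  qed (use w(7)[of u v] that in simp)
  from this[OF ti(1,2)[OF i] ti(1,2)[OF that(2)]]
  have "d (a i) (a j) <= \<bar>lf (ti j) - lf (ti i)\<bar>" unfolding ti(4)[OF i] ti(4)[OF that(2)] .
  also have "... = real (j - i) * L / real n"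
  using ti(3)[OF i] ti(3)[OF that(2)] that L0 by (simp add: of_nat_diff diff_divide_distrib[symmetric] left_diff_distrib[symmetric])
  finally show ?thesis .
 qed
 have an: "a 0 = x" "a n = y" using n by (auto simp: a_def)
 show ?thesis
 proof (rule that[of a n])
  show "chain a n" unfolding chain_def
  proof (intro conjI allI impI aX)
  fix i assume "i < n"
  then have "d (a i) (a (Suc i)) <= L / real n" using dij[of i "Suc i"] by simp
  also have "... <= 1" using n by (simp add: divide_le_eq)
  finally show "d (a i) (a (Suc i)) <= 1" .
  qed
  show "real (j - i) <= d (a i) (a j) + 2" if ij: "i <= j" "j <= n" for i j
  proof -
  have i: "i <= n" using ij by simp
  have "d x y <= d x (a i) + d (a i) (a j) + d (a j) y"
  using d_tri[OF assms(1) aX[OF i] assms(2)] d_tri[OF aX[OF i] aX[OF ij(2)] assms(2)] by simp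
  also have "d x (a i) <= real i * L / real n" using dij[of 0 i] i an by simp
  also have "d (a j) y <= real (n - j) * L / real n" using dij[of j n] ij an by simp
  finally have "d x y <= d (a i) (a j) + (real i * L / real n + real (n - j) * L / real n)" by simp
  also have "real i * L / real n + real (n - j) * L / real n = L - real (j - i) * L / real n"
  using ij n by (simp add: of_nat_diff field_simps)
  finally have 1: "real (j - i) * L / real n <= d (a i) (a j) + 1" using L by simp
  have "real (j - i) - real (j - i) * L / real n = (real (j - i) / real n) * (real n - L)"
  using n by (simp add: field_simps)
  also have "... <= 1 * (real n - L)" using ij n by (intro mult_right_mono) (auto simp: divide_le_eq)
  also have "... <= 1" using n by simp
  finally show ?thesis using 1 by simp
  qed
  show "d x (a i) + d (a i) y <= d x y + 1" if i: "i <= n" for i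
  proof -
  have "d x (a i) + d (a i) y <= real i * L / real n + real (n - i) * L / real n"
  using dij[of 0 i] dij[of i n] i an by simp
  also have "... = L" using i n by (simp add: of_nat_diff field_simps)
  finally show ?thesis using L by simp
  qed
 qed (use an in auto)
qed

definition conn :: "'a set => 'a => 'a => nat => bool" where
 "conn S x y n \<longleftrightarrow> (\<exists>a. chain a n & a 0 = x & a n = y & (\<forall>i\<le>n. a i \<in> S))"

lemma conn_trans:
 assumes "conn S x y m" "conn S y z n" shows "conn S x z (m + n)"
proof -
 obtain a e where a: "chain a m" "a 0 = x" "a m = y" "\<forall>i\<le>m. a i \<in> S" and e: "chain e n" "e 0 = y" "e n = z" "\<forall>i\<le>n. e i \<in> S"
  using assms unfolding conn_def by blast
 define f where "f i = (if i <= m then a i else e (i - m))" for i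
 have fe: "f i = e (i - m)" if "m <= i" for i using that a(3) e(2) by (cases "i = m") (auto simp: f_def)
 have "d (f i) (f (Suc i)) <= 1" if "i < m + n" for i
 proof (cases "i < m")
  case True
  then show ?thesis using a(1) by (simp add: f_def chain_def)
 next
  case False
  then show ?thesis using fe[of i] fe[of "Suc i"] e(1) that by (simp add: chain_def Suc_diff_le)
 qed
 moreover have "f i \<in> X" "f i \<in> S" if "i <= m + n" for i
  using that a(1,4) e(1,4) by (auto simp: f_def chain_def)
 ultimately have "chain f (m + n) & f 0 = x & f (m + n) = z & (\<forall>i\<le>m+n. f i \<in> S)"
  using a(2) e(3) fe[of "m + n"] by (auto simp: chain_def f_def[of 0])
 then show ?thesis unfolding conn_def by blast
qed

lemma conn_sym:
 assumes "conn S x y n" shows "conn S y x n"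
proof -
 obtain a where a: "chain a n" "a 0 = x" "a n = y" "\<forall>i\<le>n. a i \<in> S" using assms unfolding conn_def by blast
 have "d (a (n - i)) (a (n - Suc i)) <= 1" if "i < n" for i
 proof -
  have "d (a (n - Suc i)) (a (Suc (n - Suc i))) <= 1" using a(1) that by (simp add: chain_def)
  moreover have "Suc (n - Suc i) = n - i" using that by simp
  moreover have "a (n - i) \<in> X" "a (n - Suc i) \<in> X" using a(1) by (auto simp: chain_def)
  ultimately show ?thesis using d_sym by simp
 qed
 then have "chain (%i. a (n - i)) n" using a(1) by (auto simp: chain_def)
 then show ?thesis unfolding conn_def using a by (intro exI[of _ "%i. a (n - i)"]) auto
qed

lemma conn_refl: "x \<in> X ==> x \<in> S ==> conn S x x n"
 unfolding conn_def chain_def using d_zero by (intro exI[of _ "%_. x"]) auto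

lemma conn_pad:
 assumes "conn S x y n" "n <= m" shows "conn S x y m"
proof -
 have "y \<in> X" "y \<in> S" using assms(1) unfolding conn_def chain_def by auto
 from conn_trans[OF assms(1) conn_refl[OF this, of "m - n"]] show ?thesis using assms(2) by simp
qed

lemma conn_subchain:
 assumes a: "chain a n" "\<forall>i\<le>n. a i \<in> S" and ij: "i <= j" "j <= n"
 shows "conn S (a i) (a j) (j - i)"
 unfolding conn_def using assms
 by (intro exI[of _ "%k. a (i + k)"]) (auto simp: chain_def)

text \<open>Shortening rays above the branching height does not change it, so the comb between two
  points of a comb on different rays is a part of it.\<close>

lemma b_c:
 assumes X: "x \<in> X" "y \<in> X" and u: "b x y <= u1" "u1 <= s x" "b x y <= u2" "u2 <= s y"
 shows "b (c x u1) (c y u2) = b x y"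
proof -
 note b0 = b_bounds(1)[OF X]
 have sc: "s (c x u1) = u1" "s (c y u2) = u2" using s_c X u b0 by auto
 have "bset (c x u1) (c y u2) = bset x y"
 proof (intro set_eqI iffI)
  fix t assume t: "t \<in> bset x y"
  then have "t <= b x y" unfolding b_def by (rule cSup_upper[OF _ bset_bdd])
  then show "t \<in> bset (c x u1) (c y u2)" using t X u c_c by (auto simp: bset_def sc)
 next
  fix t assume "t \<in> bset (c x u1) (c y u2)"
  then show "t \<in> bset x y" using X u c_c by (auto simp: bset_def sc)
 qed
 then show ?thesis by (simp add: b_def)
qed

lemma b_same_ray:
 assumes X: "x \<in> X" and u: "0 <= u2" "u2 <= u1" "u1 <= s x"
 shows "b (c x u1) (c x u2) = u2"
proof -
 have sc: "s (c x u1) = u1" "s (c x u2) = u2" using s_c X u by auto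
 have "bset (c x u1) (c x u2) = {0..u2}"
  using X u c_c d_zero c_in by (auto simp: bset_def sc)
 then show ?thesis using u by (simp add: b_def)
qed

text \<open>The stability argument for quasi-geodesics. Let \<open>p\<close> on the comb have almost
  maximal distance \<open>D\<close> from the chain. Comb points on either side of \<open>p\<close>
  are joined by a detour over the chain that avoids the ball of radius \<open>D - 1\<close> about
  \<open>p\<close> and has a number of steps linear in \<open>D\<close>. By
  \<open>eta_near_chain\<close> it passes within a distance logarithmic in \<open>D\<close>, so
  \<open>D\<close> is bounded.\<close>

lemma eta_near:
 obtains H where "H >= 0" "!!x y a n p. x \<in> X ==> y \<in> X ==> chain a n ==> a 0 = x ==> a n = y ==>
  (!!i j. i <= j ==> j <= n ==> real (j - i) <= d (a i) (a j) + 2) ==> p \<in> eta x y ==> \<exists>i\<le>n. d p (a i) <= H"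
proof -
 obtain h where h: "h >= 0" "!!a n p. chain a (2 ^ n) ==> p \<in> eta (a 0) (a (2 ^ n)) ==>
  \<exists>i\<le>2^n. d p (a i) <= h * (real n + 1)" by (rule eta_near_chain) blast
 \<comment> \<open>The detour has at most \<open>4 * D + 10 + (4 * C * T + M')\<close> steps, which
   is \<open>alpha * D + beta\<close> for \<open>T = C * (3 * D + 4)\<close>.\<close>
 define alpha where "alpha = 12 * C * C + 4"
 define beta where "beta = 16 * C * C + M' + 10"
 define A where "A = 2 * alpha * h"
 define B where "B = 2 * alpha * (h + 1) + 2 * beta"
 define H0 where "H0 = h * (A + B + 5) + 1"
 have M'0: "M' >= 0" using M1 C1 by (simp add: M'_def)
 have alphabeta: "alpha >= 0" "beta >= 1" using C1 M'0 by (auto simp: alpha_def beta_def)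
 have AB: "A >= 0" "B >= 0" using alphabeta h(1) by (auto simp: A_def B_def)
 have key: "D <= H0"
  if X: "x \<in> X" "y \<in> X" and a: "chain a n" "a 0 \<in> {x, y}" "a n \<in> {x, y}" "{a 0, a n} = {x, y}"
  and q: "!!i j. i <= j ==> j <= n ==> real (j - i) <= d (a i) (a j) + 2"
  and t: "b x y <= t" "t <= s x" and D: "D >= 0" "!!i. i <= n ==> D <= d (c x t) (a i)"
  and near: "!!q. q \<in> eta x y ==> \<exists>i\<le>n. d q (a i) <= D + 1"
  for x y a n t D
 proof -
  define p where "p = c x t"
  note b0 = b_bounds[OF X]
  have t0: "0 <= t" using t b0 by simp
  have pX: "p \<in> X" unfolding p_def using c_in X t t0 by simp
  have aX: "a i \<in> X" if "i <= n" for i using a(1) that by (simp add: chain_def)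
  \<comment> \<open>A height difference of \<open>T\<close> forces distance at least
    \<open>3 * D + 3\<close> from \<open>p\<close>, so that a path of length about
    \<open>D + 1\<close> from there to the chain stays outside the ball.\<close>
  define T where "T = C * (3 * D + 4)"
  have T: "T >= 0" "T >= C" using C1 D(1) by (auto simp: T_def algebra_simps)
  define S where "S = {q. D - 1 <= d p q}"
  have far: "3 * D + 3 <= d p q" if "q \<in> X" "\<bar>s q - t\<bar> >= T" for q
  proof -
  have "T <= C * d p q + C" using s_lip[OF pX that(1)] that(2) s_c[OF X(1) t0 t(2)] by (simp add: p_def)
  then have "C * (3 * D + 3) <= C * d p q" by (simp add: T_def algebra_simps)
  then show ?thesis using C1 by simp
  qed
  \<comment> \<open>If cutting at height difference \<open>T\<close> runs into an end of the comb,
    that end is itself a point of the chain and no connecting path has to be found.\<close>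
  have link: "\<exists>i k. i <= n & conn S m (a i) k & real k <= D + 3 & d m (a i) <= D + 1"
  if m: "m \<in> eta x y" "\<bar>s m - t\<bar> >= T | m \<in> {x, y}" for m
  proof (cases "m \<in> {x, y}")
  case True
  then obtain i where i: "i <= n" "m = a i" using a(4) by (metis insertE insertI1 singletonD insertI2 le_refl zero_le)
  have "conn S m (a i) 0" unfolding i(2) using aX[OF i(1)] D(2)[OF i(1)] by (intro conn_refl) (auto simp: S_def p_def)
  then show ?thesis using i D(1) d_zero aX[OF i(1)] by (intro exI[of _ i] exI[of _ 0]) auto
  next
  case False
  have mX: "m \<in> X" using m(1) eta_sub[OF X] by blast
  have pm: "3 * D + 3 <= d p m" using far[OF mX] False m(2) by simp
  obtain i where i: "i <= n" "d m (a i) <= D + 1" using near[OF m(1)] by blast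
  obtain e k where e: "chain e k" "e 0 = m" "e k = a i"
  "!!i j. i <= j ==> j <= k ==> real (j - i) <= d (e i) (e j) + 2"
  "!!j. j <= k ==> d m (e j) + d (e j) (a i) <= d m (a i) + 1"
  by (rule geo_chain[OF mX aX[OF i(1)]]) blast
  have "e j \<in> S" if j: "j <= k" for j
  proof -
  have ej: "e j \<in> X" using e(1) j by (simp add: chain_def)
  have "d m (e j) <= D + 2" using e(5)[OF j] d_ge0[OF ej aX[OF i(1)]] i(2) by simp
  then show ?thesis using pm d_tri[OF pX ej mX] d_sym[OF ej mX] D(1) by (simp add: S_def)
  qed
  then have "conn S m (a i) k" unfolding conn_def using e(1-3) by blast
  moreover have "real k <= D + 3" using e(4)[of 0 k] e(2,3) i(2) by simp
  ultimately show ?thesis using i by blast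
  qed
  define u1 where "u1 = min (s x) (t + T)"
  have u1: "t <= u1" "u1 <= s x" "u1 <= t + T" using t T by (auto simp: u1_def)
  define m1 where "m1 = c x u1"
  have m1: "m1 \<in> X" "s m1 = u1" using c_in s_c X u1 t0 by (auto simp: m1_def)
  have m1eta: "m1 \<in> eta x y" using u1 t by (auto simp: eta_def m1_def)
  have m1far: "\<bar>s m1 - t\<bar> >= T | m1 \<in> {x, y}"
  proof (cases "s x <= t + T")
  case True
  then show ?thesis using c_end[OF X(1)] by (simp add: m1_def u1_def)
  next
  case False
  then show ?thesis using m1(2) T by (simp add: u1_def)
  qed
  \<comment> \<open>On the other side of \<open>p\<close> the comb either continues far enough down
    the same ray or turns at the branching height; in the second case \<open>m2\<close> is taken on
    the ray of \<open>y\<close>.\<close>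
  obtain m2 where m2: "m2 \<in> eta x y" "\<bar>s m2 - t\<bar> >= T | m2 \<in> {x, y}" "p \<in> eta m1 m2" "d m1 m2 <= 4 * C * T + M'"
  proof (cases "b x y <= t - T")
  case True
  define m where "m = c x (t - T)"
  have tT: "0 <= t - T" using True b0 by simp
  have m: "m \<in> eta x y" using True t T by (auto simp: eta_def m_def)
  have sm: "s m = t - T" unfolding m_def by (rule s_c) (use X t T tT in auto)
  have bm: "b m1 m = t - T" unfolding m1_def m_def by (rule b_same_ray) (use X u1 T tT t in auto)
  have "p = c m1 t" unfolding m1_def p_def using c_c[OF X(1) t0 u1(1,2)] by simp
  then have pe: "p \<in> eta m1 m" unfolding eta_def bm m1(2) using u1 T by auto
  have "d m m1 <= C * (u1 - (t - T))" unfolding m_def m1_def by (rule c_lip) (use X tT u1 T in auto)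
  also have "... <= C * (4 * T)" using u1 C1 T by (intro mult_left_mono) auto
  finally have "d m1 m <= 4 * C * T + M'" using d_sym[OF m1(1)] m eta_sub[OF X] M'0 by (simp add: subset_iff)
  then show ?thesis using that[of m] m sm pe T by simp
  next
  case False
  define u2 where "u2 = min (s y) (t + T)"
  have u2: "b x y <= u2" "u2 <= s y" "u2 <= t + T" using t T b0 by (auto simp: u2_def)
  define m where "m = c y u2"
  have m: "m \<in> eta x y" "m \<in> X" using u2 b0 c_in[OF X(2)] by (auto simp: eta_def m_def)
  have sm: "s m = u2" unfolding m_def by (rule s_c) (use X u2 b0 in auto)
  have mf: "\<bar>s m - t\<bar> >= T | m \<in> {x, y}"
  proof (cases "s y <= t + T")
  case True
  then show ?thesis using c_end[OF X(2)] by (simp add: m_def u2_def)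
  next
  case False
  then show ?thesis using sm T by (simp add: u2_def)
  qed
  have bm: "b m1 m = b x y" unfolding m1_def m_def by (rule b_c) (use X u1 u2 t in auto)
  have "p = c m1 t" unfolding m1_def p_def using c_c[OF X(1) t0 u1(1,2)] by simp
  then have pe: "p \<in> eta m1 m" unfolding eta_def bm m1(2) using u1 t by auto
  have cb: "c x (b x y) \<in> X" "c y (b x y) \<in> X" using c_in X b0 by auto
  have "d (c x (b x y)) m1 <= C * (u1 - b x y)" unfolding m1_def by (rule c_lip) (use X u1 b0 t in auto)
  moreover have "d (c y (b x y)) m <= C * (u2 - b x y)" unfolding m_def by (rule c_lip) (use X u2 b0 in auto)
  moreover have "C * (u1 - b x y) <= C * (2 * T)" "C * (u2 - b x y) <= C * (2 * T)"
  using u1 u2 False C1 by (auto intro!: mult_left_mono)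
  moreover have "d (c x (b x y)) (c y (b x y)) <= M'" by (rule below_b[OF X b0(1)]) simp
  ultimately have "d m1 m <= 4 * C * T + M'"
  using d_tri[OF m1(1) cb(1) m(2)] d_tri[OF cb m(2)] d_sym[OF m1(1) cb(1)] by simp
  then show ?thesis using that[of m] m mf pe by simp
  qed
  obtain i k where i: "i <= n" "conn S m1 (a i) k" "real k <= D + 3" "d m1 (a i) <= D + 1"
  using link[OF m1eta m1far] by blast
  obtain j l where j: "j <= n" "conn S m2 (a j) l" "real l <= D + 3" "d m2 (a j) <= D + 1"
  using link[OF m2(1,2)] by blast
  have m2X: "m2 \<in> X" using m2(1) eta_sub[OF X] by blast
  have S: "\<forall>i\<le>n. a i \<in> S" using D(2) by (auto simp: S_def p_def intro: order_trans[of _ D])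
  have dij: "d (a i) (a j) <= 2 * D + 2 + (4 * C * T + M')"
  using d_tri[OF aX[OF i(1)] m1(1) aX[OF j(1)]] d_tri[OF m1(1) m2X aX[OF j(1)]] d_sym[OF m1(1) aX[OF i(1)]] i(4) j(4) m2(4)
  by simp
  have "\<exists>r. conn S (a i) (a j) r & real r <= d (a i) (a j) + 2"
  proof (cases "i <= j")
  case True
  then show ?thesis using conn_subchain[OF a(1) S True j(1)] q[OF True j(1)] by blast
  next
  case False
  then have "j <= i" by simp
  then show ?thesis using conn_sym[OF conn_subchain[OF a(1) S \<open>j <= i\<close> i(1)]] q[OF \<open>j <= i\<close> i(1)] d_sym[OF aX[OF i(1)] aX[OF j(1)]] by auto
  qed
  then obtain r where r: "conn S (a i) (a j) r" "real r <= d (a i) (a j) + 2" by blast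
  define N where "N = k + (r + l)"
  have cN: "conn S m1 m2 N" unfolding N_def by (rule conn_trans[OF i(2) conn_trans[OF r(1) conn_sym[OF j(2)]]])
  have "real N <= 4 * D + 10 + (4 * C * T + M')" using i(3) j(3) r(2) dij by (simp add: N_def)
  also have "... = alpha * D + beta" by (simp add: alpha_def beta_def T_def algebra_simps)
  finally have N: "real N <= alpha * D + beta" .
  define g where "g = (LEAST g. N <= 2 ^ g)"
  have g: "N <= 2 ^ g" unfolding g_def by (rule LeastI[of _ N]) (simp add: less_imp_le)
  have g2: "2 ^ g <= 2 * (alpha * D + beta)"
  proof (cases g)
  case 0
  have "0 <= alpha * D" using alphabeta D(1) by simp
  then show ?thesis using 0 alphabeta by simp
  next
  case (Suc g')
  then have "~ N <= 2 ^ g'" using not_less_Least[of g' "%g. N <= 2 ^ g"] by (simp add: g_def)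
  then have "2 ^ g' <= N" by simp
  then have "real (2 ^ g') <= real N" by (simp only: of_nat_le_iff)
  moreover have "(2::real) ^ g' = real (2 ^ g')" by simp
  ultimately have "2 ^ g' <= alpha * D + beta" using N by linarith
  then show ?thesis using Suc by simp
  qed
  \<comment> \<open>Padding with constant steps brings the number of steps to a power of 2, at most
    twice the bound.\<close>
  obtain e where e: "chain e (2 ^ g)" "e 0 = m1" "e (2 ^ g) = m2" "\<forall>i\<le>2^g. e i \<in> S"
  using conn_pad[OF cN g] unfolding conn_def by blast
  obtain v where "v <= 2 ^ g" "d p (e v) <= h * (real g + 1)" using h(2)[OF e(1)] e(2,3) m2(3) by auto
  then have Dg: "D <= h * (real g + 1) + 1" using e(4) by (auto simp: S_def)
  have "2 ^ g <= 2 * (alpha * (h * (real g + 1) + 1) + beta)"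
  by (rule order_trans[OF g2]) (intro mult_left_mono add_right_mono Dg alphabeta(1), simp)
  also have "... = A * real g + B" by (simp add: A_def B_def algebra_simps)
  finally have "real g <= A + B + 4" by (rule two_power_le_linear[OF AB])
  then have "h * (real g + 1) <= h * (A + B + 5)" using h(1) by (intro mult_left_mono) auto
  then show ?thesis using Dg by (simp add: H0_def)
 qed
 show ?thesis
 proof (rule that[of "H0 + 1"])
  show "0 <= H0 + 1" using h(1) AB by (simp add: H0_def)
  fix x y a n p
  assume X: "x \<in> X" "y \<in> X" and a: "chain a n" "a 0 = x" "a n = y"
  and q: "!!i j. i <= j ==> j <= n ==> real (j - i) <= d (a i) (a j) + 2" and p: "p \<in> eta x y"
  define delta where "delta p = Min ((%i. d p (a i)) ` {..n})" for p
  have deltale: "delta p <= d p (a i)" if "i <= n" for p i unfolding delta_def using that by (intro Min_le) auto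
  have deltaex: "\<exists>i\<le>n. d p (a i) = delta p" for p
  proof -
  have "delta p \<in> (%i. d p (a i)) ` {..n}" unfolding delta_def by (rule Min_in) auto
  then show ?thesis by force
  qed
  have aX: "a i \<in> X" if "i <= n" for i using a(1) that by (simp add: chain_def)
  have bd: "delta p <= C * (s x + s y)" if "p \<in> eta x y" for p
  proof -
  note b0 = b_bounds[OF X]
  have aux: "delta (c w t) <= C * (s x + s y)" if w: "w \<in> X" "w = a i" "i <= n" "s w <= s x + s y" and t: "b x y <= t" "t <= s w" for w t i
  proof -
  have "delta (c w t) <= d (c w t) (c w (s w))" using deltale[OF w(3)] w(2) c_end[OF w(1)] by simp
  also have "... <= C * (s w - t)" by (rule c_lip) (use w t b0 in auto)
  also have "... <= C * (s x + s y)" using C1 w(4) t b0 by (intro mult_left_mono) auto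
  finally show ?thesis .
  qed
  have "s x <= s x + s y" "s y <= s x + s y" using s0 X by auto
  note ax = aux[OF X(1) a(2)[symmetric] le0 this(1)] and ay = aux[OF X(2) a(3)[symmetric] order_refl this(2)]
  from that consider t where "p = c x t" "b x y <= t" "t <= s x" | t where "p = c y t" "b x y <= t" "t <= s y"
  unfolding eta_def by blast
  then show ?thesis by cases (use ax ay in blast)+
  qed
  \<comment> \<open>The largest distance from the comb to the chain need not be attained; a point
    within 1 of the supremum is used, whence \<open>D + 1\<close> in the assumption
    \<open>near\<close> of \<open>key\<close>.\<close>
  define Sd where "Sd = Sup (delta ` eta x y)"
  have bdd: "bdd_above (delta ` eta x y)" using bd by (intro bdd_aboveI2)
  have up: "delta r <= Sd" if "r \<in> eta x y" for r unfolding Sd_def by (rule cSup_upper[OF imageI[OF that] bdd])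
  have "\<exists>z\<in>delta ` eta x y. Sd - 1 < z"
  using less_cSup_iff[OF _ bdd, of "Sd - 1"] p unfolding Sd_def by force
  then obtain r where r: "r \<in> eta x y" "Sd - 1 < delta r" by blast
  have near: "\<exists>i\<le>n. d r' (a i) <= delta r + 1" if "r' \<in> eta x y" for r'
  using deltaex[of r'] up[OF that] r(2) by force
  have r0: "0 <= delta r" using deltaex[of r] d_ge0 aX r(1) eta_sub[OF X] by (metis subset_iff)
  have "delta r <= H0"
  proof -
  from r(1) consider t where "r = c x t" "b x y <= t" "t <= s x" | t where "r = c y t" "b x y <= t" "t <= s y"
  unfolding eta_def by blast
  then show ?thesis
  proof cases
  case 1
  show ?thesis
  by (rule key[OF X a(1) _ _ _ q 1(2,3) r0 _ near]) (use a 1 deltale in auto)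
  next
  case 2
  show ?thesis
  by (rule key[OF X(2,1) a(1) _ _ _ q _ 2(3) r0 _ near])
  (use a 2 deltale b_commute[OF X] eta_commute[OF X] in auto)
  qed
  qed
  then show "\<exists>i\<le>n. d p (a i) <= H0 + 1" using near[OF p] by force
 qed
qed

lemma eta_between:
 obtains k where "k >= 0" "!!x y p. x \<in> X ==> y \<in> X ==> p \<in> eta x y ==> d x p + d p y <= d x y + k"
proof -
 obtain H where H: "H >= 0" "!!x y a n p. x \<in> X ==> y \<in> X ==> chain a n ==> a 0 = x ==> a n = y ==>
  (!!i j. i <= j ==> j <= n ==> real (j - i) <= d (a i) (a j) + 2) ==> p \<in> eta x y ==> \<exists>i\<le>n. d p (a i) <= H"
  by (rule eta_near) blast
 show ?thesis
 proof (rule that[of "2 * H + 1"])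
  fix x y p assume X: "x \<in> X" "y \<in> X" and p: "p \<in> eta x y"
  obtain a n where a: "chain a n" "a 0 = x" "a n = y"
  "!!i j. i <= j ==> j <= n ==> real (j - i) <= d (a i) (a j) + 2"
  "!!i. i <= n ==> d x (a i) + d (a i) y <= d x y + 1"
  by (rule geo_chain[OF X]) blast
  obtain i where i: "i <= n" "d p (a i) <= H" using H(2)[OF X a(1-4) p] by blast
  have ai: "a i \<in> X" using a(1) i by (simp add: chain_def)
  have pX: "p \<in> X" using p eta_sub[OF X] by blast
  show "d x p + d p y <= d x y + (2 * H + 1)"
  using d_tri[OF X(1) ai pX] d_tri[OF pX ai X(2)] d_sym[OF pX ai] i a(5)[OF i(1)] by simp
 qed (use H(1) in simp)
qed

text \<open>Comb points lie almost on geodesics, so the product at \<open>p0\<close> is, up to a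
  constant, the distance \<open>g x (b x y)\<close> from \<open>p0\<close> to the branching point.
  This distance is almost monotone along rays, and the ultrametric inequality passes from heights to
  products.\<close>

theorem hyperbolic: "gromov_hyperbolic X d"
proof -
 obtain k where k: "k >= 0" "!!x y p. x \<in> X ==> y \<in> X ==> p \<in> eta x y ==> d x p + d p y <= d x y + k"
  by (rule eta_between) blast
 obtain h where h: "h >= 0" "!!x y z. x \<in> X ==> y \<in> X ==> z \<in> X ==> min (b x y) (b y z) <= b x z + h"
  by (rule thin) blast
 define g where "g x t = d p0 (c x t)" for x t
 have M'0: "M' >= 0" using M1 C1 by (simp add: M'_def)
 have ray: "d x (c x t) + g x t <= d p0 x + k" if x: "x \<in> X" and t: "0 <= t" "t <= s x" for x t
 proof -
  have "s p0 = 0" using s_c[OF x order_refl s0[OF x]] c_start[OF x] by simp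
  then have "b x p0 = 0" using b_bounds[OF x p0] by simp
  then have "c x t \<in> eta x p0" using t by (auto simp: eta_def)
  from k(2)[OF x p0 this] show ?thesis
  using d_sym[OF c_in[OF x t] p0] d_sym[OF x p0] by (simp add: g_def)
 qed
 have gmono: "g x t <= g x u + k" if x: "x \<in> X" and t: "0 <= t" "t <= u" "u <= s x" for x t u
 proof -
  have u0: "0 <= u" using t by simp
  have cu: "c x u \<in> X" "s (c x u) = u" using c_in[OF x] s_c[OF x] t by auto
  have ct: "c (c x u) t = c x t" by (rule c_c[OF x t])
  have "c x t \<in> X" using c_in[OF x] t by simp
  then show ?thesis using ray[OF cu(1) t(1)] cu t d_ge0[OF cu(1), of "c x t"] by (simp add: g_def ct)
 qed
 have gcoarse: "g x t <= g x u + k + C * h" if x: "x \<in> X" and t: "0 <= t" "t <= s x" "t <= u + h" and u: "0 <= u" "u <= s x" for x t u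
 proof (cases "t <= u")
  case True
  have "0 <= C * h" using C1 h(1) by simp
  then show ?thesis using gmono[OF x t(1) True u(2)] by simp
 next
  case False
  have "d (c x u) (c x t) <= C * (t - u)" by (rule c_lip) (use x u t False in auto)
  also have "... <= C * h" using t C1 by (intro mult_left_mono) auto
  finally show ?thesis using d_tri[OF p0 c_in[OF x u] c_in[OF x t(1,2)]] k(1) by (simp add: g_def)
 qed
 have bx: "0 <= b x y" "b x y <= s x" if "x \<in> X" "y \<in> X" for x y using b_bounds[OF that] by auto
 have two: "c x (b x y) \<in> X" "c y (b x y) \<in> X" "d (c x (b x y)) (c y (b x y)) <= M'" if X: "x \<in> X" "y \<in> X" for x y
  using c_in X b_bounds[OF X] below_b[OF X] by auto
 have gpu: "gromov_product d p0 x y <= g x (b x y) + k" if X: "x \<in> X" "y \<in> X" for x y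
 proof -
  have "c x (b x y) \<in> eta x y" using b_bounds[OF X] by (auto simp: eta_def)
  from k(2)[OF X this] show ?thesis
  using d_tri[OF p0 two(1)[OF X] X(1)] d_tri[OF p0 two(1)[OF X] X(2)] d_sym[OF X(1) two(1)[OF X]] d_sym[OF X(1) p0] k(1)
  by (simp add: gromov_product_def g_def)
 qed
 have gpl: "g x (b x y) - k - M' <= gromov_product d p0 x y" if X: "x \<in> X" "y \<in> X" for x y
  using ray[OF X(1) bx[OF X]] ray[OF X(2) b_bounds(1,3)[OF X]] two[OF X] d_tri[OF X(1) two(1)[OF X] X(2)]
  d_tri[OF two(1,2)[OF X] X(2)] d_tri[OF p0 two(2,1)[OF X]] d_sym[OF two(1,2)[OF X]] d_sym[OF X(1) p0] d_sym[OF X(2) two(2)[OF X]]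
  by (simp add: gromov_product_def g_def)
 have sym: "gromov_product d p0 x y = gromov_product d p0 y x" if "x \<in> X" "y \<in> X" for x y
  using d_sym[OF that] d_sym[OF that(1) p0] d_sym[OF that(2) p0] by (simp add: gromov_product_def)
 define Del where "Del = 3 * k + 2 * M' + C * h"
 show ?thesis
 proof (rule gromov_hyperbolic_basepoint[where delta=Del and p=p0])
  show "Del >= 0" using k(1) M'0 C1 h(1) by (simp add: Del_def)
  fix x y z assume X: "x \<in> X" "y \<in> X" "z \<in> X"
  note cb = b_commute[OF X(1,3)] b_commute[OF X(2,3)]
  have lo: "g x (b x z) - k - M' <= gromov_product d p0 x z" by (rule gpl[OF X(1,3)])
  show "min (gromov_product d p0 x y) (gromov_product d p0 y z) - Del <= gromov_product d p0 x z"
  proof (cases "b x y <= b y z")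
  case True
  then have "g x (b x y) <= g x (b x z) + k + C * h"
  using h(2)[OF X] by (intro gcoarse) (use X bx in auto)
  then show ?thesis using lo gpu[OF X(1,2)] M'0 by (simp add: Del_def)
  next
  case False
  then have "g z (b z y) <= g z (b z x) + k + C * h"
  using h(2)[OF X] cb by (intro gcoarse) (use X bx in auto)
  moreover have "g z (b z x) <= g x (b x z) + M'"
  using two[OF X(1,3)] d_tri[OF p0 two(1,2)[OF X(1,3)]] by (simp add: g_def cb)
  ultimately show ?thesis using lo gpu[OF X(3,2)] sym[OF X(2,3)] by (simp add: Del_def)
  qed
 qed (use d_sym p0 in auto)
qed

end

subsection \<open>Limits of convex domains\<close>

text \<open>The Minkowski functional of \<open>S\<close>, written as the support function of the
  polar set. In this form sublinearity and the Lipschitz bound are immediate.\<close>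

definition polar_gauge :: "'a::euclidean_space set => 'a => real" where
 "polar_gauge S x = Sup ((%a. a \<bullet> x) ` {a. \<forall>y\<in>S. a \<bullet> y <= 1})"

context
 fixes S :: "'a::euclidean_space set"
 assumes S: "open S" "convex S" "ball 0 1 \<subseteq> S"
begin

lemma polar_norm_le: assumes "\<forall>y\<in>S. a \<bullet> y <= 1" shows "norm a <= 1"
proof (rule ccontr)
 assume n: "~ norm a <= 1"
 \<comment> \<open>The mean of \<open>1 / norm a\<close> and \<open>1 / (norm a)^2\<close>:
   \<open>t a\<close> still lies in the unit ball, while its inner product with \<open>a\<close>
   exceeds 1.\<close>
 define t where "t = (1 / norm a + 1 / (norm a)\<^sup>2) / 2"
 have n0: "norm a > 0" "norm a > 1" using n by auto
 have "t * norm a = (1 + 1 / norm a) / 2" using n0 by (simp add: t_def field_simps power2_eq_square)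
 moreover have "(1 + 1 / norm a) / 2 < 1" using n0 by (simp add: divide_less_eq)
 ultimately have "t * norm a < 1" by simp
 moreover have "t > 0" using n0 by (simp add: t_def add_pos_pos)
 ultimately have "t *\<^sub>R a \<in> S" using S(3) by (intro subsetD[OF S(3)]) simp
 then have "t * (norm a)\<^sup>2 <= 1" using assms by (force simp: power2_norm_eq_inner)
 moreover have "t * (norm a)\<^sup>2 = (norm a + 1) / 2" using n0 by (simp add: t_def field_simps power2_eq_square)
 ultimately show False using n0 by simp
qed

lemma polar_gauge_upper: "\<forall>y\<in>S. a \<bullet> y <= 1 ==> a \<bullet> x <= polar_gauge S x"
 unfolding polar_gauge_def
proof (rule cSup_upper)
 have "a \<bullet> x <= norm x" if "\<forall>y\<in>S. a \<bullet> y <= 1" for a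
  using norm_cauchy_schwarz[of a x] mult_right_mono[OF polar_norm_le[OF that], of "norm x"] by simp
 then show "bdd_above ((%a. a \<bullet> x) ` {a. \<forall>y\<in>S. a \<bullet> y <= 1})" by (intro bdd_aboveI2[of _ _ "norm x"]) simp
qed simp

lemma polar_gauge_least: "(!!a. \<forall>y\<in>S. a \<bullet> y <= 1 ==> a \<bullet> x <= K) ==> polar_gauge S x <= K"
 unfolding polar_gauge_def by (rule cSup_least) (auto intro!: exI[of _ 0])

lemma polar_gauge_nonneg: "0 <= polar_gauge S x"
 using polar_gauge_upper[of 0 x] by simp

lemma polar_gauge_le_norm: "polar_gauge S x <= norm x"
proof (rule polar_gauge_least)
 fix a assume "\<forall>y\<in>S. a \<bullet> y <= 1"
 then show "a \<bullet> x <= norm x"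
  using norm_cauchy_schwarz[of a x] mult_right_mono[OF polar_norm_le, of a "norm x"] by simp
qed

lemma polar_gauge_add: "polar_gauge S (x + y) <= polar_gauge S x + polar_gauge S y"
proof (rule polar_gauge_least)
 fix a assume a: "\<forall>y\<in>S. a \<bullet> y <= 1"
 show "a \<bullet> (x + y) <= polar_gauge S x + polar_gauge S y"
  using polar_gauge_upper[OF a, of x] polar_gauge_upper[OF a, of y] by (simp add: inner_add_right)
qed

lemma polar_gauge_scale_le: assumes "c >= 0" shows "polar_gauge S (c *\<^sub>R x) <= c * polar_gauge S x"
 by (rule polar_gauge_least) (use polar_gauge_upper assms in \<open>auto intro!: mult_left_mono\<close>)

lemma polar_gauge_scale: assumes "c > 0" shows "polar_gauge S (c *\<^sub>R x) = c * polar_gauge S x"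
 using polar_gauge_scale_le[of c x] polar_gauge_scale_le[of "1 / c" "c *\<^sub>R x"] assms by (simp add: field_simps)

lemma polar_gauge_lipschitz: "\<bar>polar_gauge S x - polar_gauge S y\<bar> <= norm (x - y)"
 using polar_gauge_add[of y "x - y"] polar_gauge_add[of x "y - x"] polar_gauge_le_norm[of "x - y"]
  polar_gauge_le_norm[of "y - x"] by (simp add: norm_minus_commute)

text \<open>A point of the open set can be stretched a little within it; a point outside has a
  separating functional which, normalized to 1 there, belongs to the polar.\<close>

lemma polar_gauge_less_1_iff: "polar_gauge S x < 1 \<longleftrightarrow> x \<in> S"
proof
 assume x: "x \<in> S"
 obtain e where e: "e > 0" "cball x e \<subseteq> S" using S(1) x unfolding open_contains_cball by blast
 define k where "k = e / (norm x + 1)"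
 have k: "k > 0" using e by (simp add: k_def add_nonneg_pos)
 have "k * norm x <= e" using e by (simp add: k_def divide_le_eq add_nonneg_pos)
 then have "(1 + k) *\<^sub>R x \<in> S" using k by (intro subsetD[OF e(2)]) (simp add: dist_norm scaleR_left_distrib)
 have "polar_gauge S x <= 1 / (1 + k)"
 proof (rule polar_gauge_least)
  fix a assume "\<forall>y\<in>S. a \<bullet> y <= 1"
  then have "(1 + k) * (a \<bullet> x) <= 1" using \<open>(1 + k) *\<^sub>R x \<in> S\<close> by force
  then show "a \<bullet> x <= 1 / (1 + k)" using k by (simp add: field_simps)
 qed
 also have "... < 1" using k by simp
 finally show "polar_gauge S x < 1" .
next
 assume lt: "polar_gauge S x < 1"
 show "x \<in> S"
 proof (rule ccontr)
  assume "x \<notin> S"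
  then obtain a where a: "!!y p. y \<in> S ==> p \<in> {x} ==> a \<bullet> y < a \<bullet> p"
  by (rule_tac open_separation[OF S(1,2), of "{x}"]) auto
  have "0 \<in> S" using S(3) by auto
  then have ax: "a \<bullet> x > 0" using a[of 0 x] by simp
  have "\<forall>y\<in>S. ((1 / (a \<bullet> x)) *\<^sub>R a) \<bullet> y <= 1" using a[of _ x] ax by (auto simp: divide_le_eq less_imp_le)
  from polar_gauge_upper[OF this, of x] show False using lt ax by simp
 qed
qed

lemma polar_gauge_closure: "x \<in> closure S ==> polar_gauge S x <= 1"
proof -
 assume x: "x \<in> closure S"
 have "continuous_on UNIV (polar_gauge S)" unfolding continuous_on_iff
  using polar_gauge_lipschitz by (auto simp: dist_norm intro!: exI[of _ "_::real"] intro: le_less_trans)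
 then have "closed (polar_gauge S -` {..1})" by (intro closed_vimage) auto
 moreover have "S \<subseteq> polar_gauge S -` {..1}" using polar_gauge_less_1_iff by (auto intro: less_imp_le)
 ultimately show ?thesis using x closure_minimal by blast
qed

end

section \<open>Local Hausdorff convergence of convex sets\<close>

lemma hausdorff_distance_le:
 assumes "e >= 0" "!!x. x \<in> A ==> \<exists>y\<in>B. dist x y <= e" "!!y. y \<in> B ==> \<exists>x\<in>A. dist x y <= e"
 shows "hausdorff_distance A B <= ennreal e"
 unfolding hausdorff_distance_def
proof (intro max.boundedI SUP_least)
 fix a assume "a \<in> A"
 then obtain y where y: "y \<in> B" "dist a y <= e" using assms(2) by blast
 show "(INF b\<in>B. ennreal (dist a b)) <= ennreal e" by (rule INF_lower2[OF y(1)]) (use y(2) assms(1) in simp)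
next
 fix b assume "b \<in> B"
 then obtain y where y: "y \<in> A" "dist y b <= e" using assms(3) by blast
 show "(INF a\<in>A. ennreal (dist a b)) <= ennreal e" by (rule INF_lower2[OF y(1)]) (use y(2) assms(1) in simp)
qed

lemma hausdorff_distance_lessD:
 assumes "hausdorff_distance A B < ennreal e"
 shows "x \<in> A ==> \<exists>y\<in>B. dist x y < e" "y \<in> B ==> \<exists>x\<in>A. dist x y < e"
proof -
 note h = assms[unfolded hausdorff_distance_def max_less_iff_conj]
 show "\<exists>y\<in>B. dist x y < e" if "x \<in> A"
 proof -
  have "(INF b\<in>B. ennreal (dist x b)) < ennreal e"
  using h that by (meson SUP_upper le_less_trans)
  then show ?thesis unfolding INF_less_iff by (auto simp: ennreal_less_iff)
 qed
 show "\<exists>x\<in>A. dist x y < e" if "y \<in> B"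
 proof -
  have "(INF a\<in>A. ennreal (dist a y)) < ennreal e"
  using h that by (meson SUP_upper le_less_trans)
  then show ?thesis unfolding INF_less_iff by (auto simp: ennreal_less_iff)
 qed
qed

text \<open>Only the given point is confined to the ball of radius \<open>R\<close>, not the nearby
  one, so that intersecting with balls no longer matters.\<close>

lemma local_hausdorff_near:
 assumes "local_hausdorff_tendsto Ss (D::(complex^'d) set)" "e > 0"
 shows "\<forall>\<^sub>F n in sequentially. (\<forall>x\<in>closure D. norm x <= R --> (\<exists>y\<in>closure (Ss n). dist x y < e)) &
  (\<forall>y\<in>closure (Ss n). norm y <= R --> (\<exists>x\<in>closure D. dist x y < e))"
proof -
 obtain R0 where R0: "!!R. R >= R0 ==> (%n. hausdorff_distance (closure (Ss n) \<inter> closure (ball 0 R))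
  (closure D \<inter> closure (ball 0 R))) \<longlonglongrightarrow> 0"
  using assms(1) unfolding local_hausdorff_tendsto_def by blast
 define R' where "R' = max R0 (max R 1)"
 have "\<forall>\<^sub>F n in sequentially. hausdorff_distance (closure (Ss n) \<inter> closure (ball 0 R'))
  (closure D \<inter> closure (ball 0 R')) < ennreal e"
  using R0[of R'] assms(2) by (intro order_tendstoD(2)) (auto simp: R'_def)
 then show ?thesis
 proof eventually_elim
  case (elim n)
  note h = hausdorff_distance_lessD[OF elim]
  have "R' > 0" "R <= R'" by (auto simp: R'_def)
  then have "x \<in> closure (ball 0 R')" if "norm x <= R" for x :: "complex^'d" using that by simp
  then show ?case using h by (force simp: dist_commute)
 qed
qed

lemma local_hausdorff_subseq:
 "local_hausdorff_tendsto Ss D ==> strict_mono r ==> local_hausdorff_tendsto (%n. Ss (r n)) D"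
 unfolding local_hausdorff_tendsto_def by (force dest: LIMSEQ_subseq_LIMSEQ simp: o_def)

text \<open>If a point of \<open>K\<close> is missing from the convex set, a half-space separates
  it. Moving by \<open>e\<close> along the outer normal stays in \<open>D\<close> but ends at
  distance at least \<open>e\<close> from the set, against convergence.\<close>

lemma local_hausdorff_inner:
 fixes D :: "(complex^'d) set"
 assumes lim: "local_hausdorff_tendsto Ss D" and S: "!!n. open (Ss n)" "!!n. convex (Ss n)"
  and D: "open D" and K: "compact K" "K \<subseteq> D"
 shows "\<forall>\<^sub>F n in sequentially. K \<subseteq> Ss n"
proof -
 obtain e where e: "e > 0" "!!x y. x \<in> K ==> dist x y <= e ==> y \<in> D"
 proof -
  obtain e where "0 < e" "(\<Union>x\<in>K. cball x e) \<subseteq> D" using compact_subset_open_imp_cball_epsilon_subset[OF K(1) D K(2)] by blast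
  then show ?thesis using that[of e] by force
 qed
 obtain R where R: "!!x. x \<in> K ==> norm x <= R" using compact_imp_bounded[OF K(1)] unfolding bounded_iff by blast
 have "\<forall>\<^sub>F n in sequentially. \<forall>x\<in>closure D. norm x <= R + e --> (\<exists>y\<in>closure (Ss n). dist x y < e / 2)"
  using local_hausdorff_near[OF lim, of "e / 2" "R + e"] e(1) by (auto elim: eventually_mono)
 then show ?thesis
 proof eventually_elim
  case (elim n)
  show ?case
  proof
  fix z assume z: "z \<in> K"
  show "z \<in> Ss n"
  proof (rule ccontr)
  assume "z \<notin> Ss n"
  then obtain a where a: "!!x p. x \<in> Ss n ==> p \<in> {z} ==> a \<bullet> x < a \<bullet> p"
  by (rule_tac open_separation[OF S, of "{z}" n]) auto
  have cl: "a \<bullet> x <= a \<bullet> z" if "x \<in> closure (Ss n)" for x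
  proof -
  have "Ss n \<subseteq> {x. a \<bullet> x <= a \<bullet> z}" using a by (auto intro: less_imp_le)
  then have "closure (Ss n) \<subseteq> {x. a \<bullet> x <= a \<bullet> z}" by (rule closure_minimal) (rule closed_halfspace_le)
  then show ?thesis using that by blast
  qed
  define y where "y = z + (e / norm a) *\<^sub>R a"
  have zy: "dist z y <= e" using e(1) by (simp add: y_def dist_norm)
  have "y \<in> closure D" using e(2)[OF z zy] closure_subset by blast
  moreover have "norm y <= R + e" using R[OF z] zy norm_triangle_ineq[of z "y - z"] by (simp add: dist_norm norm_minus_commute)
  ultimately obtain w where w: "w \<in> closure (Ss n)" "dist y w < e / 2" using elim by blast
  then have "a ~= 0" using a[of _ z] by (metis closure_eq_empty empty_iff ex_in_conv inner_zero_left insertI1 less_irrefl)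
  have "a \<bullet> y - a \<bullet> w <= norm a * norm (y - w)" using norm_cauchy_schwarz[of a "y - w"] by (simp add: inner_diff_right)
  also have "... <= norm a * (e / 2)" using w(2) by (intro mult_left_mono) (auto simp: dist_norm)
  finally have "a \<bullet> y - a \<bullet> z <= norm a * (e / 2)" using cl[OF w(1)] by simp
  moreover have "a \<bullet> y - a \<bullet> z = e * norm a"
  by (simp add: y_def inner_add_right dot_square_norm power2_eq_square)
  ultimately show False using \<open>a ~= 0\<close> e(1) by simp
  qed
  qed
 qed
qed

lemma local_hausdorff_outer:
 fixes D :: "(complex^'d) set"
 assumes lim: "local_hausdorff_tendsto Ss D" and K: "compact K" "K \<inter> closure D = {}"
 shows "\<forall>\<^sub>F n in sequentially. K \<inter> closure (Ss n) = {}"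
proof -
 obtain e where e: "e > 0" "!!x y. x \<in> K ==> y \<in> closure D ==> e <= dist x y"
  using separate_compact_closed[OF K(1) closed_closure K(2)] by blast
 obtain R where R: "!!x. x \<in> K ==> norm x <= R" using compact_imp_bounded[OF K(1)] unfolding bounded_iff by blast
 have "\<forall>\<^sub>F n in sequentially. \<forall>y\<in>closure (Ss n). norm y <= R --> (\<exists>x\<in>closure D. dist x y < e)"
  using local_hausdorff_near[OF lim e(1), of R] by (auto elim: eventually_mono)
 then show ?thesis
  by eventually_elim (use e(2) R in \<open>force simp: dist_commute\<close>)
qed

lemma closure_sublevel_1:
 fixes f :: "complex^'d => real"
 assumes f: "!!c. c > 0 ==> f (c *\<^sub>R x) = c * f x" and x: "f x <= 1"
 shows "x \<in> closure {y. f y < 1}"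
 unfolding closure_sequential
proof (intro exI conjI allI CollectI)
 fix n :: nat
 have p: "1 / (1 + 1 / real (Suc n)) > 0" by (simp add: add_pos_pos)
 have "f ((1 / (1 + 1 / real (Suc n))) *\<^sub>R x) = 1 / (1 + 1 / real (Suc n)) * f x" by (rule f[OF p])
 also have "... <= 1 / (1 + 1 / real (Suc n)) * 1" using x p by (intro mult_left_mono) auto
 also have "... < 1" by (simp add: add_pos_pos)
 finally show "f ((1 / (1 + 1 / real (Suc n))) *\<^sub>R x) < 1" .
next
 have "(%n. 1 / (1 + 1 / real (Suc n))) \<longlonglongrightarrow> 1 / (1 + 0)"
  by (intro tendsto_intros LIMSEQ_Suc[OF lim_1_over_n]) auto
 from tendsto_scaleR[OF this tendsto_const[of x]]
 show "(%n. (1 / (1 + 1 / real (Suc n))) *\<^sub>R x) \<longlonglongrightarrow> x" by simp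
qed

text \<open>Blaschke selection through gauges: they are 1-Lipschitz, so Arzela-Ascoli gives a
  uniform limit on the unit ball, and homogeneity extends it to every ball. The limit domain is the
  sublevel set of the limit gauge.\<close>

lemma convex_limit:
 fixes Ss :: "nat => (complex^'d) set"
 assumes S: "!!n. open (Ss n)" "!!n. convex (Ss n)" "!!n. ball 0 1 \<subseteq> Ss n"
 obtains r D where "strict_mono r" "open D" "convex D" "ball 0 1 \<subseteq> D" "local_hausdorff_tendsto (%n. Ss (r n)) D"
proof -
 define P where "P n = polar_gauge (Ss n)" for n
 have lip: "\<bar>P n x - P n y\<bar> <= norm (x - y)" for n x y unfolding P_def by (rule polar_gauge_lipschitz[OF S])
 have nn: "0 <= P n x" "P n x <= norm x" for n x unfolding P_def
  using polar_gauge_nonneg[OF S] polar_gauge_le_norm[OF S] by auto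
 have eq: "\<exists>d>0. \<forall>n y. y \<in> cball 0 1 & norm (x - y) < d --> norm (P n x - P n y) < e" if "e > 0" for x e
  using lip that by (intro exI[of _ e]) (auto intro: le_less_trans)
 have bound: "norm (P n x) <= 1" if "x \<in> cball 0 1" for n x using nn[where n=n and x=x] that by simp
 obtain g k where k: "strict_mono (k :: nat => nat)"
  "!!e. 0 < e ==> \<exists>N. \<forall>n x. n >= N & x \<in> cball 0 1 --> norm (P (k n) x - g x) < e"
  by (rule Arzela_Ascoli[of "cball (0::complex^'d) 1" P 1]) (use bound eq in auto)
 define Q where "Q x = lim (%n. P (k n) x)" for x
 have scale: "P n (c *\<^sub>R x) = c * P n x" if "c > 0" for n c x
  unfolding P_def by (rule polar_gauge_scale[OF S that])
 have unif: "\<forall>\<^sub>F n in sequentially. \<forall>x. norm x <= R --> \<bar>P (k n) x - R * g ((1 / R) *\<^sub>R x)\<bar> < e" if "e > 0" "R > 0" for R e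
 proof -
  have eR: "0 < e / R" using that by simp
  obtain N where N: "\<forall>n x. n >= N & x \<in> cball 0 1 --> norm (P (k n) x - g x) < e / R" using k(2)[OF eR] by blast
  show ?thesis unfolding eventually_sequentially
  proof (intro exI allI impI)
  fix n x assume "N <= n" "norm (x::complex^'d) <= R"
  then have "\<bar>P (k n) ((1 / R) *\<^sub>R x) - g ((1 / R) *\<^sub>R x)\<bar> < e / R" using N that by (simp add: divide_le_eq)
  then have "R * \<bar>P (k n) ((1 / R) *\<^sub>R x) - g ((1 / R) *\<^sub>R x)\<bar> < e" using that by (simp add: field_simps)
  moreover have "P (k n) x = R * P (k n) ((1 / R) *\<^sub>R x)" using scale[of R "k n" "(1 / R) *\<^sub>R x"] that by simp
  ultimately show "\<bar>P (k n) x - R * g ((1 / R) *\<^sub>R x)\<bar> < e" using that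
  by (metis abs_mult abs_of_pos right_diff_distrib)
  qed
 qed
 have lim: "(%n. P (k n) x) \<longlonglongrightarrow> R * g ((1 / R) *\<^sub>R x)" if "R > 0" "norm x <= R" for x R
 proof (rule tendstoI)
  fix e :: real assume "e > 0"
  from unif[OF this that(1)] show "\<forall>\<^sub>F n in sequentially. dist (P (k n) x) (R * g ((1 / R) *\<^sub>R x)) < e"
  by eventually_elim (use that in \<open>auto simp: dist_norm\<close>)
 qed
 have Qlim: "(%n. P (k n) x) \<longlonglongrightarrow> Q x" for x
  using lim[of "norm x + 1" x] limI[OF lim[of "norm x + 1" x]] by (simp add: Q_def add_nonneg_pos)
 have QR: "Q x = R * g ((1 / R) *\<^sub>R x)" if "R > 0" "norm x <= R" for x R
  by (rule LIMSEQ_unique[OF Qlim lim[OF that]])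
 have Qunif: "\<forall>\<^sub>F n in sequentially. \<forall>x. norm x <= R --> \<bar>P (k n) x - Q x\<bar> < e" if "e > 0" "R > 0" for R e
  using unif[OF that] by eventually_elim (use QR[OF that(2)] in auto)
 have Q0: "0 <= Q x" "Q x <= norm x" for x
  using LIMSEQ_le_const[OF Qlim, of 0 x] LIMSEQ_le_const2[OF Qlim, of x "norm x"] nn by auto
 have Qlip: "\<bar>Q x - Q y\<bar> <= norm (x - y)" for x y
  by (rule LIMSEQ_le_const2[OF tendsto_rabs[OF tendsto_diff[OF Qlim Qlim]]]) (use lip in auto)
 have Qscale: "Q (c *\<^sub>R x) = c * Q x" if "c > 0" for c x
  by (rule LIMSEQ_unique[OF Qlim]) (use tendsto_mult_left[OF Qlim, of c x] scale[OF that] in auto)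
 have Qadd: "Q (x + y) <= Q x + Q y" for x y
  by (rule LIMSEQ_le[OF Qlim tendsto_add[OF Qlim Qlim]]) (use polar_gauge_add[OF S] in \<open>auto simp: P_def\<close>)
 define D where "D = {x. Q x < 1}"
 have cont: "continuous_on UNIV Q" unfolding continuous_on_iff
 proof (intro ballI allI impI)
  fix x :: "complex^'d" and e :: real assume "e > 0"
  then show "\<exists>d>0. \<forall>x'\<in>UNIV. dist x' x < d --> dist (Q x') (Q x) < e"
  using Qlip by (intro exI[of _ e]) (auto simp: dist_norm intro: le_less_trans)
 qed
 have "open D" unfolding D_def using cont by (intro open_Collect_less) auto
 moreover have "convex D" unfolding convex_alt
 proof (intro ballI allI impI)
  fix x y and u :: real assume xy: "x \<in> D" "y \<in> D" and u: "0 <= u & u <= 1"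
  show "(1 - u) *\<^sub>R x + u *\<^sub>R y \<in> D"
  proof (cases "u = 0 | u = 1")
  case False
  then have u01: "0 < u" "u < 1" using u by auto
  have "Q ((1 - u) *\<^sub>R x + u *\<^sub>R y) <= (1 - u) * Q x + u * Q y"
  using Qadd[of "(1 - u) *\<^sub>R x" "u *\<^sub>R y"] Qscale u01 by simp
  also have "... < 1" using xy u01 by (intro convex_bound_lt) (auto simp: D_def)
  finally show ?thesis by (simp add: D_def)
  qed (use xy in auto)
 qed
 moreover have "ball 0 1 \<subseteq> D" using le_less_trans[OF Q0(2)] by (auto simp: D_def)
 moreover have clD: "x \<in> closure D \<longleftrightarrow> Q x <= 1" for x
 proof
  assume "x \<in> closure D"
  moreover have "closed {x. Q x <= 1}" using cont by (intro closed_Collect_le) auto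
  moreover have "D \<subseteq> {x. Q x <= 1}" by (auto simp: D_def)
  ultimately show "Q x <= 1" using closure_minimal[of D "{x. Q x <= 1}"] by blast
 next
  assume "Q x <= 1"
  then show "x \<in> closure D" unfolding D_def by (rule closure_sublevel_1[where f=Q, rotated]) (rule Qscale)
 qed
 have clS: "x \<in> closure (Ss n)" if "P n x <= 1" for x n
 proof -
  have "Ss n = {y. P n y < 1}" unfolding P_def polar_gauge_less_1_iff[OF S] by simp
  then show ?thesis using closure_sublevel_1[where f="P n" and x=x] scale that by simp
 qed
 \<comment> \<open>Scaling by \<open>1 / (1 + e)\<close> carries a point of one unit sublevel set
   into the other when the gauges differ by less than \<open>e\<close> there; this turns closeness
   of gauges into Hausdorff closeness.\<close>
 have shrink: "\<exists>y. norm y <= R & dist x y <= e * R & p' y <= 1"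
  if "norm x <= R" "e > 0" "p x <= 1" "\<bar>p' x - p x\<bar> < e" "!!c. c > 0 ==> p' (c *\<^sub>R x) = c * p' x"
  for x :: "complex^'d" and R e and p p' :: "complex^'d => real"
 proof (intro exI conjI)
  define c where "c = 1 / (1 + e)"
  have c: "c > 0" "c <= 1" "1 - c <= e" "c * (1 + e) = 1" using that(2) by (auto simp: c_def field_simps)
  show "norm (c *\<^sub>R x) <= R" using c that(1) mult_right_mono[OF c(2), of "norm x"] by simp
  have "x - c *\<^sub>R x = (1 - c) *\<^sub>R x" by (simp add: scaleR_left_diff_distrib)
  then have "dist x (c *\<^sub>R x) = (1 - c) * norm x" using c by (simp add: dist_norm)
  also have "... <= e * R" using c that by (intro mult_mono) auto
  finally show "dist x (c *\<^sub>R x) <= e * R" .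
  have "p' (c *\<^sub>R x) <= c * (1 + e)" unfolding that(5)[OF c(1)] using that(3,4) c by (intro mult_left_mono) auto
  then show "p' (c *\<^sub>R x) <= 1" using c by simp
 qed
 have "local_hausdorff_tendsto (%n. Ss (k n)) D" unfolding local_hausdorff_tendsto_def
 proof (intro exI[of _ 1] conjI allI impI)
  fix R :: real assume R: "1 <= R"
  then have cb: "closure (ball 0 R) = cball (0::complex^'d) R" by simp
  show "(%n. hausdorff_distance (closure (Ss (k n)) \<inter> closure (ball 0 R)) (closure D \<inter> closure (ball 0 R))) \<longlonglongrightarrow> 0"
  unfolding cb
  proof (rule order_tendstoI)
  fix a :: ennreal assume "0 < a"
  then obtain e where e: "e > 0" "ennreal e < a"
  by (metis dense ennreal_cases ennreal_less_zero_iff infinity_ennreal_def not_less_iff_gr_or_eq order.strict_trans top.not_eq_extremum)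
  have "\<forall>\<^sub>F n in sequentially. \<forall>x. norm x <= R --> \<bar>P (k n) x - Q x\<bar> < e / R" using e R by (intro Qunif) auto
  then show "\<forall>\<^sub>F n in sequentially. hausdorff_distance (closure (Ss (k n)) \<inter> cball 0 R) (closure D \<inter> cball 0 R) < a"
  proof eventually_elim
  case (elim n)
  have eR: "e / R > 0" "e / R * R = e" using e R by auto
  have "hausdorff_distance (closure (Ss (k n)) \<inter> cball 0 R) (closure D \<inter> cball 0 R) <= ennreal e"
  proof (rule hausdorff_distance_le)
  fix x assume x: "x \<in> closure (Ss (k n)) \<inter> cball 0 R"
  then have "P (k n) x <= 1" unfolding P_def by (intro polar_gauge_closure[OF S]) auto
  then obtain y where "norm y <= R" "dist x y <= e" "Q y <= 1"
  using shrink[of x R "e / R" "P (k n)" Q] x elim eR Qscale by (auto simp: abs_minus_commute)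
  then show "\<exists>y\<in>closure D \<inter> cball 0 R. dist x y <= e" using clD by auto
  next
  fix x assume x: "x \<in> closure D \<inter> cball 0 R"
  then obtain y where "norm y <= R" "dist x y <= e" "P (k n) y <= 1"
  using shrink[of x R "e / R" Q "P (k n)"] clD elim eR scale by auto
  then show "\<exists>y\<in>closure (Ss (k n)) \<inter> cball 0 R. dist y x <= e" using clS by (auto simp: dist_commute)
  qed (use e in simp)
  then show ?case using e(2) by simp
  qed
  qed simp
 qed simp
 ultimately show ?thesis using that[OF k(1)] by blast
qed

section \<open>Affine charts and limits of rescaled domains\<close>

definition chart :: "(complex^'d) set => complex^'d => complex^'d^'d => (complex^'d) set" where
 "chart Omega u A = {x. u + A *v x \<in> Omega}"

lemma open_chart: "open Omega ==> open (chart Omega u A)"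
 unfolding chart_def using open_vimage[of Omega "%x. u + A *v x"]
 by (simp add: vimage_def continuous_on_add linear_continuous_on bounded_linear_matrix)

lemma convex_chart: "convex Omega ==> convex (chart Omega u A)"
proof -
 assume c: "convex Omega"
 have "u + A *v (a *\<^sub>R x + b *\<^sub>R y) = a *\<^sub>R (u + A *v x) + b *\<^sub>R (u + A *v y)" if "a + b = 1" for a b and x y :: "complex^'a"
 proof -
  have "a *\<^sub>R u + b *\<^sub>R u = u" using that by (simp flip: scaleR_add_left)
  then show ?thesis by (simp add: linear_add[OF linear_matrix] linear_scale[OF linear_matrix] scaleR_add_right algebra_simps)
 qed
 then show ?thesis using c unfolding chart_def convex_def by simp
qed

lemma chart_image:
 assumes "invertible A"
 obtains B b where "invertible B" "chart Omega u A = (%x. B *v x + b) ` Omega"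
proof -
 obtain B where B: "A ** B = mat 1" "B ** A = mat 1" using assms unfolding invertible_def by blast
 have BA: "B *v (A *v x) = x" "A *v (B *v x) = x" for x by (simp_all add: matrix_vector_mul_assoc B)
 note lin = linear_add[OF linear_matrix] linear_diff[OF linear_matrix] linear_neg[OF linear_matrix]
 have "chart Omega u A = (%x. B *v x + (- (B *v u))) ` Omega"
 proof (intro set_eqI iffI)
  fix x assume "x \<in> chart Omega u A"
  then show "x \<in> (%x. B *v x + (- (B *v u))) ` Omega"
  by (intro image_eqI[of _ _ "u + A *v x"]) (auto simp: chart_def lin BA)
 qed (auto simp: chart_def lin BA)
 moreover have "invertible B" using B unfolding invertible_def by blast
 ultimately show ?thesis using that by blast
qed

lemma image_chart:
 assumes "B \<in> complex_affine_group"
 obtains u A where "invertible A" "B ` Omega = chart Omega u A"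
proof -
 obtain M b where M: "invertible M" "B = (%x. M *v x + b)" using assms unfolding complex_affine_group_def by blast
 obtain A where A: "M ** A = mat 1" "A ** M = mat 1" using M(1) unfolding invertible_def by blast
 have MA: "M *v (A *v x) = x" "A *v (M *v x) = x" for x by (simp_all add: matrix_vector_mul_assoc A)
 note lin = linear_add[OF linear_matrix] linear_diff[OF linear_matrix] linear_neg[OF linear_matrix]
 have "B ` Omega = chart Omega (- (A *v b)) A"
 proof (intro set_eqI iffI)
  fix x assume "x \<in> chart Omega (- (A *v b)) A"
  then show "x \<in> B ` Omega"
  by (intro image_eqI[of _ _ "- (A *v b) + A *v x"]) (auto simp: chart_def lin MA M(2))
 qed (auto simp: chart_def lin MA M(2))
 moreover have "invertible A" using A unfolding invertible_def by blast
 ultimately show ?thesis using that by blast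
qed

text \<open>Domains in normal form contain the unit ball, so a subsequence converges. A complex line
  in the limit would put discs longer than \<open>width\<close> into the rescaled domains, which the
  normal form forbids.\<close>

lemma rescaling_limit:
 fixes Omega :: "(complex^'d) set"
 assumes Omega: "open Omega" "convex Omega" "bounded Omega" and u: "!!n. u n \<in> Omega"
 obtains r :: "nat => nat" and A and D where "strict_mono r" "D \<in> affine_orbit_closure Omega"
  "local_hausdorff_tendsto (%n. chart Omega (u (r n)) (A n)) D" "!!n x. norm x < 1 ==> u (r n) + A n *v x \<in> Omega"
  "!!n w. (!!c. cmod c <= 1 ==> u (r n) + c *s (A n *v w) \<in> closure Omega) ==> norm w <= width TYPE('d)"
  "!!n. invertible (A n)" "open D" "convex D" "ball 0 1 \<subseteq> D"
proof -
 have "\<exists>A::complex^'d^'d. invertible A & (\<forall>x. norm x < 1 --> u n + A *v x \<in> Omega) &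
  (\<forall>w. (\<forall>c. cmod c <= 1 --> u n + c *s (A *v w) \<in> closure Omega) --> norm w <= width TYPE('d))" for n
  by (rule normal_form[OF Omega u[of n]]) blast
 then obtain A where A: "!!n. invertible (A n :: complex^'d^'d)" "!!n x. norm x < 1 ==> u n + A n *v x \<in> Omega"
  "!!n w. (!!c. cmod c <= 1 ==> u n + c *s (A n *v w) \<in> closure Omega) ==> norm w <= width TYPE('d)"
  by metis
 define S where "S n = chart Omega (u n) (A n)" for n
 have S: "open (S n)" "convex (S n)" "ball 0 1 \<subseteq> S n" for n
  using open_chart[OF Omega(1)] convex_chart[OF Omega(2)] A(2) by (auto simp: S_def chart_def)
 obtain r D where r: "strict_mono r" and D: "open D" "convex D" "ball 0 1 \<subseteq> D" and lim: "local_hausdorff_tendsto (%n. S (r n)) D"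
  by (rule convex_limit[of S]) (use S in auto)
 have "~ range (%c. p + c *s v) \<subseteq> D" if v: "v ~= 0" for p v :: "complex^'d"
 proof
  assume line: "range (%c. p + c *s v) \<subseteq> D"
  have int: "0 \<in> interior D" using D(1,3) by (auto simp: interior_open)
  \<comment> \<open>Contracting ever more distant points of the line towards 0 moves the line to the
    origin.\<close>
  have "c *s v \<in> closure D" for c unfolding closure_sequential
  proof (intro exI conjI allI)
  fix n :: nat
  have "p + (of_nat (Suc n) * c) *s v \<in> D" using line by blast
  moreover have "0 \<in> D" using D(3) by auto
  ultimately have "(1 - 1 / real (Suc n)) *\<^sub>R 0 + (1 / real (Suc n)) *\<^sub>R (p + (of_nat (Suc n) * c) *s v) \<in> D"
  by (intro convexD_alt[OF D(2)]) (auto simp: field_simps)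
  moreover have "(1 / real (Suc n)) *\<^sub>R ((of_nat (Suc n) * c) *s v) = c *s v"
  proof -
  have "complex_of_real (1 / real (Suc n)) * (of_nat (Suc n) * c) = c"
  by (simp del: of_nat_Suc add: of_nat_Suc[symmetric])
  then show ?thesis unfolding scaleR_smult vector_smult_assoc by simp
  qed
  ultimately show "(1 / real (Suc n)) *\<^sub>R p + c *s v \<in> D" by (simp add: scaleR_add_right)
  next
  have "(%n. (1 / real (Suc n)) *\<^sub>R p + c *s v) \<longlonglongrightarrow> 0 *\<^sub>R p + c *s v"
  by (intro tendsto_intros LIMSEQ_Suc[OF lim_1_over_n])
  then show "(%n. (1 / real (Suc n)) *\<^sub>R p + c *s v) \<longlonglongrightarrow> c *s v" by simp
  qed
  then have cv: "c *s v \<in> D" for c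
  proof -
  assume cl: "!!c. c *s v \<in> closure D"
  show ?thesis
  proof (cases "c = 0")
  case True
  then show ?thesis using D(3) by auto
  next
  case False
  have "c *s v = (1/2) *\<^sub>R ((2 * c) *s v)" unfolding scaleR_smult vector_smult_assoc by simp
  moreover have "(2 * c) *s v ~= 0" using False v by simp
  ultimately have "c *s v \<in> open_segment 0 ((2 * c) *s v)" unfolding in_segment
  by (auto intro!: exI[of _ "1/2"])
  then show ?thesis using in_interior_closure_convex_segment[OF D(2) int cl[of "2 * c"]] interior_subset by blast
  qed
  qed
  define w where "w = ((width TYPE('d) + 1) / norm v) *\<^sub>R v"
  have W: "width TYPE('d) >= 0" by (simp add: width_def)
  have nw: "norm w = width TYPE('d) + 1" using v W by (simp add: w_def)
  have "compact ((%c. c *s w) ` cball 0 1)"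
  by (intro compact_continuous_image linear_continuous_on bounded_linear_smult_left) simp
  moreover have "(%c. c *s w) ` cball 0 1 \<subseteq> D" unfolding w_def scaleR_smult vector_smult_assoc using cv by auto
  ultimately have "\<forall>\<^sub>F n in sequentially. (%c. c *s w) ` cball 0 1 \<subseteq> S (r n)"
  by (rule local_hausdorff_inner[OF lim S(1,2) D(1)])
  then obtain n where n: "(%c. c *s w) ` cball 0 1 \<subseteq> S (r n)" unfolding eventually_sequentially by blast
  have "norm w <= width TYPE('d)"
  proof (rule A(3))
  fix c :: complex assume "cmod c <= 1"
  then have "c *s w \<in> S (r n)" by (intro subsetD[OF n] imageI) simp
  then show "u (r n) + c *s (A (r n) *v w) \<in> closure Omega" using closure_subset by (auto simp: S_def chart_def matrix_smult)
  qed
  then show False using nw by simp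
 qed
 then have "C_properly_convex D" using D(2) unfolding C_properly_convex_def by blast
 then have pc: "D \<in> properly_convex_domains" using D by (auto simp: properly_convex_domains_def)
 have "\<exists>B \<in> complex_affine_group. B ` Omega = S n" for n
  using chart_image[OF A(1)] unfolding S_def complex_affine_group_def by (smt (verit) mem_Collect_eq)
 then obtain B where B: "!!n. B n \<in> complex_affine_group" "!!n. B n ` Omega = S n" by metis
 have "D \<in> affine_orbit_closure Omega" unfolding affine_orbit_closure_def
  using pc B lim by (auto intro!: exI[of _ "%n. B (r n)"])
 then show ?thesis
  using that[of r D "%n. A (r n)"] r lim A D unfolding S_def by blast
qed

subsection \<open>Simple boundaries imply hyperbolicity\<close>

text \<open>The discs at \<open>p + exp (- t) w\<close> have radius proportional to the velocity, so
  the speed is bounded. The factor 2 absorbs the variation of \<open>exp (- t)\<close> over steps of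
  length at most 1, which are then concatenated.\<close>

lemma (in ke_domain) exp_path:
 assumes k: "k > 0" and disc: "!!tau c. t0 <= tau ==> tau <= t1 ==> cmod c <= 1 ==>
  p + exp (- tau) *\<^sub>R w + c *s ((k * exp (- tau)) *\<^sub>R w) \<in> Omega"
  and tu: "t0 <= t" "t <= u" "u <= t1"
 shows "d (p + exp (- t) *\<^sub>R w) (p + exp (- u) *\<^sub>R w) <= 2 * C1 / k * (u - t)"
proof -
 define P where "P t = p + exp (- t) *\<^sub>R w" for t
 have PO: "P tau \<in> Omega" if "t0 <= tau" "tau <= t1" for tau using disc[OF that, of 0] by (simp add: P_def)
 have short: "d (P t) (P u) <= 2 * C1 / k * (u - t)" if tu: "t0 <= t" "t <= u" "u <= t1" "u - t <= 1" for t u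
 proof (cases "t = u")
  case True
  then show ?thesis using d_self by simp
 next
  case False
  define R where "R = k / (2 * (u - t))"
  have R: "R > 0" using k False tu by (simp add: R_def)
  have "d (P t) (P u) <= C1 / R"
  proof (rule d_segment_discs[OF PO PO R])
  fix z and c :: complex assume z: "z \<in> closed_segment (P t) (P u)" and c: "cmod c <= 1"
  obtain mu where mu: "0 <= mu" "mu <= 1" "z = (1 - mu) *\<^sub>R P t + mu *\<^sub>R P u" using z by (auto simp: in_segment)
  define e where "e = (1 - mu) * exp (- t) + mu * exp (- u)"
  have le: "exp (- u) <= exp (- t)" using tu by simp
  have e: "exp (- u) <= e" "e <= exp (- t)"
  proof -
  have "mu * exp (- u) <= mu * exp (- t)" "(1 - mu) * exp (- u) <= (1 - mu) * exp (- t)"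
  using le mu by (auto intro!: mult_left_mono)
  then show "exp (- u) <= e" "e <= exp (- t)" by (auto simp: e_def algebra_simps)
  qed
  have e0: "e > 0" by (rule less_le_trans[OF exp_gt_zero e(1)])
  define tau where "tau = - ln e"
  have tau: "exp (- tau) = e" using e0 by (simp add: tau_def)
  have "t <= tau" "tau <= u" using e unfolding tau[symmetric] by auto
  have zP: "z = p + exp (- tau) *\<^sub>R w" unfolding tau mu(3) P_def e_def by (simp add: algebra_simps)
  have "R *\<^sub>R (P u - P t) = (R * (exp (- u) - exp (- t))) *\<^sub>R w" by (simp add: P_def algebra_simps)
  also have "... = of_real ((R * (exp (- u) - exp (- t))) / (k * e)) *s ((k * e) *\<^sub>R w)"
  using k e0 unfolding scaleR_smult[symmetric] by simp
  finally have v: "c *s (R *\<^sub>R (P u - P t)) = (c * of_real ((R * (exp (- u) - exp (- t))) / (k * e))) *s ((k * exp (- tau)) *\<^sub>R w)"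
  by (simp add: vector_smult_assoc tau)
  \<comment> \<open>Convexity of \<open>exp\<close> on the unit interval, with
    \<open>exp 1 <= 3\<close>.\<close>
  have "exp (u - t) <= 1 + 2 * (u - t)"
  proof -
  have "exp ((1 - (u - t)) *\<^sub>R 0 + (u - t) *\<^sub>R 1) <= (1 - (u - t)) * exp 0 + (u - t) * exp (1::real)"
  using convex_onD[OF exp_convex, of "u - t" 0 1] tu by simp
  moreover have "(u - t) * exp 1 <= (u - t) * 3" using exp_le tu by (intro mult_left_mono) auto
  ultimately show ?thesis by (simp add: algebra_simps)
  qed
  then have "exp (- t) - exp (- u) <= (2 * (u - t)) * exp (- u)"
  using mult_right_mono[of "exp (u - t)" "1 + 2 * (u - t)" "exp (- u)"] by (simp add: algebra_simps flip: exp_add)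
  also have "... <= (2 * (u - t)) * e" using e tu by (intro mult_left_mono) auto
  finally have "R * (exp (- t) - exp (- u)) <= R * ((2 * (u - t)) * e)" using R by (intro mult_left_mono) auto
  also have "... = k * e" using False by (simp add: R_def)
  finally have "\<bar>R * (exp (- u) - exp (- t))\<bar> <= k * e" using R le by (simp add: abs_mult)
  then have "\<bar>(R * (exp (- u) - exp (- t))) / (k * e)\<bar> <= 1" using k e0 by (simp add: abs_divide divide_le_eq)
  then have "cmod (c * of_real ((R * (exp (- u) - exp (- t))) / (k * e))) <= 1 * 1"
  unfolding norm_mult norm_of_real using c by (intro mult_mono) auto
  then show "z + c *s (R *\<^sub>R (P u - P t)) \<in> Omega" unfolding v zP
  using \<open>t <= tau\<close> \<open>tau <= u\<close> tu by (intro disc) auto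
  qed (use tu in auto)
  then show ?thesis using False k by (simp add: R_def field_simps)
 qed
 have "d (P t) (P u) <= 2 * C1 / k * (u - t)" if "t0 <= t" "t <= u" "u <= t1" "u - t <= real n" for n t u
  using that
 proof (induction n arbitrary: u)
  case 0
  then show ?case using d_self by simp
 next
  case (Suc n)
  define v where "v = max t (u - 1)"
  have v: "t <= v" "v <= u" "u - v <= 1" "v - t <= real n" using Suc.prems by (auto simp: v_def)
  have "d (P t) (P v) <= 2 * C1 / k * (v - t)" using Suc.IH[of v] Suc.prems v by simp
  moreover have "d (P v) (P u) <= 2 * C1 / k * (u - v)" using short Suc.prems v by simp
  moreover have "d (P t) (P u) <= d (P t) (P v) + d (P v) (P u)"
  using Suc.prems v by (intro d_triangle PO) auto
  moreover have "2 * C1 / k * (v - t) + 2 * C1 / k * (u - v) = 2 * C1 / k * (u - t)" by (simp add: algebra_simps add_divide_distrib diff_divide_distrib)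
  ultimately show ?case by linarith
 qed
 from this[OF tu, of "nat \<lceil>u - t\<rceil>"] show ?thesis unfolding P_def by (simp add: of_nat_ceiling)
qed

section \<open>Rays from an interior point to the boundary\<close>

locale ke_rays = ke_domain Omega G
 for Omega :: "(complex^'d) set" and G +
 fixes p0 :: "complex^'d" and rho :: real
 assumes rho: "rho > 0" and ball_p0: "ball p0 rho \<subseteq> Omega"
begin

definition S0 :: "(complex^'d) set" where "S0 = (%x. p0 + rho *\<^sub>R x) -` Omega"

definition g :: "complex^'d => real" where "g x = polar_gauge S0 ((1 / rho) *\<^sub>R (x - p0))"

text \<open>In this scale rays have bounded speed: the gauge distance left to the boundary is
  \<open>exp (- ht x)\<close>.\<close>

definition ht :: "complex^'d => real" where "ht x = - ln (1 - g x)"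

text \<open>The boundary point on the half-line from \<open>p0\<close> through \<open>x\<close>. For
  \<open>x = p0\<close> it is \<open>p0\<close>, and the ray is constant.\<close>

definition tip :: "complex^'d => complex^'d" where "tip x = p0 + (1 / g x) *\<^sub>R (x - p0)"

definition ray :: "complex^'d => real => complex^'d" where "ray x t = tip x + exp (- t) *\<^sub>R (p0 - tip x)"

lemma p0: "p0 \<in> Omega" using ball_p0 rho by auto

lemma S0: "open S0" "convex S0" "ball 0 1 \<subseteq> S0"
proof -
 show "open S0" unfolding S0_def by (intro open_vimage open_dom continuous_intros)
 show "convex S0" unfolding S0_def
 proof (rule convexI)
  fix x y and u v :: real
  assume "x \<in> (%x. p0 + rho *\<^sub>R x) -` Omega" "y \<in> (%x. p0 + rho *\<^sub>R x) -` Omega" and uv: "0 <= u" "0 <= v" "u + v = 1"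
  then have "u *\<^sub>R (p0 + rho *\<^sub>R x) + v *\<^sub>R (p0 + rho *\<^sub>R y) \<in> Omega" by (intro convexD[OF convex_dom]) auto
  moreover have "u *\<^sub>R (p0 + rho *\<^sub>R x) + v *\<^sub>R (p0 + rho *\<^sub>R y) = (u + v) *\<^sub>R p0 + rho *\<^sub>R (u *\<^sub>R x + v *\<^sub>R y)"
  by (simp add: algebra_simps)
  ultimately show "u *\<^sub>R x + v *\<^sub>R y \<in> (%x. p0 + rho *\<^sub>R x) -` Omega" using uv by simp
 qed
 show "ball 0 1 \<subseteq> S0" unfolding S0_def using rho by (auto intro!: subsetD[OF ball_p0] simp: dist_norm)
qed

lemma g_less_1_iff: "g x < 1 \<longleftrightarrow> x \<in> Omega"
 unfolding g_def polar_gauge_less_1_iff[OF S0] using rho by (simp add: S0_def)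

lemma g_nonneg: "0 <= g x" unfolding g_def by (rule polar_gauge_nonneg[OF S0])

lemma g_add: "g (x + w) <= g x + norm w / rho"
proof -
 have "g (x + w) <= g x + polar_gauge S0 ((1 / rho) *\<^sub>R w)"
  unfolding g_def using polar_gauge_add[OF S0, of "(1 / rho) *\<^sub>R (x - p0)" "(1 / rho) *\<^sub>R w"]
  by (simp add: algebra_simps)
 then show ?thesis using polar_gauge_le_norm[OF S0, of "(1 / rho) *\<^sub>R w"] rho by simp
qed

lemma g_p0: "g p0 = 0" using polar_gauge_le_norm[OF S0, of 0] g_nonneg[of p0] by (simp add: g_def)

lemma g_scale: "c >= 0 ==> g (p0 + c *\<^sub>R (x - p0)) = c * g x"
 using polar_gauge_scale[OF S0, of c "(1 / rho) *\<^sub>R (x - p0)"] g_p0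
 by (cases "c = 0") (simp_all add: g_def mult.commute)

lemma g_lower: obtains Del where "Del > 0" "!!x. norm (x - p0) <= Del * g x"
proof -
 obtain B where B: "!!x. x \<in> Omega ==> norm x <= B" using bounded_dom unfolding bounded_iff by blast
 define Del where "Del = B + norm p0 + 1"
 have Del: "Del > 0" using B[OF p0] norm_ge_zero[of p0] unfolding Del_def by linarith
 show ?thesis
 proof (rule that[OF Del])
  fix x
  show "norm (x - p0) <= Del * g x"
  proof (cases "x = p0")
  case True
  then show ?thesis by (simp add: g_p0)
  next
  case False
  define y where "y = p0 + (Del / norm (x - p0)) *\<^sub>R (x - p0)"
  have "norm (y - p0) = Del" using False Del by (simp add: y_def)
  then have "norm y > B" using norm_triangle_ineq4[of y p0] by (simp add: Del_def)
  then have "1 <= g y" using B[of y] g_less_1_iff[of y] by force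
  also have "g y = (Del / norm (x - p0)) * g x" unfolding y_def using Del by (intro g_scale) simp
  finally show ?thesis using False by (simp add: field_simps)
  qed
 qed
qed

lemma g_pos: "x ~= p0 ==> g x > 0"
proof -
 assume x: "x ~= p0"
 obtain Del where "Del > 0" "norm (x - p0) <= Del * g x" by (rule g_lower) blast
 then show ?thesis using x g_nonneg[of x] by (cases "g x = 0") auto
qed

lemma ray_alt: "ray x t = p0 + (1 - exp (- t)) *\<^sub>R (tip x - p0)"
 by (simp add: ray_def algebra_simps)

lemma g_tip: "x ~= p0 ==> g (tip x) = 1"
 unfolding tip_def using g_pos[of x] g_scale[of "1 / g x" x] by simp

lemma g_tip_le: "g (tip x) <= 1"
 using g_tip[of x] g_p0 by (cases "x = p0") (auto simp: tip_def)

lemma g_ray: "t >= 0 ==> g (ray x t) = (1 - exp (- t)) * g (tip x)"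
 unfolding ray_alt by (rule g_scale) simp

lemma ray_ball: assumes "t >= 0" "norm w < rho * exp (- t)" shows "ray x t + w \<in> Omega"
proof -
 have "g (ray x t + w) <= (1 - exp (- t)) * g (tip x) + norm w / rho" using g_add g_ray[OF assms(1)] by metis
 also have "... < (1 - exp (- t)) * 1 + exp (- t)"
  using assms g_tip_le[of x] rho by (intro add_le_less_mono mult_left_mono) (auto simp: divide_less_eq mult.commute)
 finally show ?thesis by (simp add: g_less_1_iff)
qed

lemma ray_in: "t >= 0 ==> ray x t \<in> Omega"
 using ray_ball[of t 0 x] rho by simp

lemma ht_nonneg: "x \<in> Omega ==> ht x >= 0"
 using g_less_1_iff[of x] g_nonneg[of x] by (simp add: ht_def)

lemma exp_ht: "x \<in> Omega ==> exp (- ht x) = 1 - g x"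
 using g_less_1_iff[of x] by (simp add: ht_def)

lemma ht_p0: "ht p0 = 0" by (simp add: ht_def g_p0)

lemma ray_0: "ray x 0 = p0" by (simp add: ray_def)

lemma ray_p0: "ray p0 t = p0" by (simp add: ray_def tip_def)

lemma ray_ht: "x \<in> Omega ==> ray x (ht x) = x"
proof (cases "x = p0")
 case False
 assume x: "x \<in> Omega"
 show ?thesis unfolding ray_alt exp_ht[OF x] using g_pos[OF False] by (simp add: tip_def)
qed (simp add: ray_p0)

lemma ht_ray: "x \<in> Omega ==> 0 <= t ==> t <= ht x ==> ht (ray x t) = t"
proof (cases "x = p0")
 case False
 assume "x \<in> Omega" "0 <= t" "t <= ht x"
 then show ?thesis using g_ray[of t x] g_tip[OF False] by (simp add: ht_def)
qed (simp add: ray_p0 ht_p0)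

lemma ray_ray: "x \<in> Omega ==> 0 <= u ==> u <= t ==> ray (ray x t) u = ray x u"
proof (cases "x = p0 | t = 0")
 case False
 assume *: "x \<in> Omega" "0 <= u" "u <= t"
 have e: "1 - exp (- t) > 0" using False * by simp
 have "tip (ray x t) = tip x"
  unfolding tip_def[of "ray x t"] using g_ray[of t x] g_tip[of x] False * e by (simp add: ray_alt)
 then show ?thesis by (simp add: ray_def)
qed (auto simp: ray_p0 ray_0)

text \<open>\<open>1 - g\<close> is an infimum of affine functions positive on the domain, and their
  logarithms are all Lipschitz with the same constant \<open>C0\<close>.\<close>

lemma ht_lipschitz: assumes xy: "x \<in> Omega" "y \<in> Omega" shows "\<bar>ht x - ht y\<bar> <= C0 * d x y"
proof -
 have "ht x <= ht y + C0 * d x y" if xy: "x \<in> Omega" "y \<in> Omega" for x y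
 proof -
  have "g x <= 1 - exp (- (ht y + C0 * d x y))" unfolding g_def
  proof (rule polar_gauge_least[OF S0])
  fix a assume a: "\<forall>y\<in>S0. a \<bullet> y <= 1"
  define f where "f z = - (a \<bullet> ((1 / rho) *\<^sub>R z))" for z
  have f: "linear f" unfolding f_def by (rule linearI) (simp_all add: inner_add_right add_divide_distrib)
  have ag: "a \<bullet> ((1 / rho) *\<^sub>R (z - p0)) <= g z" for z unfolding g_def by (rule polar_gauge_upper[OF S0 a])
  have r: "1 - f p0 + f z = 1 - a \<bullet> ((1 / rho) *\<^sub>R (z - p0))" for z
  by (simp add: f_def inner_diff_right diff_divide_distrib)
  have pos: "1 - f p0 + f z > 0" if "z \<in> Omega" for z
  unfolding r using ag[of z] that g_less_1_iff[of z] by linarith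
  have "ln (1 - f p0 + f y) - ln (1 - f p0 + f x) <= C0 * d x y"
  using ln_affine_lipschitz[OF f pos xy] by linarith
  moreover have "- ht y <= ln (1 - f p0 + f y)"
  unfolding ht_def using ag[of y] pos[OF xy(2)] g_less_1_iff[of y] xy(2) by (simp add: r)
  ultimately have "- (ht y + C0 * d x y) <= ln (1 - f p0 + f x)" by linarith
  then have "exp (- (ht y + C0 * d x y)) <= 1 - f p0 + f x" using pos[OF xy(1)] by (simp only: ln_ge_iff)
  then show "a \<bullet> ((1 / rho) *\<^sub>R (x - p0)) <= 1 - exp (- (ht y + C0 * d x y))" by (simp add: r)
  qed
  then have "exp (- (ht y + C0 * d x y)) <= exp (- ht x)" unfolding exp_ht[OF xy(1)] by simp
  then show ?thesis by simp
 qed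
 from this[OF xy] this[OF xy(2,1)] show ?thesis using d_commute[of x y] by simp
qed

text \<open>Passing from height \<open>u\<close> to the lower height \<open>t\<close> is a homothety
  with centre \<open>p0\<close>, the same one on all rays.\<close>

lemma ray_mono:
 assumes "x \<in> Omega" "y \<in> Omega" "0 <= t" "t <= u"
 shows "d (ray x t) (ray y t) <= M1 * d (ray x u) (ray y u)"
proof (cases "t = 0")
 case True
 have "0 <= M1 * d (ray x u) (ray y u)" using M1_ge_1 d_nonneg by simp
 then show ?thesis using True d_self by (simp add: ray_0)
next
 case False
 define mu where "mu = (1 - exp (- t)) / (1 - exp (- u))"
 have e: "1 - exp (- t) > 0" "1 - exp (- u) > 0" "1 - exp (- t) <= 1 - exp (- u)" using False assms by auto
 then have mu: "0 < mu" "mu <= 1" by (auto simp: mu_def)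
 have "ray z t = p0 + mu *\<^sub>R (ray z u - p0)" for z using e by (simp add: ray_alt mu_def)
 then show ?thesis using d_homothety[OF p0 ray_in ray_in mu, of u u x y] assms by simp
qed

text \<open>These are the discs that \<open>exp_path\<close> asks for; \<open>k\<close> is uniform
  because \<open>norm (p0 - tip x)\<close> is bounded by the size of the domain.\<close>

lemma tip_disc:
 obtains k where "k > 0" "!!x t c. 0 <= t ==> cmod c <= 1 ==> ray x t + c *s ((k * exp (- t)) *\<^sub>R (p0 - tip x)) \<in> Omega"
proof -
 obtain Del where Del: "Del > 0" "!!x. norm (x - p0) <= Del * g x" by (rule g_lower) blast
 define k where "k = rho / (2 * Del)"
 have k: "k > 0" using rho Del by (simp add: k_def)
 show ?thesis
 proof (rule that[OF k], rule ray_ball)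
  fix x and t :: real and c :: complex assume c: "cmod c <= 1"
  have "Del * g (tip x) <= Del * 1" using Del(1) g_tip_le by (intro mult_left_mono) auto
  then have n: "norm (p0 - tip x) <= Del" using Del(2)[of "tip x"] by (simp add: norm_minus_commute)
  have "norm (c *s ((k * exp (- t)) *\<^sub>R (p0 - tip x))) = cmod c * (k * exp (- t) * norm (p0 - tip x))"
  using k by (simp add: norm_smult)
  also have "... <= 1 * (k * exp (- t) * Del)" using c k n by (intro mult_mono mult_left_mono) auto
  also have "... < rho * exp (- t)" using Del(1) rho by (simp add: k_def)
  finally show "norm (c *s ((k * exp (- t)) *\<^sub>R (p0 - tip x))) < rho * exp (- t)" .
 qed
qed

lemma ray_speed:
 obtains C where "C >= 0" "!!x t u. 0 <= t ==> t <= u ==> d (ray x t) (ray x u) <= C * (u - t)"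
proof -
 obtain k where k: "k > 0" "!!x t c. 0 <= t ==> cmod c <= 1 ==> ray x t + c *s ((k * exp (- t)) *\<^sub>R (p0 - tip x)) \<in> Omega"
  by (rule tip_disc) blast
 show ?thesis
 proof (rule that[of "2 * C1 / k"])
  fix x t u assume tu: "(0::real) <= t" "t <= u"
  show "d (ray x t) (ray x u) <= 2 * C1 / k * (u - t)" unfolding ray_def
  by (rule exp_path[OF k(1) _ tu order_refl]) (rule k(2)[unfolded ray_def])
 qed (use C1_nonneg k in simp)
qed

text \<open>Otherwise the rays stay at bounded, non-vanishing distance on arbitrarily long stretches. Rescaling
 at the middle of such a stretch gives a limit domain with a boundary point \<open>xi\<close> such that
 \<open>(1 - exp (- sigma)) xi\<close> and its translate by \<open>a\<close> stay at bounded distance as \<open>sigma\<close> grows, which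
 forces a disc in the direction \<open>a\<close> into the boundary.\<close>

lemma ray_contraction:
 assumes simple: "!!D. D \<in> affine_orbit_closure Omega ==> simple_boundary D"
 shows "\<exists>sigma\<ge>0. \<forall>x\<in>Omega. \<forall>y\<in>Omega. \<forall>t\<ge>sigma. t <= ht x --> d (ray x t) (ray y t) <= K -->
  d (ray x (t - sigma)) (ray y (t - sigma)) <= 1"
proof (rule ccontr)
 assume neg: "~ ?thesis"
 have "\<exists>x y t. x \<in> Omega & y \<in> Omega & real n <= t & t <= ht x & d (ray x t) (ray y t) <= K & 1 < d (ray x (t - real n)) (ray y (t - real n))" for n
  using neg not_less by (metis of_nat_0_le_iff)
 then obtain X Y T where XY: "!!n. X n \<in> Omega" "!!n. Y n \<in> Omega" and T: "!!n. real n <= T n" "!!n. T n <= ht (X n)"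
  and dK: "!!n. d (ray (X n) (T n)) (ray (Y n) (T n)) <= K"
  and d1: "!!n. 1 < d (ray (X n) (T n - real n)) (ray (Y n) (T n - real n))" by metis
 define K' where "K' = M1 * K"
 have upper: "d (ray (X n) tau) (ray (Y n) tau) <= K'" if "0 <= tau" "tau <= T n" for n tau
 proof -
  have "d (ray (X n) tau) (ray (Y n) tau) <= M1 * d (ray (X n) (T n)) (ray (Y n) (T n))" by (rule ray_mono[OF XY that])
  also have "... <= K'" unfolding K'_def using dK M1_ge_1 by (intro mult_left_mono) auto
  finally show ?thesis .
 qed
 \<comment> \<open>The middle of the stretch: below it the distance is still bounded away from 0,
   and above it the rays stay close over a length that tends to infinity.\<close>
 define m where "m n = T n - real n / 2" for n
 have m: "real n / 2 <= m n" "0 <= m n" "m n <= T n" "0 <= T n - real n" "T n - real n <= m n" for n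
  using T(1)[of n] of_nat_0_le_iff[of n] unfolding m_def by linarith+
 have lower: "1 < M1 * d (ray (X n) (m n)) (ray (Y n) (m n))" for n
  using ray_mono[OF XY m(4,5), of n n n] d1[of n] by linarith
 define u u' where "u n = ray (X n) (m n)" and "u' n = ray (Y n) (m n)" for n
 have uO: "u n \<in> Omega" "u' n \<in> Omega" for n using ray_in[OF m(2)] by (auto simp: u_def u'_def)
 have X0: "X n ~= p0" for n
 proof
  assume "X n = p0"
  then have "T n - real n = 0" using T(2)[of n] m(4)[of n] ht_p0 by simp
  then show False using d1[of n] d_self by (simp add: ray_0)
 qed
 have mpos: "m n > 0" for n using lower[of n] m(2)[of n] d_self by (cases "m n = 0") (auto simp: ray_0)
 obtain r A D where r: "strict_mono r" and D: "D \<in> affine_orbit_closure Omega"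
  and lim: "local_hausdorff_tendsto (%n. chart Omega (u (r n)) (A n)) D" and bA: "!!n x. norm x < 1 ==> u (r n) + A n *v x \<in> Omega"
  and wA: "!!n w. (!!c. cmod c <= 1 ==> u (r n) + c *s (A n *v w) \<in> closure Omega) ==> norm w <= width TYPE('d)"
  and iA: "!!n. invertible (A n)" and oD: "open D" "convex D" "ball 0 1 \<subseteq> D"
  by (rule rescaling_limit[where u=u, OF open_dom convex_dom bounded_dom uO(1)]) blast
 obtain B where B: "!!n. A n ** B n = mat 1" using iA unfolding invertible_def by metis
 have AB: "A n *v (B n *v x) = x" for n x by (simp add: matrix_vector_mul_assoc B)
 \<comment> \<open>In the chart centred at \<open>u\<close>, \<open>xi\<close> is the end of the
   first ray and \<open>a\<close> the point of the second ray at the same height.\<close>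
 define xi a where "xi n = B n *v (tip (X (r n)) - u (r n))" and "a n = B n *v (u' (r n) - u (r n))" for n
 define phi where "phi n x = u (r n) + A n *v x" for n x
 \<comment> \<open>Both rays start at \<open>p0\<close>, so their difference at height
   \<open>m + sigma\<close> is \<open>q\<close> times that at height \<open>m\<close>. The factor
   tends to 1 as \<open>m\<close> tends to infinity.\<close>
 define q where "q n sigma = (1 - exp (- (m (r n) + sigma))) / (1 - exp (- m (r n)))" for n sigma
 define x y where "x n sigma = (1 - exp (- sigma)) *\<^sub>R xi n" and "y n sigma = x n sigma + q n sigma *\<^sub>R a n" for n sigma
 note Alin = linear_add[OF linear_matrix] linear_scale[OF linear_matrix]
 have ee: "exp (- (t + sigma)) = exp (- sigma) * exp (- t)" for t sigma :: real by (simp flip: exp_add)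
 have phix: "phi n (x n sigma) = ray (X (r n)) (m (r n) + sigma)" for n sigma
  unfolding phi_def x_def xi_def Alin AB u_def ray_def ee by (simp add: algebra_simps)
 have phiy: "phi n (y n sigma) = ray (Y (r n)) (m (r n) + sigma)" for n sigma
 proof -
  define e where "e = 1 - exp (- m (r n))"
  have e: "e ~= 0" using mpos[of "r n"] by (simp add: e_def)
  have "u' (r n) - u (r n) = e *\<^sub>R (tip (Y (r n)) - tip (X (r n)))"
  by (simp add: u_def u'_def ray_alt e_def algebra_simps)
  then have "q n sigma *\<^sub>R (u' (r n) - u (r n)) = (1 - exp (- (m (r n) + sigma))) *\<^sub>R (tip (Y (r n)) - tip (X (r n)))"
  using e by (simp add: q_def e_def)
  moreover have "phi n (y n sigma) = phi n (x n sigma) + q n sigma *\<^sub>R (u' (r n) - u (r n))"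
  by (simp add: phi_def y_def Alin a_def AB)
  ultimately have "phi n (y n sigma) = ray (X (r n)) (m (r n) + sigma) + (1 - exp (- (m (r n) + sigma))) *\<^sub>R (tip (Y (r n)) - tip (X (r n)))"
  unfolding phix by simp
  then show ?thesis by (simp add: ray_alt algebra_simps)
 qed
 have W: "width TYPE('d) > 0" by (simp add: width_def add_pos_pos)
 obtain k where k: "k > 0" "!!x t c. 0 <= t ==> cmod c <= 1 ==> ray x t + c *s ((k * exp (- t)) *\<^sub>R (p0 - tip x)) \<in> Omega"
  by (rule tip_disc) blast
 have bxi: "norm (xi n) <= width TYPE('d) / k" for n
 proof -
  have "norm (k *\<^sub>R xi n) <= width TYPE('d)"
  proof (rule wA)
  fix c :: complex assume c: "cmod c <= 1"
  have "c *s (A n *v (k *\<^sub>R xi n)) = (- c) *s ((k * exp (- m (r n))) *\<^sub>R (p0 - tip (X (r n))))"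
  by (simp add: xi_def Alin AB u_def ray_def vec_eq_iff algebra_simps)
  then show "u (r n) + c *s (A n *v (k *\<^sub>R xi n)) \<in> closure Omega"
  using k(2)[OF m(2), of "- c"] c closure_subset unfolding u_def by auto
  qed
  then show ?thesis using k(1) by (simp add: field_simps)
 qed
 \<comment> \<open>On the complex line from 0 through \<open>a\<close> some point at distance at
   most \<open>width + 1\<close> is omitted. By \<open>line_ratio\<close> its distances to 0 and to
   \<open>a\<close> have bounded ratio, which bounds \<open>a\<close>.\<close>
 have ba: "norm (a n) <= (width TYPE('d) + 1) * (1 + exp (C0 * K'))" for n
 proof (cases "a n = 0")
  case True
  then show ?thesis using W by (simp add: add_nonneg_nonneg)
 next
  case False
  define w where "w = ((width TYPE('d) + 1) / norm (a n)) *\<^sub>R a n"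
  have "norm w = width TYPE('d) + 1" using False W by (simp add: w_def)
  then obtain c where c: "cmod c <= 1" "u (r n) + c *s (A n *v w) \<notin> closure Omega" using wA[of n w] by force
  then have p: "u (r n) + A n *v (c *s w) \<notin> Omega" using closure_subset by (auto simp: matrix_smult)
  define l where "l = norm (a n) / (width TYPE('d) + 1)"
  have aw: "c *s w + (of_real l - c) *s w = a n"
  proof -
  have "c *s w + (of_real l - c) *s w = l *\<^sub>R w" by (simp add: scaleR_smult flip: vector_sadd_rdistrib)
  also have "... = a n" using False W by (simp add: w_def l_def)
  finally show ?thesis .
  qed
  have zw: "c *s w + (- c) *s w = 0" by (simp flip: vector_sadd_rdistrib)
  have u0: "u (r n) + A n *v 0 = u (r n)" "u (r n) + A n *v a n = u' (r n)" by (simp_all add: a_def AB)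
  have "\<bar>ln (cmod (- c)) - ln (cmod (of_real l - c))\<bar> <= C0 * d (u (r n)) (u' (r n))"
  using line_ratio[OF p, of "- c" w "of_real l - c"] uO unfolding aw zw u0 by blast
  also have "... <= C0 * K'" using upper[OF m(2,3)] C0_pos unfolding u_def u'_def by (intro mult_left_mono) auto
  finally have "ln (cmod (of_real l - c)) <= C0 * K' + ln (cmod c)" by simp
  moreover have "c ~= 0" using p uO(1) by (auto simp: u0)
  ultimately have "cmod (of_real l - c) <= exp (C0 * K')"
  proof (cases "of_real l = c")
  case nl: False
  assume ln: "ln (cmod (of_real l - c)) <= C0 * K' + ln (cmod c)" "c ~= 0"
  have "ln (cmod c) <= 0" using c(1) \<open>c ~= 0\<close> by (simp add: ln_le_zero_iff)
  then have "ln (cmod (of_real l - c)) <= C0 * K'" using ln(1) by linarith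
  then show ?thesis using nl by (metis exp_le_cancel_iff exp_ln right_minus_eq zero_less_norm_iff)
  qed simp
  then have "l <= exp (C0 * K') + 1"
  using c(1) norm_triangle_ineq[of "of_real l - c" c] by simp
  then have "l * (width TYPE('d) + 1) <= (exp (C0 * K') + 1) * (width TYPE('d) + 1)" using W by (intro mult_right_mono) auto
  moreover have "l * (width TYPE('d) + 1) = norm (a n)" using W by (simp add: l_def)
  ultimately show ?thesis by (simp only: mult.commute add.commute)
 qed
 define R1 R2 where "R1 = width TYPE('d) / k" and "R2 = (width TYPE('d) + 1) * (1 + exp (C0 * K'))"
 have R: "xi n \<in> cball 0 R1" "a n \<in> cball 0 R2" for n using bxi[of n] ba[of n] by (simp_all add: R1_def R2_def)
 have "seq_compact (cball (0::complex^'d) R1 \<times> cball (0::complex^'d) R2)"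
  by (intro compact_imp_seq_compact compact_Times compact_cball)
 moreover have "\<forall>n. (xi n, a n) \<in> cball 0 R1 \<times> cball 0 R2" using R by blast
 ultimately obtain l r2 where r2: "strict_mono (r2 :: nat => nat)" "((%n. (xi n, a n)) \<circ> r2) \<longlonglongrightarrow> l"
  by (rule seq_compactE)
 define xi' a' where "xi' = fst l" and "a' = snd l"
 have lxi: "(%n. xi (r2 n)) \<longlonglongrightarrow> xi'" and la: "(%n. a (r2 n)) \<longlonglongrightarrow> a'"
  using tendsto_fst[OF r2(2)] tendsto_snd[OF r2(2)] by (simp_all add: o_def xi'_def a'_def)
 define S where "S n = chart Omega (u (r (r2 n))) (A (r2 n))" for n
 have limS: "local_hausdorff_tendsto S D" unfolding S_def by (rule local_hausdorff_subseq[OF lim r2(1)])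
 have oS: "open (S n)" "convex (S n)" for n unfolding S_def by (rule open_chart[OF open_dom], rule convex_chart[OF convex_dom])
 have inS: "z \<in> S n \<longleftrightarrow> phi (r2 n) z \<in> Omega" for z n by (simp add: S_def chart_def phi_def)
 have big: "\<forall>\<^sub>F n in sequentially. sigma <= real (r (r2 n)) / 2" for sigma
 proof -
  have "\<forall>\<^sub>F n in sequentially. 2 * sigma <= real n" using filterlim_real_sequentially by (simp add: filterlim_at_top)
  then show ?thesis
  proof eventually_elim
  case (elim n)
  have "n <= r (r2 n)" using seq_suble[OF r(1), of "r2 n"] seq_suble[OF r2(1), of n] by simp
  then show ?case using elim by linarith
  qed
 qed
 have near: "\<forall>\<^sub>F n in sequentially. x (r2 n) sigma \<in> S n & y (r2 n) sigma \<in> S n &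
  d (phi (r2 n) (x (r2 n) sigma)) (phi (r2 n) (y (r2 n) sigma)) <= K'" if "sigma >= 0" for sigma
  using big[of sigma]
 proof eventually_elim
  case (elim n)
  have "0 <= m (r (r2 n)) + sigma" "m (r (r2 n)) + sigma <= T (r (r2 n))" using elim that m(2)[of "r (r2 n)"] by (auto simp: m_def)
  then show ?case unfolding inS phix phiy using ray_in upper by blast
 qed
 have lq: "(%n. q (r2 n) sigma) \<longlonglongrightarrow> 1" for sigma
 proof -
  have "filterlim (%n. m (r (r2 n))) at_top sequentially" unfolding filterlim_at_top
  proof
  fix Z show "\<forall>\<^sub>F n in sequentially. Z <= m (r (r2 n))"
  using big[of Z] by eventually_elim (rule order_trans[OF _ m(1)])
  qed
  then have e: "(%n. exp (- m (r (r2 n)))) \<longlonglongrightarrow> 0"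
  by (intro filterlim_compose[OF exp_at_bot]) (simp add: filterlim_uminus_at_top)
  have "(%n. (1 - exp (- m (r (r2 n))) * exp (- sigma)) / (1 - exp (- m (r (r2 n))))) \<longlonglongrightarrow> (1 - 0 * exp (- sigma)) / (1 - 0)"
  by (intro tendsto_intros e) simp
  then show ?thesis unfolding q_def ee by (simp add: mult.commute)
 qed
 \<comment> \<open>Otherwise the two points would eventually lie in the unit ball of the chart, with
   discs much longer than their separation, and their distance would tend to 0.\<close>
 have a'nz: "a' ~= 0"
 proof
  assume a'0: "a' = 0"
  have "(%n. M1 * (C1 * (2 * norm (a (r2 n))))) \<longlonglongrightarrow> M1 * (C1 * (2 * norm a'))" by (intro tendsto_intros la)
  then have "\<forall>\<^sub>F n in sequentially. M1 * (C1 * (2 * norm (a (r2 n)))) < 1" unfolding a'0 by (rule order_tendstoD) simp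
  moreover have "\<forall>\<^sub>F n in sequentially. norm (a (r2 n)) < 1 / 2" using tendsto_norm[OF la] unfolding a'0 by (rule order_tendstoD) simp
  ultimately have "\<forall>\<^sub>F n in sequentially. False"
  proof eventually_elim
  case (elim n)
  define b where "b = a (r2 n)"
  define v where "v = u (r (r2 n))"
  have v': "u' (r (r2 n)) = v + A (r2 n) *v b" by (simp add: b_def a_def AB v_def)
  have lw: "1 < M1 * d v (u' (r (r2 n)))" using lower[of "r (r2 n)"] by (simp add: v_def u_def u'_def)
  have "b ~= 0" using lw d_self by (auto simp: v')
  define R where "R = 1 / (2 * norm b)"
  have "d v (u' (r (r2 n))) <= C1 / R"
  proof (rule d_segment_discs)
  show "v \<in> Omega" "u' (r (r2 n)) \<in> Omega" using uO by (auto simp: v_def)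
  show "R > 0" using \<open>b ~= 0\<close> by (simp add: R_def)
  fix z and c :: complex assume "z \<in> closed_segment v (u' (r (r2 n)))" and c: "cmod c <= 1"
  then obtain mu where mu: "0 <= mu" "mu <= 1" "z = (1 - mu) *\<^sub>R v + mu *\<^sub>R u' (r (r2 n))" by (auto simp: in_segment)
  have z: "z = v + A (r2 n) *v (mu *\<^sub>R b)" unfolding mu(3) v' by (simp add: Alin algebra_simps)
  have "R *\<^sub>R (u' (r (r2 n)) - v) = A (r2 n) *v (R *\<^sub>R b)" unfolding v' by (simp add: Alin)
  then have e: "z + c *s (R *\<^sub>R (u' (r (r2 n)) - v)) = v + A (r2 n) *v (mu *\<^sub>R b + c *s (R *\<^sub>R b))"
  unfolding z by (simp only: Alin matrix_smult add.assoc)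
  have "norm (mu *\<^sub>R b + c *s (R *\<^sub>R b)) <= mu * norm b + cmod c * (R * norm b)"
  using mu norm_triangle_ineq[of "mu *\<^sub>R b" "c *s (R *\<^sub>R b)"] by (simp add: norm_smult R_def)
  also have "... <= 1 * norm b + 1 * (R * norm b)" using mu c by (intro add_mono mult_right_mono) (auto simp: R_def)
  also have "... < 1" using elim(2) \<open>b ~= 0\<close> by (simp add: R_def b_def)
  finally have "v + A (r2 n) *v (mu *\<^sub>R b + c *s (R *\<^sub>R b)) \<in> Omega" unfolding v_def by (rule bA)
  then show "z + c *s (R *\<^sub>R (u' (r (r2 n)) - v)) \<in> Omega" unfolding e .
  qed
  then have "M1 * d v (u' (r (r2 n))) <= M1 * (C1 * (2 * norm b))"
  using M1_ge_1 by (intro mult_left_mono) (auto simp: R_def)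
  then show False using lw elim(1) by (simp add: b_def)
  qed
  then show False by simp
 qed
 have xiD: "xi' \<notin> D"
 proof
  assume "xi' \<in> D"
  then obtain e where e: "e > 0" "cball xi' e \<subseteq> D" using oD(1) open_contains_cball by blast
  have "\<forall>\<^sub>F n in sequentially. cball xi' e \<subseteq> S n" by (rule local_hausdorff_inner[OF limS oS oD(1) compact_cball e(2)])
  moreover have "\<forall>\<^sub>F n in sequentially. dist (xi (r2 n)) xi' < e" by (rule tendstoD[OF lxi e(1)])
  ultimately have "\<forall>\<^sub>F n in sequentially. xi (r2 n) \<in> S n"
  by eventually_elim (auto simp: dist_commute)
  then obtain n where "xi (r2 n) \<in> S n" unfolding eventually_sequentially by blast
  then have "tip (X (r (r2 n))) \<in> Omega" unfolding inS by (simp add: phi_def xi_def AB)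
  then show False using g_tip[OF X0, of "r (r2 n)"] g_less_1_iff[of "tip (X (r (r2 n)))"] by simp
 qed
 \<comment> \<open>An omitted point \<open>z\<close> would be too close to one of the two ray points
   compared with the other: the ratio is \<open>cmod c / cmod (1 - c)\<close>, below
   \<open>exp (- (C0 * K'))\<close>, against \<open>line_ratio\<close>. Large \<open>sigma\<close>
   brings the ray point close to \<open>xi'\<close>.\<close>
 have disc: "xi' + c *s a' \<in> closure D" if c: "cmod c < exp (- (C0 * K')) / 2" for c
 proof (rule ccontr)
  assume out: "xi' + c *s a' \<notin> closure D"
  obtain sigma where sigma: "sigma >= 0" "(1 - exp (- sigma)) *\<^sub>R xi' + c *s a' \<notin> closure D"
  proof -
  have "((%sigma. exp (- sigma)) \<longlongrightarrow> (0::real)) at_top"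
  by (intro filterlim_compose[OF exp_at_bot] filterlim_uminus_at_bot_at_top)
  then have "((%sigma. (1 - exp (- sigma)) *\<^sub>R xi' + c *s a') \<longlongrightarrow> (1 - 0) *\<^sub>R xi' + c *s a') at_top" by (intro tendsto_intros)
  then have "\<forall>\<^sub>F sigma in at_top. (1 - exp (- sigma)) *\<^sub>R xi' + c *s a' \<in> - closure D"
  using out by (intro topological_tendstoD[where S="- closure D"]) auto
  then have "\<forall>\<^sub>F sigma in at_top. 0 <= sigma & (1 - exp (- sigma)) *\<^sub>R xi' + c *s a' \<in> - closure D"
  using eventually_ge_at_top[of 0] by eventually_elim auto
  then show ?thesis using that by (auto simp: eventually_at_top_linorder)
  qed
  define z where "z n = x (r2 n) sigma + c *s (q (r2 n) sigma *\<^sub>R a (r2 n))" for n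
  have "z \<longlonglongrightarrow> (1 - exp (- sigma)) *\<^sub>R xi' + c *s (1 *\<^sub>R a')" unfolding z_def x_def
  by (intro tendsto_intros lxi bounded_linear.tendsto[OF bounded_linear_smult] lq la)
  then have "\<forall>\<^sub>F n in sequentially. z n \<in> - closure D"
  using sigma(2) by (intro topological_tendstoD[where S="- closure D"]) auto
  have "\<exists>N. z N \<notin> S N & x (r2 N) sigma \<in> S N & y (r2 N) sigma \<in> S N &
  d (phi (r2 N) (x (r2 N) sigma)) (phi (r2 N) (y (r2 N) sigma)) <= K'"
  proof -
  obtain e where e: "e > 0" "cball ((1 - exp (- sigma)) *\<^sub>R xi' + c *s a') e \<subseteq> - closure D"
  using open_contains_cball[of "- closure D"] sigma(2) by auto
  have "\<forall>\<^sub>F n in sequentially. cball ((1 - exp (- sigma)) *\<^sub>R xi' + c *s a') e \<inter> closure (S n) = {}"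
  by (rule local_hausdorff_outer[OF limS compact_cball]) (use e in auto)
  moreover have "\<forall>\<^sub>F n in sequentially. dist (z n) ((1 - exp (- sigma)) *\<^sub>R xi' + c *s a') < e"
  using tendstoD[OF \<open>z \<longlonglongrightarrow> _\<close> e(1)] by simp
  ultimately have "\<forall>\<^sub>F n in sequentially. z n \<notin> S n & x (r2 n) sigma \<in> S n & y (r2 n) sigma \<in> S n &
  d (phi (r2 n) (x (r2 n) sigma)) (phi (r2 n) (y (r2 n) sigma)) <= K'"
  using near[OF sigma(1)]
  proof eventually_elim
  case (elim n)
  have "z n \<in> cball ((1 - exp (- sigma)) *\<^sub>R xi' + c *s a') e" using elim(2) by (simp add: dist_commute)
  then show ?case using elim(1,3) closure_subset by blast
  qed
  then show ?thesis unfolding eventually_sequentially by blast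
  qed
  then obtain N where N: "z N \<notin> S N" "x (r2 N) sigma \<in> S N" "y (r2 N) sigma \<in> S N"
  "d (phi (r2 N) (x (r2 N) sigma)) (phi (r2 N) (y (r2 N) sigma)) <= K'" by blast
  define v where "v = q (r2 N) sigma *\<^sub>R a (r2 N)"
  have zx: "z N + (- c) *s v = x (r2 N) sigma" by (simp add: z_def v_def)
  have zy: "z N + (1 - c) *s v = y (r2 N) sigma" by (simp add: z_def v_def y_def flip: vector_sadd_rdistrib)
  have "c ~= 0" using N(1,2) by (auto simp: z_def)
  have K'0: "0 <= C0 * K'" using order_trans[OF d_nonneg N(4)] C0_pos by simp
  then have "exp (- (C0 * K')) <= 1" by simp
  then have c2: "cmod c < 1 / 2" using c by linarith
  have "\<bar>ln (cmod (- c)) - ln (cmod (1 - c))\<bar> <= C0 * d (phi (r2 N) (x (r2 N) sigma)) (phi (r2 N) (y (r2 N) sigma))"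
  using line_ratio[of "u (r (r2 N))" "A (r2 N)" "z N" "- c" v "1 - c"] N(1-3) unfolding zx zy inS phi_def by blast
  also have "... <= C0 * K'" using N(4) C0_pos by (intro mult_left_mono) auto
  finally have "ln (cmod (1 - c)) - C0 * K' <= ln (cmod c)" by simp
  moreover have half: "1 / 2 < cmod (1 - c)" using c2 norm_triangle_ineq2[of 1 c] by simp
  moreover have "ln (1 / 2) <= ln (cmod (1 - c))" by (rule ln_mono) (use half in simp_all)
  ultimately have "ln (1 / 2) - C0 * K' <= ln (cmod c)" by linarith
  then have "exp (ln (1 / 2) - C0 * K') <= cmod c" using \<open>c ~= 0\<close> by (simp add: ln_ge_iff)
  moreover have "exp (ln (1 / 2) - C0 * K') = exp (- (C0 * K')) / 2" unfolding exp_diff exp_minus by (simp add: field_simps)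
  ultimately show False using c by linarith
 qed
 define e where "e = exp (- (C0 * K')) / 2"
 have e: "e > 0" by (simp add: e_def)
 define f where "f z = xi' + (of_real e * z) *s a'" for z
 \<comment> \<open>\<open>f z\<close> and \<open>f (- z)\<close> lie in the closure and have the
   midpoint \<open>xi'\<close>. If \<open>f z\<close> were in the open set \<open>D\<close>, so
   would be \<open>xi'\<close>.\<close>
 have f: "f z \<in> frontier D" if "z \<in> ball 0 1" for z
 proof -
  have ce: "cmod (of_real e * z) < e" using that e by (simp add: norm_mult)
  have "f z \<notin> D"
  proof
  assume fz: "f z \<in> D"
  have "f (- z) \<in> closure D" unfolding f_def by (rule disc) (use ce in \<open>simp add: e_def\<close>)
  moreover have "f z ~= f (- z)"
  proof
  assume eq: "f z = f (- z)"
  have "f z + f (- z) = 2 *\<^sub>R xi'" by (simp add: f_def scaleR_2 flip: vector_sadd_rdistrib)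
  then have "f z = xi'" using eq by (simp add: scaleR_2[symmetric])
  then show False using xiD fz by simp
  qed
  moreover have "(1/2) *\<^sub>R f z + (1/2) *\<^sub>R f (- z) = xi'"
  proof -
  have "f z + f (- z) = 2 *\<^sub>R xi'" by (simp add: f_def scaleR_2 flip: vector_sadd_rdistrib)
  then show ?thesis by (simp flip: scaleR_add_right)
  qed
  ultimately have "xi' \<in> open_segment (f z) (f (- z))" by (auto simp: in_segment intro!: exI[of _ "1/2"])
  then have "xi' \<in> interior D"
  using in_interior_closure_convex_segment[OF oD(2), of "f z" "f (- z)"] fz oD(1) \<open>f (- z) \<in> closure D\<close> by (auto simp: interior_open)
  then show False using xiD interior_subset by blast
  qed
  moreover have "f z \<in> closure D" unfolding f_def by (rule disc) (use ce in \<open>simp add: e_def\<close>)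
  ultimately show ?thesis using oD(1) by (simp add: frontier_def interior_open)
 qed
 have "f constant_on ball 0 1"
 proof -
  have "\<forall>i. (%z. f z $ i) holomorphic_on ball 0 1" by (auto simp: f_def intro!: holomorphic_intros)
  then show ?thesis using simple[OF D] f unfolding simple_boundary_def by blast
 qed
 then have "f 0 = f (1/2)" unfolding constant_on_def by force
 then show False using a'nz e by (simp add: f_def)
qed

theorem hyperbolic_if_simple_boundaries:
 assumes simple: "!!D. D \<in> affine_orbit_closure Omega ==> simple_boundary D"
 shows "gromov_hyperbolic Omega d"
proof -
 obtain C' where C': "C' >= 0" "!!x t u. 0 <= t ==> t <= u ==> d (ray x t) (ray x u) <= C' * (u - t)"
  by (rule ray_speed) blast
 define C where "C = max 1 (max C0 C')"
 have C: "C >= 1" "C >= C0" "C >= C'" by (auto simp: C_def)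
 have "ray_space Omega d ht ray p0 C M1"
 proof
  fix x y assume xy: "x \<in> Omega" "y \<in> Omega"
  show "\<exists>w lf. w (0::real) = x & w 1 = y & (\<forall>t\<in>{0..1}. w t \<in> Omega) &
  lf 0 = (0::real) & lf 1 < d x y + 1 & continuous_on {0..1} lf &
  (\<forall>a b. 0 <= a --> a <= b --> b <= 1 --> d (w a) (w b) <= lf b - lf a)"
  by (rule near_geodesic[OF xy zero_less_one]) blast
  have "C0 * d x y <= C * d x y" using C d_nonneg by (intro mult_right_mono) auto
  then show "\<bar>ht x - ht y\<bar> <= C * d x y + C" using ht_lipschitz[OF xy] C by linarith
 next
  fix x t u assume tu: "0 <= t" "t <= (u::real)"
  have "C' * (u - t) <= C * (u - t)" using C tu by (intro mult_right_mono) auto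
  then show "d (ray x t) (ray x u) <= C * (u - t)" using C'(2)[OF tu, of x] by linarith
 next
  fix K
  obtain sigma where "sigma >= 0" "\<forall>x\<in>Omega. \<forall>y\<in>Omega. \<forall>t\<ge>sigma. t <= ht x --> d (ray x t) (ray y t) <= K -->
  d (ray x (t - sigma)) (ray y (t - sigma)) <= 1" using ray_contraction[OF simple] by blast
  then show "\<exists>sigma\<ge>0. \<forall>x\<in>Omega. \<forall>y\<in>Omega. \<forall>t. sigma <= t --> t <= ht x --> t <= ht y -->
  d (ray x t) (ray y t) <= K --> d (ray x (t - sigma)) (ray y (t - sigma)) <= 1" by blast
 qed (use d_nonneg d_self d_commute d_triangle p0 ht_nonneg ray_in ray_ht ray_0 ht_ray ray_ray C M1_ge_1 ray_mono in auto)
 then show ?thesis by (rule ray_space.hyperbolic)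
qed

end

subsection \<open>Hyperbolicity excludes flats\<close>

text \<open>Bisection loses \<open>delta\<close> once per level, hence logarithmically in the number
  of steps.\<close>

lemma gromov_chain:
 assumes hyp: "!!x y z. x \<in> X ==> y \<in> X ==> z \<in> X ==>
  min (gromov_product d w x y) (gromov_product d w y z) - delta <= gromov_product d w x z"
  and a: "!!i. i <= 2 ^ m ==> a i \<in> X" "!!i. i < 2 ^ m ==> c <= gromov_product d w (a i) (a (Suc i))"
 shows "c - real m * delta <= gromov_product d w (a 0) (a (2 ^ m))"
 using a
proof (induction m arbitrary: a)
 case (Suc m)
 have "c - real m * delta <= gromov_product d w (a 0) (a (2 ^ m))" by (rule Suc.IH) (use Suc.prems in auto)
 moreover have "c - real m * delta <= gromov_product d w (a (2 ^ m + 0)) (a (2 ^ m + 2 ^ m))"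
  by (rule Suc.IH[of "%i. a (2 ^ m + i)"]) (use Suc.prems in auto)
 moreover have "min (gromov_product d w (a 0) (a (2 ^ m))) (gromov_product d w (a (2 ^ m)) (a (2 ^ Suc m))) - delta
  <= gromov_product d w (a 0) (a (2 ^ Suc m))" by (rule hyp) (use Suc.prems in auto)
 ultimately show ?case by (simp add: mult_2 algebra_simps)
qed simp

text \<open>The half boundary of a square around the midpoint of a horizontal segment of length \<open>2 ^ Suc j\<close>
 avoids a large ball and has few vertices; hence the segment is much shorter than the sum of the
 lengths of its halves, which cannot happen at too many scales.\<close>

lemma no_flat:
 fixes d :: "'a => 'a => real"
 assumes "gromov_hyperbolic X d" and d0: "!!x y. d x y >= 0" and sym: "!!x y. d x y = d y x"
  and tri: "!!x y z. x \<in> X ==> y \<in> X ==> z \<in> X ==> d x z <= d x y + d y z" and C: "C >= 1"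
  and flat: "!!N. N > 0 ==> \<exists>p. \<forall>s\<in>{0..N}. \<forall>t\<in>{0..N}. p s t \<in> X & (\<forall>s'\<in>{0..N}. \<forall>t'\<in>{0..N}.
  d (p s t) (p s' t') <= C * (\<bar>s - s'\<bar> + \<bar>t - t'\<bar>) &
  \<bar>s - s'\<bar> <= C * d (p s t) (p s' t') + C & \<bar>t - t'\<bar> <= C * d (p s t) (p s' t') + C)"
 shows False
proof -
 obtain delta where delta: "delta >= 0" and hyp: "!!x y z w. x \<in> X ==> y \<in> X ==> z \<in> X ==> w \<in> X ==>
  min (gromov_product d w x y) (gromov_product d w y z) - delta <= gromov_product d w x z"
  using assms(1) unfolding gromov_hyperbolic_def by metis
 define A B where "A = 2 * C * delta" and "B = 2 * C * (1 + 2 * C + 2 * delta)"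
 have AB: "A >= 0" "B >= 0" using C delta by (auto simp: A_def B_def)
 define j0 where "j0 = nat \<lceil>A + B + 4\<rceil> + 1"
 \<comment> \<open>From scale \<open>j0\<close> on, the logarithmic loss along the half boundary is
   at most half of \<open>2 ^ j / C\<close>, the order of its distance from the midpoint.\<close>
 have large: "1 + 2 * C + (real j + 2) * delta <= 2 ^ j / (2 * C)" if "j >= j0" for j
 proof (rule ccontr)
  assume "~ ?thesis"
  then have "2 ^ j <= (1 + 2 * C + (real j + 2) * delta) * (2 * C)" using C by (simp add: divide_less_eq not_le less_imp_le)
  also have "... = A * real j + B" by (simp add: A_def B_def algebra_simps)
  finally have "real j <= A + B + 4" by (rule two_power_le_linear[OF AB])
  then show False using that by (simp add: j0_def) linarith
 qed
 \<comment> \<open>Every scale lowers the ratio of distance to side length by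
   \<open>1 / (2 * C)\<close>. It starts at \<open>C\<close>, so more than \<open>2 * C * C\<close>
   scales would make it negative.\<close>
 define n where "n = nat \<lceil>2 * C * C\<rceil> + 1"
 define N where "N = (2::real) ^ (j0 + n)"
 define T0 where "T0 = N / 2"
 obtain p where p: "!!s t. s \<in> {0..N} ==> t \<in> {0..N} ==> p s t \<in> X"
  "!!s t s' t'. s \<in> {0..N} ==> t \<in> {0..N} ==> s' \<in> {0..N} ==> t' \<in> {0..N} ==>
  d (p s t) (p s' t') <= C * (\<bar>s - s'\<bar> + \<bar>t - t'\<bar>)"
  "!!s t s' t'. s \<in> {0..N} ==> t \<in> {0..N} ==> s' \<in> {0..N} ==> t' \<in> {0..N} ==>
  \<bar>s - s'\<bar> <= C * d (p s t) (p s' t') + C"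
  "!!s t s' t'. s \<in> {0..N} ==> t \<in> {0..N} ==> s' \<in> {0..N} ==> t' \<in> {0..N} ==>
  \<bar>t - t'\<bar> <= C * d (p s t) (p s' t') + C"
  by (rule exE[OF flat[of N]]) (simp add: N_def, blast)
 have T0: "T0 \<in> {0..N}" by (simp add: T0_def N_def)
 have main: "d (p s T0) (p (s + 2 ^ (j0 + i)) T0) <= 2 ^ (j0 + i) * (C - real i / (2 * C))"
  if "i <= n" "0 <= s" "s + 2 ^ (j0 + i) <= N" for i s
  using that
 proof (induction i arbitrary: s)
  case 0
  have "0 <= (2::real) ^ j0" by simp
  then have "s \<in> {0..N}" "s + 2 ^ (j0 + 0) \<in> {0..N}" using 0 by (auto simp del: zero_le_power)
  then show ?case using p(2)[OF _ T0 _ T0, of s "s + 2 ^ (j0 + 0)"] by (simp add: mult.commute)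
 next
  case (Suc i)
  define j where "j = j0 + i"
  define k where "k = (2::real) ^ j"
  have k: "k > 0" "s + 2 * k <= N" "k <= T0" "2 ^ (j0 + Suc i) = 2 * k"
  proof -
  have "(2::real) ^ (j + 1) <= 2 ^ (j0 + n)" using Suc.prems(1) by (intro power_increasing) (auto simp: j_def)
  then show "k <= T0" by (simp add: k_def T0_def N_def)
  qed (use Suc.prems in \<open>auto simp: k_def j_def\<close>)
  define Q where "Q = k / (2 * C)"
  have Q: "k / C = 2 * Q" "k / (2 * C) = Q" by (auto simp: Q_def)
  define w where "w = p (s + k) T0"
  \<comment> \<open>The half boundary in unit steps: \<open>k\<close> away from the segment,
    \<open>2 * k\<close> parallel to it, \<open>k\<close> back. Their number
    \<open>4 * k = 2 ^ (j + 2)\<close> fits the bisection.\<close>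
  define a where "a i = p (s + max 0 (min (real i - k) (2 * k))) (T0 - min (min (real i) k) (4 * k - real i))" for i :: nat
  have in1: "s + max 0 (min (real i - k) (2 * k)) \<in> {0..N}" "T0 - min (min (real i) k) (4 * k - real i) \<in> {0..N}"
  if "real i <= 4 * k" for i using that k Suc.prems(2) T0 by (auto simp: min_def max_def)
  have in2: "s + k \<in> {0..N}" "s \<in> {0..N}" "s + 2 * k \<in> {0..N}" using k Suc.prems(2) by auto
  have wX: "w \<in> X" unfolding w_def by (rule p(1)[OF in2(1) T0])
  have pow: "real (2 ^ (j + 2)) = 4 * k" by (simp add: k_def)
  have i4: "real i <= 4 * k" if "i <= 2 ^ (j + 2)" for i using that unfolding pow[symmetric] by (simp only: of_nat_le_iff)
  have gp: "2 * Q - 1 - 2 * C <= gromov_product d w (a i) (a (Suc i))" if "i < 2 ^ (j + 2)" for i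
  proof -
  have i: "real i <= 4 * k" "real (Suc i) <= 4 * k" using i4[of i] i4[of "Suc i"] that by auto
  have X: "a i \<in> X" "a (Suc i) \<in> X" unfolding a_def by (rule p(1)[OF in1[OF i(1)]], rule p(1)[OF in1[OF i(2)]])
  have "d (a i) (a (Suc i)) <= C * (1 + 1)" unfolding a_def
  by (rule order_trans[OF p(2)[OF in1[OF i(1)] in1[OF i(2)]]]) (use C in \<open>auto intro!: mult_left_mono add_mono simp: min_def max_def\<close>)
  then have "d (a i) (a (Suc i)) <= 2 * C" by simp
  moreover have "k <= C * d (a i) w + C"
  proof (cases "k <= real i & real i <= 3 * k")
  case True
  then show ?thesis using p(4)[OF in1[OF i(1)] in2(1) T0] k(1) unfolding a_def w_def by (simp add: min_def split: if_splits)
  next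
  case False
  then show ?thesis using p(3)[OF in1[OF i(1)] in2(1) T0] k(1) unfolding a_def w_def by (simp add: min_def max_def split: if_splits)
  qed
  then have "2 * Q - 1 <= d (a i) w" using C unfolding Q[symmetric] by (simp add: field_simps)
  moreover have "d (a i) w <= d (a i) (a (Suc i)) + d (a (Suc i)) w" by (rule tri[OF X wX])
  ultimately have "2 * (2 * Q - 1 - 2 * C) <= d (a i) w + d (a (Suc i)) w - d (a i) (a (Suc i))" by argo
  then show ?thesis unfolding gromov_product_def by (simp add: sym[of w])
  qed
  have gc: "2 * Q - 1 - 2 * C - real (j + 2) * delta <= gromov_product d w (a 0) (a (2 ^ (j + 2)))"
  proof (rule gromov_chain[of X d w delta])
  show "a i \<in> X" if "i <= 2 ^ (j + 2)" for i unfolding a_def by (rule p(1)[OF in1[OF i4[OF that]]])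
  qed (use hyp wX gp in auto)
  have e: "a 0 = p s T0" "a (2 ^ (j + 2)) = p (s + 2 * k) T0"
  using k(1) unfolding a_def pow by (simp_all add: min_def max_def)
  have "1 + 2 * C + real (j + 2) * delta <= Q" using large[of j] by (simp add: j_def k_def Q_def add.commute)
  then have "Q <= gromov_product d w (p s T0) (p (s + 2 * k) T0)" using gc unfolding e by argo
  then have "2 * Q <= d (p s T0) w + d w (p (s + 2 * k) T0) - d (p s T0) (p (s + 2 * k) T0)"
  unfolding gromov_product_def by (simp add: sym[of w])
  moreover have "d (p s T0) w <= k * (C - real i / (2 * C))" unfolding w_def k_def j_def
  proof (rule Suc.IH)
  have "s + k <= N" using k(1,2) by linarith
  then show "s + 2 ^ (j0 + i) <= N" by (simp add: k_def j_def)
  qed (use Suc.prems in auto)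
  moreover have "d w (p (s + k + k) T0) <= k * (C - real i / (2 * C))" unfolding w_def k_def j_def
  by (rule Suc.IH) (use Suc.prems k in \<open>auto simp: k_def j_def\<close>)
  moreover have "2 * k * (C - real (Suc i) / (2 * C)) = 2 * (k * (C - real i / (2 * C))) - 2 * Q"
  using C by (simp add: Q_def field_simps)
  ultimately show ?case unfolding k(4) by (simp add: add.assoc)
 qed
 have "0 <= 2 ^ (j0 + n) * (C - real n / (2 * C))" by (rule order_trans[OF d0 main[of n 0]]) (simp_all add: N_def)
 moreover have "(2::real) ^ (j0 + n) > 0" by simp
 ultimately have "real n / (2 * C) <= C" using zero_le_mult_iff[of "2 ^ (j0 + n)" "C - real n / (2 * C)"] by linarith
 then have "real n <= 2 * C * C" using C by (simp add: divide_le_eq mult_ac)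
 then show False unfolding n_def by linarith
qed

subsection \<open>Analytic discs in the boundary\<close>

text \<open>A Harnack inequality: the Cayley transform that sends \<open>h 0\<close> to 0 maps the
  half-plane to the disc, where the Schwarz lemma applies.\<close>

lemma half_plane_bound:
 assumes h: "h holomorphic_on ball 0 1" "!!z. z \<in> ball 0 1 ==> Re (h z) > 0" and z: "z \<in> ball 0 1"
 shows "cmod (h z) * (1 - cmod z) <= cmod (h 0) * (1 + cmod z)"
proof -
 define w where "w = h 0"
 define g where "g z = (h z - w) / (h z + cnj w)" for z
 have w: "Re w > 0" using h(2)[of 0] by (simp add: w_def)
 have nz: "h z + cnj w ~= 0" if "z \<in> ball 0 1" for z using h(2)[OF that] w by (auto simp: complex_eq_iff)
 have lt: "cmod (g z) < 1" if "cmod z < 1" for z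
 proof -
  have "(cmod (h z - w))\<^sup>2 < (cmod (h z + cnj w))\<^sup>2"
  using mult_pos_pos[OF h(2)[of z] w] that unfolding cmod_power2 by (simp add: power2_eq_square algebra_simps)
  then have "cmod (h z - w) < cmod (h z + cnj w)" by (rule power2_less_imp_less) simp
  then show ?thesis using nz[of z] that by (simp add: g_def norm_divide divide_less_eq)
 qed
 have "g holomorphic_on ball 0 1" unfolding g_def by (intro holomorphic_intros h(1) nz)
 then have gz: "cmod (g z) <= cmod z" using Schwarz_Lemma(1)[of g z] lt z by (simp add: g_def w_def)
 have "h z * (1 - g z) = w + g z * cnj w" using nz[OF z] by (simp add: g_def field_simps)
 then have "cmod (h z) * cmod (1 - g z) = cmod (w + g z * cnj w)" by (metis norm_mult)
 also have "... <= cmod w * (1 + cmod (g z))" using norm_triangle_ineq[of w "g z * cnj w"] by (simp add: norm_mult algebra_simps)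
 also have "... <= cmod w * (1 + cmod z)" using gz by (intro mult_left_mono) auto
 finally have "cmod (h z) * cmod (1 - g z) <= cmod w * (1 + cmod z)" .
 moreover have "1 - cmod z <= cmod (1 - g z)" using gz norm_triangle_ineq2[of 1 "g z"] by simp
 ultimately show ?thesis unfolding w_def using mult_left_mono[of "1 - cmod z" "cmod (1 - g z)" "cmod (h z)"] by simp
qed

lemma convex_comb_line:
 "(1 - e) *\<^sub>R (p + a *s w) + e *\<^sub>R (p + b *s w) = p + (of_real (1 - e) * a + of_real e * b) *s (w::complex^'d)"
 by (simp add: vec_eq_iff complex_eq_iff algebra_simps)

text \<open>A nonconstant disc in the boundary yields an affine one. It is normalized such that \<open>xi + v\<close> is a
 relative boundary point of the intersection of the closure with the complex line of the disc.\<close>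

lemma affine_disc:
 fixes D :: "(complex^'d) set"
 assumes D: "open D" "C_properly_convex D" "D ~= {}" and "~ simple_boundary D"
 obtains xi v eps where "eps > 0" "!!c. xi + c *s v \<notin> D" "!!c. cmod c <= eps ==> xi + c *s v \<in> closure D"
  "xi + v \<in> closure D" "!!tau. tau > 0 ==> xi + of_real (1 + tau) *s v \<notin> closure D"
proof -
 have cD: "convex D" "convex (closure D)" using D(2) by (auto simp: C_properly_convex_def convex_closure)
 obtain f :: "complex => complex^'d" where f: "!!i. (%z. f z $ i) holomorphic_on ball 0 1" "f ` ball 0 1 \<subseteq> frontier D" "~ f constant_on ball 0 1"
  using assms(4) unfolding simple_boundary_def by blast
 obtain z1 where z1: "z1 \<in> ball 0 1" "f z1 ~= f 0" using f(3) unfolding constant_on_def by blast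
 define xi w where "xi = f 0" and "w = f z1 - f 0"
 have "f 0 \<in> frontier D" using f(2) by (rule subsetD) simp
 then have xi: "xi \<notin> D" "xi \<in> closure D" using D(1) by (auto simp: xi_def frontier_def interior_open)
 define r where "r = (1 - cmod z1) / 2"
 have r: "r > 0" using z1(1) by (simp add: r_def)
 \<comment> \<open>A functional separating the point maps the given analytic disc into a half-plane.
   Its values at 0 and \<open>z1\<close> are \<open>- c\<close> and \<open>1 - c\<close> times one
   number, so the Harnack inequality keeps \<open>c\<close> away from 0.\<close>
 have disc: "xi + c *s w \<in> closure D" if c: "cmod c < r" for c
 proof (rule ccontr)
  assume "xi + c *s w \<notin> closure D"
  then obtain a b where ab: "a \<bullet> (xi + c *s w) < b" "!!x. x \<in> closure D ==> b < a \<bullet> x"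
  using separating_hyperplane_closed_point[OF cD(2) closed_closure] by metis
  note lin = bounded_linear.linear[OF bounded_linear_cfun, of a]
  define h where "h z = cfun a (f z) - cfun a (xi + c *s w)" for z
  have "cfun a (f z) = (\<Sum>i\<in>UNIV. f z $ i * cfun a (axis i 1))" for z
  using arg_cong[OF basis_expansion[of "f z"], of "cfun a"] by (simp add: linear_sum[OF lin] cfun_smult)
  then have hol: "h holomorphic_on ball 0 1" unfolding h_def by (auto intro!: holomorphic_intros f(1))
  have pos: "Re (h z) > 0" if "z \<in> ball 0 1" for z
  using ab(1) ab(2)[of "f z"] f(2) that by (force simp: h_def cfun_def frontier_def)
  have "h 0 = - c * cfun a w" "h z1 = (1 - c) * cfun a w"
  by (simp_all add: h_def linear_add[OF lin] cfun_smult xi_def w_def linear_diff[OF lin] algebra_simps)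
  moreover from this have "cfun a w ~= 0" using pos[of 0] by auto
  ultimately have "cmod (1 - c) * (1 - cmod z1) <= cmod c * (1 + cmod z1)"
  using half_plane_bound[OF hol pos z1(1)] by (simp add: norm_mult mult_ac)
  moreover have "1 - cmod c <= cmod (1 - c)" using norm_triangle_ineq2[of 1 c] by simp
  then have "(1 - cmod c) * (1 - cmod z1) <= cmod (1 - c) * (1 - cmod z1)" using z1(1) by (intro mult_right_mono) auto
  ultimately have "1 - cmod z1 <= 2 * cmod c" by (simp add: algebra_simps)
  then show False using c by (simp add: r_def)
 qed
 \<comment> \<open>A point of \<open>D\<close> on this line, joined with a point of the small disc
   on the other side of \<open>xi\<close>, would put \<open>xi\<close> into
   \<open>D\<close>.\<close>
 have line: "xi + c *s w \<notin> D" for c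
 proof
  assume cD': "xi + c *s w \<in> D"
  define mu where "mu = r / (2 * (cmod c + 1))"
  have c0: "cmod c + 1 > 0" by (rule add_nonneg_pos) auto
  then have mu0: "mu > 0" using r by (simp add: mu_def)
  have "mu * (cmod c + 1) = r / 2" using c0 unfolding mu_def by (simp add: field_simps)
  then have mu: "mu > 0" "mu * cmod c < r" using r mu0 by (auto simp: distrib_left)
  have cl: "xi + (- (of_real mu * c)) *s w \<in> closure D" by (rule disc) (use mu in \<open>simp add: norm_mult\<close>)
  define e where "e = mu / (1 + mu)"
  have e: "0 < e" "e <= 1" "1 - e = 1 / (1 + mu)" using mu(1) by (auto simp: e_def field_simps)
  have "of_real (1 - e) * (- (of_real mu * c)) + of_real e * c = 0"
  proof -
  have "(1 - e) * mu = e" using mu(1) unfolding e(3) by (simp add: e_def)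
  then have "of_real (1 - e) * of_real mu = (of_real e :: complex)" by (simp only: of_real_mult[symmetric])
  then show ?thesis by (simp add: mult.assoc[symmetric])
  qed
  then have "(1 - e) *\<^sub>R (xi + (- (of_real mu * c)) *s w) + e *\<^sub>R (xi + c *s w) = xi"
  unfolding convex_comb_line by simp
  moreover have "(1 - e) *\<^sub>R (xi + (- (of_real mu * c)) *s w) + e *\<^sub>R (xi + c *s w) \<in> interior D"
  using mem_interior_closure_convex_shrink[OF cD(1) _ cl e(1,2), of "xi + c *s w"] cD' D(1)
  by (simp add: interior_open algebra_simps)
  ultimately show False using xi(1) interior_subset by auto
 qed
 obtain x0 where x0: "x0 \<in> D" using D(3) by blast
 have wnz: "w ~= 0" using z1(2) by (simp add: w_def)
 \<comment> \<open>If the closure contained the whole line, its translate halfway towards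
   \<open>x0\<close> would lie in \<open>D\<close>.\<close>
 obtain c1 where c1: "xi + c1 *s w \<notin> closure D"
 proof -
  have "(1/2) *\<^sub>R (x0 + xi) + c *s w \<in> D" if "xi + (2 * c) *s w \<in> closure D" for c
  proof -
  have "(xi + (2 * c) *s w) - (1/2) *\<^sub>R ((xi + (2 * c) *s w) - x0) \<in> interior D"
  by (rule mem_interior_closure_convex_shrink[OF cD(1) _ that]) (use x0 D(1) in \<open>auto simp: interior_open\<close>)
  moreover have "(2 * c) *s w = 2 *\<^sub>R (c *s w)" unfolding scaleR_smult vector_smult_assoc by simp
  then have "(xi + (2 * c) *s w) - (1/2) *\<^sub>R ((xi + (2 * c) *s w) - x0) = (1/2) *\<^sub>R (x0 + xi) + c *s w"
  by (simp add: vec_eq_iff complex_eq_iff field_simps)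
  ultimately show ?thesis using interior_subset by auto
  qed
  then show ?thesis using that D(2) wnz unfolding C_properly_convex_def by blast
 qed
 \<comment> \<open>The largest element \<open>m\<close> of \<open>T\<close> gives the last closure
   point in direction \<open>c1\<close>; rescaling the direction by it puts this point at
   \<open>xi + v\<close>.\<close>
 define T where "T = {tau. 0 <= tau & xi + (of_real tau * c1) *s w \<in> closure D}"
 have c1r: "r <= cmod c1" "cmod c1 > 0" using disc[of c1] c1 r by force+
 have bT: "tau <= 1" if "tau \<in> T" for tau
 proof (rule ccontr)
  assume tau: "~ tau <= 1"
  have "(1 - 1 / tau) *\<^sub>R (xi + 0 *s w) + (1 / tau) *\<^sub>R (xi + (of_real tau * c1) *s w) \<in> closure D"
  using that xi(2) tau by (intro convexD_alt[OF cD(2)]) (auto simp: T_def)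
  then show False using c1 tau unfolding convex_comb_line by simp
 qed
 have clT: "closed T"
 proof -
  have "continuous_on UNIV (%tau. xi + (of_real tau * c1) *s w)"
  by (intro continuous_intros bounded_linear.continuous_on[OF bounded_linear_smult_left])
  then have "closed ((%tau. xi + (of_real tau * c1) *s w) -` closure D)" by (intro closed_vimage) auto
  moreover have "T = {0..} \<inter> (%tau. xi + (of_real tau * c1) *s w) -` closure D" by (auto simp: T_def)
  ultimately show ?thesis by auto
 qed
 define m where "m = Sup T"
 have bdd: "bdd_above T" using bT by (intro bdd_aboveI)
 have r2T: "r / (2 * cmod c1) \<in> T"
  using r c1r by (auto simp: T_def norm_mult norm_divide divide_less_eq intro!: disc)
 have mT: "m \<in> T" unfolding m_def by (rule closed_contains_Sup[OF _ bdd clT]) (use r2T in blast)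
 have m0: "m > 0" unfolding m_def by (rule less_le_trans[OF _ cSup_upper[OF r2T bdd]]) (use r c1r in simp)
 define v where "v = (of_real m * c1) *s w"
 show ?thesis
 proof (rule that[of "r / (2 * (m * cmod c1))" xi v])
  show "0 < r / (2 * (m * cmod c1))" using r m0 c1r by simp
  show "xi + c *s v \<notin> D" for c unfolding v_def vector_smult_assoc by (rule line)
  show "xi + v \<in> closure D" using mT by (simp add: T_def v_def)
  show "xi + c *s v \<in> closure D" if "cmod c <= r / (2 * (m * cmod c1))" for c
  unfolding v_def vector_smult_assoc
  proof (rule disc)
  have "0 < m * cmod c1" using r m0 c1r by simp
  then have "cmod c * (m * cmod c1) <= r / 2" using that by (simp add: field_simps)
  then show "cmod (c * (of_real m * c1)) < r" using r m0 by (simp add: norm_mult)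
  qed
  show "xi + of_real (1 + tau) *s v \<notin> closure D" if "tau > 0" for tau
  proof
  assume "xi + of_real (1 + tau) *s v \<in> closure D"
  then have "(1 + tau) * m \<in> T" using m0 that by (simp add: T_def v_def vector_smult_assoc mult.assoc)
  then have "(1 + tau) * m <= m" unfolding m_def by (rule cSup_upper[OF _ bdd])
  then show False using mult_pos_pos[OF that m0] by (simp add: algebra_simps)
  qed
 qed
qed

subsection \<open>Hyperbolicity implies simple boundaries\<close>

text \<open>A number this close to \<open>exp (- s) * m\<close> has modulus within a factor 2 of
  \<open>exp (- s) * cmod m\<close>, so the logarithm of its modulus records \<open>s\<close> up to
  \<open>ln 2\<close>.\<close>

lemma ln_norm_gap:
 assumes z: "cmod (z - of_real (exp (- s)) * m) <= exp (- s) / 2 * cmod m"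
  and z': "cmod (z' - of_real (exp (- s')) * m) <= exp (- s') / 2 * cmod m" and m: "m ~= 0"
 shows "\<bar>s - s'\<bar> <= \<bar>ln (cmod z) - ln (cmod z')\<bar> + 2 * ln 2"
proof -
 have "\<bar>ln (cmod z) + s - ln (cmod m)\<bar> <= ln 2" if z: "cmod (z - of_real (exp (- s)) * m) <= exp (- s) / 2 * cmod m" for z s
 proof -
  define E where "E = exp (- s) * cmod m"
  have E: "E > 0" "ln E = ln (cmod m) - s" using m by (auto simp: E_def ln_mult)
  have "cmod (of_real (exp (- s)) * m) = E" by (simp add: E_def norm_mult)
  then have "E / 2 <= cmod z" "cmod z <= 2 * E"
  using z E(1) norm_triangle_ineq2[of "of_real (exp (- s)) * m" z] norm_triangle_ineq2[of z "of_real (exp (- s)) * m"]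
  by (auto simp: E_def norm_minus_commute)
  then have "ln (E / 2) <= ln (cmod z)" "ln (cmod z) <= ln (2 * E)" using E(1) by (auto intro!: ln_mono)
  then show ?thesis using E by (simp add: ln_mult ln_div)
 qed
 from this[OF z] this[OF z'] show ?thesis by linarith
qed

text \<open>\<open>P s t\<close> lies on the segment from \<open>xi + (1 - exp (- t)) v\<close>, a
  point on the line of the boundary disc, to the base point \<open>x0\<close>: \<open>s\<close> is
  the depth towards the boundary, \<open>t\<close> the depth towards the edge \<open>xi + v\<close>.
  Discs bound the speed in both directions from above, and two complex functionals recover
  \<open>s\<close> and \<open>t\<close> from below. A square of given size involves compact data
  only, so it fits into one rescaled copy of \<open>Omega\<close>.\<close>

theorem (in ke_domain) simple_boundary_if_hyperbolic:
 assumes hyp: "gromov_hyperbolic Omega d" and Dorb: "D \<in> affine_orbit_closure Omega"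
 shows "simple_boundary D"
proof (rule ccontr)
 assume ns: "~ simple_boundary D"
 have oD: "open D" "D ~= {}" "C_properly_convex D"
  using Dorb by (auto simp: affine_orbit_closure_def properly_convex_domains_def)
 have cD: "convex D" "convex (closure D)" using oD(3) by (auto simp: C_properly_convex_def convex_closure)
 obtain F where F: "!!n. F n \<in> complex_affine_group" "local_hausdorff_tendsto (%n. F n ` Omega) D"
  using Dorb by (auto simp: affine_orbit_closure_def)
 have "\<exists>u A. F n ` Omega = chart Omega u A" for n by (rule image_chart[OF F(1)[of n], of Omega]) blast
 then obtain u A where uA: "!!n. F n ` Omega = chart Omega (u n) (A n)" by metis
 define S where "S n = chart Omega (u n) (A n)" for n
 have lim: "local_hausdorff_tendsto S D" using F(2) by (simp add: uA S_def[abs_def])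
 have S: "open (S n)" "convex (S n)" for n
  unfolding S_def by (rule open_chart[OF open_dom], rule convex_chart[OF convex_dom])
 obtain xi v eps where eps: "eps > 0" and line: "!!c. xi + c *s v \<notin> D" and disc: "!!c. cmod c <= eps ==> xi + c *s v \<in> closure D"
  and edge: "xi + v \<in> closure D" "!!tau. tau > 0 ==> xi + of_real (1 + tau) *s v \<notin> closure D"
  by (rule affine_disc[OF oD(1,3,2) ns]) blast
 obtain x0 r where x0: "x0 \<in> D" "r > 0" "ball x0 r \<subseteq> D" using oD(1,2) unfolding open_contains_ball by blast
 define eta where "eta = x0 - xi"
 define Z where "Z a b = xi + a *s v + b *s eta" for a b
 have shrink: "(1 - l) *\<^sub>R y + l *\<^sub>R x \<in> D" if "y \<in> closure D" "x \<in> D" "0 < l" "l <= 1" for x y l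
 proof -
  have "y - l *\<^sub>R (y - x) \<in> interior D"
  by (rule mem_interior_closure_convex_shrink[OF cD(1) _ that(1,3,4)]) (use that oD(1) in \<open>simp add: interior_open\<close>)
  then show ?thesis using interior_subset by (auto simp: algebra_simps)
 qed
 have Zcomb: "(1 - l) *\<^sub>R Z a b + l *\<^sub>R Z a' b' = Z (of_real (1 - l) * a + of_real l * a') (of_real (1 - l) * b + of_real l * b')" for l a b a' b'
  by (simp add: Z_def vec_eq_iff complex_eq_iff algebra_simps)
 have x0Z: "x0 = Z 0 1" by (simp add: Z_def eta_def)
 have compactZ: "compact ((%q. Z (g q) (h q)) ` T)" if "compact T" "continuous_on T g" "continuous_on T h"
  for T :: "'b::topological_space set" and g h
 proof (rule compact_continuous_image[OF _ that(1)])
  note sm = bounded_linear.continuous_on[OF bounded_linear_smult_left]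
  show "continuous_on T (%q. Z (g q) (h q))" unfolding Z_def
  by (rule continuous_on_add[OF continuous_on_add[OF continuous_on_const sm[OF that(2)]] sm[OF that(3)]])
 qed
 have vnz: "v ~= 0" using edge(1) edge(2)[of 1] by (metis add.right_neutral vector_smult_rzero zero_less_one)
 define k where "k = r / (2 * (norm eta + norm v))"
 have nv: "norm eta + norm v > 0" using vnz by (simp add: add_nonneg_pos)
 have k: "k > 0" using nv x0(2) by (simp add: k_def)
 \<comment> \<open>For \<open>c\<close> in the unit disc these are discs centred at
   \<open>P s t\<close> in the directions of the \<open>t\<close>-curve and the
   \<open>s\<close>-curve, with the radii that \<open>exp_path\<close> requires.\<close>
 define E1 E2 where "E1 s t c = Z (of_real (1 - exp (- s)) * (of_real (1 - exp (- t)) - c * of_real (eps * exp (- t)))) (of_real (exp (- s)))"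
  and "E2 s t c = Z (of_real (1 - exp (- s)) * of_real (1 - exp (- t)) - c * of_real (k * exp (- s) * (1 - exp (- t)))) (of_real (exp (- s)) + c * of_real (k * exp (- s)))" for s t c
 have disc1: "E1 s t c \<in> D"
  if "0 <= s" "0 <= t" "cmod c <= 1" for s t c
 proof -
  have "(1 - exp (- t)) *\<^sub>R (xi + 1 *s v) + exp (- t) *\<^sub>R (xi + (- (c * of_real eps)) *s v) \<in> closure D"
  proof (rule convexD_alt[OF cD(2)])
  show "xi + (- (c * of_real eps)) *s v \<in> closure D"
  by (rule disc) (use eps mult_right_mono[OF that(3), of eps] in \<open>simp add: norm_mult\<close>)
  qed (use edge(1) that in auto)
  then have "Z (of_real (1 - exp (- t)) - c * of_real (eps * exp (- t))) 0 \<in> closure D"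
  unfolding convex_comb_line by (simp add: Z_def algebra_simps)
  from shrink[OF this x0(1), of "exp (- s)"] show ?thesis using that unfolding E1_def x0Z Zcomb by simp
 qed
 have disc2: "E2 s t c \<in> D"
  if "0 <= s" "0 <= t" "cmod c <= 1" for s t c
 proof -
  have "(1 - exp (- t)) *\<^sub>R (xi + 1 *s v) + exp (- t) *\<^sub>R (xi + 0 *s v) \<in> closure D"
  by (rule convexD_alt[OF cD(2)]) (use that edge(1) disc[of 0] eps in auto)
  then have 1: "Z (of_real (1 - exp (- t))) 0 \<in> closure D" unfolding convex_comb_line by (simp add: Z_def)
  have "Z (- (c * of_real (k * (1 - exp (- t))))) (1 + c * of_real k) \<in> ball x0 r"
  proof -
  have "x0 - Z (- (c * of_real (k * (1 - exp (- t))))) (1 + c * of_real k) = (c * of_real k) *s (of_real (1 - exp (- t)) *s v - eta)"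
  by (simp add: Z_def eta_def vec_eq_iff algebra_simps)
  then have "dist x0 (Z (- (c * of_real (k * (1 - exp (- t))))) (1 + c * of_real k)) = cmod c * (k * norm (of_real (1 - exp (- t)) *s v - eta))"
  using k unfolding dist_norm by (simp only: norm_smult norm_mult norm_of_real mult.assoc abs_of_pos)
  also have "... <= 1 * (k * (norm eta + norm v))"
  proof (intro mult_mono)
  have "norm (of_real (1 - exp (- t)) *s v) = \<bar>1 - exp (- t)\<bar> * norm v" by (simp only: norm_smult norm_of_real)
  also have "... <= 1 * norm v" using that by (intro mult_right_mono) auto
  finally show "norm (of_real (1 - exp (- t)) *s v - eta) <= norm eta + norm v"
  using norm_triangle_ineq4[of "of_real (1 - exp (- t)) *s v" eta] by linarith
  qed (use that k in auto)
  also have "... = r / 2" using nv unfolding k_def by (simp add: field_simps)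
  also have "... < r" using x0(2) by simp
  finally show ?thesis by simp
  qed
  then have 2: "Z (- (c * of_real (k * (1 - exp (- t))))) (1 + c * of_real k) \<in> D" using x0(3) by blast
  from shrink[OF 1 2, of "exp (- s)"] show ?thesis using that unfolding E2_def Zcomb by (simp add: algebra_simps)
 qed
 define P where "P s t = Z (of_real (1 - exp (- s)) * of_real (1 - exp (- t))) (of_real (exp (- s)))" for s t
 define C where "C = max (2 * ln 2) (max (max 1 C0) (max (2 * C1 / eps) (2 * C1 / k)))"
 have C: "C >= 1" "C >= C0" "C >= 2 * C1 / eps" "C >= 2 * C1 / k" "C >= 2 * ln 2" by (auto simp: C_def)
 have flat: "\<exists>p. \<forall>s\<in>{0..N}. \<forall>t\<in>{0..N}. p s t \<in> Omega & (\<forall>s'\<in>{0..N}. \<forall>t'\<in>{0..N}.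
  d (p s t) (p s' t') <= C * (\<bar>s - s'\<bar> + \<bar>t - t'\<bar>) &
  \<bar>s - s'\<bar> <= C * d (p s t) (p s' t') + C & \<bar>t - t'\<bar> <= C * d (p s t) (p s' t') + C)"
  if N: "N > 0" for N
 proof -
  \<comment> \<open>In \<open>lo2\<close> both \<open>tau2\<close> and
    \<open>exp (- s0) * (1 + 4 / mu)\<close> contribute \<open>exp (- N) / 4\<close> to the error,
    together half of the smallest value \<open>exp (- N)\<close> of
    \<open>exp (- t)\<close>.\<close>
  define tau2 where "tau2 = exp (- N) / 4"
  have tau2: "0 < tau2" "tau2 <= 1" using N by (auto simp: tau2_def intro: order_trans[of _ 1])
  have "Z (of_real (1 + tau2)) 0 \<in> - closure D" using edge(2)[OF tau2(1)] by (simp add: Z_def)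
  then obtain e where e: "e > 0" "ball (Z (of_real (1 + tau2)) 0) e \<subseteq> - closure D"
  using open_Compl[OF closed_closure, of D] open_contains_ball by blast
  define mu where "mu = e / (2 * (norm eta + 1))"
  have mu: "mu > 0" using e(1) by (simp add: mu_def add_nonneg_pos)
  \<comment> \<open>A disc in direction \<open>eta\<close> beyond the edge. A functional separating
    all of it, not only its centre, is bounded on \<open>eta\<close> by a multiple of its value on
    \<open>v\<close>.\<close>
  define T where "T = (%c. Z (of_real (1 + tau2)) (c * of_real mu)) ` cball 0 1"
  have T_out: "T \<inter> closure D = {}"
  proof -
  have "Z (of_real (1 + tau2)) (c * of_real mu) \<in> ball (Z (of_real (1 + tau2)) 0) e" if "cmod c <= 1" for c
  proof -
  have "dist (Z (of_real (1 + tau2)) 0) (Z (of_real (1 + tau2)) (c * of_real mu)) = cmod c * (mu * norm eta)"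
  using mu by (simp add: Z_def dist_norm norm_smult norm_mult)
  also have "... <= 1 * (mu * norm eta)" using that mu by (intro mult_right_mono) auto
  also have "... <= mu * (norm eta + 1)" using mu by simp
  also have "... = e / 2" unfolding mu_def using norm_ge_zero[of eta] by (simp add: field_simps add_nonneg_eq_0_iff)
  finally show ?thesis using e(1) by simp
  qed
  then have "T \<subseteq> ball (Z (of_real (1 + tau2)) 0) e" unfolding T_def by (intro image_subsetI) simp
  then show ?thesis using e(2) by blast
  qed
  \<comment> \<open>From depth \<open>s0\<close> on, the \<open>eta\<close>-part of
    \<open>P s t\<close> is negligible for the second functional; the square begins there.\<close>
  define s0 where "s0 = N + ln (4 * (1 + 4 / mu))"
  have mu4: "1 + 4 / mu > 1" using mu by simp
  have es0: "exp (- s0) * (1 + 4 / mu) = exp (- N) / 4"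
  proof -
  have "exp (- (N + ln (4 * X))) * X = exp (- N) / 4" if "X > 0" for X using that by (simp add: exp_diff)
  from this[of "1 + 4 / mu"] show ?thesis unfolding s0_def using mu4 by linarith
  qed
  have "ln (4 * (1 + 4 / mu)) >= 0" by (rule ln_ge_zero) (use mu in \<open>simp add: add_increasing2\<close>)
  then have s0: "s0 >= 0" using N by (simp add: s0_def)
  define L where "L = s0 + N"
  \<comment> \<open>Makes the error in \<open>lo1\<close> at most \<open>exp (- L) / 2\<close>, half
    of the smallest value of \<open>exp (- s)\<close> on the square.\<close>
  define tau1 where "tau1 = exp (- L) / (2 * (1 + 4 / eps))"
  have eps4: "1 + 4 / eps > 1" using eps by simp
  have "exp (- L) / (2 * X) * X = exp (- L) / 2" "0 < exp (- L) / (2 * X)" if "X > 1" for X using that by simp_all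
  from this[OF eps4] have tau1: "tau1 > 0" "tau1 * (1 + 4 / eps) = exp (- L) / 2" unfolding tau1_def by auto
  have "tau1 * 1 <= tau1 * (1 + 4 / eps)" using tau1(1) eps4 by (intro mult_left_mono) auto
  also have "... <= 1 / 2" unfolding tau1(2) using s0 N by (simp add: L_def)
  finally have tau1h: "tau1 <= 1 / 2" by simp
  \<comment> \<open>A point just behind the disc as seen from \<open>x0\<close>. A functional that
    omits its value must be small on \<open>v\<close>, because the domain contains the disc
    \<open>K3\<close> at height \<open>tau1\<close>.\<close>
  define q where "q = Z 0 (of_real (- tau1))"
  have q: "q \<notin> closure D"
  proof
  assume "q \<in> closure D"
  from shrink[OF this x0(1), of "tau1 / (1 + tau1)"] have "Z 0 (of_real (1 - tau1 / (1 + tau1)) * of_real (- tau1) + of_real (tau1 / (1 + tau1))) \<in> D"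
  using tau1(1) unfolding q_def x0Z Zcomb by simp
  moreover have "(1 - tau1 / (1 + tau1)) * (- tau1) + tau1 / (1 + tau1) = 0" using tau1(1) by (simp add: field_simps)
  then have "of_real (1 - tau1 / (1 + tau1)) * of_real (- tau1) + of_real (tau1 / (1 + tau1)) = (0::complex)"
  by (metis of_real_0 of_real_add of_real_mult)
  ultimately show False using line[of 0] by (simp add: Z_def)
  qed
  define I where "I = {0..L} \<times> {0..N} \<times> cball (0::complex) 1"
  have I: "compact I" unfolding I_def by (intro compact_Times compact_cball compact_Icc)
  define K1 K2 where "K1 = (%q. E1 (fst q) (fst (snd q)) (snd (snd q))) ` I" and "K2 = (%q. E2 (fst q) (fst (snd q)) (snd (snd q))) ` I"
  define K3 where "K3 = (%q. Z (of_real (1 - tau1) * (snd (snd q) * of_real eps)) (of_real tau1)) ` I"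
  have K: "compact K1" "compact K2" "compact K3" unfolding K1_def K2_def K3_def E1_def E2_def
  by (intro compactZ[OF I] continuous_intros)+
  have KD: "K1 \<subseteq> D" "K2 \<subseteq> D" unfolding K1_def K2_def by (intro image_subsetI disc1 disc2; auto simp: I_def)+
  have KD3: "K3 \<subseteq> D"
  proof -
  have "Z (of_real (1 - tau1) * (c * of_real eps)) (of_real tau1) \<in> D" if "cmod c <= 1" for c
  proof -
  have "Z (c * of_real eps) 0 \<in> closure D"
  using disc[of "c * of_real eps"] mult_right_mono[OF that, of eps] eps by (simp add: Z_def norm_mult)
  from shrink[OF this x0(1) tau1(1)] show ?thesis using tau1h unfolding x0Z Zcomb by simp
  qed
  then show ?thesis unfolding K3_def by (intro image_subsetI) (auto simp only: I_def mem_Times_iff mem_cball_0)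
  qed
  \<comment> \<open>Convergence of the rescaled domains is used only here; one index serves all
    compact sets, and the distance estimates are made in \<open>Omega\<close> through that
    chart.\<close>
  have "\<forall>\<^sub>F n in sequentially. K1 \<subseteq> S n & K2 \<subseteq> S n & K3 \<subseteq> S n & T \<inter> closure (S n) = {} & {q} \<inter> closure (S n) = {}"
  proof (intro eventually_conj local_hausdorff_inner[OF lim S oD(1)] local_hausdorff_outer[OF lim] K KD KD3 T_out)
  show "compact T" unfolding T_def by (intro compactZ compact_cball continuous_intros)
  qed (use q in auto)
  from eventually_happens'[OF sequentially_bot this]
  obtain n where n: "K1 \<subseteq> S n" "K2 \<subseteq> S n" "K3 \<subseteq> S n" "T \<inter> closure (S n) = {}" "q \<notin> closure (S n)" by auto
  define phi where "phi x = u n + A n *v x" for x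
  have phiS: "phi x \<in> Omega \<longleftrightarrow> x \<in> S n" for x by (simp add: phi_def S_def chart_def)
  note Alin = linear_add[OF linear_matrix] linear_scale[OF linear_matrix] matrix_smult
  have in1: "phi (E1 s t c) \<in> Omega"
  if "s \<in> {0..L}" "t \<in> {0..N}" "cmod c <= 1" for s t c
  unfolding phiS by (rule subsetD[OF n(1)[unfolded K1_def]], rule image_eqI[of _ _ "(s, t, c)"])
  (use that in \<open>simp_all only: fst_conv snd_conv I_def mem_Times_iff mem_cball_0\<close>)
  have in2: "phi (E2 s t c) \<in> Omega"
  if "s \<in> {0..L}" "t \<in> {0..N}" "cmod c <= 1" for s t c
  unfolding phiS by (rule subsetD[OF n(2)[unfolded K2_def]], rule image_eqI[of _ _ "(s, t, c)"])
  (use that in \<open>simp_all only: fst_conv snd_conv I_def mem_Times_iff mem_cball_0\<close>)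
  have in3: "phi (Z (of_real (1 - tau1) * (c * of_real eps)) (of_real tau1)) \<in> Omega" if "cmod c <= 1" for c
  unfolding phiS by (rule subsetD[OF n(3)[unfolded K3_def]], rule image_eqI[of _ _ "(0, 0, c)"])
  (use that s0 N in \<open>auto simp: I_def L_def\<close>)
  have PO: "phi (P s t) \<in> Omega" if "s \<in> {0..L}" "t \<in> {0..N}" for s t using in1[OF that, of 0] by (simp add: P_def E1_def)
  have up1: "d (phi (P s t)) (phi (P s t')) <= C * (t' - t)" if "s \<in> {0..L}" "0 <= t" "t <= t'" "t' <= N" for s t t'
  proof -
  define p w where "p = phi (Z (of_real (1 - exp (- s))) (of_real (exp (- s))))" and "w = A n *v ((- of_real (1 - exp (- s))) *s v)"
  have e: "phi (P s t) = p + exp (- t) *\<^sub>R w" for t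
  by (simp add: p_def w_def phi_def P_def Z_def Alin scaleR_smult vec_eq_iff algebra_simps)
  have "d (p + exp (- t) *\<^sub>R w) (p + exp (- t') *\<^sub>R w) <= 2 * C1 / eps * (t' - t)"
  proof (rule exp_path[OF eps _ that(2-4)])
  fix tau c assume "0 <= tau" "tau <= N" "cmod c <= 1"
  moreover have "p + exp (- tau) *\<^sub>R w + c *s ((eps * exp (- tau)) *\<^sub>R w) = phi (E1 s tau c)"
  by (simp add: E1_def p_def w_def phi_def Z_def Alin scaleR_smult vec_eq_iff algebra_simps)
  ultimately show "p + exp (- tau) *\<^sub>R w + c *s ((eps * exp (- tau)) *\<^sub>R w) \<in> Omega" using in1 that(1) by simp
  qed
  also have "... <= C * (t' - t)" using that C by (intro mult_right_mono) auto
  finally show ?thesis unfolding e .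
  qed
  have up2: "d (phi (P s t)) (phi (P s' t)) <= C * (s' - s)" if "t \<in> {0..N}" "0 <= s" "s <= s'" "s' <= L" for s s' t
  proof -
  define p w where "p = phi (Z (of_real (1 - exp (- t))) 0)" and "w = A n *v ((- of_real (1 - exp (- t))) *s v + eta)"
  have e: "phi (P s t) = p + exp (- s) *\<^sub>R w" for s
  by (simp add: p_def w_def phi_def P_def Z_def Alin scaleR_smult vec_eq_iff algebra_simps)
  have "d (p + exp (- s) *\<^sub>R w) (p + exp (- s') *\<^sub>R w) <= 2 * C1 / k * (s' - s)"
  proof (rule exp_path[OF k _ that(2-4)])
  fix tau c assume "0 <= tau" "tau <= L" "cmod c <= 1"
  moreover have "p + exp (- tau) *\<^sub>R w + c *s ((k * exp (- tau)) *\<^sub>R w) = phi (E2 tau t c)"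
  by (simp add: E2_def p_def w_def phi_def Z_def Alin scaleR_smult vec_eq_iff algebra_simps)
  ultimately show "p + exp (- tau) *\<^sub>R w + c *s ((k * exp (- tau)) *\<^sub>R w) \<in> Omega" using in2 that(1) by simp
  qed
  also have "... <= C * (s' - s)" using that C by (intro mult_right_mono) auto
  finally show ?thesis unfolding e .
  qed
  have lo1: "\<bar>s - s'\<bar> <= C0 * d (phi (P s t)) (phi (P s' t')) + 2 * ln 2"
  if st: "s \<in> {0..L}" "t \<in> {0..N}" "s' \<in> {0..L}" "t' \<in> {0..N}" for s t s' t'
  proof -
  have qO: "u n + A n *v p \<notin> Omega" if "p \<in> {q}" for p
  using n(5) closure_subset[of "S n"] that unfolding phiS[unfolded phi_def] by blast
  obtain l :: "complex^'d => complex" where l: "linear l" "!!c x. l (c *s x) = c * l x"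
  "!!x p. phi x \<in> Omega ==> p \<in> {q} ==> l x ~= l p"
  "!!x y p. phi x \<in> Omega ==> phi y \<in> Omega ==> p \<in> {q} ==> \<bar>ln (cmod (l x - l p)) - ln (cmod (l y - l p))\<bar> <= C0 * d (phi x) (phi y)"
  unfolding phi_def by (rule separating_functional[of "{q}", OF convex_singleton insert_not_empty qO]) blast+
  have lZ: "l (Z a b) - l q = a * l v + (b + of_real tau1) * l eta" for a b
  by (simp add: q_def Z_def linear_add[OF l(1)] linear_diff[OF l(1)] l(2) algebra_simps)
  have nz: "of_real (1 - tau1) * (c * of_real eps) * l v + (of_real tau1 + of_real tau1) * l eta ~= 0" if "cmod c <= 1" for c
  unfolding lZ[symmetric] using l(3)[OF in3[OF that]] by simp
  have etanz: "l eta ~= 0" using nz[of 0] by auto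
  \<comment> \<open>If \<open>l v\<close> were larger, some \<open>c\<close> in the unit disc would
    solve the equation excluded by \<open>nz\<close>.\<close>
  have lv: "eps * cmod (l v) <= 4 * tau1 * cmod (l eta)"
  proof (rule ccontr)
  assume "~ ?thesis"
  then have big: "4 * tau1 * cmod (l eta) < eps * cmod (l v)" by simp
  have "0 <= 4 * tau1 * cmod (l eta)" using tau1(1) by simp
  then have vnz: "l v ~= 0" using big by auto
  define c where "c = - (of_real (2 * tau1) * l eta) / (of_real ((1 - tau1) * eps) * l v)"
  have den: "(1 - tau1) * eps > 0" using tau1h eps by simp
  have "2 * tau1 * cmod (l eta) <= (1 / 2) * (eps * cmod (l v))" using big by simp
  also have "... <= (1 - tau1) * (eps * cmod (l v))" using tau1h eps by (intro mult_right_mono) auto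
  finally have le: "2 * tau1 * cmod (l eta) <= (1 - tau1) * eps * cmod (l v)" by (simp add: mult.assoc)
  have "cmod c = 2 * tau1 * cmod (l eta) / ((1 - tau1) * eps * cmod (l v))"
  unfolding c_def norm_divide norm_minus_cancel norm_mult[of "of_real _"] norm_of_real abs_of_pos[OF den] using tau1(1) by simp
  moreover have "(1 - tau1) * eps * cmod (l v) > 0" using den vnz by simp
  ultimately have "cmod c <= 1" using le by simp
  moreover have "of_real (1 - tau1) * (c * of_real eps) * l v = - (of_real (2 * tau1) * l eta)"
  using vnz tau1h eps by (simp add: c_def)
  ultimately show False using nz[of c] by simp
  qed
  have est: "cmod (l (P s t) - l q - of_real (exp (- s)) * l eta) <= exp (- s) / 2 * cmod (l eta)"
  if "s \<in> {0..L}" "t \<in> {0..N}" for s t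
  proof -
  have "l (P s t) - l q - of_real (exp (- s)) * l eta = of_real ((1 - exp (- s)) * (1 - exp (- t))) * l v + of_real tau1 * l eta"
  unfolding P_def lZ by (simp add: algebra_simps)
  also have "cmod ... <= \<bar>(1 - exp (- s)) * (1 - exp (- t))\<bar> * cmod (l v) + tau1 * cmod (l eta)"
  using norm_triangle_ineq[of "of_real ((1 - exp (- s)) * (1 - exp (- t))) * l v" "of_real tau1 * l eta"] tau1(1)
  by (simp only: norm_mult norm_of_real abs_of_pos)
  also have "... <= 1 * cmod (l v) + tau1 * cmod (l eta)"
  using that by (intro add_right_mono mult_right_mono) (auto simp: abs_mult mult_le_one)
  also have "cmod (l v) <= (4 / eps) * tau1 * cmod (l eta)" using lv eps by (simp add: field_simps)
  also have "1 * ((4 / eps) * tau1 * cmod (l eta)) + tau1 * cmod (l eta) = (tau1 * (1 + 4 / eps)) * cmod (l eta)" by (simp add: algebra_simps)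
  also have "... <= exp (- s) / 2 * cmod (l eta)" unfolding tau1(2) using that by (intro mult_right_mono) auto
  finally show ?thesis by simp
  qed
  show ?thesis
  using ln_norm_gap[OF est[OF st(1,2)] est[OF st(3,4)] etanz] l(4)[OF PO[OF st(1,2)] PO[OF st(3,4)], of q] by simp
  qed
  have lo2: "\<bar>t - t'\<bar> <= C0 * d (phi (P s t)) (phi (P s' t')) + 2 * ln 2"
  if st: "s \<in> {s0..L}" "t \<in> {0..N}" "s' \<in> {s0..L}" "t' \<in> {0..N}" for s t s' t'
  proof -
  define zeta where "zeta = Z (of_real (1 + tau2)) 0"
  have cT: "convex T"
  proof -
  have "T = (%x. zeta + x) ` ((%c. (of_real mu * c) *s eta) ` cball 0 1)" unfolding T_def zeta_def image_image Z_def by (simp add: mult.commute)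
  moreover have "linear (%c. (of_real mu * c) *s eta)" by (rule linearI) (simp_all add: vec_eq_iff algebra_simps)
  ultimately show ?thesis by (simp add: convex_translation convex_linear_image)
  qed
  have TO: "u n + A n *v p \<notin> Omega" if "p \<in> T" for p
  using n(4) closure_subset[of "S n"] that unfolding phiS[unfolded phi_def] by blast
  have T0: "T ~= {}" "zeta \<in> T" by (auto simp: T_def zeta_def intro!: image_eqI[of _ _ 0])
  obtain l :: "complex^'d => complex" where l: "linear l" "!!c x. l (c *s x) = c * l x"
  "!!x p. phi x \<in> Omega ==> p \<in> T ==> l x ~= l p"
  "!!x y p. phi x \<in> Omega ==> phi y \<in> Omega ==> p \<in> T ==> \<bar>ln (cmod (l x - l p)) - ln (cmod (l y - l p))\<bar> <= C0 * d (phi x) (phi y)"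
  unfolding phi_def by (rule separating_functional[OF cT T0(1) TO]) blast+
  have lZ: "l (Z a b) - l zeta = (a - of_real (1 + tau2)) * l v + b * l eta" for a b
  by (simp add: zeta_def Z_def linear_add[OF l(1)] linear_diff[OF l(1)] l(2) algebra_simps)
  \<comment> \<open>Otherwise \<open>l\<close> would take its value at \<open>x\<close> also at a
    point of \<open>T\<close>.\<close>
  have far: "mu * cmod (l eta) < cmod (l x - l zeta)" if x: "phi x \<in> Omega" for x
  proof (rule ccontr)
  assume neg: "~ ?thesis"
  have xz: "l x ~= l zeta" by (rule l(3)[OF x T0(2)])
  then have etanz: "l eta ~= 0" using neg by auto
  define c where "c = (l x - l zeta) / (of_real mu * l eta)"
  have "cmod c <= 1" using neg etanz mu by (simp add: c_def norm_divide norm_mult divide_le_eq)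
  then have "l x ~= l (Z (of_real (1 + tau2)) (c * of_real mu))" by (intro l(3)[OF x]) (auto simp: T_def)
  moreover have "l (Z (of_real (1 + tau2)) (c * of_real mu)) - l zeta = l x - l zeta"
  unfolding lZ using etanz mu by (simp add: c_def)
  ultimately show False by simp
  qed
  have es: "exp (- s0) <= mu / 2"
  proof -
  have "exp (- s0) * (4 / mu) <= exp (- s0) * (1 + 4 / mu)" by (intro mult_left_mono) auto
  also have "... <= 1" unfolding es0 using N by (simp add: order_trans[of _ 1])
  finally show ?thesis using mu by (simp add: field_simps)
  qed
  \<comment> \<open>\<open>far\<close> at the corner \<open>P s0 0\<close>, where the
    \<open>eta\<close>-part has size at most \<open>mu / 2\<close> and is absorbed.\<close>
  have leta: "cmod (l eta) <= 4 / mu * cmod (l v)"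
  proof -
  have "mu * cmod (l eta) < cmod (l (P s0 0) - l zeta)" using s0 N by (intro far PO) (auto simp: L_def)
  also have "l (P s0 0) - l zeta = of_real (exp (- s0)) * l eta - of_real (1 + tau2) * l v" unfolding P_def lZ by (simp add: algebra_simps)
  also have "cmod ... <= exp (- s0) * cmod (l eta) + (1 + tau2) * cmod (l v)"
  using norm_triangle_ineq4[of "of_real (exp (- s0)) * l eta" "of_real (1 + tau2) * l v"] tau2 by (simp only: norm_mult norm_of_real) simp
  also have "... <= mu / 2 * cmod (l eta) + 2 * cmod (l v)" using es tau2 by (intro add_mono mult_right_mono) auto
  finally show ?thesis using mu by (simp add: field_simps)
  qed
  have vnz: "l v ~= 0"
  proof
  assume "l v = 0"
  then have "l eta = 0" using leta by simp
  then show False using far[OF PO[of s t]] st s0 \<open>l v = 0\<close> unfolding P_def lZ by simp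
  qed
  have est: "cmod (l (P s t) - l zeta - of_real (exp (- t)) * (- l v)) <= exp (- t) / 2 * cmod (- l v)"
  if "s \<in> {s0..L}" "t \<in> {0..N}" for s t
  proof -
  have "l (P s t) - l zeta - of_real (exp (- t)) * (- l v) = of_real (exp (- s)) * l eta - of_real (exp (- s) * (1 - exp (- t)) + tau2) * l v"
  unfolding P_def lZ by (simp add: algebra_simps)
  also have "cmod ... <= exp (- s) * cmod (l eta) + \<bar>exp (- s) * (1 - exp (- t)) + tau2\<bar> * cmod (l v)"
  using norm_triangle_ineq4[of "of_real (exp (- s)) * l eta" "of_real (exp (- s) * (1 - exp (- t)) + tau2) * l v"]
  by (simp only: norm_mult norm_of_real abs_exp_cancel)
  also have "... <= exp (- s0) * (4 / mu * cmod (l v)) + (exp (- s0) * 1 + tau2) * cmod (l v)"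
  proof (intro add_mono mult_mono leta mult_right_mono)
  have "exp (- s) * (1 - exp (- t)) <= exp (- s0) * 1" using that by (intro mult_mono) auto
  moreover have "0 <= exp (- s) * (1 - exp (- t))" using that by simp
  ultimately show "\<bar>exp (- s) * (1 - exp (- t)) + tau2\<bar> <= exp (- s0) * 1 + tau2" using tau2 by simp
  qed (use that mu tau2 in \<open>auto intro: add_nonneg_nonneg\<close>)
  also have "... = (exp (- s0) * (1 + 4 / mu) + tau2) * cmod (l v)" by (simp add: algebra_simps)
  also have "... <= exp (- t) / 2 * cmod (l v)" unfolding es0 tau2_def using that by (intro mult_right_mono) auto
  finally show ?thesis by simp
  qed
  have st': "s \<in> {0..L}" "s' \<in> {0..L}" using st s0 by auto
  show ?thesis
  using ln_norm_gap[OF est[OF st(1,2)] est[OF st(3,4)]] vnz l(4)[OF PO[OF st'(1) st(2)] PO[OF st'(2) st(4)] T0(2)] by simp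
  qed
  show ?thesis
  proof (intro exI[of _ "%s t. phi (P (s0 + s) t)"] ballI conjI)
  fix s t assume st: "s \<in> {0..N}" "t \<in> {0..N}"
  have s: "s0 + s \<in> {0..L}" "s0 + s \<in> {s0..L}" using st s0 by (auto simp: L_def)
  show "phi (P (s0 + s) t) \<in> Omega" by (rule PO[OF s(1) st(2)])
  fix s' t' assume st': "s' \<in> {0..N}" "t' \<in> {0..N}"
  have s': "s0 + s' \<in> {0..L}" "s0 + s' \<in> {s0..L}" using st' s0 by (auto simp: L_def)
  have "C0 * d (phi (P (s0 + s) t)) (phi (P (s0 + s') t')) <= C * d (phi (P (s0 + s) t)) (phi (P (s0 + s') t'))"
  using C d_nonneg by (intro mult_right_mono) auto
  then show "\<bar>s - s'\<bar> <= C * d (phi (P (s0 + s) t)) (phi (P (s0 + s') t')) + C"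
  "\<bar>t - t'\<bar> <= C * d (phi (P (s0 + s) t)) (phi (P (s0 + s') t')) + C"
  using lo1[OF s(1) st(2) s'(1) st'(2)] lo2[OF s(2) st(2) s'(2) st'(2)] C(5) by simp_all
  have a: "d (phi (P (s0 + s) t)) (phi (P (s0 + s') t)) <= C * \<bar>s - s'\<bar>"
  using up2[OF st(2), of "s0 + s" "s0 + s'"] up2[OF st(2), of "s0 + s'" "s0 + s"] s s' d_commute
  by (cases "s <= s'") auto
  have b: "d (phi (P (s0 + s') t)) (phi (P (s0 + s') t')) <= C * \<bar>t - t'\<bar>"
  using up1[OF s'(1), of t t'] up1[OF s'(1), of t' t] st st' d_commute by (cases "t <= t'") auto
  have "d (phi (P (s0 + s) t)) (phi (P (s0 + s') t')) <= d (phi (P (s0 + s) t)) (phi (P (s0 + s') t)) + d (phi (P (s0 + s') t)) (phi (P (s0 + s') t'))"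
  by (intro d_triangle PO s s' st st')
  then show "d (phi (P (s0 + s) t)) (phi (P (s0 + s') t')) <= C * (\<bar>s - s'\<bar> + \<bar>t - t'\<bar>)" using a b by (simp add: distrib_left)
  qed
 qed
 show False by (rule no_flat[OF hyp d_nonneg d_commute d_triangle C(1) flat])
qed

theorem theorem1p5:
  fixes \<Omega> :: "(complex ^ 'd) set"
    and G :: "complex ^ 'd \<Rightarrow> complex ^ 'd \<Rightarrow> complex ^ 'd \<Rightarrow> real"
  assumes "open \<Omega>" and "\<Omega> \<noteq> {}" and "convex \<Omega>" and "bounded \<Omega>"
    and "complete_kaehler_einstein \<Omega> G"
  shows "gromov_hyperbolic \<Omega> (riemannian_distance \<Omega> G) \<longleftrightarrow>
         (\<forall>D \<in> affine_orbit_closure \<Omega>. simple_boundary D)"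
proof -
  have ke: "kaehler_metric \<Omega> G" "\<And>z v w. z \<in> \<Omega> \<Longrightarrow> ricci_curvature G z v w = - G z v w"
    "Metric_space.mcomplete \<Omega> (riemannian_distance \<Omega> G)"
    using assms(5) by (auto simp: complete_kaehler_einstein_def)
  interpret ke_domain \<Omega> G
    by unfold_locales (use assms ke in auto)
  obtain p0 where "p0 \<in> \<Omega>" using assms(2) by blast
  then obtain r where r: "r > 0" "ball p0 r \<subseteq> \<Omega>" using assms(1) open_contains_ball by blast
  interpret ke_rays \<Omega> G p0 r
    by unfold_locales (use r in auto)
  show ?thesis using hyperbolic_if_simple_boundaries simple_boundary_if_hyperbolic by blast
qed

end
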